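(* Suppose that $0<H<1/2$, that $b$ is of class $\mathcal{C}^3$ and of linear growth with $b'\in\mathcal{C}_b^2$, and that $x_0$ is of class $\mathcal{C}^1$. Let $X$ solve the stochastic delay differential equation described in the context, let $X^n$ be its Euler–Maruyama scheme with step $\Delta_n=\tau/n$, and let $U^n=X-X^n$. Then for every $T>0$ and $p\ge1$ there is a constant $C>0$, independent of $n$, such that $$\sup_{0\le t\le T}\mathbb{E}(|U^n_t|^p)^{1/p}\le C\Delta_n^{\min\{3H,\,H+1/2\}}.$$
   Context: Setting. $(\Omega,\mathcal F,\mathbb P)$ is a complete probability space carrying a two-sided Wiener process $W$. For $H\in(0,1)$, $B_t=\int_{-\infty}^t[(t-s)_+^{H-1/2}-(-s)_+^{H-1/2}]\,\mathrm dW_s$, where $(x)_+^p:=x^p\mathbf 1_{x>0}$; this is a fractional Brownian motion (up to normalization) of index $H$. $\tau>0$, and $\eta$ is a finite deterministic signed measure on $[0,\tau]$. $x_0$ is a continuous deterministic function on $[-\tau,0]$, extended by $0$ outside $[-\tau,0]$. $b:\mathbb R\to\mathbb R$ is always at least $\mathcal C^1$ and of linear growth. $\mathcal C_b^k$ denotes bounded $\mathcal C^k$ functions with bounded derivatives up to order $k$. $X$ is the unique solution of $$X_t=x_0(0)+\int_0^t\int_{[0,\tau]}b(X_{s-r})\,\eta(\mathrm dr)\,\mathrm ds+B_t,\ t\ge0;\qquad X_t=x_0(t),\ -\tau\le t<0.$$ For $n\in\mathbb N$ put $\Delta_n=\tau/n$ and $\mathcal T(s)=[s/\Delta_n]\Delta_n$,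 $s\ge0$ ($[\cdot]$ is the integer part). The Euler–Maruyama scheme is $$X^n_t=x_0(0)+\int_0^t\int_{[0,\tau]}b(X^n_{\mathcal T(s)-\mathcal T(r)})\,\eta(\mathrm dr)\,\mathrm ds+B_t,\ t\ge0;\qquad X^n_t=x_0(t),\ -\tau\le t<0.$$ *)

theory Defs
  imports "HOL-Probability.Probability"
begin

subsection \<open>Finite signed measures\<close>

text \<open>
  Only the measurable space underlying \<open>M\<close> is used. The series converges for every
  rearrangement of the sets \<open>A i\<close>, hence absolutely; real values make the signed measure finite.
\<close>

definition finite_signed_measure :: "'a measure \<Rightarrow> ('a set \<Rightarrow> real) \<Rightarrow> bool" where
  "finite_signed_measure M \<eta> \<longleftrightarrow>
     \<eta> {} = 0 \<and>
     (\<forall>A :: nat \<Rightarrow> 'a set. range A \<subseteq> sets M \<longrightarrow> disjoint_family A \<longrightarrow>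
        (\<lambda>i. \<eta> (A i)) sums \<eta> (\<Union>i. A i))"

text \<open>
  The positive part of the Jordan decomposition; the negative part is the positive part of
  \<open>- \<eta>\<close>. The supremum is over a bounded set, since a finite signed measure is bounded.
\<close>

definition jordan_pos :: "'a measure \<Rightarrow> ('a set \<Rightarrow> real) \<Rightarrow> 'a measure" where
  "jordan_pos M \<eta> =
     measure_of (space M) (sets M) (\<lambda>A. ennreal (SUP B\<in>{B \<in> sets M. B \<subseteq> A}. \<eta> B))"

definition jordan_neg :: "'a measure \<Rightarrow> ('a set \<Rightarrow> real) \<Rightarrow> 'a measure" where
  "jordan_neg M \<eta> = jordan_pos M (\<lambda>A. - \<eta> A)"

definition signed_integral :: "'a measure \<Rightarrow> ('a set \<Rightarrow> real) \<Rightarrow> ('a \<Rightarrow> real) \<Rightarrow> real" where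
  "signed_integral M \<eta> f = (\<integral>r. f r \<partial>jordan_pos M \<eta>) - (\<integral>r. f r \<partial>jordan_neg M \<eta>)"


subsection \<open>Wiener process and Wiener integral\<close>

definition two_sided_wiener :: "'a measure \<Rightarrow> (real \<Rightarrow> 'a \<Rightarrow> real) \<Rightarrow> bool" where
  "two_sided_wiener M W \<longleftrightarrow>
     (\<forall>t. W t \<in> borel_measurable M) \<and>
     (AE \<omega> in M. W 0 \<omega> = 0) \<and>
     (AE \<omega> in M. continuous_on UNIV (\<lambda>t. W t \<omega>)) \<and>
     (\<forall>s t. s < t \<longrightarrow>
        distributed M lborel (\<lambda>\<omega>. W t \<omega> - W s \<omega>) (normal_density 0 (sqrt (t - s)))) \<and>
     (\<forall>(u :: nat \<Rightarrow> real) k. strict_mono u \<longrightarrow>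
        prob_space.indep_vars M (\<lambda>_. borel) (\<lambda>i \<omega>. W (u (Suc i)) \<omega> - W (u i) \<omega>) {..<k})"

text \<open>A triple \<open>(c, u, v)\<close> stands for \<open>c\<close> times the indicator function of the interval \<open>(u, v]\<close>.\<close>

type_synonym step = "(real \<times> real \<times> real) list"

definition step_fun :: "step \<Rightarrow> real \<Rightarrow> real" where
  "step_fun \<phi> s = (\<Sum>(c, u, v)\<leftarrow>\<phi>. c * indicator {u<..v} s)"

definition step_integral :: "(real \<Rightarrow> 'a \<Rightarrow> real) \<Rightarrow> step \<Rightarrow> 'a \<Rightarrow> real" where
  "step_integral W \<phi> \<omega> = (\<Sum>(c, u, v)\<leftarrow>\<phi>. c * (W v \<omega> - W u \<omega>))"

text \<open>
  \<open>Y\<close> is a version of the integral of the deterministic square integrable function \<open>f\<close> over the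
  whole line with respect to \<open>W\<close>: the limit in mean square of integrals of step functions that
  approximate \<open>f\<close> in \<open>L\<^sup>2(\<real>)\<close>.
\<close>

definition has_wiener_integral ::
    "'a measure \<Rightarrow> (real \<Rightarrow> 'a \<Rightarrow> real) \<Rightarrow> (real \<Rightarrow> real) \<Rightarrow> ('a \<Rightarrow> real) \<Rightarrow> bool" where
  "has_wiener_integral M W f Y \<longleftrightarrow>
     f \<in> borel_measurable borel \<and> Y \<in> borel_measurable M \<and>
     (\<exists>\<phi> :: nat \<Rightarrow> step.
        (\<forall>k. \<forall>(c, u, v)\<in>set (\<phi> k). u \<le> v) \<and>
        (\<lambda>k. \<integral>\<^sup>+ s. ennreal ((f s - step_fun (\<phi> k) s)\<^sup>2) \<partial>lborel) \<longlonglongrightarrow> 0 \<and>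
        (\<lambda>k. \<integral>\<^sup>+ \<omega>. ennreal ((Y \<omega> - step_integral W (\<phi> k) \<omega>)\<^sup>2) \<partial>M) \<longlonglongrightarrow> 0)"


subsection \<open>Fractional Brownian motion\<close>

definition pos_powr :: "real \<Rightarrow> real \<Rightarrow> real" where
  "pos_powr x p = (if x > 0 then x powr p else 0)"

definition fbm_kernel :: "real \<Rightarrow> real \<Rightarrow> real \<Rightarrow> real" where
  "fbm_kernel H t s = pos_powr (t - s) (H - 1/2) - pos_powr (- s) (H - 1/2)"

text \<open>
  Each \<open>B t\<close> is determined by the stochastic integral only up to a null set; as usual a version
  with continuous paths is taken.
\<close>

definition fbm_from_wiener ::
    "'a measure \<Rightarrow> (real \<Rightarrow> 'a \<Rightarrow> real) \<Rightarrow> real \<Rightarrow> (real \<Rightarrow> 'a \<Rightarrow> real) \<Rightarrow> bool" where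
  "fbm_from_wiener M W H B \<longleftrightarrow>
     (\<forall>t\<ge>0. has_wiener_integral M W (\<lambda>s. indicator {..t} s * fbm_kernel H t s) (B t)) \<and>
     (AE \<omega> in M. continuous_on {0..} (\<lambda>t. B t \<omega>))"


subsection \<open>Function classes\<close>

definition class_C :: "nat \<Rightarrow> (real \<Rightarrow> real) \<Rightarrow> bool" where
  "class_C k f \<longleftrightarrow>
     (\<forall>j<k. \<forall>x. (deriv ^^ j) f field_differentiable at x) \<and>
     continuous_on UNIV ((deriv ^^ k) f)"

definition class_Cb :: "nat \<Rightarrow> (real \<Rightarrow> real) \<Rightarrow> bool" where
  "class_Cb k f \<longleftrightarrow> class_C k f \<and> (\<forall>j\<le>k. bounded (range ((deriv ^^ j) f)))"

definition linear_growth :: "(real \<Rightarrow> real) \<Rightarrow> bool" where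
  "linear_growth f \<longleftrightarrow> (\<exists>K. \<forall>x. \<bar>f x\<bar> \<le> K * (1 + \<bar>x\<bar>))"

text \<open>At the end points of the interval the derivative is one-sided.\<close>

definition C1_on_Icc :: "real \<Rightarrow> real \<Rightarrow> (real \<Rightarrow> real) \<Rightarrow> bool" where
  "C1_on_Icc u v f \<longleftrightarrow>
     (\<exists>f'. continuous_on {u..v} f' \<and>
        (\<forall>t\<in>{u..v}. (f has_real_derivative f' t) (at t within {u..v})))"


subsection \<open>The delay equation and its Euler--Maruyama scheme\<close>

text \<open>The delay measure \<open>\<eta>\<close> lives on the Borel subsets of \<open>[0, \<tau>]\<close>.\<close>

abbreviation delay_space :: "real \<Rightarrow> real measure" where
  "delay_space \<tau> \<equiv> restrict_space borel {0..\<tau>}"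

text \<open>
  Continuity of the paths on \<open>[0, \<infinity>)\<close> (and of \<open>x0\<close>, \<open>b\<close>) makes the integrand bounded and Borel on
  \<open>[0, t] \<times> [0, \<tau>]\<close>, so that all integrals exist.
\<close>

definition sdde_solution ::
    "'a measure \<Rightarrow> real \<Rightarrow> (real set \<Rightarrow> real) \<Rightarrow> (real \<Rightarrow> real) \<Rightarrow> (real \<Rightarrow> real) \<Rightarrow>
     (real \<Rightarrow> 'a \<Rightarrow> real) \<Rightarrow> (real \<Rightarrow> 'a \<Rightarrow> real) \<Rightarrow> bool" where
  "sdde_solution M \<tau> \<eta> b x0 B X \<longleftrightarrow>
     (\<forall>t\<ge>-\<tau>. X t \<in> borel_measurable M) \<and>
     (AE \<omega> in M.
        continuous_on {0..} (\<lambda>t. X t \<omega>) \<and>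
        (\<forall>t\<in>{-\<tau>..<0}. X t \<omega> = x0 t) \<and>
        (\<forall>t\<ge>0. X t \<omega> =
           x0 0 + (LBINT s:{0..t}. signed_integral (delay_space \<tau>) \<eta> (\<lambda>r. b (X (s - r) \<omega>)))
           + B t \<omega>))"

definition grid_floor :: "real \<Rightarrow> real \<Rightarrow> real" where
  "grid_floor \<Delta> s = of_int \<lfloor>s / \<Delta>\<rfloor> * \<Delta>"

text \<open>
  Here the integrand is piecewise constant, so that the integrals exist without further
  conditions on the paths.
\<close>

definition euler_scheme ::
    "'a measure \<Rightarrow> real \<Rightarrow> (real set \<Rightarrow> real) \<Rightarrow> (real \<Rightarrow> real) \<Rightarrow> (real \<Rightarrow> real) \<Rightarrow>
     (real \<Rightarrow> 'a \<Rightarrow> real) \<Rightarrow> nat \<Rightarrow> (real \<Rightarrow> 'a \<Rightarrow> real) \<Rightarrow> bool" where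
  "euler_scheme M \<tau> \<eta> b x0 B n Y \<longleftrightarrow>
     (\<forall>t\<ge>-\<tau>. Y t \<in> borel_measurable M) \<and>
     (AE \<omega> in M.
        (\<forall>t\<in>{-\<tau>..<0}. Y t \<omega> = x0 t) \<and>
        (\<forall>t\<ge>0. Y t \<omega> =
           x0 0 + (LBINT s:{0..t}. signed_integral (delay_space \<tau>) \<eta>
                     (\<lambda>r. b (Y (grid_floor (\<tau> / real n) s - grid_floor (\<tau> / real n) r) \<omega>)))
           + B t \<omega>))"

end

theory Submission
  imports Defs
begin

text \<open>
  The local error \<open>b (X\<^sup>n (s - r)) - b (X\<^sup>n (\<T> s - \<T> r))\<close> is only of size \<open>\<Delta> powr H\<close>, but its time
  integral is smaller. Cut the integral at the grid points and, for fixed \<open>r\<close> and fixed position in the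
  mesh, sum the increments of \<open>b (X\<^sup>n)\<close> over all meshes; with \<open>rate = min (3 * H) (H + 1/2)\<close>, this sum
  has to be of size \<open>\<Delta> powr (rate - 1)\<close>. A second order Taylor expansion leaves third order terms, which
  contribute \<open>\<Delta> powr (3 * H - 1)\<close>. The main terms are conditioned on the past of \<open>W\<close> along dyadic
  scales: passing from one scale to the next produces martingale differences, whose sum gains a square
  root and contributes \<open>\<Delta> powr (H - 1/2)\<close>, and terms in which the expansion point is moved, which are
  again of third order. The conditional moments of the later increments of \<open>B\<close> decay because the kernel
  does, so that no Malliavin calculus is needed. Gronwall's inequality in \<open>L\<^sup>p\<close> turns the bound for the
  integrated local error into the bound for \<open>X - X\<^sup>n\<close>.
\<close>

section \<open>Moment bounds\<close>

text \<open>Conditioning at a single scale is not enough. Given the past of \<open>t k\<close>, the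
  increments minus their conditional means are martingale differences, but the means stay random and
  of size \<open>D powr H\<close> each. Given the past of the first grid point the means have a
  bounded sum, but the centred increments are no longer martingale differences. The dyadic scales
  connect the two. In the right half of a block, of time length \<open>len\<close>, the conditional
  moments sum up to order \<open>len powr H\<close>, because the weights
  \<open>(1 + l) powr (H - 1)\<close> do. Moving the expansion point multiplies this by
  \<open>len powr (2 * H)\<close>; with at most \<open>T / len\<close> blocks this gives
  \<open>len powr (3 * H - 1)\<close>. The martingale part gives
  \<open>sqrt (T / len) * len powr H\<close>. Both exponents are at least \<open>rate - 1\<close>,
  which is negative, so the sum over the scales is geometric and the finest scale dominates. A first
  order expansion would gain only \<open>len powr H\<close> in place of
  \<open>len powr (2 * H)\<close>, and hence lead to \<open>2 * H\<close> in place of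
  \<open>3 * H\<close>.\<close>

text \<open>A convex function lies above its tangents, here at \<open>m\<close>. The inequalities of
  Jensen, Minkowski and Lyapunov below all rest on this.\<close>

lemma power_tangent:
  fixes x m :: real
  assumes "0 \<le> x" "0 \<le> m"
  shows "real (Suc p) * m ^ p * x \<le> x ^ Suc p + real p * m ^ Suc p"
proof (induction p)
  case 0
  then show ?case by simp
next
  case (Suc p)
  \<comment> \<open>The inequality for \<open>Suc p\<close> is \<open>x\<close> times the one for
    \<open>p\<close> plus a nonnegative multiple of \<open>(x - m)\<^sup>2\<close>.\<close>
  have "0 \<le> x * (x ^ Suc p + real p * m ^ Suc p - real (Suc p) * m ^ p * x)"
    using Suc assms by (intro mult_nonneg_nonneg) auto
  moreover have "0 \<le> real (Suc p) * m ^ p * (x - m)\<^sup>2"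
    using assms by simp
  ultimately show ?case
    by (simp add: algebra_simps power2_eq_square)
qed

text \<open>The tangent inequality for \<open>x / c\<close>, multiplied by \<open>c\<close>. Both
  sides become homogeneous of degree one in \<open>x\<close> and \<open>c\<close>, so that
  \<open>c\<close> can be a weight depending on the variable of integration.\<close>

lemma ennreal_power_tangent:
  fixes x c :: real
  assumes "0 \<le> x" "0 < c" "0 \<le> m"
  shows "ennreal (real (Suc p) * m ^ p) * ennreal x
           \<le> ennreal (x ^ Suc p / c ^ p) + ennreal (real p * m ^ Suc p) * ennreal c"
proof -
  have "real (Suc p) * m ^ p * (x / c) \<le> (x / c) ^ Suc p + real p * m ^ Suc p"
    using assms by (intro power_tangent) auto
  then have "c * (real (Suc p) * m ^ p * (x / c)) \<le> c * ((x / c) ^ Suc p + real p * m ^ Suc p)"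
    using assms by (intro mult_left_mono) auto
  moreover have "c * (real (Suc p) * m ^ p * (x / c)) = real (Suc p) * m ^ p * x"
    and "c * ((x / c) ^ Suc p + real p * m ^ Suc p) = x ^ Suc p / c ^ p + real p * m ^ Suc p * c"
    using assms by (simp_all add: power_divide distrib_left)
  ultimately have "real (Suc p) * m ^ p * x \<le> x ^ Suc p / c ^ p + real p * m ^ Suc p * c"
    by linarith
  then show ?thesis
    using assms by (simp add: ennreal_mult[symmetric] ennreal_plus[symmetric] del: ennreal_plus)
qed

text \<open>Jensen's inequality for the weight \<open>c\<close>, multiplied out so that \<open>c\<close> need not have mass one.\<close>

lemma nn_integral_power_le:
  fixes G c :: "'b \<Rightarrow> real"
  assumes [measurable]: "G \<in> borel_measurable N" "c \<in> borel_measurable N"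
    and G: "\<And>r. r \<in> space N \<Longrightarrow> 0 \<le> G r" and c: "\<And>r. r \<in> space N \<Longrightarrow> 0 < c r"
    and C: "(\<integral>\<^sup>+ r. c r \<partial>N) = ennreal C" "0 < C"
  shows "(\<integral>\<^sup>+ r. G r \<partial>N) ^ Suc p \<le> ennreal (C ^ p) * (\<integral>\<^sup>+ r. ennreal (G r ^ Suc p / c r ^ p) \<partial>N)"
    (is "?g ^ Suc p \<le> _ * ?I")
proof -
  have tangent: "ennreal (real (Suc p) * m ^ p) * ?g \<le> ?I + ennreal (real p * m ^ Suc p * C)" if "0 \<le> m" for m
  proof -
    have "ennreal (real (Suc p) * m ^ p) * ?g
        = (\<integral>\<^sup>+ r. ennreal (real (Suc p) * m ^ p) * ennreal (G r) \<partial>N)"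
      by (rule nn_integral_cmult[symmetric]) measurable
    also have "\<dots> \<le> (\<integral>\<^sup>+ r. ennreal (G r ^ Suc p / c r ^ p)
        + ennreal (real p * m ^ Suc p) * ennreal (c r) \<partial>N)"
      using that G c by (intro nn_integral_mono ennreal_power_tangent) auto
    also have "\<dots> = ?I + ennreal (real p * m ^ Suc p) * ennreal C"
      by (subst nn_integral_add) (auto simp: nn_integral_cmult C)
    finally show ?thesis
      using that C by (simp add: ennreal_mult)
  qed
  show ?thesis
  proof (cases "?I = \<infinity>")
    case True
    then show ?thesis using C by (simp add: ennreal_mult_top)
  next
    case False
    then obtain i where i: "?I = ennreal i" "0 \<le> i"
      by (cases ?I) auto
    \<comment> \<open>The tangent at \<open>1\<close> shows finiteness; only then can the best
      tangent, at the mean \<open>g / C\<close>, be used.\<close>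
    have "?g < \<infinity>"
      using tangent[of 1] i C by (auto simp: ennreal_mult_less_top ennreal_plus[symmetric] simp del: ennreal_plus
        dest!: order.strict_trans1[where c = top])
    then obtain g where g: "?g = ennreal g" "0 \<le> g"
      by (cases ?g) auto
    have "real (Suc p) * (g / C) ^ p * g \<le> i + real p * (g / C) ^ Suc p * C"
      using tangent[of "g / C"] i g C
      by (simp add: ennreal_mult[symmetric] ennreal_plus[symmetric] del: ennreal_plus of_nat_Suc)
    moreover have "real (Suc p) * (g / C) ^ p * g = (g / C) ^ Suc p * C + real p * (g / C) ^ Suc p * C"
      using C by (simp add: field_simps)
    ultimately have "(g / C) ^ Suc p * C \<le> i"
      by linarith
    then have "g ^ Suc p \<le> C ^ p * i"
      using C by (simp add: power_divide field_simps)
    then show ?thesis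
      using i g C by (simp add: ennreal_power ennreal_mult[symmetric] del: power_Suc)
  qed
qed

section \<open>Moments of a fixed order\<close>

context prob_space
begin

text \<open>The norm of order \<open>p\<close> is at most \<open>c\<close>. The power is natural and
  the integral nonnegative, so the bound itself contains the integrability; real orders come in only
  at the very end.\<close>

definition Lp_le :: "nat \<Rightarrow> ('a \<Rightarrow> real) \<Rightarrow> real \<Rightarrow> bool" where
  "Lp_le p Z c \<longleftrightarrow> Z \<in> borel_measurable M \<and> 0 \<le> c \<and> (\<integral>\<^sup>+ \<omega>. ennreal (\<bar>Z \<omega>\<bar> ^ p) \<partial>M) \<le> ennreal (c ^ p)"

lemma Lp_le_mono_bound: "Lp_le p Z c \<Longrightarrow> c \<le> c' \<Longrightarrow> Lp_le p Z c'"
  unfolding Lp_le_def by (auto intro: order_trans ennreal_leI power_mono)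

lemma Lp_le_dom:
  assumes "Lp_le p Z c" "Z' \<in> borel_measurable M" "AE \<omega> in M. \<bar>Z' \<omega>\<bar> \<le> \<bar>Z \<omega>\<bar>"
  shows "Lp_le p Z' c"
proof -
  have "(\<integral>\<^sup>+ \<omega>. ennreal (\<bar>Z' \<omega>\<bar> ^ p) \<partial>M) \<le> (\<integral>\<^sup>+ \<omega>. ennreal (\<bar>Z \<omega>\<bar> ^ p) \<partial>M)"
    using assms(3) by (intro nn_integral_mono_AE) (auto intro!: ennreal_leI power_mono)
  then show ?thesis
    using assms unfolding Lp_le_def by (auto intro: order_trans)
qed

lemma Lp_le_cmult_abs:
  assumes "Lp_le p Z c" "0 \<le> a"
  shows "Lp_le p (\<lambda>\<omega>. a * \<bar>Z \<omega>\<bar>) (a * c)"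
proof -
  have [measurable]: "Z \<in> borel_measurable M" and c: "0 \<le> c" and Z: "(\<integral>\<^sup>+ \<omega>. ennreal (\<bar>Z \<omega>\<bar> ^ p) \<partial>M) \<le> ennreal (c ^ p)"
    using assms(1) by (auto simp: Lp_le_def)
  have "(\<integral>\<^sup>+ \<omega>. ennreal (\<bar>a * \<bar>Z \<omega>\<bar>\<bar> ^ p) \<partial>M) = ennreal (a ^ p) * (\<integral>\<^sup>+ \<omega>. ennreal (\<bar>Z \<omega>\<bar> ^ p) \<partial>M)"
    using assms(2) by (subst nn_integral_cmult[symmetric])
      (auto simp: abs_mult power_mult_distrib ennreal_mult[symmetric] intro!: nn_integral_cong)
  also have "\<dots> \<le> ennreal (a ^ p) * ennreal (c ^ p)" by (intro mult_left_mono Z) auto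
  also have "\<dots> = ennreal ((a * c) ^ p)" using assms(2) c by (simp add: ennreal_mult[symmetric] power_mult_distrib)
  finally show ?thesis using assms(2) c by (auto simp: Lp_le_def)
qed

text \<open>Several arguments divide by the bound and therefore work with \<open>c + e\<close> for
  positive \<open>e\<close>; this passes to the limit.\<close>

lemma Lp_le_eps:
  assumes "\<And>e. 0 < e \<Longrightarrow> Lp_le p Z (c + e)" "0 \<le> c"
  shows "Lp_le p Z c"
proof -
  have "((\<lambda>n. ennreal ((c + 1 / real (Suc n)) ^ p)) \<longlongrightarrow> ennreal ((c + 0) ^ p)) sequentially"
    by (intro tendsto_ennrealI tendsto_power tendsto_add tendsto_const) (rule LIMSEQ_Suc[OF lim_1_over_n])
  then have "(\<integral>\<^sup>+ \<omega>. ennreal (\<bar>Z \<omega>\<bar> ^ p) \<partial>M) \<le> ennreal ((c + 0) ^ p)"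
    by (rule LIMSEQ_le_const) (use assms(1) in \<open>auto simp: Lp_le_def\<close>)
  moreover have "Z \<in> borel_measurable M"
    using assms(1)[of 1] by (auto simp: Lp_le_def)
  ultimately show ?thesis
    using assms(2) by (simp add: Lp_le_def)
qed

text \<open>Minkowski's integral inequality. Jensen's inequality is applied with the norm bound
  \<open>c\<close> itself as weight; after Fubini, each \<open>r\<close> contributes at most
  \<open>c r ^ Suc p / c r ^ p = c r\<close>.\<close>

lemma Lp_le_nn_integral:
  fixes G :: "'b \<times> 'a \<Rightarrow> real" and c :: "'b \<Rightarrow> real"
  assumes N: "sigma_finite_measure N"
    and [measurable]: "G \<in> borel_measurable (N \<Otimes>\<^sub>M M)" "c \<in> borel_measurable N"
    and G: "\<And>r \<omega>. r \<in> space N \<Longrightarrow> \<omega> \<in> space M \<Longrightarrow> 0 \<le> G (r, \<omega>)"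
    and c: "\<And>r. r \<in> space N \<Longrightarrow> 0 < c r"
    and C: "(\<integral>\<^sup>+ r. c r \<partial>N) \<le> ennreal C" "0 \<le> C"
    and le: "\<And>r. r \<in> space N \<Longrightarrow> Lp_le (Suc p) (\<lambda>\<omega>. G (r, \<omega>)) (c r)"
    and [measurable]: "Z \<in> borel_measurable M"
    and Z: "AE \<omega> in M. ennreal \<bar>Z \<omega>\<bar> \<le> (\<integral>\<^sup>+ r. G (r, \<omega>) \<partial>N)"
  shows "Lp_le (Suc p) Z C"
proof -
  interpret N: sigma_finite_measure N by (rule N)
  interpret MN: pair_sigma_finite N M ..
  obtain C' where C': "(\<integral>\<^sup>+ r. c r \<partial>N) = ennreal C'" "0 \<le> C'" "C' \<le> C"
    using C by (cases "\<integral>\<^sup>+ r. c r \<partial>N") (auto simp: top_unique)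
  have "(\<integral>\<^sup>+ \<omega>. ennreal (\<bar>Z \<omega>\<bar> ^ Suc p) \<partial>M) \<le> ennreal (C' ^ Suc p)"
  \<comment> \<open>The weight is positive everywhere, so total mass zero means that
    \<open>N\<close> is the zero measure.\<close>
  proof (cases "C' = 0")
    case True
    then have "AE r in N. ennreal (c r) = 0"
      using C' by (simp add: nn_integral_0_iff_AE)
    then have "AE r in N. False"
      by (rule AE_mp) (use c in \<open>auto intro!: AE_I2 simp: ennreal_eq_0_iff not_le\<close>)
    then have int0: "(\<integral>\<^sup>+ r. G (r, \<omega>) \<partial>N) = 0" for \<omega>
      by (subst nn_integral_cong_AE[where v = "\<lambda>_. 0"]) auto
    have "AE \<omega> in M. \<bar>Z \<omega>\<bar> ^ Suc p = 0"
    proof (use Z in eventually_elim)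
      case (elim \<omega>)
      then have "ennreal \<bar>Z \<omega>\<bar> \<le> 0" by (simp only: int0)
      then show ?case by simp
    qed
    then have "(\<integral>\<^sup>+ \<omega>. ennreal (\<bar>Z \<omega>\<bar> ^ Suc p) \<partial>M) = 0"
      by (subst nn_integral_0_iff_AE) auto
    then show ?thesis by simp
  next
    case False
    then have C'0: "0 < C'" using C' by simp
    have "(\<integral>\<^sup>+ \<omega>. ennreal (\<bar>Z \<omega>\<bar> ^ Suc p) \<partial>M) \<le> (\<integral>\<^sup>+ \<omega>. (\<integral>\<^sup>+ r. G (r, \<omega>) \<partial>N) ^ Suc p \<partial>M)"
    proof (rule nn_integral_mono_AE, use Z in eventually_elim)
      case (elim \<omega>)
      then show ?case
        using power_mono[OF elim, of "Suc p"] by (simp add: ennreal_power del: power_Suc)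
    qed
    also have "\<dots> \<le> (\<integral>\<^sup>+ \<omega>. ennreal (C' ^ p) * (\<integral>\<^sup>+ r. ennreal (G (r, \<omega>) ^ Suc p / c r ^ p) \<partial>N) \<partial>M)"
      using G c C' C'0 by (intro nn_integral_mono nn_integral_power_le) auto
    also have "\<dots> = ennreal (C' ^ p) * (\<integral>\<^sup>+ \<omega>. \<integral>\<^sup>+ r. ennreal (G (r, \<omega>) ^ Suc p / c r ^ p) \<partial>N \<partial>M)"
      by (rule nn_integral_cmult) measurable
    also have "(\<integral>\<^sup>+ \<omega>. \<integral>\<^sup>+ r. ennreal (G (r, \<omega>) ^ Suc p / c r ^ p) \<partial>N \<partial>M)
        = (\<integral>\<^sup>+ r. \<integral>\<^sup>+ \<omega>. ennreal (G (r, \<omega>) ^ Suc p / c r ^ p) \<partial>M \<partial>N)"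
      by (rule MN.Fubini') measurable
    also have "\<dots> \<le> (\<integral>\<^sup>+ r. ennreal (c r) \<partial>N)"
    proof (rule nn_integral_mono)
      fix r assume r: "r \<in> space N"
      have "(\<integral>\<^sup>+ \<omega>. ennreal (G (r, \<omega>) ^ Suc p / c r ^ p) \<partial>M)
          = (\<integral>\<^sup>+ \<omega>. ennreal (1 / c r ^ p) * ennreal (\<bar>G (r, \<omega>)\<bar> ^ Suc p) \<partial>M)"
        using G[OF r] c[OF r] by (intro nn_integral_cong) (auto simp: ennreal_mult[symmetric])
      also have "\<dots> = ennreal (1 / c r ^ p) * (\<integral>\<^sup>+ \<omega>. ennreal (\<bar>G (r, \<omega>)\<bar> ^ Suc p) \<partial>M)"
        using r by (intro nn_integral_cmult) measurable
      also have "\<dots> \<le> ennreal (1 / c r ^ p) * ennreal (c r ^ Suc p)"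
        using le[OF r] unfolding Lp_le_def by (intro mult_left_mono) auto
      also have "\<dots> = ennreal (c r)"
        using c[OF r] by (simp add: ennreal_mult[symmetric])
      finally show "(\<integral>\<^sup>+ \<omega>. ennreal (G (r, \<omega>) ^ Suc p / c r ^ p) \<partial>M) \<le> ennreal (c r)" .
    qed
    also have "ennreal (C' ^ p) * (\<integral>\<^sup>+ r. ennreal (c r) \<partial>N) = ennreal (C' ^ Suc p)"
      using C' by (simp add: ennreal_mult[symmetric] mult.commute)
    finally show ?thesis
      by (simp add: mult_left_mono)
  qed
  also have "\<dots> \<le> ennreal (C ^ Suc p)"
    using C' by (intro ennreal_leI power_mono)
  finally show ?thesis
    using C by (simp add: Lp_le_def)
qed

lemma Lp_le_sum:
  assumes A: "finite A" and p: "1 \<le> p" and le: "\<And>i. i \<in> A \<Longrightarrow> Lp_le p (Z i) (c i)"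
  shows "Lp_le p (\<lambda>\<omega>. \<Sum>i\<in>A. Z i \<omega>) (\<Sum>i\<in>A. c i)"
proof (rule Lp_le_eps)
  obtain p' where p': "p = Suc p'" using p by (cases p) auto
  show c0: "0 \<le> (\<Sum>i\<in>A. c i)"
    using le by (intro sum_nonneg) (auto simp: Lp_le_def)
  have [measurable]: "Z i \<in> borel_measurable M" if "i \<in> A" for i
    using le[OF that] by (simp add: Lp_le_def)
  have m: "(\<lambda>x. \<bar>Z (fst x) (snd x)\<bar>) \<in> borel_measurable (count_space A \<Otimes>\<^sub>M M)"
    using A by (intro measurable_pair_measure_countable1 countable_finite) auto
  fix e :: real assume e: "0 < e"
  \<comment> \<open>The weights have to be positive: each bound is raised by \<open>d\<close>, and
    all of them together by at most \<open>e\<close>.\<close>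
  define d where "d = e / (1 + real (card A))"
  have d: "0 < d" using e by (simp add: d_def)
  show "Lp_le p (\<lambda>\<omega>. \<Sum>i\<in>A. Z i \<omega>) ((\<Sum>i\<in>A. c i) + e)"
    unfolding p'
  proof (rule Lp_le_nn_integral[where N = "count_space A" and c = "\<lambda>i. c i + d"
        and G = "\<lambda>x. \<bar>Z (fst x) (snd x)\<bar>"])
    show "sigma_finite_measure (count_space A)"
      by (rule sigma_finite_measure_count_space_finite[OF A])
    show "Lp_le (Suc p') (\<lambda>\<omega>. \<bar>Z (fst (i, \<omega>)) (snd (i, \<omega>))\<bar>) (c i + d)" if "i \<in> space (count_space A)" for i
      using Lp_le_mono_bound[OF le[of i], of "c i + d"] that d by (auto simp: p' Lp_le_def)
    show "(\<integral>\<^sup>+ i. ennreal (c i + d) \<partial>count_space A) \<le> ennreal ((\<Sum>i\<in>A. c i) + e)"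
    proof -
      have "(\<integral>\<^sup>+ i. ennreal (c i + d) \<partial>count_space A) = ennreal (\<Sum>i\<in>A. c i + d)"
        using A le d by (subst nn_integral_count_space_finite, simp, subst sum_ennreal)
          (auto simp: Lp_le_def intro: add_nonneg_nonneg)
      also have "\<dots> \<le> ennreal ((\<Sum>i\<in>A. c i) + e)"
      proof (intro ennreal_leI)
        have "real (card A) * d \<le> e" using e by (simp add: d_def field_simps)
        then show "(\<Sum>i\<in>A. c i + d) \<le> (\<Sum>i\<in>A. c i) + e" by (simp add: sum.distrib)
      qed
      finally show ?thesis .
    qed
    show "AE \<omega> in M. ennreal \<bar>\<Sum>i\<in>A. Z i \<omega>\<bar> \<le> (\<integral>\<^sup>+ i. ennreal \<bar>Z (fst (i, \<omega>)) (snd (i, \<omega>))\<bar> \<partial>count_space A)"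
      using A by (auto simp: nn_integral_count_space_finite sum_abs)
  qed (use c0 e d le m in \<open>auto simp: Lp_le_def add_nonneg_pos\<close>)
qed

lemma Lp_le_add:
  assumes "1 \<le> p" "Lp_le p Z c" "Lp_le p Z' c'"
  shows "Lp_le p (\<lambda>\<omega>. Z \<omega> + Z' \<omega>) (c + c')"
  using Lp_le_sum[of "UNIV :: bool set" p "case_bool Z Z'" "case_bool c c'"] assms
  by (auto simp: UNIV_bool add.commute split: bool.splits)

lemma Lp_le_mult:
  assumes "Lp_le (2 * p) Z c" "Lp_le (2 * p) Z' c'"
  shows "Lp_le p (\<lambda>\<omega>. Z \<omega> * Z' \<omega>) (c * c')"
proof -
  have [measurable]: "Z \<in> borel_measurable M" "Z' \<in> borel_measurable M" and c: "0 \<le> c" "0 \<le> c'"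
    using assms by (auto simp: Lp_le_def)
  have *: "(\<integral>\<^sup>+ \<omega>. ennreal (\<bar>Z \<omega> * Z' \<omega>\<bar> ^ p) \<partial>M) = (\<integral>\<^sup>+ \<omega>. ennreal (\<bar>Z \<omega>\<bar> ^ p) * ennreal (\<bar>Z' \<omega>\<bar> ^ p) \<partial>M)"
    by (simp add: ennreal_mult[symmetric] abs_mult power_mult_distrib)
  have "(\<integral>\<^sup>+ \<omega>. ennreal (\<bar>Z \<omega>\<bar> ^ p) * ennreal (\<bar>Z' \<omega>\<bar> ^ p) \<partial>M)\<^sup>2
      \<le> (\<integral>\<^sup>+ \<omega>. (ennreal (\<bar>Z \<omega>\<bar> ^ p))\<^sup>2 \<partial>M) * (\<integral>\<^sup>+ \<omega>. (ennreal (\<bar>Z' \<omega>\<bar> ^ p))\<^sup>2 \<partial>M)"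
    by (rule Cauchy_Schwarz_nn_integral) measurable
  also have "\<dots> \<le> ennreal (c ^ (2 * p)) * ennreal (c' ^ (2 * p))"
    using assms by (intro mult_mono) (auto simp: Lp_le_def ennreal_power power_mult[symmetric] mult.commute)
  also have "\<dots> = (ennreal ((c * c') ^ p))\<^sup>2"
    using c by (simp add: ennreal_mult[symmetric] ennreal_power power_mult_distrib power_mult[symmetric] mult.commute)
  finally have "(\<integral>\<^sup>+ \<omega>. ennreal (\<bar>Z \<omega>\<bar> ^ p) * ennreal (\<bar>Z' \<omega>\<bar> ^ p) \<partial>M) \<le> ennreal ((c * c') ^ p)"
    by (cases "\<integral>\<^sup>+ \<omega>. ennreal (\<bar>Z \<omega>\<bar> ^ p) * ennreal (\<bar>Z' \<omega>\<bar> ^ p) \<partial>M")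
      (use c in \<open>auto simp: ennreal_power top_unique power2_le_iff_abs_le\<close>)
  then show ?thesis
    using c * by (simp add: Lp_le_def)
qed

text \<open>Lyapunov's inequality, descending by one order at a time: the tangent inequality with
  \<open>x = 1\<close> and \<open>m = \<bar>Z\<bar> / c\<close> bounds the moment of order
  \<open>n\<close> by the one of order \<open>Suc n\<close>.\<close>

lemma Lp_le_lower:
  assumes "p \<le> q" "1 \<le> p" "Lp_le q Z c"
  shows "Lp_le p Z c"
  using assms
proof (induction rule: inc_induct)
  case (step n)
  then have Z: "Lp_le (Suc n) Z c" by simp
  then have [measurable]: "Z \<in> borel_measurable M" and c: "0 \<le> c" by (auto simp: Lp_le_def)
  have *: "Lp_le n Z c" if Z: "Lp_le (Suc n) Z c" and c: "0 < c" for c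
  proof -
    have "ennreal (real (Suc n)) * ennreal (\<bar>Z \<omega>\<bar> ^ n)
        \<le> ennreal (real n / c) * ennreal (\<bar>Z \<omega>\<bar> ^ Suc n) + ennreal (c ^ n)" for \<omega>
    proof -
      have "real (Suc n) * (\<bar>Z \<omega>\<bar> / c) ^ n * 1 \<le> 1 ^ Suc n + real n * (\<bar>Z \<omega>\<bar> / c) ^ Suc n"
        using c by (intro power_tangent) auto
      then have "c ^ n * (real (Suc n) * (\<bar>Z \<omega>\<bar> / c) ^ n) \<le> c ^ n * (1 + real n * (\<bar>Z \<omega>\<bar> / c) ^ Suc n)"
        using c by (intro mult_left_mono) auto
      moreover have "c ^ n * (real (Suc n) * (\<bar>Z \<omega>\<bar> / c) ^ n) = real (Suc n) * \<bar>Z \<omega>\<bar> ^ n"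
        and "c ^ n * (1 + real n * (\<bar>Z \<omega>\<bar> / c) ^ Suc n) = real n / c * \<bar>Z \<omega>\<bar> ^ Suc n + c ^ n"
        using c by (simp_all add: power_divide distrib_left)
      ultimately have "real (Suc n) * \<bar>Z \<omega>\<bar> ^ n \<le> real n / c * \<bar>Z \<omega>\<bar> ^ Suc n + c ^ n"
        by linarith
      then show ?thesis
        using c by (simp add: ennreal_mult[symmetric] ennreal_plus[symmetric] del: ennreal_plus)
    qed
    then have "(\<integral>\<^sup>+ \<omega>. ennreal (real (Suc n)) * ennreal (\<bar>Z \<omega>\<bar> ^ n) \<partial>M)
        \<le> (\<integral>\<^sup>+ \<omega>. ennreal (real n / c) * ennreal (\<bar>Z \<omega>\<bar> ^ Suc n) + ennreal (c ^ n) \<partial>M)"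
      by (intro nn_integral_mono) auto
    also have "\<dots> = ennreal (real n / c) * (\<integral>\<^sup>+ \<omega>. ennreal (\<bar>Z \<omega>\<bar> ^ Suc n) \<partial>M) + ennreal (c ^ n)"
      by (subst nn_integral_add) (auto simp: nn_integral_cmult emeasure_space_1)
    also have "\<dots> \<le> ennreal (real n / c) * ennreal (c ^ Suc n) + ennreal (c ^ n)"
      using Z by (intro add_mono mult_left_mono) (auto simp: Lp_le_def)
    also have "\<dots> = ennreal (real (Suc n)) * ennreal (c ^ n)"
      using c by (simp add: ennreal_mult[symmetric] ennreal_plus[symmetric] field_simps del: ennreal_plus)
    also have "(\<integral>\<^sup>+ \<omega>. ennreal (real (Suc n)) * ennreal (\<bar>Z \<omega>\<bar> ^ n) \<partial>M)
        = ennreal (real (Suc n)) * (\<integral>\<^sup>+ \<omega>. ennreal (\<bar>Z \<omega>\<bar> ^ n) \<partial>M)"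
      by (rule nn_integral_cmult) measurable
    finally show ?thesis
      using c by (subst (asm) ennreal_mult_le_mult_iff) (auto simp: Lp_le_def)
  qed
  show ?case
    by (rule Lp_le_eps[OF _ c], rule *) (use Lp_le_mono_bound[OF Z] c in auto)
qed auto

lemma Lp_le_integrable:
  assumes "Lp_le p Z c"
  shows "integrable M (\<lambda>\<omega>. \<bar>Z \<omega>\<bar> ^ p)"
proof (rule integrableI_bounded)
  show "(\<lambda>\<omega>. \<bar>Z \<omega>\<bar> ^ p) \<in> borel_measurable M"
    using assms by (auto simp: Lp_le_def)
  show "(\<integral>\<^sup>+ \<omega>. ennreal (norm (\<bar>Z \<omega>\<bar> ^ p)) \<partial>M) < \<infinity>"
    using assms by (auto simp: Lp_le_def elim: order.strict_trans1)
qed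

lemma Lp_le_expectation:
  assumes "Lp_le p Z c"
  shows "expectation (\<lambda>\<omega>. \<bar>Z \<omega>\<bar> ^ p) \<le> c ^ p"
proof -
  have "ennreal (expectation (\<lambda>\<omega>. \<bar>Z \<omega>\<bar> ^ p)) \<le> ennreal (c ^ p)"
    using assms by (subst nn_integral_eq_integral[symmetric]) (auto simp: Lp_le_def intro: Lp_le_integrable[OF assms])
  then show ?thesis
    using assms by (simp add: Lp_le_def)
qed

lemma Lp_leI_expectation:
  assumes "Z \<in> borel_measurable M" "integrable M (\<lambda>\<omega>. \<bar>Z \<omega>\<bar> ^ p)"
    and "expectation (\<lambda>\<omega>. \<bar>Z \<omega>\<bar> ^ p) \<le> c ^ p" "0 \<le> c"
  shows "Lp_le p Z c"
  using assms by (auto simp: Lp_le_def nn_integral_eq_integral)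

end

section \<open>Moments of sums of martingale differences\<close>

text \<open>The term linear in \<open>z\<close> will vanish in expectation. All higher terms are
  absorbed with weight \<open>1 / n\<close> on \<open>s ^ (2 * q)\<close>, so that \<open>n\<close>
  steps multiply the moment by at most \<open>exp (4 ^ q)\<close>. The constant \<open>4 ^ q\<close>
  is the sum of the binomial coefficients.\<close>

lemma power_sum_le_martingale_step:
  fixes s z :: real
  assumes q: "1 \<le> q" and n: "1 \<le> (n :: nat)"
  shows "(s + z) ^ (2 * q) \<le> s ^ (2 * q) + real (2 * q) * (s ^ (2 * q - 1) * z)
           + 4 ^ q * (s ^ (2 * q) / real n + real n ^ (q - 1) * z ^ (2 * q))"
proof -
  define R where "R = s ^ (2 * q) / real n + real n ^ (q - 1) * z ^ (2 * q)"
  have n0: "0 < real n" using n by simp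
  have R0: "0 \<le> R" unfolding R_def by simp
  have term_le: "z ^ j * s ^ (2 * q - j) \<le> R" if j: "2 \<le> j" "j \<le> 2 * q" for j
  proof -
    have "z ^ j * s ^ (2 * q - j) \<le> \<bar>z\<bar> ^ j * \<bar>s\<bar> ^ (2 * q - j)"
      by (metis abs_ge_self abs_mult power_abs)
    also have "\<dots> \<le> R"
    \<comment> \<open>If \<open>s\<close> dominates, each of at least two factors \<open>z\<close>
      is traded for \<open>s / sqrt n\<close>, a gain of \<open>1 / n\<close> at least. Otherwise at
      most \<open>2 * q - 2\<close> factors \<open>s\<close> are traded for
      \<open>sqrt n * z\<close>.\<close>
    proof (cases "sqrt (real n) * \<bar>z\<bar> \<le> \<bar>s\<bar>")
      case True
      have "(sqrt (real n) * \<bar>z\<bar>) ^ j \<le> \<bar>s\<bar> ^ j"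
        using True by (intro power_mono) auto
      then have a: "sqrt (real n) ^ j * (\<bar>z\<bar> ^ j * \<bar>s\<bar> ^ (2 * q - j)) \<le> \<bar>s\<bar> ^ j * \<bar>s\<bar> ^ (2 * q - j)"
        by (auto simp: power_mult_distrib mult.assoc[symmetric] intro!: mult_right_mono)
      have "real n = sqrt (real n) ^ 2" by simp
      also have "\<dots> \<le> sqrt (real n) ^ j"
        using j n by (intro power_increasing) auto
      finally have "real n * (\<bar>z\<bar> ^ j * \<bar>s\<bar> ^ (2 * q - j)) \<le> sqrt (real n) ^ j * (\<bar>z\<bar> ^ j * \<bar>s\<bar> ^ (2 * q - j))"
        by (intro mult_right_mono) auto
      also note a
      also have "\<bar>s\<bar> ^ j * \<bar>s\<bar> ^ (2 * q - j) = s ^ (2 * q)"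
        using j by (simp add: power_add[symmetric] power_even_abs)
      finally have "\<bar>z\<bar> ^ j * \<bar>s\<bar> ^ (2 * q - j) \<le> s ^ (2 * q) / real n"
        using n0 by (simp add: field_simps)
      also have "\<dots> \<le> R" unfolding R_def by simp
      finally show ?thesis .
    next
      case False
      have "\<bar>s\<bar> ^ (2 * q - j) \<le> (sqrt (real n) * \<bar>z\<bar>) ^ (2 * q - j)"
        using False by (intro power_mono) auto
      then have "\<bar>z\<bar> ^ j * \<bar>s\<bar> ^ (2 * q - j) \<le> \<bar>z\<bar> ^ j * (sqrt (real n) * \<bar>z\<bar>) ^ (2 * q - j)"
        by (intro mult_left_mono) auto
      also have "\<dots> = sqrt (real n) ^ (2 * q - j) * z ^ (2 * q)"
        using j by (simp add: power_mult_distrib mult.left_commute power_add[symmetric] power_even_abs)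
      also have "\<dots> \<le> sqrt (real n) ^ (2 * (q - 1)) * z ^ (2 * q)"
        using j n by (intro mult_right_mono power_increasing) auto
      also have "sqrt (real n) ^ (2 * (q - 1)) = real n ^ (q - 1)"
        by (simp add: power_mult)
      also have "real n ^ (q - 1) * z ^ (2 * q) \<le> R" unfolding R_def by simp
      finally show ?thesis .
    qed
    finally show ?thesis .
  qed
  have "(s + z) ^ (2 * q) = (\<Sum>j\<le>2 * q. real (2 * q choose j) * z ^ j * s ^ (2 * q - j))"
    by (subst add.commute) (simp add: binomial_ring)
  also have "{..2 * q} = insert 0 (insert 1 {2..2 * q})"
    using q by auto
  also have "(\<Sum>j\<in>insert 0 (insert 1 {2..2 * q}). real (2 * q choose j) * z ^ j * s ^ (2 * q - j))
      = s ^ (2 * q) + real (2 * q) * (s ^ (2 * q - 1) * z)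
        + (\<Sum>j\<in>{2..2 * q}. real (2 * q choose j) * (z ^ j * s ^ (2 * q - j)))"
    by (simp add: mult.assoc mult.commute[of z])
  also have "(\<Sum>j\<in>{2..2 * q}. real (2 * q choose j) * (z ^ j * s ^ (2 * q - j)))
      \<le> (\<Sum>j\<in>{2..2 * q}. real (2 * q choose j) * R)"
    using term_le by (intro sum_mono mult_left_mono) auto
  also have "\<dots> \<le> (\<Sum>j\<le>2 * q. real (2 * q choose j) * R)"
    using R0 by (intro sum_mono2) auto
  also have "\<dots> = 4 ^ q * R"
    by (simp add: sum_distrib_right[symmetric] of_nat_sum[symmetric] choose_row_sum power_mult del: of_nat_sum)
  finally show ?thesis
    unfolding R_def by simp
qed

context prob_space
begin

lemma Lp_le_Fatou:
  assumes le: "\<And>k :: nat. Lp_le p (Z k) c" and Z: "Z' \<in> borel_measurable M"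
    and lim: "AE \<omega> in M. (\<lambda>k. Z k \<omega>) \<longlonglongrightarrow> Z' \<omega>"
  shows "Lp_le p Z' c"
proof -
  have [measurable]: "Z k \<in> borel_measurable M" for k using le by (auto simp: Lp_le_def)
  have "(\<integral>\<^sup>+ \<omega>. ennreal (\<bar>Z' \<omega>\<bar> ^ p) \<partial>M) \<le> (\<integral>\<^sup>+ \<omega>. liminf (\<lambda>k. ennreal (\<bar>Z k \<omega>\<bar> ^ p)) \<partial>M)"
  proof (rule nn_integral_mono_AE, use lim in eventually_elim)
    case (elim \<omega>)
    then have "(\<lambda>k. ennreal (\<bar>Z k \<omega>\<bar> ^ p)) \<longlonglongrightarrow> ennreal (\<bar>Z' \<omega>\<bar> ^ p)"
      by (intro tendsto_ennrealI tendsto_power tendsto_rabs)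
    then show ?case
      by (metis lim_imp_Liminf order_refl sequentially_bot)
  qed
  also have "\<dots> \<le> liminf (\<lambda>k. \<integral>\<^sup>+ \<omega>. ennreal (\<bar>Z k \<omega>\<bar> ^ p) \<partial>M)"
    by (rule nn_integral_liminf) measurable
  also have "\<dots> \<le> ennreal (c ^ p)"
    using le by (intro Liminf_le) (auto simp: Lp_le_def)
  finally show ?thesis
    using le[of 0] Z by (auto simp: Lp_le_def)
qed

lemma abs_power_mult_le:
  fixes x y :: real
  assumes "a \<le> m"
  shows "\<bar>x\<bar> ^ a * \<bar>y\<bar> ^ (m - a) \<le> \<bar>x\<bar> ^ m + \<bar>y\<bar> ^ m"
proof (cases "\<bar>x\<bar> \<le> \<bar>y\<bar>")
  case True
  have "\<bar>x\<bar> ^ a * \<bar>y\<bar> ^ (m - a) \<le> \<bar>y\<bar> ^ a * \<bar>y\<bar> ^ (m - a)"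
    using True by (intro mult_right_mono power_mono) auto
  also have "\<dots> = \<bar>y\<bar> ^ m" using assms by (simp add: power_add[symmetric])
  finally show ?thesis by (simp add: add_increasing)
next
  case False
  have "\<bar>x\<bar> ^ a * \<bar>y\<bar> ^ (m - a) \<le> \<bar>x\<bar> ^ a * \<bar>x\<bar> ^ (m - a)"
    using False by (intro mult_left_mono power_mono) auto
  also have "\<dots> = \<bar>x\<bar> ^ m" using assms by (simp add: power_add[symmetric])
  finally show ?thesis by (simp add: add_increasing2)
qed

text \<open>A discrete Burkholder inequality; only the orthogonality that the proof uses is assumed.\<close>

lemma Lp_le_martingale:
  assumes q: "1 \<le> q"
  shows "\<exists>K\<ge>0. \<forall>(n :: nat) D d.
    (\<forall>i<n. Lp_le (2 * q) (D i) d) \<longrightarrow>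
    (\<forall>i<n. expectation (\<lambda>\<omega>. (\<Sum>j<i. D j \<omega>) ^ (2 * q - 1) * D i \<omega>) = 0) \<longrightarrow> 0 \<le> d \<longrightarrow>
    Lp_le (2 * q) (\<lambda>\<omega>. \<Sum>i<n. D i \<omega>) (K * (sqrt (real n) * d))"
proof (intro exI[of _ "exp (4 ^ q) * 4 ^ q :: real"] conjI allI impI)
  show "0 \<le> exp (4 ^ q) * (4 ^ q :: real)" by simp
  fix n :: nat and D d
  assume D: "\<forall>i<n. Lp_le (2 * q) (D i) d" and d: "0 \<le> d"
    and orth: "\<forall>i<n. expectation (\<lambda>\<omega>. (\<Sum>j<i. D j \<omega>) ^ (2 * q - 1) * D i \<omega>) = 0"
  let ?C = "4 ^ q :: real" and ?K = "exp (4 ^ q) * 4 ^ q :: real"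
  let ?S = "\<lambda>i \<omega>. \<Sum>j<i. D j \<omega>"
  show "Lp_le (2 * q) (?S n) (?K * (sqrt (real n) * d))"
  proof (cases "n = 0")
    case True
    then show ?thesis using d q by (auto simp: Lp_le_def power_0_left)
  next
    case False
    then have n: "1 \<le> n" by simp
    have [measurable]: "D i \<in> borel_measurable M" if "i < n" for i
      using D that by (auto simp: Lp_le_def)
    have S: "Lp_le (2 * q) (?S i) (\<Sum>j<i. d)" if "i \<le> n" for i
      using D that q by (intro Lp_le_sum) auto
    have iS: "integrable M (\<lambda>\<omega>. ?S i \<omega> ^ (2 * q))" if "i \<le> n" for i
      using Lp_le_integrable[OF S[OF that]] by (simp add: power_even_abs)
    have iD: "integrable M (\<lambda>\<omega>. D i \<omega> ^ (2 * q))" if "i < n" for i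
      using Lp_le_integrable[of "2 * q" "D i" d] D that by (simp add: power_even_abs)
    have iSD: "integrable M (\<lambda>\<omega>. ?S i \<omega> ^ (2 * q - 1) * D i \<omega>)" if "i < n" for i
    proof (rule Bochner_Integration.integrable_bound[OF Bochner_Integration.integrable_add[OF iS iD]])
      show "AE \<omega> in M. norm (?S i \<omega> ^ (2 * q - 1) * D i \<omega>) \<le> norm (?S i \<omega> ^ (2 * q) + D i \<omega> ^ (2 * q))"
        using abs_power_mult_le[of "2 * q - 1" "2 * q" "?S i \<omega>" "D i \<omega>" for \<omega>] q
        by (intro AE_I2) (simp add: abs_mult power_abs[symmetric] power_even_abs)
    qed (use that in auto)
    \<comment> \<open>What one difference adds to the moment. The sum \<open>n * b\<close> equals
      \<open>4 ^ q * (sqrt n * d) ^ (2 * q)\<close>, which is the order aimed at.\<close>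
    define b where "b = ?C * real n ^ (q - 1) * d ^ (2 * q)"
    have b: "0 \<le> b" using d by (simp add: b_def)
    have "expectation (\<lambda>\<omega>. ?S i \<omega> ^ (2 * q)) \<le> (1 + ?C / real n) ^ i * real i * b" if "i \<le> n" for i
      using that
    proof (induction i)
      case 0
      then show ?case using q by (simp add: power_0_left)
    next
      case (Suc i)
      then have i: "i < n" by simp
      have "expectation (\<lambda>\<omega>. ?S (Suc i) \<omega> ^ (2 * q)) \<le> expectation (\<lambda>\<omega>. ?S i \<omega> ^ (2 * q)
           + real (2 * q) * (?S i \<omega> ^ (2 * q - 1) * D i \<omega>)
           + ?C * (?S i \<omega> ^ (2 * q) / real n + real n ^ (q - 1) * D i \<omega> ^ (2 * q)))"
        using iS[OF Suc.prems] iS[of i] iD[OF i] iSD[OF i] i power_sum_le_martingale_step[OF q n]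
        by (intro integral_mono Bochner_Integration.integrable_add integrable_mult_right
            integrable_divide_zero) auto
      also have "\<dots> = (1 + ?C / real n) * expectation (\<lambda>\<omega>. ?S i \<omega> ^ (2 * q))
          + ?C * (real n ^ (q - 1) * expectation (\<lambda>\<omega>. D i \<omega> ^ (2 * q)))"
      proof -
        have "expectation (\<lambda>\<omega>. ?S i \<omega> ^ (2 * q - 1) * D i \<omega>) = 0"
          using orth i by blast
        then show ?thesis
          using iS[of i] iD[OF i] iSD[OF i] i by (simp add: distrib_left distrib_right)
      qed
      also have "\<dots> \<le> (1 + ?C / real n) * ((1 + ?C / real n) ^ i * real i * b) + b"
      proof (rule add_mono)
        show "(1 + ?C / real n) * expectation (\<lambda>\<omega>. ?S i \<omega> ^ (2 * q))
            \<le> (1 + ?C / real n) * ((1 + ?C / real n) ^ i * real i * b)"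
          using Suc i by (intro mult_left_mono) auto
        have "expectation (\<lambda>\<omega>. D i \<omega> ^ (2 * q)) \<le> d ^ (2 * q)"
          using Lp_le_expectation[of "2 * q" "D i" d] D i by (simp add: power_even_abs)
        then show "?C * (real n ^ (q - 1) * expectation (\<lambda>\<omega>. D i \<omega> ^ (2 * q))) \<le> b"
          unfolding b_def mult.assoc by (intro mult_left_mono) auto
      qed
      also have "\<dots> \<le> (1 + ?C / real n) * ((1 + ?C / real n) ^ i * real i * b) + (1 + ?C / real n) ^ Suc i * b"
      proof -
        have "1 * b \<le> (1 + ?C / real n) ^ Suc i * b"
          using b by (intro mult_right_mono one_le_power) auto
        then show ?thesis by simp
      qed
      also have "\<dots> = (1 + ?C / real n) ^ Suc i * real (Suc i) * b"
      proof -
        have "r * (r ^ i * real i * b) + r ^ Suc i * b = r ^ Suc i * real (Suc i) * b" for r :: real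
          by (simp add: algebra_simps)
        then show ?thesis .
      qed
      finally show ?case .
    qed
    then have "expectation (\<lambda>\<omega>. ?S n \<omega> ^ (2 * q)) \<le> (1 + ?C / real n) ^ n * real n * b"
      by simp
    also have "\<dots> \<le> exp (?C / real n) ^ n * real n * b"
      using b by (intro mult_right_mono power_mono exp_ge_add_one_self) auto
    also have "exp (?C / real n) ^ n = exp ?C"
      using n by (simp add: exp_of_nat_mult[symmetric])
    also have "exp ?C * real n * b = ?K * (real n ^ q * d ^ (2 * q))"
      using q by (cases q) (auto simp: b_def)
    also have "\<dots> \<le> ?K ^ (2 * q) * (real n ^ q * d ^ (2 * q))"
    proof (rule mult_right_mono)
      have "1 \<le> ?K"
        using mult_mono[of 1 "exp ?C" 1 ?C] by (simp add: one_le_power)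
      then show "?K \<le> ?K ^ (2 * q)"
        using power_increasing[of 1 "2 * q" ?K] q by simp
    qed (use d in simp)
    also have "\<dots> = (?K * (sqrt (real n) * d)) ^ (2 * q)"
      by (simp add: power_mult_distrib power_mult)
    finally show ?thesis
      using iS[of n] d by (intro Lp_leI_expectation) (auto simp: power_even_abs)
  qed
qed

section \<open>Families bounded uniformly in all orders\<close>

text \<open>The constant may depend on the order \<open>p\<close> but not on the index, so that
  uniformity in \<open>n\<close>, in time and in the delay is expressed by the index set. All orders
  are required at once because a product of order \<open>p\<close> consumes factors of order
  \<open>2 * p\<close>.\<close>

definition Lp_O :: "'i set \<Rightarrow> ('i \<Rightarrow> 'a \<Rightarrow> real) \<Rightarrow> ('i \<Rightarrow> real) \<Rightarrow> bool" where
  "Lp_O I Z s \<longleftrightarrow> (\<forall>i\<in>I. 0 \<le> s i) \<and> (\<forall>p\<ge>1. \<exists>C\<ge>0. \<forall>i\<in>I. Lp_le p (Z i) (C * s i))"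

lemma Lp_O_measurable: "Lp_O I Z s \<Longrightarrow> i \<in> I \<Longrightarrow> Z i \<in> borel_measurable M"
  unfolding Lp_O_def Lp_le_def by (meson order_refl)

lemma Lp_O_nonneg: "Lp_O I Z s \<Longrightarrow> i \<in> I \<Longrightarrow> 0 \<le> s i"
  unfolding Lp_O_def by auto

lemma Lp_O_E:
  assumes "Lp_O I Z s" "1 \<le> p"
  obtains C where "0 \<le> C" "\<And>i. i \<in> I \<Longrightarrow> Lp_le p (Z i) (C * s i)"
  using assms unfolding Lp_O_def by blast

lemma Lp_O_scale:
  assumes "Lp_O I Z s" "\<And>i. i \<in> I \<Longrightarrow> s i \<le> K * s' i" "\<And>i. i \<in> I \<Longrightarrow> 0 \<le> s' i"
  shows "Lp_O I Z s'"
  unfolding Lp_O_def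
proof (intro conjI allI impI ballI)
  fix p :: nat assume "1 \<le> p"
  then obtain C where C: "0 \<le> C" "\<And>i. i \<in> I \<Longrightarrow> Lp_le p (Z i) (C * s i)"
    using assms(1) by (auto elim: Lp_O_E)
  have "C * s i \<le> C * \<bar>K\<bar> * s' i" if "i \<in> I" for i
  proof -
    have "s i \<le> \<bar>K\<bar> * s' i"
      using assms(2,3)[OF that] by (meson abs_ge_self mult_right_mono order_trans)
    then show ?thesis using C(1) by (simp add: mult.assoc mult_left_mono)
  qed
  then show "\<exists>C\<ge>0. \<forall>i\<in>I. Lp_le p (Z i) (C * s' i)"
    using C by (intro exI[of _ "C * \<bar>K\<bar>"]) (auto intro: Lp_le_mono_bound)
qed (use assms in auto)

lemma Lp_O_dom:
  assumes "Lp_O I Z s" "\<And>i. i \<in> I \<Longrightarrow> Z' i \<in> borel_measurable M"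
    "\<And>i. i \<in> I \<Longrightarrow> AE \<omega> in M. \<bar>Z' i \<omega>\<bar> \<le> K * \<bar>Z i \<omega>\<bar>"
  shows "Lp_O I Z' s"
  unfolding Lp_O_def
proof (intro conjI allI impI ballI)
  fix p :: nat assume p: "1 \<le> p"
  then obtain C where C: "0 \<le> C" "\<And>i. i \<in> I \<Longrightarrow> Lp_le p (Z i) (C * s i)"
    using assms(1) by (auto elim: Lp_O_E)
  have "Lp_le p (Z' i) (\<bar>K\<bar> * C * s i)" if i: "i \<in> I" for i
  proof (rule Lp_le_dom)
    have [measurable]: "Z i \<in> borel_measurable M" using C i by (auto simp: Lp_le_def)
    have "(\<integral>\<^sup>+ \<omega>. ennreal (\<bar>\<bar>K\<bar> * Z i \<omega>\<bar> ^ p) \<partial>M) = ennreal (\<bar>K\<bar> ^ p) * (\<integral>\<^sup>+ \<omega>. ennreal (\<bar>Z i \<omega>\<bar> ^ p) \<partial>M)"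
      by (subst nn_integral_cmult[symmetric])
        (auto simp: abs_mult power_mult_distrib ennreal_mult)
    also have "\<dots> \<le> ennreal (\<bar>K\<bar> ^ p) * ennreal ((C * s i) ^ p)"
      using C(2)[OF i] by (intro mult_left_mono) (auto simp: Lp_le_def)
    finally show "Lp_le p (\<lambda>\<omega>. \<bar>K\<bar> * Z i \<omega>) (\<bar>K\<bar> * C * s i)"
      using C(1) Lp_O_nonneg[OF assms(1) i]
      by (simp add: Lp_le_def ennreal_mult[symmetric] power_mult_distrib mult.assoc)
    show "AE \<omega> in M. \<bar>Z' i \<omega>\<bar> \<le> \<bar>\<bar>K\<bar> * Z i \<omega>\<bar>"
    proof (use assms(3)[OF i] in eventually_elim)
      case (elim \<omega>)
      then show ?case
        using mult_right_mono[OF abs_ge_self[of K], of "\<bar>Z i \<omega>\<bar>"] by (simp add: abs_mult)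
    qed
  qed (use assms i in auto)
  then show "\<exists>C\<ge>0. \<forall>i\<in>I. Lp_le p (Z' i) (C * s i)"
    using C by (intro exI[of _ "\<bar>K\<bar> * C"]) auto
qed (use assms in \<open>auto simp: Lp_O_def\<close>)

lemma Lp_O_reindex: "Lp_O J Z s \<Longrightarrow> (\<And>i. i \<in> I \<Longrightarrow> h i \<in> J) \<Longrightarrow> Lp_O I (\<lambda>i. Z (h i)) (\<lambda>i. s (h i))"
  unfolding Lp_O_def by blast

lemma Lp_O_cong:
  assumes "Lp_O I Z s" "\<And>i \<omega>. i \<in> I \<Longrightarrow> Z i \<omega> = Z' i \<omega>" "\<And>i. i \<in> I \<Longrightarrow> s i = s' i"
  shows "Lp_O I Z' s'"
proof -
  have "Z i = Z' i" if "i \<in> I" for i using assms(2)[OF that] by auto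
  then show ?thesis
    using assms(1,3) unfolding Lp_O_def by (metis (no_types, lifting))
qed

lemma Lp_O_add:
  assumes "Lp_O I Z s" "Lp_O I Z' s'"
  shows "Lp_O I (\<lambda>i \<omega>. Z i \<omega> + Z' i \<omega>) (\<lambda>i. s i + s' i)"
  unfolding Lp_O_def
proof (intro conjI allI impI ballI)
  fix p :: nat assume p: "1 \<le> p"
  obtain C where C: "0 \<le> C" "\<And>i. i \<in> I \<Longrightarrow> Lp_le p (Z i) (C * s i)"
    using assms(1) p by (auto elim: Lp_O_E)
  obtain C' where C': "0 \<le> C'" "\<And>i. i \<in> I \<Longrightarrow> Lp_le p (Z' i) (C' * s' i)"
    using assms(2) p by (auto elim: Lp_O_E)
  have "Lp_le p (\<lambda>\<omega>. Z i \<omega> + Z' i \<omega>) ((C + C') * (s i + s' i))" if i: "i \<in> I" for i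
    by (rule Lp_le_mono_bound[OF Lp_le_add[OF p C(2)[OF i] C'(2)[OF i]]])
      (use C(1) C'(1) Lp_O_nonneg[OF assms(1) i] Lp_O_nonneg[OF assms(2) i] in \<open>simp add: algebra_simps\<close>)
  then show "\<exists>C\<ge>0. \<forall>i\<in>I. Lp_le p (\<lambda>\<omega>. Z i \<omega> + Z' i \<omega>) (C * (s i + s' i))"
    using C(1) C'(1) by (intro exI[of _ "C + C'"]) auto
qed (use assms in \<open>auto simp: Lp_O_def\<close>)

lemma Lp_O_cmult:
  assumes "Lp_O I Z s" "\<And>i. i \<in> I \<Longrightarrow> \<bar>c i\<bar> \<le> K"
  shows "Lp_O I (\<lambda>i \<omega>. c i * Z i \<omega>) s"
proof (rule Lp_O_dom[OF assms(1)])
  show "AE \<omega> in M. \<bar>c i * Z i \<omega>\<bar> \<le> K * \<bar>Z i \<omega>\<bar>" if "i \<in> I" for i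
    using assms(2)[OF that] by (intro AE_I2) (simp add: abs_mult mult_right_mono)
qed (use Lp_O_measurable[OF assms(1)] in auto)

lemma Lp_O_diff:
  assumes "Lp_O I Z s" "Lp_O I Z' s'"
  shows "Lp_O I (\<lambda>i \<omega>. Z i \<omega> - Z' i \<omega>) (\<lambda>i. s i + s' i)"
  using Lp_O_add[OF assms(1) Lp_O_cmult[OF assms(2), of "\<lambda>_. - 1" 1]] by simp

lemma Lp_O_mult:
  assumes "Lp_O I Z s" "Lp_O I Z' s'"
  shows "Lp_O I (\<lambda>i \<omega>. Z i \<omega> * Z' i \<omega>) (\<lambda>i. s i * s' i)"
  unfolding Lp_O_def
proof (intro conjI allI impI ballI)
  fix p :: nat assume p: "1 \<le> p"
  obtain C where C: "0 \<le> C" "\<And>i. i \<in> I \<Longrightarrow> Lp_le (2 * p) (Z i) (C * s i)"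
    using assms(1) p by (auto elim: Lp_O_E[where p = "2 * p"])
  obtain C' where C': "0 \<le> C'" "\<And>i. i \<in> I \<Longrightarrow> Lp_le (2 * p) (Z' i) (C' * s' i)"
    using assms(2) p by (auto elim: Lp_O_E[where p = "2 * p"])
  have "Lp_le p (\<lambda>\<omega>. Z i \<omega> * Z' i \<omega>) ((C * C') * (s i * s' i))" if i: "i \<in> I" for i
    using Lp_le_mult[OF C(2)[OF i] C'(2)[OF i]] by (simp add: mult_ac)
  then show "\<exists>C\<ge>0. \<forall>i\<in>I. Lp_le p (\<lambda>\<omega>. Z i \<omega> * Z' i \<omega>) (C * (s i * s' i))"
    using C(1) C'(1) by (intro exI[of _ "C * C'"]) auto
qed (use assms in \<open>auto simp: Lp_O_def\<close>)

lemma Lp_O_bounded_mult: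
  assumes "Lp_O I Z s" "\<And>i. i \<in> I \<Longrightarrow> g i \<in> borel_measurable M" "\<And>i \<omega>. i \<in> I \<Longrightarrow> \<bar>g i \<omega>\<bar> \<le> K"
  shows "Lp_O I (\<lambda>i \<omega>. g i \<omega> * Z i \<omega>) s"
proof (rule Lp_O_dom[OF assms(1)])
  show "(\<lambda>\<omega>. g i \<omega> * Z i \<omega>) \<in> borel_measurable M" if "i \<in> I" for i
    using Lp_O_measurable[OF assms(1) that] assms(2)[OF that] by measurable
  show "AE \<omega> in M. \<bar>g i \<omega> * Z i \<omega>\<bar> \<le> K * \<bar>Z i \<omega>\<bar>" if "i \<in> I" for i
    using assms(3)[OF that] by (intro AE_I2) (simp add: abs_mult mult_right_mono)
qed

lemma Lp_O_const:
  assumes "\<And>i. i \<in> I \<Longrightarrow> \<bar>c i\<bar> \<le> K * s i" "\<And>i. i \<in> I \<Longrightarrow> 0 \<le> s i"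
  shows "Lp_O I (\<lambda>i _. c i) s"
  unfolding Lp_O_def
proof (intro conjI allI impI ballI)
  have le: "\<bar>c i\<bar> \<le> \<bar>K\<bar> * s i" if "i \<in> I" for i
    using assms[OF that] by (meson abs_ge_self mult_right_mono order_trans)
  then show "\<exists>C\<ge>0. \<forall>i\<in>I. Lp_le p (\<lambda>_. c i) (C * s i)" for p
    using assms(2) by (intro exI[of _ "\<bar>K\<bar>"])
      (auto simp: Lp_le_def emeasure_space_1 intro!: ennreal_leI power_mono)
qed (use assms in auto)

lemma Lp_O_sum:
  assumes Z: "Lp_O (SIGMA i:I. A i) (\<lambda>(i, k). Z i k) (\<lambda>(i, k). s i k)" and A: "\<And>i. i \<in> I \<Longrightarrow> finite (A i)"
  shows "Lp_O I (\<lambda>i \<omega>. \<Sum>k\<in>A i. Z i k \<omega>) (\<lambda>i. \<Sum>k\<in>A i. s i k)"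
  unfolding Lp_O_def
proof (intro conjI allI impI ballI)
  show "0 \<le> (\<Sum>k\<in>A i. s i k)" if "i \<in> I" for i
    using Lp_O_nonneg[OF Z] that by (intro sum_nonneg) auto
  fix p :: nat assume p: "1 \<le> p"
  obtain C where C: "0 \<le> C" "\<And>x. x \<in> (SIGMA i:I. A i) \<Longrightarrow> Lp_le p ((\<lambda>(i, k). Z i k) x) (C * (\<lambda>(i, k). s i k) x)"
    using Z p by (auto elim: Lp_O_E)
  have "Lp_le p (\<lambda>\<omega>. \<Sum>k\<in>A i. Z i k \<omega>) (\<Sum>k\<in>A i. C * s i k)" if "i \<in> I" for i
    using C(2)[of "(i, k)" for k] that p A by (intro Lp_le_sum) auto
  then show "\<exists>C\<ge>0. \<forall>i\<in>I. Lp_le p (\<lambda>\<omega>. \<Sum>k\<in>A i. Z i k \<omega>) (C * (\<Sum>k\<in>A i. s i k))"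
    using C(1) by (auto simp: sum_distrib_left)
qed

text \<open>Orthogonality is asked for all powers \<open>m\<close>, since the bound of order
  \<open>2 * p\<close> uses the power \<open>2 * p - 1\<close>. The size \<open>d i\<close> is
  common to all \<open>k\<close>, so the number of summands enters through its square root.\<close>

lemma Lp_O_martingale:
  assumes D: "Lp_O (SIGMA i:I. {..<n i}) (\<lambda>(i, k). D i k) (\<lambda>(i, k). d i)"
    and d: "\<And>i. i \<in> I \<Longrightarrow> 0 \<le> d i"
    and orth: "\<And>i k m. i \<in> I \<Longrightarrow> k < n i \<Longrightarrow> expectation (\<lambda>\<omega>. (\<Sum>j<k. D i j \<omega>) ^ m * D i k \<omega>) = 0"
  shows "Lp_O I (\<lambda>i \<omega>. \<Sum>k<n i. D i k \<omega>) (\<lambda>i. sqrt (real (n i)) * d i)"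
  unfolding Lp_O_def
proof (intro conjI allI impI ballI)
  fix p :: nat assume p: "1 \<le> p"
  obtain K where K: "0 \<le> K" "\<And>n D d. \<lbrakk>\<forall>i<n. Lp_le (2 * p) (D i) d;
     \<forall>i<n. expectation (\<lambda>\<omega>. (\<Sum>j<i. D j \<omega>) ^ (2 * p - 1) * D i \<omega>) = 0; 0 \<le> d\<rbrakk> \<Longrightarrow>
    Lp_le (2 * p) (\<lambda>\<omega>. \<Sum>i<n. D i \<omega>) (K * (sqrt (real n) * d))"
    using Lp_le_martingale[OF p] by blast
  obtain C where C: "0 \<le> C" "\<And>x. x \<in> (SIGMA i:I. {..<n i}) \<Longrightarrow> Lp_le (2 * p) ((\<lambda>(i, k). D i k) x) (C * (\<lambda>(i, k). d i) x)"
    using D p by (auto elim: Lp_O_E[where p = "2 * p"])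
  have "Lp_le p (\<lambda>\<omega>. \<Sum>k<n i. D i k \<omega>) (K * C * (sqrt (real (n i)) * d i))" if i: "i \<in> I" for i
  proof -
    have "Lp_le (2 * p) (\<lambda>\<omega>. \<Sum>k<n i. D i k \<omega>) (K * (sqrt (real (n i)) * (C * d i)))"
      using C(2)[of "(i, k)" for k] C(1) d[OF i] i orth by (intro K(2)) auto
    then show ?thesis
      using p by (auto simp: mult_ac intro: Lp_le_lower[rotated 2])
  qed
  then show "\<exists>C\<ge>0. \<forall>i\<in>I. Lp_le p (\<lambda>\<omega>. \<Sum>k<n i. D i k \<omega>) (C * (sqrt (real (n i)) * d i))"
    using C(1) K(1) by (intro exI[of _ "K * C"]) auto
qed (use d in auto)

section \<open>Integrals over time and delay, Gronwall's inequality\<close>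

text \<open>Minkowski's inequality for the product of Lebesgue measure and \<open>\<mu>\<close>. The
  bounds on \<open>G\<close> are available for \<open>s\<close> in \<open>{a..b}\<close> only, which
  is why the product measure is restricted to a rectangle.\<close>

lemma Lp_le_double_integral:
  fixes G :: "real \<Rightarrow> 'b \<Rightarrow> 'a \<Rightarrow> real" and c :: "real \<Rightarrow> real"
  assumes \<mu>: "finite_measure \<mu>" and p: "1 \<le> p"
    and [measurable]: "(\<lambda>((s, r), \<omega>). G s r \<omega>) \<in> borel_measurable ((borel \<Otimes>\<^sub>M \<mu>) \<Otimes>\<^sub>M M)"
    and G: "\<And>s r \<omega>. s \<in> {a..b} \<Longrightarrow> r \<in> space \<mu> \<Longrightarrow> \<omega> \<in> space M \<Longrightarrow> 0 \<le> G s r \<omega>"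
    and [measurable]: "c \<in> borel_measurable borel"
    and c: "\<And>s. s \<in> {a..b} \<Longrightarrow> 0 < c s"
    and C: "(\<integral>\<^sup>+ s. ennreal (c s) * indicator {a..b} s \<partial>lborel) * ennreal (measure \<mu> (space \<mu>)) \<le> ennreal C" "0 \<le> C"
    and le: "\<And>s r. s \<in> {a..b} \<Longrightarrow> r \<in> space \<mu> \<Longrightarrow> Lp_le p (G s r) (c s)"
    and [measurable]: "Z \<in> borel_measurable M"
    and Z: "AE \<omega> in M. ennreal \<bar>Z \<omega>\<bar> \<le> (\<integral>\<^sup>+ s. (\<integral>\<^sup>+ r. G s r \<omega> \<partial>\<mu>) * indicator {a..b} s \<partial>lborel)"
  shows "Lp_le p Z C"
proof -
  interpret \<mu>: finite_measure \<mu> by (rule \<mu>)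
  interpret L\<mu>: pair_sigma_finite lborel \<mu> ..
  obtain p' where p': "p = Suc p'" using p by (cases p) auto
  let ?R = "{a..b} \<times> space \<mu>"
  have R[measurable]: "?R \<in> sets (lborel \<Otimes>\<^sub>M \<mu>)" by simp
  let ?N = "restrict_space (lborel \<Otimes>\<^sub>M \<mu>) ?R"
  have sN: "sigma_finite_measure ?N"
    by (rule sigma_finite_measure_restrict_space) (auto intro: L\<mu>.sigma_finite_measure_axioms)
  have spN: "space ?N = ?R"
    by (auto simp: space_restrict_space space_pair_measure)
  have idN: "(\<lambda>x. x) \<in> ?N \<rightarrow>\<^sub>M borel \<Otimes>\<^sub>M \<mu>"
    by (rule measurable_restrict_space1) measurable
  have fstN: "fst \<in> ?N \<rightarrow>\<^sub>M borel"
    by (rule measurable_restrict_space1) measurable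
  have m: "(\<lambda>(x, \<omega>). (x, \<omega>)) \<in> ?N \<Otimes>\<^sub>M M \<rightarrow>\<^sub>M (borel \<Otimes>\<^sub>M \<mu>) \<Otimes>\<^sub>M M"
    using idN by measurable
  show ?thesis
    unfolding p'
  proof (rule Lp_le_nn_integral[where N = ?N and c = "\<lambda>x. c (fst x)" and G = "\<lambda>((s, r), \<omega>). G s r \<omega>"])
    show "(\<lambda>((s, r), \<omega>). G s r \<omega>) \<in> borel_measurable (?N \<Otimes>\<^sub>M M)"
      using measurable_compose[OF m assms(3)] by (simp add: case_prod_beta')
    show "(\<lambda>x. c (fst x)) \<in> borel_measurable ?N"
      using fstN by measurable
    have "(\<integral>\<^sup>+ x. ennreal (c (fst x)) \<partial>?N) = (\<integral>\<^sup>+ x. ennreal (c (fst x)) * indicator ?R x \<partial>(lborel \<Otimes>\<^sub>M \<mu>))"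
      by (rule nn_integral_restrict_space) auto
    also have "\<dots> = (\<integral>\<^sup>+ s. \<integral>\<^sup>+ r. ennreal (c s) * indicator ?R (s, r) \<partial>\<mu> \<partial>lborel)"
      by (subst \<mu>.nn_integral_fst[symmetric]) auto
    also have "\<dots> = (\<integral>\<^sup>+ s. (ennreal (c s) * indicator {a..b} s) * ennreal (measure \<mu> (space \<mu>)) \<partial>lborel)"
    proof (rule nn_integral_cong)
      fix s :: real
      have "(\<integral>\<^sup>+ r. ennreal (c s) * indicator ?R (s, r) \<partial>\<mu>) = (\<integral>\<^sup>+ r. ennreal (c s) * indicator {a..b} s \<partial>\<mu>)"
        by (intro nn_integral_cong) (auto simp: indicator_def)
      also have "\<dots> = (ennreal (c s) * indicator {a..b} s) * ennreal (measure \<mu> (space \<mu>))"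
        by (simp add: \<mu>.emeasure_eq_measure)
      finally show "(\<integral>\<^sup>+ r. ennreal (c s) * indicator ?R (s, r) \<partial>\<mu>) = (ennreal (c s) * indicator {a..b} s) * ennreal (measure \<mu> (space \<mu>))" .
    qed
    also have "\<dots> = (\<integral>\<^sup>+ s. ennreal (c s) * indicator {a..b} s \<partial>lborel) * ennreal (measure \<mu> (space \<mu>))"
      by (rule nn_integral_multc) auto
    finally show "(\<integral>\<^sup>+ x. ennreal (c (fst x)) \<partial>?N) \<le> ennreal C"
      using C by simp
    show "AE \<omega> in M. ennreal \<bar>Z \<omega>\<bar> \<le> (\<integral>\<^sup>+ x. ennreal ((\<lambda>((s, r), \<omega>). G s r \<omega>) (x, \<omega>)) \<partial>?N)"
      using Z
    proof (rule AE_mp, intro AE_I2 impI)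
      fix \<omega> assume \<omega>: "\<omega> \<in> space M"
        and "ennreal \<bar>Z \<omega>\<bar> \<le> (\<integral>\<^sup>+ s. (\<integral>\<^sup>+ r. G s r \<omega> \<partial>\<mu>) * indicator {a..b} s \<partial>lborel)"
      note this(2)
      have pm: "(\<lambda>x. (x, \<omega>)) \<in> lborel \<Otimes>\<^sub>M \<mu> \<rightarrow>\<^sub>M (borel \<Otimes>\<^sub>M \<mu>) \<Otimes>\<^sub>M M"
        using \<omega> by measurable
      have gm: "(\<lambda>x. G (fst x) (snd x) \<omega>) \<in> borel_measurable (lborel \<Otimes>\<^sub>M \<mu>)"
        using measurable_compose[OF pm assms(3)] by (simp add: case_prod_beta')
      have gm': "G s r' \<omega> = (\<lambda>x. G (fst x) (snd x) \<omega>) (s, r')" for s r' by simp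
      note \<open>ennreal \<bar>Z \<omega>\<bar> \<le> (\<integral>\<^sup>+ s. (\<integral>\<^sup>+ r. G s r \<omega> \<partial>\<mu>) * indicator {a..b} s \<partial>lborel)\<close>
      also have "(\<integral>\<^sup>+ s. (\<integral>\<^sup>+ r. G s r \<omega> \<partial>\<mu>) * indicator {a..b} s \<partial>lborel)
          = (\<integral>\<^sup>+ s. \<integral>\<^sup>+ r. ennreal (G s r \<omega>) * indicator ?R (s, r) \<partial>\<mu> \<partial>lborel)"
      proof (rule nn_integral_cong)
        fix s :: real
        have "(\<integral>\<^sup>+ r. ennreal (G s r \<omega>) * indicator ?R (s, r) \<partial>\<mu>) = (\<integral>\<^sup>+ r. ennreal (G s r \<omega>) * indicator {a..b} s \<partial>\<mu>)"
          by (intro nn_integral_cong) (auto simp: indicator_def)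
        also have "\<dots> = (\<integral>\<^sup>+ r. G s r \<omega> \<partial>\<mu>) * indicator {a..b} s"
          using measurable_compose[OF measurable_Pair1' gm] by (intro nn_integral_multc) simp_all
        finally show "(\<integral>\<^sup>+ r. G s r \<omega> \<partial>\<mu>) * indicator {a..b} s = (\<integral>\<^sup>+ r. ennreal (G s r \<omega>) * indicator ?R (s, r) \<partial>\<mu>)" ..
      qed
      also have "\<dots> = (\<integral>\<^sup>+ x. ennreal (G (fst x) (snd x) \<omega>) * indicator ?R x \<partial>(lborel \<Otimes>\<^sub>M \<mu>))"
        using gm by (subst \<mu>.nn_integral_fst[symmetric]) auto
      also have "\<dots> = (\<integral>\<^sup>+ x. ennreal (G (fst x) (snd x) \<omega>) \<partial>?N)"
        by (rule nn_integral_restrict_space[symmetric]) auto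
      finally show "ennreal \<bar>Z \<omega>\<bar> \<le> (\<integral>\<^sup>+ x. ennreal ((\<lambda>((s, r), \<omega>). G s r \<omega>) (x, \<omega>)) \<partial>?N)"
        by (simp add: case_prod_beta')
    qed
  qed (use sN spN G c C le p' in auto)
qed

text \<open>Multiplying by the indicator of \<open>E k\<close> keeps the linear inequality and makes \<open>Z\<close> bounded;
  for bounded processes the weighted supremum of \<open>exp (- l t) \<parallel>Z t\<parallel>\<close> absorbs the integral term.\<close>

lemma Lp_le_gronwall:
  fixes Z A :: "real \<Rightarrow> 'a \<Rightarrow> real" and \<rho> :: "real \<Rightarrow> 'b \<Rightarrow> real"
  assumes \<mu>: "finite_measure \<mu>" and p: "1 \<le> p"
    and Zm: "(\<lambda>(t, \<omega>). Z t \<omega>) \<in> borel_measurable (borel \<Otimes>\<^sub>M M)"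
    and \<rho>m: "(\<lambda>(s, r). \<rho> s r) \<in> borel_measurable (borel \<Otimes>\<^sub>M \<mu>)"
    and \<rho>: "\<And>s r. s \<in> {0..T} \<Longrightarrow> r \<in> space \<mu> \<Longrightarrow> \<rho> s r \<in> {-\<tau>..s}" and \<tau>: "0 \<le> \<tau>"
    and Z0: "\<And>t \<omega>. 0 \<le> Z t \<omega>"
    and A: "\<And>t. t \<in> {0..T} \<Longrightarrow> Lp_le p (A t) \<alpha>"
    and neg: "\<And>t. t \<in> {-\<tau>..<0} \<Longrightarrow> Lp_le p (Z t) \<alpha>" and \<alpha>: "0 \<le> \<alpha>"
    and E: "\<And>k. E k \<in> sets M" "incseq E" "AE \<omega> in M. \<exists>k :: nat. \<omega> \<in> E k"
    and bound: "\<And>k t \<omega>. \<omega> \<in> E k \<Longrightarrow> t \<in> {-\<tau>..T} \<Longrightarrow> Z t \<omega> \<le> real k"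
    and ineq: "\<And>t. t \<in> {0..T} \<Longrightarrow> AE \<omega> in M. ennreal (Z t \<omega>) \<le> ennreal \<bar>A t \<omega>\<bar>
       + (\<integral>\<^sup>+ s. (\<integral>\<^sup>+ r. ennreal (\<kappa> * Z (\<rho> s r) \<omega>) \<partial>\<mu>) * indicator {0..t} s \<partial>lborel)"
    and \<kappa>: "0 < \<kappa>" and l: "0 < l" "2 * \<kappa> * measure \<mu> (space \<mu>) \<le> l"
    and t: "t \<in> {0..T}"
  shows "Lp_le p (Z t) (2 * \<alpha> * exp (l * t))"
proof -
  interpret \<mu>: finite_measure \<mu> by (rule \<mu>)
  have Zt[measurable]: "Z t \<in> borel_measurable M" for t
    using measurable_compose[OF measurable_Pair1' Zm, of t] by simp
  have E'[measurable]: "E k \<in> sets M" for k by (rule E(1))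
  have main: "Lp_le p (\<lambda>\<omega>. indicator (E k) \<omega> * Z t \<omega>) (2 * \<alpha> * exp (l * max t 0))"
    if t: "t \<in> {-\<tau>..T}" for k t
  proof -
    define Zk where "Zk t \<omega> = indicator (E k) \<omega> * Z t \<omega>" for t \<omega>
    have Zkm[measurable]: "(\<lambda>(t, \<omega>). Zk t \<omega>) \<in> borel_measurable (borel \<Otimes>\<^sub>M M)"
      using Zm unfolding Zk_def by measurable
    have Zk[measurable]: "Zk t \<in> borel_measurable M" for t
      unfolding Zk_def by measurable
    have Zk0: "0 \<le> Zk t \<omega>" "Zk t \<omega> \<le> Z t \<omega>" for t \<omega>
      using Z0 by (auto simp: Zk_def indicator_def)
    have Zk_bound: "Zk t \<omega> \<le> real k" if "t \<in> {-\<tau>..T}" for t \<omega>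
      using bound[of \<omega> k t] that by (auto simp: Zk_def indicator_def)
    \<comment> \<open>\<open>P R\<close> says that the weighted supremum of the norms is at most
      \<open>R\<close>.\<close>
    define P where "P R \<longleftrightarrow> (\<forall>t\<in>{-\<tau>..T}. Lp_le p (Zk t) (R * exp (l * max t 0)))" for R
    have start: "P (real k + 2 * \<alpha>)"
      unfolding P_def
    proof
      fix t assume t: "t \<in> {-\<tau>..T}"
      have "(\<integral>\<^sup>+ \<omega>. ennreal (\<bar>Zk t \<omega>\<bar> ^ p) \<partial>M) \<le> (\<integral>\<^sup>+ \<omega>. ennreal (real k ^ p) \<partial>M)"
        using Zk_bound[OF t] Zk0(1) by (intro nn_integral_mono ennreal_leI power_mono) auto
      then have "Lp_le p (Zk t) (real k)"
        by (simp add: Lp_le_def emeasure_space_1)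
      then show "Lp_le p (Zk t) ((real k + 2 * \<alpha>) * exp (l * max t 0))"
      proof (rule Lp_le_mono_bound)
        have "real k * 1 \<le> (real k + 2 * \<alpha>) * exp (l * max t 0)"
          using \<alpha> l by (intro mult_mono) auto
        then show "real k \<le> (real k + 2 * \<alpha>) * exp (l * max t 0)" by simp
      qed
    qed
    \<comment> \<open>Integrating \<open>exp (l * s)\<close> gains \<open>1 / l\<close>, and the
      lower bound on \<open>l\<close> turns this into the contraction factor one half.\<close>
    have step: "P (\<alpha> + R / 2)" if PR: "P R" and R: "0 < R" for R
      unfolding P_def
    proof
      fix t assume t: "t \<in> {-\<tau>..T}"
      show "Lp_le p (Zk t) ((\<alpha> + R / 2) * exp (l * max t 0))"
      proof (cases "t < 0")
        case True
        have "t \<in> {-\<tau>..<0}" using t True by simp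
        then have "Lp_le p (Z t) (\<alpha> + R / 2)"
          by (rule Lp_le_mono_bound[OF neg]) (use R in simp)
        moreover have "AE \<omega> in M. \<bar>Zk t \<omega>\<bar> \<le> \<bar>Z t \<omega>\<bar>"
          using Zk0[of t] Z0[of t] by simp
        ultimately have "Lp_le p (Zk t) (\<alpha> + R / 2)"
          using Zk by (blast intro: Lp_le_dom)
        then show ?thesis using True by simp
      next
        case False
        then have t0: "t \<in> {0..T}" using t by auto
        \<comment> \<open>The part of \<open>Zk t\<close> that exceeds \<open>A t\<close> and so has
          to be paid for by the integral term. It vanishes outside \<open>E k\<close>.\<close>
        define Q where "Q \<omega> = max (Zk t \<omega> - \<bar>A t \<omega>\<bar>) 0" for \<omega>
        have [measurable]: "A t \<in> borel_measurable M" using A[OF t0] by (auto simp: Lp_le_def)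
        have Q[measurable]: "Q \<in> borel_measurable M" unfolding Q_def by measurable
        have "Lp_le p Q (R / 2 * exp (l * t))"
        proof (rule Lp_le_double_integral[where \<mu> = \<mu> and a = 0 and b = t and c = "\<lambda>s. \<kappa> * R * exp (l * s)"
              and G = "\<lambda>s r \<omega>. \<kappa> * Zk (\<rho> s r) \<omega>"])
          have "(\<lambda>x. (case_prod \<rho> (fst x), snd x)) \<in> (borel \<Otimes>\<^sub>M \<mu>) \<Otimes>\<^sub>M M \<rightarrow>\<^sub>M borel \<Otimes>\<^sub>M M"
            using \<rho>m by measurable
          from measurable_compose[OF this Zkm]
          show "(\<lambda>((s, r), \<omega>). \<kappa> * Zk (\<rho> s r) \<omega>) \<in> borel_measurable ((borel \<Otimes>\<^sub>M \<mu>) \<Otimes>\<^sub>M M)"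
            by (simp add: case_prod_beta')
          show "Lp_le p (\<lambda>\<omega>. \<kappa> * Zk (\<rho> s r) \<omega>) (\<kappa> * R * exp (l * s))"
            if s: "s \<in> {0..t}" and r: "r \<in> space \<mu>" for s r
          proof -
            have \<rho>': "\<rho> s r \<in> {-\<tau>..s}" using \<rho>[of s r] s r t0 by auto
            then have "Lp_le p (Zk (\<rho> s r)) (R * exp (l * max (\<rho> s r) 0))"
              using PR s t0 unfolding P_def by auto
            then have "Lp_le p (Zk (\<rho> s r)) (R * exp (l * s))"
              by (rule Lp_le_mono_bound) (use \<rho>' R l s in auto)
            then have L: "(\<integral>\<^sup>+ \<omega>. ennreal (\<bar>Zk (\<rho> s r) \<omega>\<bar> ^ p) \<partial>M) \<le> ennreal ((R * exp (l * s)) ^ p)"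
              by (simp add: Lp_le_def)
            have "(\<integral>\<^sup>+ \<omega>. ennreal (\<bar>\<kappa> * Zk (\<rho> s r) \<omega>\<bar> ^ p) \<partial>M)
                = ennreal (\<kappa> ^ p) * (\<integral>\<^sup>+ \<omega>. ennreal (\<bar>Zk (\<rho> s r) \<omega>\<bar> ^ p) \<partial>M)"
              using \<kappa> by (subst nn_integral_cmult[symmetric]) (auto simp: abs_mult power_mult_distrib ennreal_mult)
            also have "\<dots> \<le> ennreal (\<kappa> ^ p) * ennreal ((R * exp (l * s)) ^ p)"
              by (intro mult_left_mono L) auto
            also have "\<dots> = ennreal ((\<kappa> * R * exp (l * s)) ^ p)"
              using \<kappa> R by (simp add: ennreal_mult[symmetric] power_mult_distrib mult_ac)
            finally show ?thesis using \<kappa> R by (simp add: Lp_le_def)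
          qed
          have "(\<integral>\<^sup>+ s. ennreal (\<kappa> * R * exp (l * s)) * indicator {0..t} s \<partial>lborel)
              = ennreal (\<kappa> * R * exp (l * t) / l - \<kappa> * R * exp (l * 0) / l)"
            using \<kappa> R l t0
            by (intro nn_integral_FTC_Icc) (auto intro!: derivative_eq_intros)
          also have "\<dots> * ennreal (measure \<mu> (space \<mu>)) \<le> ennreal (\<kappa> * R * exp (l * t) / l) * ennreal (l / (2 * \<kappa>))"
            using \<kappa> R l by (intro mult_mono ennreal_leI) (auto simp: field_simps)
          also have "\<dots> = ennreal (R / 2 * exp (l * t))"
            using \<kappa> R l by (simp add: ennreal_mult[symmetric] field_simps)
          finally show "(\<integral>\<^sup>+ s. ennreal (\<kappa> * R * exp (l * s)) * indicator {0..t} s \<partial>lborel)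
              * ennreal (measure \<mu> (space \<mu>)) \<le> ennreal (R / 2 * exp (l * t))" .
          show "AE \<omega> in M. ennreal \<bar>Q \<omega>\<bar> \<le> (\<integral>\<^sup>+ s. (\<integral>\<^sup>+ r. ennreal (\<kappa> * Zk (\<rho> s r) \<omega>) \<partial>\<mu>) * indicator {0..t} s \<partial>lborel)"
          proof (use ineq[OF t0] in eventually_elim)
            case (elim \<omega>)
            show ?case
            proof (cases "\<omega> \<in> E k")
              case True
              then have Zk_eq: "Zk s \<omega> = Z s \<omega>" for s by (simp add: Zk_def)
              have "ennreal (Z t \<omega>) - ennreal \<bar>A t \<omega>\<bar> \<le> (\<integral>\<^sup>+ s. (\<integral>\<^sup>+ r. ennreal (\<kappa> * Z (\<rho> s r) \<omega>) \<partial>\<mu>) * indicator {0..t} s \<partial>lborel)"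
                using elim by (simp add: ennreal_minus_le_iff)
              then show ?thesis
                by (auto simp: Q_def Zk_eq ennreal_minus max_def)
            qed (simp add: Q_def Zk_def)
          qed
        qed (use \<mu> p \<kappa> R Zk0 in auto)
        moreover have "Lp_le p (A t) (\<alpha> * exp (l * t))"
        proof (rule Lp_le_mono_bound[OF A[OF t0]])
          show "\<alpha> \<le> \<alpha> * exp (l * t)"
            using mult_left_mono[of 1 "exp (l * t)" \<alpha>] \<alpha> l t0 by simp
        qed
        then have "Lp_le p (\<lambda>\<omega>. \<bar>A t \<omega>\<bar>) (\<alpha> * exp (l * t))"
          by (rule Lp_le_dom) auto
        ultimately have "Lp_le p (\<lambda>\<omega>. \<bar>A t \<omega>\<bar> + Q \<omega>) (\<alpha> * exp (l * t) + R / 2 * exp (l * t))"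
          using p by (intro Lp_le_add) auto
        then have "Lp_le p (Zk t) (\<alpha> * exp (l * t) + R / 2 * exp (l * t))"
          by (rule Lp_le_dom) (auto simp: Q_def Zk0)
        then show ?thesis
          using t0 by (simp add: distrib_right)
      qed
    qed
    \<comment> \<open>\<open>2 * \<alpha>\<close> is the fixed point of the map that sends
      \<open>R\<close> to \<open>\<alpha> + R / 2\<close>, and every application halves the excess.
      The added \<open>1\<close> keeps \<open>R\<close> positive.\<close>
    have iter: "P (2 * \<alpha> + (real k + 1) / 2 ^ j)" for j :: nat
    proof (induction j)
      case 0
      have "P (real k + 2 * \<alpha>)" by (rule start)
      then show ?case
        unfolding P_def by (auto intro: Lp_le_mono_bound)
    next
      case (Suc j)
      have "P (\<alpha> + (2 * \<alpha> + (real k + 1) / 2 ^ j) / 2)"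
        using \<alpha> by (intro step Suc add_nonneg_pos) auto
      then show ?case by (simp add: field_simps)
    qed
    have "Lp_le p (Zk t) (2 * \<alpha> * exp (l * max t 0))"
    proof (rule Lp_le_eps)
      fix e :: real assume e: "0 < e"
      have "(\<lambda>j. (1/2) ^ j :: real) \<longlonglongrightarrow> 0"
        by (rule LIMSEQ_power_zero) simp
      then have "(\<lambda>j. (real k + 1) * exp (l * max t 0) * (1/2) ^ j :: real) \<longlonglongrightarrow> 0"
        by (rule tendsto_mult_right_zero)
      then have "\<forall>\<^sub>F j in sequentially. (real k + 1) * exp (l * max t 0) * (1/2) ^ j < e"
        using e by (rule order_tendstoD)
      then obtain j where j: "(real k + 1) * exp (l * max t 0) * (1/2) ^ j < e"
        by (auto simp: eventually_sequentially)
      show "Lp_le p (Zk t) (2 * \<alpha> * exp (l * max t 0) + e)"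
      proof (rule Lp_le_mono_bound)
        show "Lp_le p (Zk t) ((2 * \<alpha> + (real k + 1) / 2 ^ j) * exp (l * max t 0))"
          using iter[of j] t unfolding P_def by blast
        have "(2 * \<alpha> + (real k + 1) / 2 ^ j) * exp (l * max t 0)
            = 2 * \<alpha> * exp (l * max t 0) + (real k + 1) * exp (l * max t 0) * (1/2) ^ j"
          by (simp add: distrib_right power_divide)
        then show "(2 * \<alpha> + (real k + 1) / 2 ^ j) * exp (l * max t 0) \<le> 2 * \<alpha> * exp (l * max t 0) + e"
          using j by linarith
      qed
    qed (use \<alpha> in simp)
    then show ?thesis unfolding Zk_def .
  qed
  show ?thesis
  proof (rule Lp_le_Fatou)
    show "Lp_le p (\<lambda>\<omega>. indicator (E k) \<omega> * Z t \<omega>) (2 * \<alpha> * exp (l * t))" for k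
      using main[of t k] t \<tau> by auto
    show "AE \<omega> in M. (\<lambda>k. indicator (E k) \<omega> * Z t \<omega>) \<longlonglongrightarrow> Z t \<omega>"
    proof (use E(3) in eventually_elim)
      case (elim \<omega>)
      then obtain k where k: "\<omega> \<in> E k" by blast
      have "\<forall>\<^sub>F k in sequentially. indicator (E k) \<omega> * Z t \<omega> = Z t \<omega>"
        using eventually_ge_at_top[of k]
      proof eventually_elim
        case (elim j)
        then have "\<omega> \<in> E j" using k incseqD[OF E(2)] by blast
        then show ?case by simp
      qed
      then show ?case by (rule tendsto_eventually)
    qed
  qed (rule Zt)
qed

end

section \<open>The past of a Wiener process\<close>

text \<open>Independence of increments is given along strictly increasing infinite sequences, so a
  finite set of times is enumerated and then continued beyond its maximum in unit steps.\<close>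

lemma finite_set_strict_mono_grid:
  fixes E :: "real set"
  assumes E: "finite E" "E \<noteq> {}"
  shows "\<exists>(u :: nat \<Rightarrow> real) k. strict_mono u \<and> E = u ` {..k}"
proof -
  define l where "l = sorted_list_of_set E"
  have l: "set l = E" "sorted_wrt (<) l" "l \<noteq> []"
    using E by (auto simp: l_def)
  define k where "k = length l - 1"
  have k: "length l = Suc k" using l by (cases l) (auto simp: k_def)
  define u where "u i = (if i \<le> k then l ! i else l ! k + real (i - k))" for i
  have "u i < u (Suc i)" for i
  proof (cases "Suc i \<le> k")
    case True
    then show ?thesis using sorted_wrt_nth_less[OF l(2), of i "Suc i"] k by (simp add: u_def)
  next
    case False
    then show ?thesis by (cases "i = k") (auto simp: u_def)
  qed
  then have "strict_mono u" by (rule strict_mono_Suc_iff[THEN iffD2, rule_format])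
  moreover have "E = u ` {..k}"
    using l(1) k by (auto simp: u_def set_conv_nth image_iff less_Suc_eq_le)
  ultimately show ?thesis by blast
qed

section \<open>Step functions and their integrals\<close>

definition valid_step :: "step \<Rightarrow> bool" where
  "valid_step \<phi> \<longleftrightarrow> (\<forall>(c, p, q)\<in>set \<phi>. p \<le> q)"

definition step_ends :: "step \<Rightarrow> real set" where
  "step_ends \<phi> = (\<Union>(c, p, q)\<in>set \<phi>. {p, q})"

lemma finite_step_ends: "finite (step_ends \<phi>)"
  unfolding step_ends_def by (auto split: prod.splits)

lemma step_fun_Nil [simp]: "step_fun [] s = 0"
  and step_fun_Cons: "step_fun ((c, p, q) # \<phi>) s = c * indicator {p<..q} s + step_fun \<phi> s"
  and step_integral_Nil [simp]: "step_integral W [] \<omega> = 0"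
  and step_integral_Cons: "step_integral W ((c, p, q) # \<phi>) \<omega> = c * (W q \<omega> - W p \<omega>) + step_integral W \<phi> \<omega>"
  by (simp_all add: step_fun_def step_integral_def)

lemma step_fun_measurable [measurable]: "step_fun \<phi> \<in> borel_measurable borel"
proof (induction \<phi>)
  case Nil
  then show ?case by (simp add: step_fun_def)
next
  case (Cons x \<phi>)
  obtain c p q where "x = (c, p, q)" by (cases x)
  then have "step_fun (x # \<phi>) = (\<lambda>s. c * indicator {p<..q} s + step_fun \<phi> s)"
    by (auto simp: step_fun_Cons)
  then show ?case using Cons by simp
qed

lemma indicator_Ioc_telescope:
  fixes u :: "nat \<Rightarrow> real"
  assumes u: "strict_mono u" and ij: "i \<le> j"
  shows "indicator {u i<..u j} s = (\<Sum>l\<in>{i..<j}. indicator {u l<..u (Suc l)} s :: real)"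
  using ij
proof (induction j rule: dec_induct)
  case (step j)
  have "{u i<..u (Suc j)} = {u i<..u j} \<union> {u j<..u (Suc j)}"
    using strict_mono_less_eq[OF u, of i j] strict_mono_less_eq[OF u, of j "Suc j"] step(1) by auto
  moreover have "{u i<..u j} \<inter> {u j<..u (Suc j)} = {}" by auto
  ultimately show ?case
    using step by (simp add: indicator_add[symmetric])
qed simp

text \<open>Intervals in the list may overlap; refining them to a common grid yields disjoint cells.
  The cells are open on the left, so the value on a cell is the value at its right end
  point.\<close>

lemma step_grid:
  fixes u :: "nat \<Rightarrow> real"
  assumes u: "strict_mono u" and \<phi>: "valid_step \<phi>" "step_ends \<phi> \<subseteq> u ` {..k}"
  shows step_grid_fun: "step_fun \<phi> s = (\<Sum>l<k. step_fun \<phi> (u (Suc l)) * indicator {u l<..u (Suc l)} s)"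
    and step_grid_integral: "step_integral W \<phi> \<omega> = (\<Sum>l<k. step_fun \<phi> (u (Suc l)) * (W (u (Suc l)) \<omega> - W (u l) \<omega>))"
proof -
  have "step_fun \<phi> s = (\<Sum>l<k. step_fun \<phi> (u (Suc l)) * indicator {u l<..u (Suc l)} s)
    \<and> step_integral W \<phi> \<omega> = (\<Sum>l<k. step_fun \<phi> (u (Suc l)) * (W (u (Suc l)) \<omega> - W (u l) \<omega>))"
  using \<phi>
proof (induction \<phi>)
  case (Cons x \<phi>)
  obtain c p q where x: "x = (c, p, q)" by (cases x)
  have "p \<le> q" "p \<in> u ` {..k}" "q \<in> u ` {..k}" and \<phi>: "valid_step \<phi>" "step_ends \<phi> \<subseteq> u ` {..k}"
    using Cons.prems by (auto simp: x valid_step_def step_ends_def)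
  then obtain i j where ij: "p = u i" "q = u j" "i \<le> j" "j \<le> k"
    using strict_mono_less_eq[OF u] by auto
  have ind: "indicator {u i<..u j} (u (Suc l)) = (if l \<in> {i..<j} then 1 else 0 :: real)" for l
    using strict_mono_less_eq[OF u] strict_mono_less[OF u] by (auto simp: indicator_def)
  have restr: "(\<Sum>l<k. (if l \<in> {i..<j} then 1 else 0) * g l) = (\<Sum>l\<in>{i..<j}. g l :: real)" for g
    using ij by (intro sum.mono_neutral_cong_right) auto
  have "(\<Sum>l<k. step_fun (x # \<phi>) (u (Suc l)) * indicator {u l<..u (Suc l)} s)
      = c * (\<Sum>l<k. (if l \<in> {i..<j} then 1 else 0) * indicator {u l<..u (Suc l)} s)
        + (\<Sum>l<k. step_fun \<phi> (u (Suc l)) * indicator {u l<..u (Suc l)} s)"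
    unfolding x ij step_fun_Cons ind sum_distrib_left sum.distrib[symmetric]
    by (intro sum.cong refl) (simp only: distrib_right mult.assoc)
  also have "\<dots> = step_fun (x # \<phi>) s"
    unfolding restr indicator_Ioc_telescope[OF u ij(3), symmetric] conjunct1[OF Cons.IH[OF \<phi>], symmetric]
    by (simp only: x ij step_fun_Cons)
  finally have *: "step_fun (x # \<phi>) s = (\<Sum>l<k. step_fun (x # \<phi>) (u (Suc l)) * indicator {u l<..u (Suc l)} s)" ..
  have "(\<Sum>l<k. step_fun (x # \<phi>) (u (Suc l)) * (W (u (Suc l)) \<omega> - W (u l) \<omega>))
      = c * (\<Sum>l<k. (if l \<in> {i..<j} then 1 else 0) * (W (u (Suc l)) \<omega> - W (u l) \<omega>))
        + (\<Sum>l<k. step_fun \<phi> (u (Suc l)) * (W (u (Suc l)) \<omega> - W (u l) \<omega>))"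
    unfolding x ij step_fun_Cons ind sum_distrib_left sum.distrib[symmetric]
    by (intro sum.cong refl) (simp only: distrib_right mult.assoc)
  also have "\<dots> = c * (W (u j) \<omega> - W (u i) \<omega>) + step_integral W \<phi> \<omega>"
    unfolding restr using conjunct2[OF Cons.IH[OF \<phi>]] ij(3) by (simp add: sum_Suc_diff'[of i j "\<lambda>l. W (u l) \<omega>"])
  finally have "step_integral W (x # \<phi>) \<omega> = (\<Sum>l<k. step_fun (x # \<phi>) (u (Suc l)) * (W (u (Suc l)) \<omega> - W (u l) \<omega>))"
    by (simp add: x ij step_integral_Cons)
  with * show ?case by blast
  qed simp
  then show "step_fun \<phi> s = (\<Sum>l<k. step_fun \<phi> (u (Suc l)) * indicator {u l<..u (Suc l)} s)"
    and "step_integral W \<phi> \<omega> = (\<Sum>l<k. step_fun \<phi> (u (Suc l)) * (W (u (Suc l)) \<omega> - W (u l) \<omega>))"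
    by blast+
qed

lemma step_grid_nn_integral:
  fixes u :: "nat \<Rightarrow> real"
  assumes u: "strict_mono u" and \<phi>: "valid_step \<phi>" "step_ends \<phi> \<subseteq> u ` {..k}"
  shows "(\<integral>\<^sup>+ s. ennreal ((step_fun \<phi> s)\<^sup>2) \<partial>lborel)
    = ennreal (\<Sum>l<k. (step_fun \<phi> (u (Suc l)))\<^sup>2 * (u (Suc l) - u l))"
proof -
  let ?a = "\<lambda>l. step_fun \<phi> (u (Suc l))" and ?I = "\<lambda>l. {u l<..u (Suc l)}"
  have le: "u l \<le> u (Suc l)" for l using strict_mono_less_eq[OF u, of l "Suc l"] by simp
  have disj: "indicator (?I l) s * indicator (?I l') s = (if l = l' then indicator (?I l) s else 0 :: real)" for l l' s
  proof (cases "l = l'")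
    case False
    have "\<not> (u l < s \<and> s \<le> u (Suc l) \<and> u l' < s \<and> s \<le> u (Suc l'))"
    proof (cases "l < l'")
      case True
      then have "u (Suc l) \<le> u l'" using strict_mono_less_eq[OF u] by simp
      then show ?thesis by auto
    next
      case False
      then have "u (Suc l') \<le> u l" using strict_mono_less_eq[OF u] \<open>l \<noteq> l'\<close> by simp
      then show ?thesis by auto
    qed
    then show ?thesis using False by (auto simp: indicator_def)
  qed (auto simp: indicator_def)
  have sq: "(step_fun \<phi> s)\<^sup>2 = (\<Sum>l<k. (?a l)\<^sup>2 * indicator (?I l) s)" for s
  proof -
    have "(step_fun \<phi> s)\<^sup>2 = (\<Sum>l<k. ?a l * indicator (?I l) s) * (\<Sum>l<k. ?a l * indicator (?I l) s)"
      using step_grid(1)[OF u \<phi>, of s] by (simp add: power2_eq_square)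
    also have "\<dots> = (\<Sum>l<k. \<Sum>l'<k. ?a l * ?a l' * (indicator (?I l) s * indicator (?I l') s))"
      unfolding sum_product by (intro sum.cong refl) (simp add: mult_ac)
    also have "\<dots> = (\<Sum>l<k. (?a l)\<^sup>2 * indicator (?I l) s)"
      unfolding disj by (intro sum.cong refl)
        (simp add: if_distrib[of "(*) _"] power2_eq_square cong: if_cong)
    finally show ?thesis .
  qed
  have "(\<integral>\<^sup>+ s. ennreal ((step_fun \<phi> s)\<^sup>2) \<partial>lborel)
      = (\<integral>\<^sup>+ s. (\<Sum>l<k. ennreal ((?a l)\<^sup>2) * indicator (?I l) s) \<partial>lborel)"
  proof (intro nn_integral_cong)
    fix s
    have "ennreal ((step_fun \<phi> s)\<^sup>2) = (\<Sum>l<k. ennreal ((?a l)\<^sup>2 * indicator (?I l) s))"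
      unfolding sq[of s] by (rule sum_ennreal[symmetric]) auto
    then show "ennreal ((step_fun \<phi> s)\<^sup>2) = (\<Sum>l<k. ennreal ((?a l)\<^sup>2) * indicator (?I l) s)"
      by (simp add: ennreal_mult'' ennreal_indicator)
  qed
  also have "\<dots> = (\<Sum>l<k. ennreal ((?a l)\<^sup>2) * emeasure lborel (?I l))"
    by (subst nn_integral_sum) (auto simp: nn_integral_cmult_indicator)
  also have "\<dots> = (\<Sum>l<k. ennreal ((?a l)\<^sup>2 * (u (Suc l) - u l)))"
    using le by (intro sum.cong refl) (simp add: ennreal_mult'')
  also have "\<dots> = ennreal (\<Sum>l<k. (?a l)\<^sup>2 * (u (Suc l) - u l))"
    using le by (intro sum_ennreal) auto
  finally show ?thesis .
qed

text \<open>With \<open>g = min v\<close> or \<open>g = max v\<close> it cuts a step function at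
  \<open>v\<close> into past and future: end points on the wrong side are moved to \<open>v\<close>,
  and an interval lying there becomes empty.\<close>

definition step_map :: "(real \<Rightarrow> real) \<Rightarrow> step \<Rightarrow> step" where
  "step_map g \<phi> = map (\<lambda>(c, p, q). (c, g p, g q)) \<phi>"

lemma step_map_Nil [simp]: "step_map g [] = []"
  and step_map_Cons: "step_map g ((c, p, q) # \<phi>) = (c, g p, g q) # step_map g \<phi>"
  by (simp_all add: step_map_def)

lemma valid_step_map: "mono g \<Longrightarrow> valid_step \<phi> \<Longrightarrow> valid_step (step_map g \<phi>)"
  by (auto simp: valid_step_def step_map_def mono_def)

lemma step_ends_map: "step_ends (step_map g \<phi>) = g ` step_ends \<phi>"
  by (force simp: step_ends_def step_map_def)

lemma step_fun_past: "step_fun (step_map (min v) \<phi>) s = step_fun \<phi> s * indicator {..v} s"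
proof (induction \<phi>)
  case (Cons x \<phi>)
  obtain c p q where "x = (c, p, q)" by (cases x)
  then show ?case using Cons
    by (auto simp: step_map_Cons step_fun_Cons indicator_def min_def algebra_simps split: if_splits)
qed simp

lemma step_fun_future: "step_fun (step_map (max v) \<phi>) s = step_fun \<phi> s * indicator {v<..} s"
proof (induction \<phi>)
  case (Cons x \<phi>)
  obtain c p q where "x = (c, p, q)" by (cases x)
  then show ?case using Cons
    by (auto simp: step_map_Cons step_fun_Cons indicator_def max_def algebra_simps split: if_splits)
qed simp

lemma step_integral_split:
  "step_integral W \<phi> \<omega> = step_integral W (step_map (min v) \<phi>) \<omega> + step_integral W (step_map (max v) \<phi>) \<omega>"
proof (induction \<phi>)
  case (Cons x \<phi>)
  obtain c p q where "x = (c, p, q)" by (cases x)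
  then show ?case using Cons
    by (auto simp: step_map_Cons step_integral_Cons min_def max_def algebra_simps)
qed simp

text \<open>The moment of order \<open>2 * q\<close> of a standard normal variable, i.e. the product
  of the odd numbers below \<open>2 * q\<close>.\<close>

definition gauss_moment :: "nat \<Rightarrow> real" where
  "gauss_moment q = fact (2 * q) / (2 ^ q * fact q)"

locale wiener = prob_space +
  fixes W :: "real \<Rightarrow> 'a \<Rightarrow> real"
  assumes wiener: "two_sided_wiener M W"
begin

lemma W_measurable [measurable]: "W t \<in> borel_measurable M"
  using wiener unfolding two_sided_wiener_def by auto

lemma W_increment: "s < t \<Longrightarrow> distributed M lborel (\<lambda>\<omega>. W t \<omega> - W s \<omega>) (normal_density 0 (sqrt (t - s)))"
  using wiener unfolding two_sided_wiener_def by auto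

lemma W_indep: "strict_mono u \<Longrightarrow> indep_vars (\<lambda>_. borel) (\<lambda>i \<omega>. W (u (Suc i)) \<omega> - W (u i) \<omega>) {..<k}"
  using wiener unfolding two_sided_wiener_def by auto

lemma step_integral_measurable [measurable]: "step_integral W \<phi> \<in> borel_measurable M"
proof (induction \<phi>)
  case Nil
  then show ?case by (simp add: step_integral_def)
next
  case (Cons x \<phi>)
  obtain c p q where "x = (c, p, q)" by (cases x)
  then have "step_integral W (x # \<phi>) = (\<lambda>\<omega>. c * (W q \<omega> - W p \<omega>) + step_integral W \<phi> \<omega>)"
    by (auto simp: step_integral_Cons)
  then show ?case using Cons by simp
qed

text \<open>On a common grid the integral is a sum of independent Gaussian variables, hence
  Gaussian, and its variance is the squared norm of the step function in
  \<open>L\<^sup>2\<close>.\<close>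

lemma step_integral_moments:
  assumes \<phi>: "valid_step \<phi>"
  obtains \<sigma> where "0 \<le> \<sigma>" "(\<integral>\<^sup>+ s. ennreal ((step_fun \<phi> s)\<^sup>2) \<partial>lborel) = ennreal (\<sigma>\<^sup>2)"
    "\<And>k. integrable M (\<lambda>\<omega>. step_integral W \<phi> \<omega> ^ k)"
    "\<And>q. expectation (\<lambda>\<omega>. step_integral W \<phi> \<omega> ^ (2 * q)) = gauss_moment q * \<sigma> ^ (2 * q)"
    "expectation (step_integral W \<phi>) = 0"
proof -
  have "\<exists>(u :: nat \<Rightarrow> real) k. strict_mono u \<and> insert 0 (step_ends \<phi>) = u ` {..k}"
    by (rule finite_set_strict_mono_grid) (simp_all add: finite_step_ends)
  then obtain u :: "nat \<Rightarrow> real" and k where u: "strict_mono u" and E: "insert 0 (step_ends \<phi>) = u ` {..k}"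
    by (elim exE conjE)
  let ?a = "\<lambda>l. step_fun \<phi> (u (Suc l))" and ?D = "\<lambda>l \<omega>. W (u (Suc l)) \<omega> - W (u l) \<omega>"
  have ends: "step_ends \<phi> \<subseteq> u ` {..k}" using E by auto
  have lt: "u l < u (Suc l)" for l using strict_mono_less[OF u, of l "Suc l"] by simp
  \<comment> \<open>Cells with coefficient zero are dropped because a normal density needs a
    positive deviation; if no cell is left, the integral is zero.\<close>
  define L where "L = {l. l < k \<and> ?a l \<noteq> 0}"
  have L: "finite L" by (simp add: L_def)
  have S: "step_integral W \<phi> \<omega> = (\<Sum>l\<in>L. ?a l * ?D l \<omega>)" for \<omega>
    unfolding step_grid(2)[OF u \<phi> ends] L_def by (intro sum.mono_neutral_cong_right) auto
  define \<sigma> where "\<sigma> = sqrt (\<Sum>l\<in>L. (\<bar>?a l\<bar> * sqrt (u (Suc l) - u l))\<^sup>2)"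
  have \<sigma>0: "0 \<le> \<sigma>" unfolding \<sigma>_def by (intro real_sqrt_ge_zero sum_nonneg) auto
  have "\<sigma>\<^sup>2 = (\<Sum>l\<in>L. (\<bar>?a l\<bar> * sqrt (u (Suc l) - u l))\<^sup>2)"
    unfolding \<sigma>_def by (intro real_sqrt_pow2 sum_nonneg) auto
  also have "\<dots> = (\<Sum>l\<in>L. (?a l)\<^sup>2 * (u (Suc l) - u l))"
    using lt by (intro sum.cong refl) (simp add: power_mult_distrib less_imp_le)
  also have "\<dots> = (\<Sum>l<k. (?a l)\<^sup>2 * (u (Suc l) - u l))"
    unfolding L_def by (intro sum.mono_neutral_cong_left) auto
  finally have N: "(\<integral>\<^sup>+ s. ennreal ((step_fun \<phi> s)\<^sup>2) \<partial>lborel) = ennreal (\<sigma>\<^sup>2)"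
    using step_grid_nn_integral[OF u \<phi> ends] by simp
  show thesis
  proof (cases "L = {}")
    case True
    then have "step_integral W \<phi> = (\<lambda>_. 0)" using S by auto
    moreover have "\<sigma> = 0" using True by (simp add: \<sigma>_def)
    ultimately show thesis
      using N by (intro that[of 0]) (auto simp: power_0_left gauss_moment_def prob_space)
  next
    case False
    have "distributed M lborel (\<lambda>\<omega>. \<Sum>l\<in>L. ?a l * ?D l \<omega>)
       (normal_density (\<Sum>l\<in>L. 0) (sqrt (\<Sum>l\<in>L. (\<bar>?a l\<bar> * sqrt (u (Suc l) - u l))\<^sup>2)))"
    proof (rule sum_indep_normal[OF L False])
      have "indep_vars (\<lambda>_. borel) (\<lambda>l. (\<lambda>x. ?a l * x) \<circ> ?D l) L"
        using indep_vars_subset[OF W_indep[OF u, of k], of L]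
        by (intro indep_vars_compose[where M' = "\<lambda>_. borel"]) (auto simp: L_def)
      then show "indep_vars (\<lambda>_. borel) (\<lambda>l \<omega>. ?a l * ?D l \<omega>) L" by (simp add: comp_def)
      show "0 < \<bar>?a l\<bar> * sqrt (u (Suc l) - u l)" if "l \<in> L" for l
        using that lt by (auto simp: L_def)
      show "distributed M lborel (\<lambda>\<omega>. ?a l * ?D l \<omega>) (normal_density 0 (\<bar>?a l\<bar> * sqrt (u (Suc l) - u l)))"
        if "l \<in> L" for l
        using normal_density_affine[OF W_increment[OF lt[of l]], of "?a l" 0] lt[of l] that by (simp add: L_def)
    qed
    then have D: "distributed M lborel (step_integral W \<phi>) (normal_density 0 \<sigma>)"
      by (simp add: \<sigma>_def S[abs_def])
    have \<sigma>: "0 < \<sigma>"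
      unfolding \<sigma>_def using False L lt
      by (intro real_sqrt_gt_zero sum_pos) (auto simp: L_def less_imp_neq[symmetric])
    show thesis
    proof (rule that[OF \<sigma>0 N])
      show "integrable M (\<lambda>\<omega>. step_integral W \<phi> \<omega> ^ k)" for k
        using distributed_integrable[OF D, of "\<lambda>x. x ^ k"] integrable_normal_moment[OF \<sigma>, of 0 k] by simp
      show "expectation (\<lambda>\<omega>. step_integral W \<phi> \<omega> ^ (2 * q)) = gauss_moment q * \<sigma> ^ (2 * q)" for q
        using distributed_integral[OF D, of "\<lambda>x. x ^ (2 * q)"] integral_normal_moment_even[OF \<sigma>, of 0 q] \<sigma>
        by (simp add: gauss_moment_def power_divide power_mult[symmetric] field_simps)
      show "expectation (step_integral W \<phi>) = 0"
        using distributed_integral[OF D, of "\<lambda>x. x"] integral_normal_moment_nz_1[OF \<sigma>, of 0] by simp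
    qed
  qed
qed

section \<open>The past of the Wiener process\<close>

text \<open>Cylinder events up to time \<open>v\<close>, negative times included, each changed on a
  null set. The change puts all null sets into the generated past, so that being equal almost surely
  to a past variable suffices for measurability. Subtracting \<open>W 0\<close> makes the events
  functions of increments, whose joint law is known.\<close>

definition past_events :: "real \<Rightarrow> 'a set set" where
  "past_events v = {A \<in> events. \<exists>D S. finite D \<and> D \<subseteq> {..v} \<and> (\<forall>t. S t \<in> sets borel) \<and>
     (AE \<omega> in M. \<omega> \<in> A \<longleftrightarrow> (\<forall>t\<in>D. W t \<omega> - W 0 \<omega> \<in> S t))}"

definition past :: "real \<Rightarrow> 'a measure" where
  "past v = sigma (space M) (past_events v)"

lemma past_events_subset: "past_events v \<subseteq> events"
  unfolding past_events_def by auto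

lemma space_past [simp]: "space (past v) = space M"
  unfolding past_def by (rule space_measure_of) (use past_events_subset sets.space_closed in blast)

lemma sets_past: "sets (past v) = sigma_sets (space M) (past_events v)"
  unfolding past_def by (rule sets_measure_of) (use past_events_subset sets.space_closed in blast)

lemma subalgebra_past: "subalgebra M (past v)"
  unfolding subalgebra_def sets_past using past_events_subset by (auto intro: sets.sigma_sets_subset[THEN subsetD])

lemma past_mono:
  assumes "v \<le> w"
  shows "sets (past v) \<subseteq> sets (past w)"
proof -
  have "D \<subseteq> {..w}" if "D \<subseteq> {..v}" for D :: "real set"
    using that assms by auto
  then show ?thesis
    unfolding sets_past past_events_def by (intro sigma_sets_mono') blast
qed

lemma null_sets_past:
  assumes "N \<in> null_sets M"
  shows "N \<in> sets (past v)"
proof -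
  have "N \<in> past_events v"
    unfolding past_events_def using assms AE_not_in[OF assms]
    by (auto intro!: exI[of _ "{v}"] exI[of _ "\<lambda>_. {}"])
  then show ?thesis unfolding sets_past by (rule sigma_sets.Basic)
qed

lemma W_past_measurable:
  assumes "t \<le> v"
  shows "(\<lambda>\<omega>. W t \<omega> - W 0 \<omega>) \<in> borel_measurable (past v)"
proof (rule measurableI)
  fix S :: "real set" assume S: "S \<in> sets borel"
  have "(\<lambda>\<omega>. W t \<omega> - W 0 \<omega>) -` S \<inter> space M \<in> past_events v"
    unfolding past_events_def using assms S
    by (auto intro!: exI[of _ "{t}"] exI[of _ "\<lambda>_. S"] measurable_sets AE_I2)
  then show "(\<lambda>\<omega>. W t \<omega> - W 0 \<omega>) -` S \<inter> space (past v) \<in> sets (past v)"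
    unfolding sets_past space_past by (rule sigma_sets.Basic)
qed simp

lemma Int_stable_past_events: "Int_stable (past_events v)"
proof (rule Int_stableI)
  fix A B assume "A \<in> past_events v" "B \<in> past_events v"
  then obtain D1 S1 D2 S2 where A: "A \<in> events" "finite D1" "D1 \<subseteq> {..v}" "\<And>t. S1 t \<in> sets borel"
      "AE \<omega> in M. \<omega> \<in> A \<longleftrightarrow> (\<forall>t\<in>D1. W t \<omega> - W 0 \<omega> \<in> S1 t)"
    and B: "B \<in> events" "finite D2" "D2 \<subseteq> {..v}" "\<And>t. S2 t \<in> sets borel"
      "AE \<omega> in M. \<omega> \<in> B \<longleftrightarrow> (\<forall>t\<in>D2. W t \<omega> - W 0 \<omega> \<in> S2 t)"
    unfolding past_events_def by auto
  define S where "S t = (if t \<in> D1 then S1 t else UNIV) \<inter> (if t \<in> D2 then S2 t else UNIV)" for t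
  have "AE \<omega> in M. \<omega> \<in> A \<inter> B \<longleftrightarrow> (\<forall>t\<in>D1 \<union> D2. W t \<omega> - W 0 \<omega> \<in> S t)"
    using A(5) B(5) by eventually_elim (auto simp: S_def split: if_splits)
  moreover have "S t \<in> sets borel" for t using A(4) B(4) by (auto simp: S_def)
  ultimately show "A \<inter> B \<in> past_events v"
    unfolding past_events_def using A B
    by (auto intro!: exI[of _ "D1 \<union> D2"] exI[of _ S])
qed

lemma step_integral_past_measurable:
  assumes "step_ends \<phi> \<subseteq> {..v}"
  shows "step_integral W \<phi> \<in> borel_measurable (past v)"
  using assms
proof (induction \<phi>)
  case Nil
  then show ?case by (simp add: step_integral_def)
next
  case (Cons x \<phi>)
  obtain c p q where x: "x = (c, p, q)" by (cases x)
  have "step_integral W (x # \<phi>) = (\<lambda>\<omega>. c * ((W q \<omega> - W 0 \<omega>) - (W p \<omega> - W 0 \<omega>)) + step_integral W \<phi> \<omega>)"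
    by (auto simp: x step_integral_Cons)
  moreover have pq: "q \<le> v" "p \<le> v"
    using Cons.prems by (auto simp: x step_ends_def)
  moreover have "step_integral W \<phi> \<in> borel_measurable (past v)"
    using Cons by (auto simp: step_ends_def)
  ultimately show ?case
    using borel_measurable_add[OF borel_measurable_times[OF borel_measurable_const
          borel_measurable_diff[OF W_past_measurable[OF pq(1)] W_past_measurable[OF pq(2)]]]] by metis
qed

end

section \<open>Convergence in mean square\<close>

lemma L2_tendsto:
  fixes g :: "'b \<Rightarrow> real" and h :: "nat \<Rightarrow> 'b \<Rightarrow> real"
  assumes [measurable]: "g \<in> borel_measurable N" "\<And>k. h k \<in> borel_measurable N"
    and lim: "(\<lambda>k. \<integral>\<^sup>+ x. ennreal ((g x - h k x)\<^sup>2) \<partial>N) \<longlonglongrightarrow> 0"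
    and h: "\<And>k. integrable N (\<lambda>x. (h k x)\<^sup>2)"
  shows L2_limit_integrable: "integrable N (\<lambda>x. (g x)\<^sup>2)"
    and L2_tendsto_square: "(\<lambda>k. \<integral>x. \<bar>(g x)\<^sup>2 - (h k x)\<^sup>2\<bar> \<partial>N) \<longlonglongrightarrow> 0"
    and L2_tendsto_diff: "(\<lambda>k. \<integral>x. (g x - h k x)\<^sup>2 \<partial>N) \<longlonglongrightarrow> 0"
    and L2_diff_integrable: "integrable N (\<lambda>x. (g x - h k x)\<^sup>2)"
proof -
  have "\<forall>\<^sub>F k in sequentially. (\<integral>\<^sup>+ x. ennreal ((g x - h k x)\<^sup>2) \<partial>N) < 1"
    using lim by (rule order_tendstoD) simp
  then obtain K where K: "(\<integral>\<^sup>+ x. ennreal ((g x - h K x)\<^sup>2) \<partial>N) < 1"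
    by (auto simp: eventually_sequentially)
  have iK: "integrable N (\<lambda>x. (g x - h K x)\<^sup>2)"
    using K by (intro integrableI_bounded) (auto elim: order.strict_trans)
  have "integrable N (\<lambda>x. 2 * (h K x)\<^sup>2 + 2 * (g x - h K x)\<^sup>2)"
    using iK h by simp
  then show g: "integrable N (\<lambda>x. (g x)\<^sup>2)"
  proof (rule Bochner_Integration.integrable_bound)
    have "(g x)\<^sup>2 \<le> 2 * (h K x)\<^sup>2 + 2 * (g x - h K x)\<^sup>2" for x
      using zero_le_power2[of "g x - 2 * h K x"] by (simp add: power2_eq_square algebra_simps)
    then show "AE x in N. norm ((g x)\<^sup>2) \<le> norm (2 * (h K x)\<^sup>2 + 2 * (g x - h K x)\<^sup>2)"
      by (auto intro!: AE_I2)
  qed simp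
  show ik: "integrable N (\<lambda>x. (g x - h k x)\<^sup>2)" for k
  proof (rule Bochner_Integration.integrable_bound)
    show "integrable N (\<lambda>x. 2 * (g x)\<^sup>2 + 2 * (h k x)\<^sup>2)" using g h by simp
    have "(g x - h k x)\<^sup>2 \<le> 2 * (g x)\<^sup>2 + 2 * (h k x)\<^sup>2" for x
      using zero_le_power2[of "g x + h k x"] by (simp add: power2_eq_square algebra_simps)
    then show "AE x in N. norm ((g x - h k x)\<^sup>2) \<le> norm (2 * (g x)\<^sup>2 + 2 * (h k x)\<^sup>2)"
      by (auto intro!: AE_I2)
  qed simp
  define d where "d k = (\<integral>x. (g x - h k x)\<^sup>2 \<partial>N)" for k
  have "(\<lambda>k. ennreal (d k)) \<longlonglongrightarrow> ennreal 0"
    using lim ik by (simp add: d_def nn_integral_eq_integral)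
  then show d: "d \<longlonglongrightarrow> 0"
    by (subst (asm) tendsto_ennreal_iff) (auto simp: d_def)
  define G where "G = (\<integral>x. (g x)\<^sup>2 \<partial>N)"
  have G: "0 \<le> G" by (simp add: G_def)
  have le: "(\<integral>x. \<bar>(g x)\<^sup>2 - (h k x)\<^sup>2\<bar> \<partial>N) \<le> e * G + (1 + 1 / e) * d k" if e: "0 < e" for e k
  proof -
    \<comment> \<open>Young's inequality for the mixed term of \<open>a\<close> and
      \<open>a - b\<close>: the small factor \<open>e\<close> goes to the fixed function, the large
      one to the difference that tends to zero.\<close>
    have pt: "\<bar>a\<^sup>2 - b\<^sup>2\<bar> \<le> e * a\<^sup>2 + (1 + 1 / e) * (a - b)\<^sup>2" for a b :: real
    proof -
      define c where "c = a - b"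
      have b: "b = a - c" by (simp add: c_def)
      have "0 \<le> (e * \<bar>a\<bar> - \<bar>c\<bar>)\<^sup>2 / e" using e by simp
      then have "2 * (\<bar>a\<bar> * \<bar>c\<bar>) \<le> e * a\<^sup>2 + 1 / e * c\<^sup>2"
        using e by (simp add: power2_eq_square field_simps)
      moreover have "\<bar>a\<^sup>2 - b\<^sup>2\<bar> \<le> 2 * (\<bar>a\<bar> * \<bar>c\<bar>) + c\<^sup>2"
      proof -
        have "a\<^sup>2 - b\<^sup>2 = 2 * (a * c) - c\<^sup>2" by (simp add: b power2_eq_square algebra_simps)
        then have "\<bar>a\<^sup>2 - b\<^sup>2\<bar> \<le> \<bar>2 * (a * c)\<bar> + \<bar>c\<^sup>2\<bar>" by linarith
        then show ?thesis by (simp add: abs_mult)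
      qed
      ultimately show ?thesis by (simp add: c_def distrib_right)
    qed
    have "(\<integral>x. \<bar>(g x)\<^sup>2 - (h k x)\<^sup>2\<bar> \<partial>N) \<le> (\<integral>x. e * (g x)\<^sup>2 + (1 + 1 / e) * (g x - h k x)\<^sup>2 \<partial>N)"
      using g h[of k] ik[of k] pt by (intro integral_mono Bochner_Integration.integrable_add) auto
    also have "\<dots> = e * G + (1 + 1 / e) * d k"
      using g ik by (simp add: G_def d_def)
    finally show ?thesis .
  qed
  show "(\<lambda>k. \<integral>x. \<bar>(g x)\<^sup>2 - (h k x)\<^sup>2\<bar> \<partial>N) \<longlonglongrightarrow> 0"
  proof (rule LIMSEQ_I)
    fix r :: real assume r: "0 < r"
    define e where "e = r / (2 * (G + 1))"
    have e: "0 < e" using r G by (simp add: e_def)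
    have eG: "e * G \<le> r / 2" using r G by (simp add: e_def field_simps)
    have "(\<lambda>k. (1 + 1 / e) * d k) \<longlonglongrightarrow> 0" using d by (rule tendsto_mult_right_zero)
    then have "\<forall>\<^sub>F k in sequentially. (1 + 1 / e) * d k < r / 2"
      using r by (intro order_tendstoD) auto
    then obtain n where n: "\<And>k. n \<le> k \<Longrightarrow> (1 + 1 / e) * d k < r / 2"
      by (auto simp: eventually_sequentially)
    have "norm ((\<integral>x. \<bar>(g x)\<^sup>2 - (h k x)\<^sup>2\<bar> \<partial>N) - 0) < r" if "n \<le> k" for k
    proof -
      have "(\<integral>x. \<bar>(g x)\<^sup>2 - (h k x)\<^sup>2\<bar> \<partial>N) < r" using le[OF e, of k] n[OF that] eG by linarith
      then show ?thesis by simp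
    qed
    then show "\<exists>n. \<forall>k\<ge>n. norm ((\<integral>x. \<bar>(g x)\<^sup>2 - (h k x)\<^sup>2\<bar> \<partial>N) - 0) < r" by blast
  qed
qed

lemma step_fun_eq_0:
  assumes "step_ends \<phi> \<subseteq> {v..}" "s \<le> v"
  shows "step_fun \<phi> s = 0"
  using assms(1)
proof (induction \<phi>)
  case (Cons x \<phi>)
  obtain c p q where x: "x = (c, p, q)" by (cases x)
  then show ?case
    using Cons assms(2) by (auto simp: step_fun_Cons step_ends_def indicator_def)
qed simp

section \<open>Independence of past and future\<close>

context wiener
begin

text \<open>All times involved lie on one grid. The past event depends on the cells before
  \<open>v\<close> and the integral on those after \<open>v\<close>, and disjoint groups of
  independent increments are independent.\<close>

lemma past_events_future_indep:
  assumes v: "0 \<le> v" and \<phi>: "valid_step \<phi>" "step_ends \<phi> \<subseteq> {v..}"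
    and A: "A \<in> past_events v" and X: "X \<in> sets borel"
  shows "prob (A \<inter> (step_integral W \<phi> -` X \<inter> space M)) = prob A * prob (step_integral W \<phi> -` X \<inter> space M)"
proof -
  obtain D S where A': "A \<in> events" "finite D" "D \<subseteq> {..v}" "\<And>t. S t \<in> sets borel"
      "AE \<omega> in M. \<omega> \<in> A \<longleftrightarrow> (\<forall>t\<in>D. W t \<omega> - W 0 \<omega> \<in> S t)"
    using A unfolding past_events_def by auto
  \<comment> \<open>The point \<open>v\<close> separates the two groups of cells. The point
    \<open>0\<close> enters through \<open>W 0\<close>, and \<open>0 \<le> v\<close> puts the
    increments from \<open>0\<close> into the group of the past.\<close>
  define E where "E = insert 0 (insert v (D \<union> step_ends \<phi>))"
  have "\<exists>(u :: nat \<Rightarrow> real) k. strict_mono u \<and> E = u ` {..k}"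
    by (rule finite_set_strict_mono_grid) (simp_all add: E_def finite_step_ends A'(2))
  then obtain u :: "nat \<Rightarrow> real" and k where u: "strict_mono u" and E: "E = u ` {..k}"
    by (elim exE conjE)
  define idx where "idx = inv u"
  have idx: "u (idx t) = t" "idx t \<le> k" if "t \<in> E" for t
    using that strict_mono_imp_inj_on[OF u] by (auto simp: idx_def E inv_f_f)
  define m where "m = idx v"
  have vE: "v \<in> E" "0 \<in> E" "D \<subseteq> E" "step_ends \<phi> \<subseteq> E" by (auto simp: E_def)
  have m: "u m = v" "m \<le> k" using idx vE by (auto simp: m_def)
  have idx_le: "idx t \<le> m" if "t \<in> E" "t \<le> v" for t
    using strict_mono_less_eq[OF u, of "idx t" m] idx[OF that(1)] m that by simp
  let ?X = "\<lambda>l \<omega>. W (u (Suc l)) \<omega> - W (u l) \<omega>"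
  have Wt: "W t \<omega> - W 0 \<omega> = (\<Sum>l<idx t. ?X l \<omega>) - (\<Sum>l<idx 0. ?X l \<omega>)" if "t \<in> E" for t \<omega>
    using idx(1)[OF that] idx(1)[OF vE(2)] by (simp add: sum_lessThan_telescope[of "\<lambda>l. W (u l) \<omega>"])
  have int: "step_integral W \<phi> \<omega> = (\<Sum>l\<in>{m..<k}. step_fun \<phi> (u (Suc l)) * ?X l \<omega>)" for \<omega>
  proof -
    have "step_fun \<phi> (u (Suc l)) = 0" if "l < m" for l
      using that strict_mono_less_eq[OF u, of "Suc l" m] m by (intro step_fun_eq_0[OF \<phi>(2)]) auto
    then show ?thesis
      using step_grid(2)[OF u \<phi>(1), of k W \<omega>] vE(4) E m
      by (auto intro!: sum.mono_neutral_cong_right)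
  qed
  let ?P = "\<Pi>\<^sub>M l\<in>{..<m}. (borel :: real measure)" and ?Q = "\<Pi>\<^sub>M l\<in>{m..<k}. (borel :: real measure)"
  have ind: "indep_var ?P (\<lambda>\<omega>. restrict (\<lambda>l. ?X l \<omega>) {..<m}) ?Q (\<lambda>\<omega>. restrict (\<lambda>l. ?X l \<omega>) {m..<k})"
    using m by (intro indep_var_restrict[OF W_indep[OF u, of k]]) auto
  define a where "a = {x \<in> space ?P. \<forall>t\<in>D. (\<Sum>l<idx t. x l) - (\<Sum>l<idx 0. x l) \<in> S t}"
  define b where "b = {x \<in> space ?Q. (\<Sum>l\<in>{m..<k}. step_fun \<phi> (u (Suc l)) * x l) \<in> X}"
  have psum: "(\<lambda>x. (\<Sum>l<i. x l)) \<in> borel_measurable ?P" if "i \<le> m" for i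
    using that by (intro borel_measurable_sum measurable_component_singleton) auto
  have DE: "t \<in> E" "t \<le> v" if "t \<in> D" for t
    using that A'(3) vE by auto
  have pm: "(\<lambda>x. (\<Sum>l<idx t. x l) - (\<Sum>l<idx 0. x l)) \<in> borel_measurable ?P" if "t \<in> D" for t
    using psum[OF idx_le[OF DE[OF that]]] psum[OF idx_le[OF vE(2) v]] by (rule borel_measurable_diff)
  have a: "a \<in> sets ?P"
    unfolding a_def
  proof (rule sets.sets_Collect_finite_All)
    fix t assume "t \<in> D"
    from measurable_sets[OF pm[OF this] A'(4)[of t]]
    show "{x \<in> space ?P. (\<Sum>l<idx t. x l) - (\<Sum>l<idx 0. x l) \<in> S t} \<in> sets ?P"
      by (simp add: vimage_def Int_def conj_commute)
  qed (rule A'(2))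
  have "(\<lambda>x. (\<Sum>l\<in>{m..<k}. step_fun \<phi> (u (Suc l)) * x l)) \<in> borel_measurable ?Q"
    by (intro borel_measurable_sum borel_measurable_times borel_measurable_const measurable_component_singleton) auto
  from measurable_sets[OF this X] have b: "b \<in> sets ?Q"
    by (simp add: b_def vimage_def Int_def conj_commute)
  have preA: "(\<lambda>\<omega>. restrict (\<lambda>l. ?X l \<omega>) {..<m}) -` a \<inter> space M
      = {\<omega>\<in>space M. \<forall>t\<in>D. W t \<omega> - W 0 \<omega> \<in> S t}" (is "?A' = _")
  proof -
    have "(\<Sum>l<idx t. restrict (\<lambda>l. ?X l \<omega>) {..<m} l) = (\<Sum>l<idx t. ?X l \<omega>)" if "t \<in> E" "t \<le> v" for t \<omega>
      using idx_le[OF that] by (intro sum.cong) auto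
    then show ?thesis
      using A'(3) vE v by (auto simp: a_def space_PiM Wt subset_iff)
  qed
  have preB: "(\<lambda>\<omega>. restrict (\<lambda>l. ?X l \<omega>) {m..<k}) -` b \<inter> space M = step_integral W \<phi> -` X \<inter> space M" (is "?B' = _")
    by (auto simp: b_def space_PiM int)
  have "(\<lambda>\<omega>. (restrict (\<lambda>l. ?X l \<omega>) {..<m}, restrict (\<lambda>l. ?X l \<omega>) {m..<k})) -` (a \<times> b) \<inter> space M = ?A' \<inter> ?B'"
    by auto
  with indep_varD[OF ind a b] have eq: "prob (?A' \<inter> ?B') = prob ?A' * prob ?B'"
    by simp
  have meas: "?A' \<in> events" "?B' \<in> events"
    using indep_var_rv1[OF ind] indep_var_rv2[OF ind] a b by (auto intro: measurable_sets)
  have AE: "AE \<omega> in M. \<omega> \<in> A \<longleftrightarrow> \<omega> \<in> ?A'"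
    unfolding preA using A'(5) AE_space by eventually_elim simp
  have "prob (A \<inter> ?B') = prob (?A' \<inter> ?B')"
  proof (rule measure_eq_AE)
    show "AE \<omega> in M. \<omega> \<in> A \<inter> ?B' \<longleftrightarrow> \<omega> \<in> ?A' \<inter> ?B'"
      using AE by eventually_elim blast
  qed (use meas A'(1) in auto)
  moreover have "prob A = prob ?A'"
    by (rule measure_eq_AE[OF AE A'(1) meas(1)])
  ultimately show ?thesis
    using eq unfolding preB by simp
qed

text \<open>The generating events are closed under intersection, so independence extends to the
  generated \<open>\<sigma>\<close>-algebra.\<close>

lemma past_future_indep:
  assumes v: "0 \<le> v" and \<phi>: "valid_step \<phi>" "step_ends \<phi> \<subseteq> {v..}" and A: "A \<in> sets (past v)"
  shows "indep_var borel (indicator A :: 'a \<Rightarrow> real) borel (step_integral W \<phi>)"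
proof -
  let ?B = "{step_integral W \<phi> -` X \<inter> space M | X. X \<in> sets borel}"
  have Aev: "A \<in> events" using A subalgebra_past by (auto simp: subalgebra_def)
  have "indep_set (past_events v) ?B"
    using past_events_subset past_events_future_indep[OF v \<phi>]
    by (intro indep_setI) (auto intro: measurable_sets)
  then have "indep_sets (\<lambda>i. sigma_sets (space M) (case_bool (past_events v) ?B i)) UNIV"
    unfolding indep_set_def
  proof (rule indep_sets_sigma)
    have "Int_stable ?B"
    proof (rule Int_stableI, clarify)
      fix X Y :: "real set" assume "X \<in> sets borel" "Y \<in> sets borel"
      then show "\<exists>Z. (step_integral W \<phi> -` X \<inter> space M) \<inter> (step_integral W \<phi> -` Y \<inter> space M)
          = step_integral W \<phi> -` Z \<inter> space M \<and> Z \<in> sets borel"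
        by (intro exI[of _ "X \<inter> Y"]) auto
    qed
    then show "Int_stable (case_bool (past_events v) ?B i)" for i
      using Int_stable_past_events by (cases i) auto
  qed
  then have "indep_sets (\<lambda>i. {case_bool (indicator A) (step_integral W \<phi>) i -` X \<inter> space M | X.
      X \<in> sets (case_bool borel borel i)}) UNIV"
  proof (rule indep_sets_mono_sets)
    fix i :: bool
    show "{case_bool (indicator A) (step_integral W \<phi>) i -` X \<inter> space M | X. X \<in> sets (case_bool borel borel i)}
        \<subseteq> sigma_sets (space M) (case_bool (past_events v) ?B i)"
    proof (cases i)
      case True
      have "(indicator A :: 'a \<Rightarrow> real) \<in> borel_measurable (past v)"
        using A by simp
      then have "(indicator A :: 'a \<Rightarrow> real) -` X \<inter> space M \<in> sets (past v)" if "X \<in> sets borel" for X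
        using that measurable_sets[of "indicator A :: 'a \<Rightarrow> real" "past v" borel X] by simp
      then show ?thesis using True by (auto simp: sets_past)
    next
      case False
      then show ?thesis by (auto intro: sigma_sets.Basic)
    qed
  qed
  then show ?thesis
    unfolding indep_var_def indep_vars_def2 using Aev by (auto split: bool.split)
qed

lemma finite_measure_subalgebra_past: "finite_measure_subalgebra M (past v)"
  by (unfold_locales) (rule subalgebra_past)

abbreviation cexp :: "real \<Rightarrow> ('a \<Rightarrow> real) \<Rightarrow> 'a \<Rightarrow> real" where
  "cexp v \<equiv> real_cond_exp M (past v)"

lemma cexp_future_power:
  assumes v: "0 \<le> v" and \<phi>: "valid_step \<phi>" "step_ends \<phi> \<subseteq> {v..}"
  shows "AE \<omega> in M. cexp v (\<lambda>\<omega>. step_integral W \<phi> \<omega> ^ k) \<omega> = expectation (\<lambda>\<omega>. step_integral W \<phi> \<omega> ^ k)"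
proof -
  interpret P: finite_measure_subalgebra M "past v" by (rule finite_measure_subalgebra_past)
  have i: "integrable M (\<lambda>\<omega>. step_integral W \<phi> \<omega> ^ k)"
    using step_integral_moments[OF \<phi>(1)] by metis
  show ?thesis
  proof (rule P.real_cond_exp_charact)
    fix A assume A: "A \<in> sets (past v)"
    then have Aev[measurable]: "A \<in> events" using subalgebra_past by (auto simp: subalgebra_def)
    have "indep_var borel ((\<lambda>x. x) \<circ> (indicator A :: 'a \<Rightarrow> real)) borel ((\<lambda>x. x ^ k) \<circ> step_integral W \<phi>)"
      by (rule indep_var_compose[OF past_future_indep[OF v \<phi> A]]) auto
    then have "indep_var borel (indicator A :: 'a \<Rightarrow> real) borel (\<lambda>\<omega>. step_integral W \<phi> \<omega> ^ k)"
      by (simp add: comp_def)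
    moreover have "integrable M (indicator A :: 'a \<Rightarrow> real)"
      by (rule integrable_real_indicator) (auto simp: emeasure_eq_measure)
    ultimately have "expectation (\<lambda>\<omega>. indicator A \<omega> * step_integral W \<phi> \<omega> ^ k)
        = prob A * expectation (\<lambda>\<omega>. step_integral W \<phi> \<omega> ^ k)"
      using i by (subst indep_var_lebesgue_integral) auto
    then show "(\<integral>\<omega>\<in>A. step_integral W \<phi> \<omega> ^ k \<partial>M) = (\<integral>\<omega>\<in>A. expectation (\<lambda>\<omega>. step_integral W \<phi> \<omega> ^ k) \<partial>M)"
      by (simp add: set_lebesgue_integral_def)
  qed (use i in auto)
qed

lemma cexp_L1_contraction:
  assumes f: "integrable M f"
  shows "expectation (\<lambda>\<omega>. \<bar>cexp v f \<omega>\<bar>) \<le> expectation (\<lambda>\<omega>. \<bar>f \<omega>\<bar>)"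
proof -
  interpret P: finite_measure_subalgebra M "past v" by (rule finite_measure_subalgebra_past)
  have [measurable]: "f \<in> borel_measurable M" using f by simp
  have "(\<integral>\<^sup>+ \<omega>. ennreal \<bar>cexp v f \<omega>\<bar> \<partial>M) \<le> (\<integral>\<^sup>+ \<omega>. 1 * nn_cond_exp M (past v) (\<lambda>\<omega>. ennreal \<bar>f \<omega>\<bar>) \<omega> \<partial>M)"
    using P.real_cond_exp_abs[of f] by (intro nn_integral_mono_AE) auto
  also have "\<dots> = (\<integral>\<^sup>+ \<omega>. 1 * ennreal \<bar>f \<omega>\<bar> \<partial>M)"
    by (rule P.nn_cond_exp_intg) auto
  finally have "ennreal (expectation (\<lambda>\<omega>. \<bar>cexp v f \<omega>\<bar>)) \<le> ennreal (expectation (\<lambda>\<omega>. \<bar>f \<omega>\<bar>))"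
    using f P.real_cond_exp_int(1)[OF f] by (simp add: nn_integral_eq_integral)
  then show ?thesis by simp
qed

end

lemma L2_lim_diff:
  fixes g g' :: "'b \<Rightarrow> real"
  assumes [measurable]: "g \<in> borel_measurable N" "g' \<in> borel_measurable N" "\<And>k. h k \<in> borel_measurable N" "\<And>k. h' k \<in> borel_measurable N"
    and lim: "(\<lambda>k. \<integral>\<^sup>+ x. ennreal ((g x - h k x)\<^sup>2) \<partial>N) \<longlonglongrightarrow> 0" "(\<lambda>k. \<integral>\<^sup>+ x. ennreal ((g' x - h' k x)\<^sup>2) \<partial>N) \<longlonglongrightarrow> 0"
  shows "(\<lambda>k. \<integral>\<^sup>+ x. ennreal ((g x - g' x - (h k x - h' k x))\<^sup>2) \<partial>N) \<longlonglongrightarrow> 0"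
proof (rule tendsto_sandwich[OF _ _ tendsto_const])
  show "\<forall>\<^sub>F k in sequentially. (\<integral>\<^sup>+ x. ennreal ((g x - g' x - (h k x - h' k x))\<^sup>2) \<partial>N)
      \<le> 2 * (\<integral>\<^sup>+ x. ennreal ((g x - h k x)\<^sup>2) \<partial>N) + 2 * (\<integral>\<^sup>+ x. ennreal ((g' x - h' k x)\<^sup>2) \<partial>N)"
  proof (intro always_eventually allI)
    fix k
    have "ennreal ((g x - g' x - (h k x - h' k x))\<^sup>2) \<le> 2 * ennreal ((g x - h k x)\<^sup>2) + 2 * ennreal ((g' x - h' k x)\<^sup>2)" for x
    proof -
      have "(g x - g' x - (h k x - h' k x))\<^sup>2 \<le> 2 * (g x - h k x)\<^sup>2 + 2 * (g' x - h' k x)\<^sup>2"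
        using zero_le_power2[of "(g x - h k x) + (g' x - h' k x)"] by (simp add: power2_eq_square algebra_simps)
      then have "ennreal ((g x - g' x - (h k x - h' k x))\<^sup>2) \<le> ennreal (2 * (g x - h k x)\<^sup>2 + 2 * (g' x - h' k x)\<^sup>2)"
        by (rule ennreal_leI)
      then show ?thesis by (simp add: ennreal_mult)
    qed
    then have "(\<integral>\<^sup>+ x. ennreal ((g x - g' x - (h k x - h' k x))\<^sup>2) \<partial>N)
        \<le> (\<integral>\<^sup>+ x. 2 * ennreal ((g x - h k x)\<^sup>2) + 2 * ennreal ((g' x - h' k x)\<^sup>2) \<partial>N)"
      by (intro nn_integral_mono) auto
    then show "(\<integral>\<^sup>+ x. ennreal ((g x - g' x - (h k x - h' k x))\<^sup>2) \<partial>N)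
      \<le> 2 * (\<integral>\<^sup>+ x. ennreal ((g x - h k x)\<^sup>2) \<partial>N) + 2 * (\<integral>\<^sup>+ x. ennreal ((g' x - h' k x)\<^sup>2) \<partial>N)"
      by (simp add: nn_integral_add nn_integral_cmult)
  qed
  show "(\<lambda>k. 2 * (\<integral>\<^sup>+ x. ennreal ((g x - h k x)\<^sup>2) \<partial>N) + 2 * (\<integral>\<^sup>+ x. ennreal ((g' x - h' k x)\<^sup>2) \<partial>N)) \<longlonglongrightarrow> 0"
    using tendsto_add[OF ennreal_tendsto_cmult[OF _ lim(1), of 2] ennreal_tendsto_cmult[OF _ lim(2), of 2]] by simp
qed simp

lemma gauss_moment_pos: "0 < gauss_moment q"
  by (simp add: gauss_moment_def)

context wiener
begin

text \<open>The integral is cut at \<open>v\<close> into \<open>P + Q\<close>. \<open>P\<close> is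
  known at time \<open>v\<close>, \<open>Q\<close> is centred and independent of the past; hence the
  mixed term drops out and only the variance of \<open>Q\<close>, a number, is added to the square
  of \<open>P\<close>.\<close>

lemma cexp_step_integral:
  assumes v: "0 \<le> v" and \<phi>: "valid_step \<phi>"
  defines "P \<equiv> step_integral W (step_map (min v) \<phi>)"
  shows "P \<in> borel_measurable (past v)"
    and "AE \<omega> in M. cexp v (step_integral W \<phi>) \<omega> = P \<omega>"
    and "AE \<omega> in M. cexp v (\<lambda>\<omega>. (step_integral W \<phi> \<omega>)\<^sup>2) \<omega>
           = (P \<omega>)\<^sup>2 + (\<integral>s. (step_fun \<phi> s * indicator {v<..} s)\<^sup>2 \<partial>lborel)"
proof -
  interpret A: finite_measure_subalgebra M "past v" by (rule finite_measure_subalgebra_past)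
  define Q where "Q = step_integral W (step_map (max v) \<phi>)"
  have vp: "valid_step (step_map (min v) \<phi>)" "valid_step (step_map (max v) \<phi>)"
    using \<phi> by (auto intro!: valid_step_map simp: mono_def)
  have S: "step_integral W \<phi> = (\<lambda>\<omega>. P \<omega> + Q \<omega>)"
    unfolding P_def Q_def by (intro ext step_integral_split)
  have fut: "step_ends (step_map (max v) \<phi>) \<subseteq> {v..}"
    by (auto simp: step_ends_map)
  show P[measurable]: "P \<in> borel_measurable (past v)"
    unfolding P_def by (intro step_integral_past_measurable) (auto simp: step_ends_map)
  have PM[measurable]: "P \<in> borel_measurable M" and QM[measurable]: "Q \<in> borel_measurable M"
    unfolding P_def Q_def by measurable
  obtain \<sigma>1 where iP: "\<And>k. integrable M (\<lambda>\<omega>. P \<omega> ^ k)"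
    using step_integral_moments[OF vp(1)] unfolding P_def by metis
  obtain \<sigma> where \<sigma>: "0 \<le> \<sigma>" "(\<integral>\<^sup>+ s. ennreal ((step_fun (step_map (max v) \<phi>) s)\<^sup>2) \<partial>lborel) = ennreal (\<sigma>\<^sup>2)"
    and iQ: "\<And>k. integrable M (\<lambda>\<omega>. Q \<omega> ^ k)"
    and Q2: "\<And>q. expectation (\<lambda>\<omega>. Q \<omega> ^ (2 * q)) = gauss_moment q * \<sigma> ^ (2 * q)"
    and Q1: "expectation Q = 0"
    using step_integral_moments[OF vp(2)] unfolding Q_def by metis
  have Q2': "expectation (\<lambda>\<omega>. (Q \<omega>)\<^sup>2) = (\<integral>s. (step_fun \<phi> s * indicator {v<..} s)\<^sup>2 \<partial>lborel)"
  proof -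
    have "expectation (\<lambda>\<omega>. (Q \<omega>)\<^sup>2) = \<sigma>\<^sup>2"
      using Q2[of 1] by (simp add: gauss_moment_def)
    also have "\<sigma>\<^sup>2 = (\<integral>s. (step_fun \<phi> s * indicator {v<..} s)\<^sup>2 \<partial>lborel)"
      using \<sigma>(2) by (subst integral_eq_nn_integral) (auto simp: step_fun_future)
    finally show ?thesis .
  qed
  have cP: "AE \<omega> in M. cexp v P \<omega> = P \<omega>"
    using iP[of 1] P by (intro A.real_cond_exp_F_meas) auto
  have cQ: "AE \<omega> in M. cexp v Q \<omega> = 0"
    using cexp_future_power[OF v vp(2) fut, of 1] Q1 by (simp add: Q_def)
  have cQ2: "AE \<omega> in M. cexp v (\<lambda>\<omega>. (Q \<omega>)\<^sup>2) \<omega> = expectation (\<lambda>\<omega>. (Q \<omega>)\<^sup>2)"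
    using cexp_future_power[OF v vp(2) fut, of 2] by (simp add: Q_def)
  have iPQ: "integrable M (\<lambda>\<omega>. P \<omega> * Q \<omega>)"
  proof (rule Bochner_Integration.integrable_bound)
    show "integrable M (\<lambda>\<omega>. (P \<omega>)\<^sup>2 + (Q \<omega>)\<^sup>2)" using iP[of 2] iQ[of 2] by simp
    have "\<bar>P \<omega> * Q \<omega>\<bar> \<le> (P \<omega>)\<^sup>2 + (Q \<omega>)\<^sup>2" for \<omega>
      using abs_power_mult_le[of 1 2 "P \<omega>" "Q \<omega>"] by (simp add: abs_mult)
    then show "AE \<omega> in M. norm (P \<omega> * Q \<omega>) \<le> norm ((P \<omega>)\<^sup>2 + (Q \<omega>)\<^sup>2)" by simp
  qed simp
  have cPQ: "AE \<omega> in M. cexp v (\<lambda>\<omega>. P \<omega> * Q \<omega>) \<omega> = P \<omega> * cexp v Q \<omega>"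
    using iPQ by (intro A.real_cond_exp_mult) auto
  have "AE \<omega> in M. cexp v (\<lambda>\<omega>. P \<omega> + Q \<omega>) \<omega> = cexp v P \<omega> + cexp v Q \<omega>"
    using iP[of 1] iQ[of 1] by (intro A.real_cond_exp_add) auto
  with cP cQ show "AE \<omega> in M. cexp v (step_integral W \<phi>) \<omega> = P \<omega>"
    unfolding S by eventually_elim simp
  have cP2: "AE \<omega> in M. cexp v (\<lambda>\<omega>. (P \<omega>)\<^sup>2) \<omega> = (P \<omega>)\<^sup>2"
    using iP[of 2] P by (intro A.real_cond_exp_F_meas) auto
  have c1: "AE \<omega> in M. cexp v (\<lambda>\<omega>. (P \<omega>)\<^sup>2 + 2 * (P \<omega> * Q \<omega>)) \<omega> = cexp v (\<lambda>\<omega>. (P \<omega>)\<^sup>2) \<omega> + cexp v (\<lambda>\<omega>. 2 * (P \<omega> * Q \<omega>)) \<omega>"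
    using iP[of 2] iPQ by (intro A.real_cond_exp_add) auto
  have c2: "AE \<omega> in M. cexp v (\<lambda>\<omega>. (P \<omega>)\<^sup>2 + 2 * (P \<omega> * Q \<omega>) + (Q \<omega>)\<^sup>2) \<omega>
      = cexp v (\<lambda>\<omega>. (P \<omega>)\<^sup>2 + 2 * (P \<omega> * Q \<omega>)) \<omega> + cexp v (\<lambda>\<omega>. (Q \<omega>)\<^sup>2) \<omega>"
    using iP[of 2] iQ[of 2] iPQ by (intro A.real_cond_exp_add) auto
  have c3: "AE \<omega> in M. cexp v (\<lambda>\<omega>. 2 * (P \<omega> * Q \<omega>)) \<omega> = 2 * cexp v (\<lambda>\<omega>. P \<omega> * Q \<omega>) \<omega>"
    by (rule A.real_cond_exp_cmult[OF iPQ])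
  have sq: "(\<lambda>\<omega>. (P \<omega> + Q \<omega>)\<^sup>2) = (\<lambda>\<omega>. (P \<omega>)\<^sup>2 + 2 * (P \<omega> * Q \<omega>) + (Q \<omega>)\<^sup>2)"
    by (simp add: power2_sum algebra_simps)
  show "AE \<omega> in M. cexp v (\<lambda>\<omega>. (step_integral W \<phi> \<omega>)\<^sup>2) \<omega>
      = (P \<omega>)\<^sup>2 + (\<integral>s. (step_fun \<phi> s * indicator {v<..} s)\<^sup>2 \<partial>lborel)"
    using c1 c2 c3 cP2 cPQ cQ cQ2 unfolding S sq by eventually_elim (simp add: Q2')
qed

lemma step_fun_square_integrable:
  assumes "valid_step \<phi>" and A: "A \<in> sets borel"
  shows "integrable lborel (\<lambda>s. (step_fun \<phi> s * indicator A s)\<^sup>2)"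
proof (rule Bochner_Integration.integrable_bound)
  obtain \<sigma> where "(\<integral>\<^sup>+ s. ennreal ((step_fun \<phi> s)\<^sup>2) \<partial>lborel) = ennreal (\<sigma>\<^sup>2)"
    using step_integral_moments[OF assms(1)] by metis
  then show "integrable lborel (\<lambda>s. (step_fun \<phi> s)\<^sup>2)"
    by (intro integrableI_bounded) auto
  show "AE s in lborel. norm ((step_fun \<phi> s * indicator A s)\<^sup>2) \<le> norm ((step_fun \<phi> s)\<^sup>2)"
    by (auto simp: indicator_def)
qed (use A in measurable)

lemma step_integral_integrable:
  assumes "valid_step \<phi>"
  shows "integrable M (\<lambda>\<omega>. step_integral W \<phi> \<omega> ^ k)" and "integrable M (step_integral W \<phi>)"
proof -
  show *: "integrable M (\<lambda>\<omega>. step_integral W \<phi> \<omega> ^ k)" for k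
    by (rule step_integral_moments[OF assms])
  show "integrable M (step_integral W \<phi>)"
    using *[of 1] by simp
qed

section \<open>Conditional moments of Wiener integrals\<close>

context
  fixes f :: "real \<Rightarrow> real" and Z :: "'a \<Rightarrow> real"
  assumes hw: "has_wiener_integral M W f Z"
begin

lemma wiener_integral_measurable: "f \<in> borel_measurable borel" "Z \<in> borel_measurable M"
  using hw unfolding has_wiener_integral_def by auto

lemma wiener_integral_approx:
  obtains \<phi> where "\<And>k. valid_step (\<phi> k)"
    "(\<lambda>k. \<integral>\<^sup>+ s. ennreal ((f s - step_fun (\<phi> k) s)\<^sup>2) \<partial>lborel) \<longlonglongrightarrow> 0"
    "(\<lambda>k. \<integral>\<^sup>+ \<omega>. ennreal ((Z \<omega> - step_integral W (\<phi> k) \<omega>)\<^sup>2) \<partial>M) \<longlonglongrightarrow> 0"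
proof -
  from hw obtain \<phi> where "\<forall>k. \<forall>(c, u, v)\<in>set (\<phi> k). u \<le> v"
    and lim: "(\<lambda>k. \<integral>\<^sup>+ s. ennreal ((f s - step_fun (\<phi> k) s)\<^sup>2) \<partial>lborel) \<longlonglongrightarrow> 0"
    "(\<lambda>k. \<integral>\<^sup>+ \<omega>. ennreal ((Z \<omega> - step_integral W (\<phi> k) \<omega>)\<^sup>2) \<partial>M) \<longlonglongrightarrow> 0"
    unfolding has_wiener_integral_def by (elim conjE exE)
  then have "valid_step (\<phi> k)" for k by (simp add: valid_step_def)
  from this lim show thesis by (rule that)
qed

lemma wiener_integral_square_integrable:
  shows "integrable M (\<lambda>\<omega>. (Z \<omega>)\<^sup>2)" and "integrable M Z" and "integrable lborel (\<lambda>s. (f s)\<^sup>2)"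
proof -
  note [measurable] = wiener_integral_measurable
  obtain \<phi> where \<phi>: "\<And>k. valid_step (\<phi> k)"
    "(\<lambda>k. \<integral>\<^sup>+ s. ennreal ((f s - step_fun (\<phi> k) s)\<^sup>2) \<partial>lborel) \<longlonglongrightarrow> 0"
    "(\<lambda>k. \<integral>\<^sup>+ \<omega>. ennreal ((Z \<omega> - step_integral W (\<phi> k) \<omega>)\<^sup>2) \<partial>M) \<longlonglongrightarrow> 0"
    by (rule wiener_integral_approx) blast
  have "integrable M (\<lambda>\<omega>. (step_integral W (\<phi> k) \<omega>)\<^sup>2)" for k
    by (rule step_integral_integrable[OF \<phi>(1)])
  then show "integrable M (\<lambda>\<omega>. (Z \<omega>)\<^sup>2)"
    by (intro L2_limit_integrable[OF _ _ \<phi>(3)]) auto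
  then have "Lp_le 2 Z (sqrt (expectation (\<lambda>\<omega>. (Z \<omega>)\<^sup>2)))"
    by (intro Lp_leI_expectation) auto
  then have "Lp_le 1 Z (sqrt (expectation (\<lambda>\<omega>. (Z \<omega>)\<^sup>2)))"
    by (rule Lp_le_lower[rotated 2]) auto
  then show "integrable M Z"
    using Lp_le_integrable[of 1 Z] integrable_abs_iff[of Z M] by simp
  have "integrable lborel (\<lambda>s. (step_fun (\<phi> k) s)\<^sup>2)" for k
    using step_fun_square_integrable[OF \<phi>(1), of UNIV] by simp
  then show "integrable lborel (\<lambda>s. (f s)\<^sup>2)"
    by (intro L2_limit_integrable[OF _ _ \<phi>(2)]) auto
qed

lemma wiener_integral_restrict_tendsto:
  assumes \<phi>: "\<And>k. valid_step (\<phi> k)" "(\<lambda>k. \<integral>\<^sup>+ s. ennreal ((f s - step_fun (\<phi> k) s)\<^sup>2) \<partial>lborel) \<longlonglongrightarrow> 0"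
    and A[measurable]: "A \<in> sets borel"
  shows "(\<lambda>k. \<integral>s. (step_fun (\<phi> k) s * indicator A s)\<^sup>2 \<partial>lborel) \<longlonglongrightarrow> (\<integral>s. (f s * indicator A s)\<^sup>2 \<partial>lborel)"
proof -
  note [measurable] = wiener_integral_measurable
  let ?g = "\<lambda>s. f s * indicator A s" and ?h = "\<lambda>k s. step_fun (\<phi> k) s * indicator A s"
  have lim: "(\<lambda>k. \<integral>\<^sup>+ s. ennreal ((?g s - ?h k s)\<^sup>2) \<partial>lborel) \<longlonglongrightarrow> 0"
  proof (rule tendsto_sandwich[OF _ _ tendsto_const \<phi>(2)])
    show "\<forall>\<^sub>F k in sequentially. (\<integral>\<^sup>+ s. ennreal ((?g s - ?h k s)\<^sup>2) \<partial>lborel)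
        \<le> (\<integral>\<^sup>+ s. ennreal ((f s - step_fun (\<phi> k) s)\<^sup>2) \<partial>lborel)"
      by (intro always_eventually allI nn_integral_mono) (auto simp: indicator_def)
  qed simp
  have ih: "integrable lborel (\<lambda>s. (?h k s)\<^sup>2)" for k
    by (rule step_fun_square_integrable[OF \<phi>(1) A])
  have ig: "integrable lborel (\<lambda>s. (?g s)\<^sup>2)"
    by (rule L2_limit_integrable[OF _ _ lim ih]) auto
  have 0: "(\<lambda>k. \<integral>s. \<bar>(?g s)\<^sup>2 - (?h k s)\<^sup>2\<bar> \<partial>lborel) \<longlonglongrightarrow> 0"
    by (rule L2_tendsto_square[OF _ _ lim ih]) auto
  have "(\<lambda>k. (\<integral>s. (?h k s)\<^sup>2 \<partial>lborel) - (\<integral>s. (?g s)\<^sup>2 \<partial>lborel)) \<longlonglongrightarrow> 0"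
  proof (rule Lim_null_comparison[OF always_eventually 0], rule allI)
    fix k
    have "(\<integral>s. (?h k s)\<^sup>2 \<partial>lborel) - (\<integral>s. (?g s)\<^sup>2 \<partial>lborel) = (\<integral>s. (?h k s)\<^sup>2 - (?g s)\<^sup>2 \<partial>lborel)"
      using ih ig by simp
    also have "norm \<dots> \<le> (\<integral>s. norm ((?h k s)\<^sup>2 - (?g s)\<^sup>2) \<partial>lborel)"
      by (rule integral_norm_bound)
    also have "\<dots> = (\<integral>s. \<bar>(?g s)\<^sup>2 - (?h k s)\<^sup>2\<bar> \<partial>lborel)"
      by (simp add: abs_minus_commute)
    finally show "norm ((\<integral>s. (?h k s)\<^sup>2 \<partial>lborel) - (\<integral>s. (?g s)\<^sup>2 \<partial>lborel)) \<le> (\<integral>s. \<bar>(?g s)\<^sup>2 - (?h k s)\<^sup>2\<bar> \<partial>lborel)" .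
  qed
  then show ?thesis by (simp add: LIM_zero_iff)
qed

text \<open>Conditional expectation contracts in \<open>L\<^sup>1\<close>, and both the integrals
  and their squares converge there; a subsequence then converges almost surely. This transfers the
  formulas for step functions to all integrands.\<close>

lemma wiener_integral_cexp_approx:
  assumes v: "0 \<le> v"
  obtains \<phi> where "\<And>k. valid_step (\<phi> k)"
    "(\<lambda>k. \<integral>\<^sup>+ s. ennreal ((f s - step_fun (\<phi> k) s)\<^sup>2) \<partial>lborel) \<longlonglongrightarrow> 0"
    "AE \<omega> in M. (\<lambda>k. step_integral W (step_map (min v) (\<phi> k)) \<omega>) \<longlonglongrightarrow> cexp v Z \<omega>"
    "AE \<omega> in M. (\<lambda>k. (step_integral W (step_map (min v) (\<phi> k)) \<omega>)\<^sup>2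
        + (\<integral>s. (step_fun (\<phi> k) s * indicator {v<..} s)\<^sup>2 \<partial>lborel)) \<longlonglongrightarrow> cexp v (\<lambda>\<omega>. (Z \<omega>)\<^sup>2) \<omega>"
proof -
  interpret A: finite_measure_subalgebra M "past v" by (rule finite_measure_subalgebra_past)
  note [measurable] = wiener_integral_measurable
  note iZ = wiener_integral_square_integrable
  obtain \<phi> where \<phi>: "\<And>k. valid_step (\<phi> k)"
    "(\<lambda>k. \<integral>\<^sup>+ s. ennreal ((f s - step_fun (\<phi> k) s)\<^sup>2) \<partial>lborel) \<longlonglongrightarrow> 0"
    "(\<lambda>k. \<integral>\<^sup>+ \<omega>. ennreal ((Z \<omega> - step_integral W (\<phi> k) \<omega>)\<^sup>2) \<partial>M) \<longlonglongrightarrow> 0"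
    by (rule wiener_integral_approx) blast
  let ?S = "\<lambda>k. step_integral W (\<phi> k)" and ?P = "\<lambda>k. step_integral W (step_map (min v) (\<phi> k))"
  let ?\<nu> = "\<lambda>k. \<integral>s. (step_fun (\<phi> k) s * indicator {v<..} s)\<^sup>2 \<partial>lborel"
  have iS2: "integrable M (\<lambda>\<omega>. (?S k \<omega>)\<^sup>2)" and iS: "integrable M (?S k)" for k
    using step_integral_integrable[OF \<phi>(1)[of k]] by blast+
  have d2: "integrable M (\<lambda>\<omega>. (Z \<omega> - ?S k \<omega>)\<^sup>2)" for k
    by (rule L2_diff_integrable[OF _ _ \<phi>(3) iS2]) auto
  have lim2: "(\<lambda>k. expectation (\<lambda>\<omega>. (Z \<omega> - ?S k \<omega>)\<^sup>2)) \<longlonglongrightarrow> 0"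
    by (rule L2_tendsto_diff[OF _ _ \<phi>(3) iS2]) auto
  have limsq: "(\<lambda>k. expectation (\<lambda>\<omega>. \<bar>(Z \<omega>)\<^sup>2 - (?S k \<omega>)\<^sup>2\<bar>)) \<longlonglongrightarrow> 0"
    by (rule L2_tendsto_square[OF _ _ \<phi>(3) iS2]) auto
  have le1: "expectation (\<lambda>\<omega>. \<bar>Z \<omega> - ?S k \<omega>\<bar>) \<le> sqrt (expectation (\<lambda>\<omega>. (Z \<omega> - ?S k \<omega>)\<^sup>2))" for k
  proof -
    have "Lp_le 2 (\<lambda>\<omega>. Z \<omega> - ?S k \<omega>) (sqrt (expectation (\<lambda>\<omega>. (Z \<omega> - ?S k \<omega>)\<^sup>2)))"
      using d2 by (intro Lp_leI_expectation) auto
    then have "Lp_le 1 (\<lambda>\<omega>. Z \<omega> - ?S k \<omega>) (sqrt (expectation (\<lambda>\<omega>. (Z \<omega> - ?S k \<omega>)\<^sup>2)))"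
      by (rule Lp_le_lower[rotated 2]) auto
    from Lp_le_expectation[OF this] show ?thesis by simp
  qed
  have lim1: "(\<lambda>k. expectation (\<lambda>\<omega>. \<bar>Z \<omega> - ?S k \<omega>\<bar>)) \<longlonglongrightarrow> 0"
  proof (rule tendsto_sandwich[OF _ _ tendsto_const])
    show "(\<lambda>k. sqrt (expectation (\<lambda>\<omega>. (Z \<omega> - ?S k \<omega>)\<^sup>2))) \<longlonglongrightarrow> 0"
      using tendsto_real_sqrt[OF lim2] by simp
  qed (use le1 in auto)
  \<comment> \<open>Adding both errors yields one subsequence that serves the variable and its
    square.\<close>
  define e where "e k \<omega> = \<bar>cexp v (\<lambda>\<omega>. Z \<omega> - ?S k \<omega>) \<omega>\<bar> + \<bar>cexp v (\<lambda>\<omega>. (Z \<omega>)\<^sup>2 - (?S k \<omega>)\<^sup>2) \<omega>\<bar>" for k \<omega>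
  have i1: "integrable M (\<lambda>\<omega>. Z \<omega> - ?S k \<omega>)" and i2: "integrable M (\<lambda>\<omega>. (Z \<omega>)\<^sup>2 - (?S k \<omega>)\<^sup>2)" for k
    using iZ iS iS2 by auto
  have ie: "integrable M (e k)" for k
    unfolding e_def using A.real_cond_exp_int(1)[OF i1] A.real_cond_exp_int(1)[OF i2] by auto
  have "(\<lambda>k. expectation (\<lambda>\<omega>. norm (e k \<omega>))) \<longlonglongrightarrow> 0"
  proof (rule tendsto_sandwich[OF _ _ tendsto_const])
    have "expectation (\<lambda>\<omega>. norm (e k \<omega>)) = expectation (\<lambda>\<omega>. \<bar>cexp v (\<lambda>\<omega>. Z \<omega> - ?S k \<omega>) \<omega>\<bar>)
        + expectation (\<lambda>\<omega>. \<bar>cexp v (\<lambda>\<omega>. (Z \<omega>)\<^sup>2 - (?S k \<omega>)\<^sup>2) \<omega>\<bar>)" for k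
      unfolding e_def using A.real_cond_exp_int(1)[OF i1] A.real_cond_exp_int(1)[OF i2] by (simp add: abs_of_nonneg)
    then show "\<forall>\<^sub>F k in sequentially. expectation (\<lambda>\<omega>. norm (e k \<omega>))
        \<le> expectation (\<lambda>\<omega>. \<bar>Z \<omega> - ?S k \<omega>\<bar>) + expectation (\<lambda>\<omega>. \<bar>(Z \<omega>)\<^sup>2 - (?S k \<omega>)\<^sup>2\<bar>)"
      using cexp_L1_contraction[OF i1] cexp_L1_contraction[OF i2] by (simp add: add_mono)
    show "(\<lambda>k. expectation (\<lambda>\<omega>. \<bar>Z \<omega> - ?S k \<omega>\<bar>) + expectation (\<lambda>\<omega>. \<bar>(Z \<omega>)\<^sup>2 - (?S k \<omega>)\<^sup>2\<bar>)) \<longlonglongrightarrow> 0"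
      using tendsto_add[OF lim1 limsq] by simp
  qed simp
  then obtain r :: "nat \<Rightarrow> nat" where r: "strict_mono r" "AE \<omega> in M. (\<lambda>n. e (r n) \<omega>) \<longlonglongrightarrow> 0"
    using tendsto_L1_AE_subseq[of M e, OF ie] by blast
  have c1: "AE \<omega> in M. \<forall>k. cexp v (\<lambda>\<omega>. Z \<omega> - ?S k \<omega>) \<omega> = cexp v Z \<omega> - ?P k \<omega>"
  proof (subst AE_all_countable, rule allI)
    fix k
    show "AE \<omega> in M. cexp v (\<lambda>\<omega>. Z \<omega> - ?S k \<omega>) \<omega> = cexp v Z \<omega> - ?P k \<omega>"
      using A.real_cond_exp_diff[OF iZ(2) iS[of k]] cexp_step_integral(2)[OF v \<phi>(1)[of k]]
      by eventually_elim simp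
  qed
  have c2: "AE \<omega> in M. \<forall>k. cexp v (\<lambda>\<omega>. (Z \<omega>)\<^sup>2 - (?S k \<omega>)\<^sup>2) \<omega> = cexp v (\<lambda>\<omega>. (Z \<omega>)\<^sup>2) \<omega> - ((?P k \<omega>)\<^sup>2 + ?\<nu> k)"
  proof (subst AE_all_countable, rule allI)
    fix k
    show "AE \<omega> in M. cexp v (\<lambda>\<omega>. (Z \<omega>)\<^sup>2 - (?S k \<omega>)\<^sup>2) \<omega> = cexp v (\<lambda>\<omega>. (Z \<omega>)\<^sup>2) \<omega> - ((?P k \<omega>)\<^sup>2 + ?\<nu> k)"
      using A.real_cond_exp_diff[OF iZ(1) iS2[of k]] cexp_step_integral(3)[OF v \<phi>(1)[of k]]
      by eventually_elim simp
  qed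
  have lims: "AE \<omega> in M. (\<lambda>n. ?P (r n) \<omega>) \<longlonglongrightarrow> cexp v Z \<omega>
      \<and> (\<lambda>n. (?P (r n) \<omega>)\<^sup>2 + ?\<nu> (r n)) \<longlonglongrightarrow> cexp v (\<lambda>\<omega>. (Z \<omega>)\<^sup>2) \<omega>"
    using r(2) c1 c2
  proof eventually_elim
    case (elim \<omega>)
    have "(\<lambda>n. ?P (r n) \<omega> - cexp v Z \<omega>) \<longlonglongrightarrow> 0"
      by (rule Lim_null_comparison[OF _ elim(1)]) (use elim(2) in \<open>simp add: e_def abs_minus_commute\<close>)
    moreover have "(\<lambda>n. ((?P (r n) \<omega>)\<^sup>2 + ?\<nu> (r n)) - cexp v (\<lambda>\<omega>. (Z \<omega>)\<^sup>2) \<omega>) \<longlonglongrightarrow> 0"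
      by (rule Lim_null_comparison[OF _ elim(1)]) (use elim(3) in \<open>simp add: e_def abs_minus_commute\<close>)
    ultimately show ?case by (simp only: LIM_zero_iff)
  qed
  show thesis
  proof (rule that[of "\<lambda>n. \<phi> (r n)"])
    show "(\<lambda>k. \<integral>\<^sup>+ s. ennreal ((f s - step_fun (\<phi> (r k)) s)\<^sup>2) \<partial>lborel) \<longlonglongrightarrow> 0"
      using LIMSEQ_subseq_LIMSEQ[OF \<phi>(2) r(1)] by (simp add: comp_def)
  qed (use \<phi>(1) lims in \<open>auto elim: AE_mp\<close>)
qed

text \<open>The conditional variance of a Wiener integral is deterministic.\<close>

lemma cexp_wiener_integral_square:
  assumes v: "0 \<le> v"
  shows "AE \<omega> in M. cexp v (\<lambda>\<omega>. (Z \<omega>)\<^sup>2) \<omega> = (cexp v Z \<omega>)\<^sup>2 + (\<integral>s. (f s * indicator {v<..} s)\<^sup>2 \<partial>lborel)"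
proof -
  obtain \<phi> where \<phi>: "\<And>k. valid_step (\<phi> k)"
    "(\<lambda>k. \<integral>\<^sup>+ s. ennreal ((f s - step_fun (\<phi> k) s)\<^sup>2) \<partial>lborel) \<longlonglongrightarrow> 0"
    "AE \<omega> in M. (\<lambda>k. step_integral W (step_map (min v) (\<phi> k)) \<omega>) \<longlonglongrightarrow> cexp v Z \<omega>"
    "AE \<omega> in M. (\<lambda>k. (step_integral W (step_map (min v) (\<phi> k)) \<omega>)\<^sup>2
        + (\<integral>s. (step_fun (\<phi> k) s * indicator {v<..} s)\<^sup>2 \<partial>lborel)) \<longlonglongrightarrow> cexp v (\<lambda>\<omega>. (Z \<omega>)\<^sup>2) \<omega>"
    by (rule wiener_integral_cexp_approx[OF v]) blast
  have \<nu>: "(\<lambda>k. \<integral>s. (step_fun (\<phi> k) s * indicator {v<..} s)\<^sup>2 \<partial>lborel) \<longlonglongrightarrow> (\<integral>s. (f s * indicator {v<..} s)\<^sup>2 \<partial>lborel)"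
    by (rule wiener_integral_restrict_tendsto[OF \<phi>(1,2)]) simp
  show ?thesis
    using \<phi>(3,4)
  proof eventually_elim
    case (elim \<omega>)
    show ?case
      by (rule LIMSEQ_unique[OF elim(2) tendsto_add[OF tendsto_power[OF elim(1)] \<nu>]])
  qed
qed

text \<open>The conditional expectation is a limit of integrals of step functions cut at
  \<open>v\<close>, so Fatou's lemma carries over their Gaussian moments. Only the part of the
  integrand before \<open>v\<close> counts, which is the source of all decay below.\<close>

lemma cexp_wiener_integral_moment:
  assumes v: "0 \<le> v" and q: "1 \<le> q"
    and \<nu>: "(\<integral>s. (f s * indicator {..v} s)\<^sup>2 \<partial>lborel) \<le> c\<^sup>2" "0 \<le> c"
  shows "Lp_le (2 * q) (cexp v Z) ((1 + gauss_moment q) * c)"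
proof (rule Lp_le_eps)
  interpret A: finite_measure_subalgebra M "past v" by (rule finite_measure_subalgebra_past)
  \<comment> \<open>The added one makes \<open>?K\<close> at least one, so that its power
    \<open>2 * q\<close> dominates the Gaussian moment without taking roots.\<close>
  let ?K = "1 + gauss_moment q"
  have K: "1 \<le> ?K" "gauss_moment q \<le> ?K ^ (2 * q)"
  proof -
    show "1 \<le> ?K" using gauss_moment_pos[of q] by simp
    then show "gauss_moment q \<le> ?K ^ (2 * q)"
      using power_increasing[of 1 "2 * q" ?K] q by simp
  qed
  show "0 \<le> ?K * c" using K \<nu> by simp
  fix e :: real assume e: "0 < e"
  define d where "d = e / ?K"
  have d: "0 < d" "?K * d = e" using e K by (auto simp: d_def)
  obtain \<phi> where \<phi>: "\<And>k. valid_step (\<phi> k)"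
    "(\<lambda>k. \<integral>\<^sup>+ s. ennreal ((f s - step_fun (\<phi> k) s)\<^sup>2) \<partial>lborel) \<longlonglongrightarrow> 0"
    "AE \<omega> in M. (\<lambda>k. step_integral W (step_map (min v) (\<phi> k)) \<omega>) \<longlonglongrightarrow> cexp v Z \<omega>"
    by (rule wiener_integral_cexp_approx[OF v]) blast
  have lim: "(\<lambda>k. \<integral>s. (step_fun (\<phi> k) s * indicator {..v} s)\<^sup>2 \<partial>lborel) \<longlonglongrightarrow> (\<integral>s. (f s * indicator {..v} s)\<^sup>2 \<partial>lborel)"
    by (rule wiener_integral_restrict_tendsto[OF \<phi>(1,2)]) simp
  have "c\<^sup>2 < (c + d)\<^sup>2" using \<nu> d by (intro power_strict_mono) auto
  then have "(\<integral>s. (f s * indicator {..v} s)\<^sup>2 \<partial>lborel) < (c + d)\<^sup>2" using \<nu> by linarith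
  with lim have "\<forall>\<^sub>F k in sequentially. (\<integral>s. (step_fun (\<phi> k) s * indicator {..v} s)\<^sup>2 \<partial>lborel) < (c + d)\<^sup>2"
    by (rule order_tendstoD)
  then obtain N where N: "\<And>k. N \<le> k \<Longrightarrow> (\<integral>s. (step_fun (\<phi> k) s * indicator {..v} s)\<^sup>2 \<partial>lborel) < (c + d)\<^sup>2"
    by (auto simp: eventually_sequentially)
  show "Lp_le (2 * q) (cexp v Z) (?K * c + e)"
  proof (rule Lp_le_Fatou)
    show "AE \<omega> in M. (\<lambda>k. step_integral W (step_map (min v) (\<phi> (k + N))) \<omega>) \<longlonglongrightarrow> cexp v Z \<omega>"
      using \<phi>(3) by eventually_elim (rule LIMSEQ_ignore_initial_segment)
    fix k
    have vp: "valid_step (step_map (min v) (\<phi> (k + N)))"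
      using \<phi>(1) by (intro valid_step_map) (auto simp: mono_def)
    obtain \<sigma> where \<sigma>: "0 \<le> \<sigma>" "(\<integral>\<^sup>+ s. ennreal ((step_fun (step_map (min v) (\<phi> (k + N))) s)\<^sup>2) \<partial>lborel) = ennreal (\<sigma>\<^sup>2)"
      and iP: "\<And>j. integrable M (\<lambda>\<omega>. step_integral W (step_map (min v) (\<phi> (k + N))) \<omega> ^ j)"
      and P: "\<And>q. expectation (\<lambda>\<omega>. step_integral W (step_map (min v) (\<phi> (k + N))) \<omega> ^ (2 * q)) = gauss_moment q * \<sigma> ^ (2 * q)"
      using step_integral_moments[OF vp] by metis
    have "\<sigma>\<^sup>2 = (\<integral>s. (step_fun (\<phi> (k + N)) s * indicator {..v} s)\<^sup>2 \<partial>lborel)"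
      using \<sigma>(2) by (subst integral_eq_nn_integral) (auto simp: step_fun_past)
    also have "\<dots> < (c + d)\<^sup>2" by (rule N) simp
    finally have \<sigma>_le: "\<sigma> \<le> c + d"
      using power2_le_imp_le[of \<sigma> "c + d"] \<nu>(2) d(1) by simp
    have "gauss_moment q * \<sigma> ^ (2 * q) \<le> ?K ^ (2 * q) * (c + d) ^ (2 * q)"
      using K \<sigma>_le \<sigma>(1) gauss_moment_pos[of q] by (intro mult_mono power_mono) auto
    also have "\<dots> = (?K * c + e) ^ (2 * q)"
      using d(2) by (simp add: power_mult_distrib[symmetric] distrib_left)
    finally show "Lp_le (2 * q) (step_integral W (step_map (min v) (\<phi> (k + N)))) (?K * c + e)"
      using iP[of "2 * q"] P[of q] K \<nu> e by (intro Lp_leI_expectation) (auto simp: power_even_abs)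
  qed simp
qed

text \<open>The conditional variance vanishes, so \<open>Z\<close> and its projection on the past
  have the same second moment; the projection then leaves no residue.\<close>

lemma wiener_integral_past:
  assumes v: "0 \<le> v" and f: "\<And>s. v < s \<Longrightarrow> f s = 0"
  shows "AE \<omega> in M. cexp v Z \<omega> = Z \<omega>"
proof -
  interpret A: finite_measure_subalgebra M "past v" by (rule finite_measure_subalgebra_past)
  note [measurable] = wiener_integral_measurable
  note iZ = wiener_integral_square_integrable
  have 0: "(\<lambda>s. (f s * indicator {v<..} s)\<^sup>2) = (\<lambda>_. 0)"
  proof
    show "(f s * indicator {v<..} s)\<^sup>2 = 0" for s
      by (cases "v < s") (simp_all add: f)
  qed
  have sq: "AE \<omega> in M. cexp v (\<lambda>\<omega>. (Z \<omega>)\<^sup>2) \<omega> = (cexp v Z \<omega>)\<^sup>2"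
    using cexp_wiener_integral_square[OF v] by (simp add: 0)
  have ic: "integrable M (\<lambda>\<omega>. (cexp v Z \<omega>)\<^sup>2)"
    using A.real_cond_exp_int(1)[OF iZ(1)] by (rule integrable_cong_AE_imp) (use sq in \<open>auto elim: AE_mp\<close>)
  have E2: "expectation (\<lambda>\<omega>. (cexp v Z \<omega>)\<^sup>2) = expectation (\<lambda>\<omega>. (Z \<omega>)\<^sup>2)"
    using A.real_cond_exp_int(2)[OF iZ(1)] integral_cong_AE[OF _ _ sq] by simp
  have iZc: "integrable M (\<lambda>\<omega>. cexp v Z \<omega> * Z \<omega>)"
  proof (rule Bochner_Integration.integrable_bound)
    show "integrable M (\<lambda>\<omega>. (cexp v Z \<omega>)\<^sup>2 + (Z \<omega>)\<^sup>2)" using ic iZ by simp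
    have "\<bar>cexp v Z \<omega> * Z \<omega>\<bar> \<le> (cexp v Z \<omega>)\<^sup>2 + (Z \<omega>)\<^sup>2" for \<omega>
      using abs_power_mult_le[of 1 2 "cexp v Z \<omega>" "Z \<omega>"] by (simp add: abs_mult)
    then show "AE \<omega> in M. norm (cexp v Z \<omega> * Z \<omega>) \<le> norm ((cexp v Z \<omega>)\<^sup>2 + (Z \<omega>)\<^sup>2)" by simp
  qed simp
  have Ec: "expectation (\<lambda>\<omega>. cexp v Z \<omega> * Z \<omega>) = expectation (\<lambda>\<omega>. (cexp v Z \<omega>)\<^sup>2)"
    using A.real_cond_exp_intg(2)[OF iZc] by (simp add: power2_eq_square)
  have "expectation (\<lambda>\<omega>. (cexp v Z \<omega> - Z \<omega>)\<^sup>2)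
      = expectation (\<lambda>\<omega>. (cexp v Z \<omega>)\<^sup>2 + (Z \<omega>)\<^sup>2 - 2 * (cexp v Z \<omega> * Z \<omega>))"
    by (simp add: power2_diff mult.assoc)
  also have "\<dots> = 0"
    using ic iZ iZc Ec E2 by simp
  finally have "AE \<omega> in M. (cexp v Z \<omega> - Z \<omega>)\<^sup>2 = 0"
  proof (subst (asm) integral_nonneg_eq_0_iff_AE)
    show "integrable M (\<lambda>\<omega>. (cexp v Z \<omega> - Z \<omega>)\<^sup>2)"
      using ic iZ iZc by (simp add: power2_diff mult.assoc)
  qed auto
  then show ?thesis by eventually_elim simp
qed

end

text \<open>Preimages under \<open>Z\<close> and \<open>Z'\<close> differ within a null set, and
  every event contained in it belongs to the past as well.\<close>

lemma borel_measurable_past_AE: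
  assumes "AE \<omega> in M. Z \<omega> = Z' \<omega>" "Z' \<in> borel_measurable (past v)" "Z \<in> borel_measurable M"
  shows "(Z :: 'a \<Rightarrow> real) \<in> borel_measurable (past v)"
proof (rule measurableI)
  fix S :: "real set" assume S: "S \<in> sets borel"
  obtain N where N: "N \<in> null_sets M" "{\<omega>\<in>space M. Z \<omega> \<noteq> Z' \<omega>} \<subseteq> N"
    using assms(1) by (auto elim!: AE_E)
  have ev: "Z -` S \<inter> space M \<in> events" using measurable_sets[OF assms(3) S] .
  have "Z' -` S \<inter> space M \<in> sets (past v)" using measurable_sets[OF assms(2) S] by simp
  moreover have "N \<in> sets (past v)" by (rule null_sets_past[OF N(1)])
  moreover have "Z -` S \<inter> space M \<inter> N \<in> sets (past v)"
    using null_set_Int2[OF N(1) ev] by (intro null_sets_past) (simp add: Int_commute)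
  moreover have "Z -` S \<inter> space M = (Z' -` S \<inter> space M - N) \<union> (Z -` S \<inter> space M \<inter> N)"
    using N(2) by auto
  ultimately show "Z -` S \<inter> space (past v) \<in> sets (past v)"
    by (metis sets.Diff sets.Un space_past)
qed simp

lemma has_wiener_integral_diff:
  assumes "has_wiener_integral M W f Z" "has_wiener_integral M W f' Z'"
  shows "has_wiener_integral M W (\<lambda>s. f s - f' s) (\<lambda>\<omega>. Z \<omega> - Z' \<omega>)"
proof -
  note [measurable] = wiener_integral_measurable[OF assms(1)] wiener_integral_measurable[OF assms(2)]
  obtain \<phi> where \<phi>: "\<And>k. valid_step (\<phi> k)"
    "(\<lambda>k. \<integral>\<^sup>+ s. ennreal ((f s - step_fun (\<phi> k) s)\<^sup>2) \<partial>lborel) \<longlonglongrightarrow> 0"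
    "(\<lambda>k. \<integral>\<^sup>+ \<omega>. ennreal ((Z \<omega> - step_integral W (\<phi> k) \<omega>)\<^sup>2) \<partial>M) \<longlonglongrightarrow> 0"
    by (rule wiener_integral_approx[OF assms(1)]) blast
  obtain \<psi> where \<psi>: "\<And>k. valid_step (\<psi> k)"
    "(\<lambda>k. \<integral>\<^sup>+ s. ennreal ((f' s - step_fun (\<psi> k) s)\<^sup>2) \<partial>lborel) \<longlonglongrightarrow> 0"
    "(\<lambda>k. \<integral>\<^sup>+ \<omega>. ennreal ((Z' \<omega> - step_integral W (\<psi> k) \<omega>)\<^sup>2) \<partial>M) \<longlonglongrightarrow> 0"
    by (rule wiener_integral_approx[OF assms(2)]) blast
  define \<zeta> where "\<zeta> k = \<phi> k @ map (\<lambda>(c, p, q). (- c, p, q)) (\<psi> k)" for k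
  have neg: "step_fun (map (\<lambda>(c, p, q). (- c, p, q)) \<psi>) s = - step_fun \<psi> s"
    "step_integral W (map (\<lambda>(c, p, q). (- c, p, q)) \<psi>) \<omega> = - step_integral W \<psi> \<omega>" for \<psi> s \<omega>
    by (induction \<psi>) (auto simp: step_fun_def step_integral_def algebra_simps)
  have \<zeta>: "step_fun (\<zeta> k) s = step_fun (\<phi> k) s - step_fun (\<psi> k) s"
    "step_integral W (\<zeta> k) \<omega> = step_integral W (\<phi> k) \<omega> - step_integral W (\<psi> k) \<omega>" for k s \<omega>
    using neg(1)[of "\<psi> k" s] neg(2)[of "\<psi> k" \<omega>] by (simp_all add: \<zeta>_def step_fun_def step_integral_def)
  have "\<forall>k. \<forall>(c, u, v)\<in>set (\<zeta> k). u \<le> v"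
    using \<phi>(1) \<psi>(1) by (fastforce simp: \<zeta>_def valid_step_def)
  moreover have "(\<lambda>k. \<integral>\<^sup>+ s. ennreal ((f s - f' s - step_fun (\<zeta> k) s)\<^sup>2) \<partial>lborel) \<longlonglongrightarrow> 0"
    unfolding \<zeta> by (rule L2_lim_diff[OF _ _ _ _ \<phi>(2) \<psi>(2)]) auto
  moreover have "(\<lambda>k. \<integral>\<^sup>+ \<omega>. ennreal ((Z \<omega> - Z' \<omega> - step_integral W (\<zeta> k) \<omega>)\<^sup>2) \<partial>M) \<longlonglongrightarrow> 0"
    unfolding \<zeta> by (rule L2_lim_diff[OF _ _ _ _ \<phi>(3) \<psi>(3)]) auto
  ultimately show ?thesis
    unfolding has_wiener_integral_def by (intro conjI exI[of _ \<zeta>]) auto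
qed

end

section \<open>Increments of fractional Brownian motion\<close>

text \<open>This will be the conditional variance of \<open>B x - B c\<close> given the past of
  \<open>c\<close>, the part driven by \<open>W\<close> after time \<open>c\<close>.\<close>

lemma nn_integral_pos_powr_square:
  assumes H: "0 < H" and c: "c \<le> x"
  shows "(\<integral>\<^sup>+ r. ennreal ((pos_powr (x - r) (H - 1/2))\<^sup>2 * indicator {c<..} r) \<partial>lborel)
    = ennreal ((x - c) powr (2 * H) / (2 * H))"
proof -
  have "(\<integral>\<^sup>+ r. ennreal ((pos_powr (x - r) (H - 1/2))\<^sup>2 * indicator {c<..} r) \<partial>lborel)
      = (\<integral>\<^sup>+ r. ennreal ((pos_powr r (H - 1/2))\<^sup>2 * indicator {..<x - c} r) \<partial>lborel)"
    by (subst nn_integral_real_affine[where c = "-1" and t = x])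
      (auto simp: pos_powr_def indicator_def intro!: nn_integral_cong arg_cong[where f = ennreal])
  also have "\<dots> = (\<integral>\<^sup>+ r. ennreal (indicator {0..x - c} r * r powr (2 * H - 1)) \<partial>lborel)"
  proof (rule nn_integral_cong_AE)
    have "AE r in lborel. r \<noteq> x - c \<and> r \<noteq> 0"
      using AE_lborel_singleton[of "x - c"] AE_lborel_singleton[of 0] by eventually_elim simp
    then show "AE r in lborel. ennreal ((pos_powr r (H - 1/2))\<^sup>2 * indicator {..<x - c} r)
        = ennreal (indicator {0..x - c} r * r powr (2 * H - 1))"
    proof eventually_elim
      case (elim r)
      show ?case
      proof (cases "0 < r \<and> r < x - c")
        case True
        have "(r powr (H - 1/2))\<^sup>2 = r powr (2 * H - 1)"
          by (simp add: power2_eq_square powr_add[symmetric])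
        then show ?thesis using True by (simp add: pos_powr_def)
      qed (use elim in \<open>auto simp: pos_powr_def indicator_def\<close>)
    qed
  qed
  also have "\<dots> = ennreal ((x - c) powr (2 * H - 1 + 1) / (2 * H - 1 + 1))"
    using H c by (intro nn_integral_has_integral_lebesgue has_integral_powr_from_0) auto
  finally show ?thesis by simp
qed

lemma nn_integral_powr_tail:
  assumes H: "H < 1" and c: "c < x"
  shows "(\<integral>\<^sup>+ r. ennreal ((x - r) powr (2 * H - 3) * indicator {..c} r) \<partial>lborel)
    = ennreal ((x - c) powr (2 * H - 2) / (2 - 2 * H))"
proof -
  have "(\<integral>\<^sup>+ r. ennreal ((x - r) powr (2 * H - 3) * indicator {..c} r) \<partial>lborel)
      = (\<integral>\<^sup>+ r. ennreal (indicator {x - c..} r * r powr (2 * H - 3)) \<partial>lborel)"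
    by (subst nn_integral_real_affine[where c = "-1" and t = x])
      (auto simp: indicator_def intro!: nn_integral_cong)
  also have "\<dots> = ennreal (- ((x - c) powr (2 * H - 3 + 1)) / (2 * H - 3 + 1))"
    using H c by (intro nn_integral_has_integral_lebesgue has_integral_powr_to_inf) auto
  also have "- ((x - c) powr (2 * H - 3 + 1)) / (2 * H - 3 + 1) = (x - c) powr (2 * H - 2) / (2 - 2 * H)"
  proof -
    have "- y / - z = y / z" for y z :: real by simp
    from this[of "(x - c) powr (2 * H - 2)" "2 - 2 * H"] show ?thesis by simp
  qed
  finally show ?thesis .
qed

text \<open>Mean value theorem: the derivative is largest at the left end, and
  \<open>\<bar>a\<bar>\<close> is at most one.\<close>

lemma powr_diff_le:
  fixes a x y :: real
  assumes a: "- 1 \<le> a" "a \<le> 0" and xy: "0 < x" "x \<le> y"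
  shows "\<bar>y powr a - x powr a\<bar> \<le> (y - x) * x powr (a - 1)"
proof (cases "x = y")
  case False
  then have "x < y" using xy by simp
  have "\<exists>z>x. z < y \<and> y powr a - x powr a = (y - x) * (a * z powr (a - 1))"
    by (rule MVT2[OF \<open>x < y\<close>]) (use xy in \<open>auto intro!: derivative_eq_intros simp: field_simps powr_diff\<close>)
  then obtain z where z: "x < z" "y powr a - x powr a = (y - x) * (a * z powr (a - 1))" by blast
  have "\<bar>a\<bar> * z powr (a - 1) \<le> 1 * x powr (a - 1)"
    using a z xy by (intro mult_mono powr_mono2') auto
  then show ?thesis
    using z xy by (simp add: abs_mult mult_left_mono)
qed simp

text \<open>Seen from before \<open>v\<close>, the kernel is smooth near \<open>u\<close> and
  \<open>s\<close>: its difference is at most \<open>(s - u) * (u - r) powr (H - 3/2)\<close>.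
  Integrating the square over \<open>r \<le> v\<close> gives the decay in
  \<open>u - v\<close>.\<close>

lemma kernel_far_integral:
  assumes H: "0 < H" "H < 1/2" and vus: "v < u" "u \<le> s"
  shows "(\<integral>\<^sup>+ r. ennreal ((pos_powr (s - r) (H - 1/2) - pos_powr (u - r) (H - 1/2))\<^sup>2 * indicator {..v} r) \<partial>lborel)
    \<le> ennreal (((s - u) * (u - v) powr (H - 1))\<^sup>2)"
proof -
  have "(pos_powr (s - r) (H - 1/2) - pos_powr (u - r) (H - 1/2))\<^sup>2 * indicator {..v} r
      \<le> (s - u)\<^sup>2 * ((u - r) powr (2 * H - 3) * indicator {..v} r)" for r
  proof (cases "r \<le> v")
    case True
    have "\<bar>(s - r) powr (H - 1/2) - (u - r) powr (H - 1/2)\<bar> \<le> ((s - r) - (u - r)) * (u - r) powr (H - 1/2 - 1)"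
      using True H vus by (intro powr_diff_le) auto
    then have "\<bar>(s - r) powr (H - 1/2) - (u - r) powr (H - 1/2)\<bar>\<^sup>2 \<le> (((s - r) - (u - r)) * (u - r) powr (H - 1/2 - 1))\<^sup>2"
      by (intro power_mono) auto
    also have "\<dots> = (s - u)\<^sup>2 * (u - r) powr (2 * H - 3)"
      by (simp add: power_mult_distrib power2_eq_square powr_add[symmetric])
    finally show ?thesis
      using True vus by (simp add: pos_powr_def)
  qed simp
  then have "(\<integral>\<^sup>+ r. ennreal ((pos_powr (s - r) (H - 1/2) - pos_powr (u - r) (H - 1/2))\<^sup>2 * indicator {..v} r) \<partial>lborel)
      \<le> (\<integral>\<^sup>+ r. ennreal ((s - u)\<^sup>2) * ennreal ((u - r) powr (2 * H - 3) * indicator {..v} r) \<partial>lborel)"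
    by (intro nn_integral_mono) (auto simp: ennreal_mult[symmetric] intro: ennreal_leI)
  also have "\<dots> = ennreal ((s - u)\<^sup>2) * ennreal ((u - v) powr (2 * H - 2) / (2 - 2 * H))"
    using H vus by (subst nn_integral_cmult) (auto simp: nn_integral_powr_tail)
  also have "\<dots> = ennreal ((s - u)\<^sup>2 * ((u - v) powr (2 * H - 2) / (2 - 2 * H)))"
    using H by (intro ennreal_mult[symmetric]) auto
  also have "\<dots> \<le> ennreal (((s - u) * (u - v) powr (H - 1))\<^sup>2)"
  proof (intro ennreal_leI)
    have "(u - v) powr (2 * H - 2) / (2 - 2 * H) \<le> (u - v) powr (2 * H - 2)"
      using divide_left_mono[of 1 "2 - 2 * H" "(u - v) powr (2 * H - 2)"] H by simp
    then have "(s - u)\<^sup>2 * ((u - v) powr (2 * H - 2) / (2 - 2 * H)) \<le> (s - u)\<^sup>2 * (u - v) powr (2 * H - 2)"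
      by (intro mult_left_mono) auto
    also have "\<dots> = ((s - u) * (u - v) powr (H - 1))\<^sup>2"
      by (simp add: power_mult_distrib power2_eq_square powr_add[symmetric])
    finally show "(s - u)\<^sup>2 * ((u - v) powr (2 * H - 2) / (2 - 2 * H)) \<le> ((s - u) * (u - v) powr (H - 1))\<^sup>2" .
  qed
  finally show ?thesis .
qed

lemma pos_powr_measurable [measurable]: "(\<lambda>x. pos_powr x a) \<in> borel_measurable borel"
  unfolding pos_powr_def by measurable

text \<open>Cut at distance \<open>h = s - u\<close> before \<open>u\<close>. The far part is the
  previous bound and contributes \<open>1\<close> to the constant. In the near part both kernels are
  nonnegative, so their squares can be estimated separately;
  \<open>(2 * h) powr (2 * H) \<le> 2 * h powr (2 * H)\<close> gives the \<open>3\<close>.\<close>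

lemma kernel_full_integral:
  assumes H: "0 < H" "H < 1/2" and us: "u \<le> s"
  shows "(\<integral>\<^sup>+ r. ennreal ((pos_powr (s - r) (H - 1/2) - pos_powr (u - r) (H - 1/2))\<^sup>2) \<partial>lborel)
    \<le> ennreal ((1 + 3 / (2 * H)) * ((s - u) powr H)\<^sup>2)"
proof (cases "u = s")
  case False
  define h where "h = s - u"
  have h: "0 < h" using us False by (simp add: h_def)
  let ?g = "\<lambda>x r. pos_powr (x - r) (H - 1/2)"
  have sq: "(h powr H)\<^sup>2 = h powr (2 * H)"
    by (simp add: power2_eq_square powr_add[symmetric])
  have "(\<integral>\<^sup>+ r. ennreal ((?g s r - ?g u r)\<^sup>2) \<partial>lborel)
      \<le> (\<integral>\<^sup>+ r. ennreal ((?g s r - ?g u r)\<^sup>2 * indicator {..u - h} r)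
        + (ennreal ((?g s r)\<^sup>2 * indicator {u - h<..} r) + ennreal ((?g u r)\<^sup>2 * indicator {u - h<..} r)) \<partial>lborel)"
  proof (rule nn_integral_mono)
    fix r
    have "(?g s r - ?g u r)\<^sup>2 \<le> (?g s r)\<^sup>2 + (?g u r)\<^sup>2"
      by (simp add: power2_diff pos_powr_def)
    then show "ennreal ((?g s r - ?g u r)\<^sup>2) \<le> ennreal ((?g s r - ?g u r)\<^sup>2 * indicator {..u - h} r)
        + (ennreal ((?g s r)\<^sup>2 * indicator {u - h<..} r) + ennreal ((?g u r)\<^sup>2 * indicator {u - h<..} r))"
      by (cases "r \<le> u - h") (auto simp: ennreal_plus[symmetric] ennreal_leI simp del: ennreal_plus)
  qed
  also have "\<dots> = (\<integral>\<^sup>+ r. ennreal ((?g s r - ?g u r)\<^sup>2 * indicator {..u - h} r) \<partial>lborel)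
      + (ennreal ((s - (u - h)) powr (2 * H) / (2 * H)) + ennreal ((u - (u - h)) powr (2 * H) / (2 * H)))"
    using H h us by (subst nn_integral_add, simp, simp, subst nn_integral_add, simp, simp)
      (simp add: nn_integral_pos_powr_square)
  also have "\<dots> \<le> ennreal (((s - u) * (u - (u - h)) powr (H - 1))\<^sup>2)
      + (ennreal ((s - (u - h)) powr (2 * H) / (2 * H)) + ennreal ((u - (u - h)) powr (2 * H) / (2 * H)))"
    using H h us by (intro add_mono kernel_far_integral) auto
  also have "\<dots> = ennreal ((h * h powr (H - 1))\<^sup>2 + ((2 * h) powr (2 * H) / (2 * H) + h powr (2 * H) / (2 * H)))"
  proof -
    have "s - (u - h) = 2 * h" by (simp add: h_def)
    then show ?thesis using H by (simp add: h_def ennreal_plus[symmetric] del: ennreal_plus)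
  qed
  also have "\<dots> \<le> ennreal ((1 + 3 / (2 * H)) * (h powr H)\<^sup>2)"
  proof (rule ennreal_leI)
    have "h * h powr (H - 1) = h powr H"
      using h by (simp add: powr_diff)
    moreover have "(2 * h) powr (2 * H) \<le> 2 * h powr (2 * H)"
    proof -
      have "2 powr (2 * H) \<le> 2 powr 1" using H by (intro powr_mono) auto
      then show ?thesis using h by (simp add: powr_mult)
    qed
    then have "(2 * h) powr (2 * H) / (2 * H) \<le> 2 * h powr (2 * H) / (2 * H)"
      using H by (intro divide_right_mono) auto
    ultimately have "(h * h powr (H - 1))\<^sup>2 + ((2 * h) powr (2 * H) / (2 * H) + h powr (2 * H) / (2 * H))
        \<le> h powr (2 * H) + (2 * h powr (2 * H) / (2 * H) + h powr (2 * H) / (2 * H))"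
      using sq by simp
    also have "\<dots> = (1 + 3 / (2 * H)) * h powr (2 * H)"
      using H by (simp add: field_simps)
    finally show "(h * h powr (H - 1))\<^sup>2 + ((2 * h) powr (2 * H) / (2 * H) + h powr (2 * H) / (2 * H))
        \<le> (1 + 3 / (2 * H)) * (h powr H)\<^sup>2"
      using sq by simp
  qed
  finally show ?thesis unfolding h_def .
qed simp

locale fbm = wiener +
  fixes B :: "real \<Rightarrow> 'a \<Rightarrow> real" and H :: real
  assumes H: "0 < H" "H < 1/2" and fbm: "fbm_from_wiener M W H B"
begin

abbreviation kernel :: "real \<Rightarrow> real \<Rightarrow> real" where
  "kernel t r \<equiv> pos_powr (t - r) (H - 1/2)"

lemma B_wiener_integral:
  assumes "0 \<le> t"
  shows "has_wiener_integral M W (\<lambda>r. kernel t r - kernel 0 r) (B t)"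
proof -
  have "has_wiener_integral M W (\<lambda>s. indicator {..t} s * fbm_kernel H t s) (B t)"
    using fbm assms unfolding fbm_from_wiener_def by blast
  also have "(\<lambda>s. indicator {..t} s * fbm_kernel H t s) = (\<lambda>r. kernel t r - kernel 0 r)"
    using assms by (auto simp: fbm_kernel_def pos_powr_def indicator_def)
  finally show ?thesis .
qed

lemma B_measurable: "0 \<le> t \<Longrightarrow> B t \<in> borel_measurable M"
  using wiener_integral_measurable(2)[OF B_wiener_integral] .

lemma B_increment_wiener_integral:
  assumes "0 \<le> u" "0 \<le> s"
  shows "has_wiener_integral M W (\<lambda>r. kernel s r - kernel u r) (\<lambda>\<omega>. B s \<omega> - B u \<omega>)"
  using has_wiener_integral_diff[OF B_wiener_integral[OF assms(2)] B_wiener_integral[OF assms(1)]] by simp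

lemma B_increment_integrable:
  assumes "0 \<le> u" "0 \<le> s"
  shows "integrable M (\<lambda>\<omega>. B s \<omega> - B u \<omega>)" and "integrable M (\<lambda>\<omega>. (B s \<omega> - B u \<omega>)\<^sup>2)"
  using wiener_integral_square_integrable[OF B_increment_wiener_integral[OF assms]] by auto

lemma B_increment_past:
  assumes "0 \<le> u" "u \<le> s" "s \<le> v"
  shows "AE \<omega> in M. cexp v (\<lambda>\<omega>. B s \<omega> - B u \<omega>) \<omega> = B s \<omega> - B u \<omega>"
  using assms by (intro wiener_integral_past[OF B_increment_wiener_integral]) (auto simp: pos_powr_def)

text \<open>\<open>B 0\<close> is only given as some version of the integral of zero; the moment
  bound with \<open>c = 0\<close> identifies it.\<close>

lemma B_0: "AE \<omega> in M. B 0 \<omega> = 0"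
proof -
  note hw = B_wiener_integral[of 0, simplified]
  have "Lp_le (2 * 1) (cexp 0 (B 0)) ((1 + gauss_moment 1) * 0)"
    by (rule cexp_wiener_integral_moment[OF hw]) auto
  then have "(\<integral>\<^sup>+ \<omega>. ennreal (\<bar>cexp 0 (B 0) \<omega>\<bar> ^ 2) \<partial>M) = 0"
    by (simp add: Lp_le_def)
  then have "AE \<omega> in M. cexp 0 (B 0) \<omega> = 0"
    by (subst (asm) nn_integral_0_iff_AE) auto
  moreover have "AE \<omega> in M. cexp 0 (B 0) \<omega> = B 0 \<omega>"
    by (rule wiener_integral_past[OF hw]) auto
  ultimately show ?thesis by eventually_elim simp
qed

lemma B_past_measurable:
  assumes "0 \<le> t" "t \<le> v"
  shows "B t \<in> borel_measurable (past v)"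
proof (rule borel_measurable_past_AE)
  show "AE \<omega> in M. B t \<omega> = cexp v (B t) \<omega>"
  proof -
    have "AE \<omega> in M. cexp v (B t) \<omega> = B t \<omega>"
      using assms by (intro wiener_integral_past[OF B_wiener_integral]) (auto simp: pos_powr_def)
    then show ?thesis by eventually_elim simp
  qed
qed (use B_measurable assms in auto)

text \<open>Without any assumption on the position of \<open>v\<close> the conditional increment is
  no larger than the increment itself; for \<open>v = s\<close> this is the bound for the
  increment.\<close>

lemma cexp_increment_O_close:
  "Lp_O {(v, u, s). 0 \<le> v \<and> 0 \<le> u \<and> u \<le> s} (\<lambda>(v, u, s). cexp v (\<lambda>\<omega>. B s \<omega> - B u \<omega>)) (\<lambda>(v, u, s). (s - u) powr H)"
  unfolding Lp_O_def
proof (intro conjI allI impI ballI)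
  fix p :: nat assume p: "1 \<le> p"
  define K where "K = sqrt (1 + 3 / (2 * H))"
  have K: "0 \<le> K" "K\<^sup>2 = 1 + 3 / (2 * H)" using H by (auto simp: K_def)
  have "Lp_le p (cexp v (\<lambda>\<omega>. B s \<omega> - B u \<omega>)) ((1 + gauss_moment p) * (K * (s - u) powr H))"
    if "0 \<le> v" "0 \<le> u" "u \<le> s" for v u s
  proof -
    note hw = B_increment_wiener_integral[of u s]
    note [measurable] = wiener_integral_measurable[OF hw]
    have "(\<integral>r. ((kernel s r - kernel u r) * indicator {..v} r)\<^sup>2 \<partial>lborel) \<le> (\<integral>r. (kernel s r - kernel u r)\<^sup>2 \<partial>lborel)"
    proof (rule integral_mono')
      show "integrable lborel (\<lambda>r. (kernel s r - kernel u r)\<^sup>2)"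
        using that by (intro wiener_integral_square_integrable(3)[OF hw]) auto
    qed (auto simp: indicator_def)
    also have "\<dots> \<le> (1 + 3 / (2 * H)) * ((s - u) powr H)\<^sup>2"
      using kernel_full_integral[OF H that(3)] H that
      by (subst (asm) nn_integral_eq_integral) (auto intro!: wiener_integral_square_integrable(3)[OF hw])
    also have "\<dots> = (K * (s - u) powr H)\<^sup>2" by (simp add: K power_mult_distrib)
    finally have "Lp_le (2 * p) (cexp v (\<lambda>\<omega>. B s \<omega> - B u \<omega>)) ((1 + gauss_moment p) * (K * (s - u) powr H))"
      using that p K by (intro cexp_wiener_integral_moment[OF hw]) auto
    then show ?thesis using p by (auto intro: Lp_le_lower[rotated 2])
  qed
  then show "\<exists>C\<ge>0. \<forall>i\<in>{(v, u, s). 0 \<le> v \<and> 0 \<le> u \<and> u \<le> s}. Lp_le p ((\<lambda>(v, u, s). cexp v (\<lambda>\<omega>. B s \<omega> - B u \<omega>)) i)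
      (C * (\<lambda>(v, u, s). (s - u) powr H) i)"
    using K(1) gauss_moment_pos[of p] by (intro exI[of _ "(1 + gauss_moment p) * K"]) (auto simp: mult.assoc)
qed auto

text \<open>For an increment that starts after \<open>v\<close> the bound decays like
  \<open>(u - v) powr (H - 1)\<close>. An exponent above \<open>-1\<close> is not summable, but its
  partial sums grow only like the power \<open>H\<close>.\<close>

lemma cexp_increment_O_far:
  "Lp_O {(v, u, s). 0 \<le> v \<and> v < u \<and> u \<le> s} (\<lambda>(v, u, s). cexp v (\<lambda>\<omega>. B s \<omega> - B u \<omega>))
    (\<lambda>(v, u, s). (s - u) * (u - v) powr (H - 1))"
  unfolding Lp_O_def
proof (intro conjI allI impI ballI)
  fix p :: nat assume p: "1 \<le> p"
  have "Lp_le p (cexp v (\<lambda>\<omega>. B s \<omega> - B u \<omega>)) ((1 + gauss_moment p) * ((s - u) * (u - v) powr (H - 1)))"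
    if "0 \<le> v" "v < u" "u \<le> s" for v u s
  proof -
    note hw = B_increment_wiener_integral[of u s]
    note [measurable] = wiener_integral_measurable[OF hw]
    have 0: "((kernel s r - kernel u r) * indicator {..v} r)\<^sup>2 = (kernel s r - kernel u r)\<^sup>2 * indicator {..v} r" for r
      by (simp add: indicator_def)
    have "integrable lborel (\<lambda>r. (kernel s r - kernel u r)\<^sup>2)"
      using that by (intro wiener_integral_square_integrable(3)[OF hw]) auto
    then have "integrable lborel (\<lambda>r. ((kernel s r - kernel u r) * indicator {..v} r)\<^sup>2)"
      by (rule Bochner_Integration.integrable_bound) (auto simp: indicator_def)
    then have "(\<integral>r. ((kernel s r - kernel u r) * indicator {..v} r)\<^sup>2 \<partial>lborel) \<le> ((s - u) * (u - v) powr (H - 1))\<^sup>2"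
      using kernel_far_integral[OF H that(2,3)]
      by (subst (asm) nn_integral_eq_integral) (auto simp: 0)
    then have "Lp_le (2 * p) (cexp v (\<lambda>\<omega>. B s \<omega> - B u \<omega>)) ((1 + gauss_moment p) * ((s - u) * (u - v) powr (H - 1)))"
      using that p by (intro cexp_wiener_integral_moment[OF hw]) auto
    then show ?thesis using p by (auto intro: Lp_le_lower[rotated 2])
  qed
  then show "\<exists>C\<ge>0. \<forall>i\<in>{(v, u, s). 0 \<le> v \<and> v < u \<and> u \<le> s}. Lp_le p ((\<lambda>(v, u, s). cexp v (\<lambda>\<omega>. B s \<omega> - B u \<omega>)) i)
      (C * (\<lambda>(v, u, s). (s - u) * (u - v) powr (H - 1)) i)"
    using gauss_moment_pos[of p] by (intro exI[of _ "1 + gauss_moment p"]) auto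
qed auto

lemma B_increment_O:
  "Lp_O {(u, s). 0 \<le> u \<and> u \<le> s} (\<lambda>(u, s) \<omega>. B s \<omega> - B u \<omega>) (\<lambda>(u, s). (s - u) powr H)"
proof (rule Lp_O_dom[where K = 1])
  show "Lp_O {(u, s). 0 \<le> u \<and> u \<le> s} (\<lambda>(u, s). cexp s (\<lambda>\<omega>. B s \<omega> - B u \<omega>)) (\<lambda>(u, s). (s - u) powr H)"
    using Lp_O_reindex[OF cexp_increment_O_close, of "{(u, s). 0 \<le> u \<and> u \<le> s}" "\<lambda>(u, s). (s, u, s)"]
    by (auto simp: case_prod_beta')
  fix i :: "real \<times> real" assume i: "i \<in> {(u, s). 0 \<le> u \<and> u \<le> s}"
  then show "(case i of (u, s) \<Rightarrow> \<lambda>\<omega>. B s \<omega> - B u \<omega>) \<in> borel_measurable M"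
    using B_measurable by (auto split: prod.splits)
  show "AE \<omega> in M. \<bar>(case i of (u, s) \<Rightarrow> \<lambda>\<omega>. B s \<omega> - B u \<omega>) \<omega>\<bar>
      \<le> 1 * \<bar>(case i of (u, s) \<Rightarrow> cexp s (\<lambda>\<omega>. B s \<omega> - B u \<omega>)) \<omega>\<bar>"
    using i B_increment_past[of "fst i" "snd i" "snd i"] by (auto split: prod.splits elim: AE_mp)
qed

text \<open>When the increment starts at the conditioning time, the second kernel vanishes after
  \<open>v\<close> and the variance is explicit. The squares in \<open>\<gamma>\<close> are formed
  from \<open>t j\<close> for this reason.\<close>

lemma cexp_increment_square:
  assumes "0 \<le> v" "v \<le> s"
  shows "AE \<omega> in M. cexp v (\<lambda>\<omega>. (B s \<omega> - B v \<omega>)\<^sup>2) \<omega>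
    = (cexp v (\<lambda>\<omega>. B s \<omega> - B v \<omega>) \<omega>)\<^sup>2 + (s - v) powr (2 * H) / (2 * H)"
proof -
  have "(\<integral>r. ((kernel s r - kernel v r) * indicator {v<..} r)\<^sup>2 \<partial>lborel)
      = (\<integral>r. (kernel s r)\<^sup>2 * indicator {v<..} r \<partial>lborel)"
    by (intro Bochner_Integration.integral_cong) (auto simp: pos_powr_def indicator_def)
  also have "\<dots> = (s - v) powr (2 * H) / (2 * H)"
    using nn_integral_pos_powr_square[OF H(1) assms(2)] H
    by (subst integral_eq_nn_integral) auto
  finally show ?thesis
    using cexp_wiener_integral_square[OF B_increment_wiener_integral, of v s v] assms by simp
qed

end

section \<open>Sums of powers\<close>

text \<open>Concavity: the slope at the right end point is the smallest one. After division by
  \<open>(1 + n) powr g\<close> this is Young's inequality for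
  \<open>y = n / (1 + n)\<close>.\<close>

lemma powr_Suc_diff_ge:
  assumes g: "0 < g" "g \<le> 1"
  shows "g * (1 + real n) powr (g - 1) \<le> (1 + real n) powr g - real n powr g"
proof -
  define y where "y = real n / (1 + real n)"
  have y: "0 \<le> y" "real n = y * (1 + real n)" by (simp_all add: y_def)
  have "y powr g \<le> 1 + g * (y - 1)"
  proof (cases "y = 0")
    case False
    then have "y powr g * 1 powr (1 - g) \<le> g * y + (1 - g) * 1"
      using g y by (intro Youngs_inequality_0) auto
    then show ?thesis by (simp add: algebra_simps)
  qed (use g in simp)
  then have "(1 + real n) powr g * y powr g \<le> (1 + real n) powr g * (1 + g * (y - 1))"
    by (intro mult_left_mono) auto
  moreover have "(1 + real n) powr g * y powr g = real n powr g"
  proof -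
    have "(1 + real n) powr g * y powr g = (y * (1 + real n)) powr g"
      using y(1) by (simp add: powr_mult mult.commute)
    also have "y * (1 + real n) = real n" by (rule y(2)[symmetric])
    finally show ?thesis .
  qed
  moreover have "(1 + real n) powr g * (1 + g * (y - 1)) = (1 + real n) powr g - g * (1 + real n) powr (g - 1)"
  proof -
    have "y - 1 = - 1 / (1 + real n)" by (simp add: y_def field_simps)
    moreover have "(1 + real n) powr (g - 1) = (1 + real n) powr g / (1 + real n)"
      by (simp add: powr_diff)
    ultimately show ?thesis by (simp only:) (simp add: right_diff_distrib distrib_left)
  qed
  ultimately show ?thesis by linarith
qed

lemma sum_powr_le:
  assumes g: "0 < g" "g \<le> 1"
  shows "(\<Sum>l<n. (1 + real l) powr (g - 1)) \<le> real n powr g / g"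
proof (induction n)
  case (Suc n)
  have "(1 + real n) powr (g - 1) \<le> ((1 + real n) powr g - real n powr g) / g"
    using powr_Suc_diff_ge[OF g, of n] g by (simp add: field_simps)
  then have "(\<Sum>l<Suc n. (1 + real l) powr (g - 1)) \<le> real n powr g / g + ((1 + real n) powr g - real n powr g) / g"
    using Suc by simp
  also have "\<dots> = real (Suc n) powr g / g"
    using g by (simp add: add_divide_distrib[symmetric])
  finally show ?case .
qed simp

text \<open>After division by \<open>(1 + n) powr g\<close> this reads
  \<open>y \<le> y powr g\<close> for \<open>y = n / (1 + n)\<close> in the unit interval.\<close>

lemma powr_Suc_diff_le:
  assumes g: "0 < g" "g \<le> 1"
  shows "(1 + real n) powr g - real n powr g \<le> (1 + real n) powr (g - 1)"
proof -
  define y where "y = real n / (1 + real n)"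
  have y: "0 \<le> y" "y \<le> 1" "real n = y * (1 + real n)" by (simp_all add: y_def)
  have "y powr 1 \<le> y powr g"
  proof (cases "y = 0")
    case False
    then show ?thesis using g y powr_mono'[of g 1 y] by simp
  qed simp
  then have "(1 + real n) powr g * y \<le> (1 + real n) powr g * y powr g"
    using y by (intro mult_left_mono) auto
  moreover have "(1 + real n) powr g * y powr g = real n powr g"
  proof -
    have "(1 + real n) powr g * y powr g = (y * (1 + real n)) powr g"
      using y(1) by (simp add: powr_mult mult.commute)
    also have "y * (1 + real n) = real n" by (rule y(3)[symmetric])
    finally show ?thesis .
  qed
  moreover have "(1 + real n) powr g * y = (1 + real n) powr g - (1 + real n) powr (g - 1)"
  proof -
    have "y = 1 - 1 / (1 + real n)" by (simp add: y_def field_simps)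
    moreover have "(1 + real n) powr (g - 1) = (1 + real n) powr g / (1 + real n)"
      by (simp add: powr_diff)
    ultimately show ?thesis by (simp only:) (simp add: right_diff_distrib distrib_left)
  qed
  ultimately show ?thesis by linarith
qed

text \<open>Lowers an exponent at the price of a constant that depends on the horizon only.\<close>

lemma powr_le_powr_bounded:
  assumes "0 < y" "y \<le> T" "b \<le> (c :: real)"
  shows "y powr c \<le> T powr (c - b) * y powr b"
proof -
  have "y powr c = y powr (c - b) * y powr b" by (simp add: powr_add[symmetric])
  also have "\<dots> \<le> T powr (c - b) * y powr b"
    using assms by (intro mult_right_mono powr_mono2) auto
  finally show ?thesis .
qed

text \<open>For a negative exponent the smallest scale dominates, and the number of scales does not
  enter.\<close>

lemma sum_dyadic_le:
  fixes g D :: real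
  assumes g: "g < 0" and D: "0 \<le> D"
  shows "(\<Sum>m<n. (2 ^ m * D) powr g) \<le> 1 / (1 - 2 powr g) * D powr g"
proof -
  have r: "2 powr g < 1" "0 < 2 powr g" using g powr_less_mono[of g 0 2] by auto
  have "(\<Sum>m<n. (2 ^ m * D) powr g) = (\<Sum>m<n. (2 powr g) ^ m) * D powr g"
    unfolding sum_distrib_right
    by (intro sum.cong refl) (simp add: powr_mult powr_realpow[symmetric] powr_powr mult.commute)
  also have "\<dots> \<le> 1 / (1 - 2 powr g) * D powr g"
  proof (rule mult_right_mono)
    have "(\<Sum>m<n. (2 powr g) ^ m) = (1 - (2 powr g) ^ n) / (1 - 2 powr g)"
      using r g by (simp add: sum_gp_strict)
    also have "\<dots> \<le> 1 / (1 - 2 powr g)"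
      using r by (intro divide_right_mono) auto
    finally show "(\<Sum>m<n. (2 powr g) ^ m) \<le> 1 / (1 - 2 powr g)" .
  qed simp
  finally show ?thesis .
qed

context prob_space
begin

lemma Lp_O_Un:
  assumes "Lp_O I Z s" "Lp_O J Z s"
  shows "Lp_O (I \<union> J) Z s"
  unfolding Lp_O_def
proof (intro conjI allI impI)
  fix p :: nat assume p: "1 \<le> p"
  obtain C where C: "0 \<le> C" "\<And>i. i \<in> I \<Longrightarrow> Lp_le p (Z i) (C * s i)"
    using assms(1) p by (auto elim: Lp_O_E)
  obtain C' where C': "0 \<le> C'" "\<And>i. i \<in> J \<Longrightarrow> Lp_le p (Z i) (C' * s i)"
    using assms(2) p by (auto elim: Lp_O_E)
  have "Lp_le p (Z i) (max C C' * s i)" if "i \<in> I \<union> J" for i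
  proof -
    have s: "0 \<le> s i" using that assms by (auto simp: Lp_O_def)
    from that show ?thesis
    proof
      assume "i \<in> I"
      from C(2)[OF this] show ?thesis
        by (rule Lp_le_mono_bound) (use s in \<open>auto intro: mult_right_mono\<close>)
    next
      assume "i \<in> J"
      from C'(2)[OF this] show ?thesis
        by (rule Lp_le_mono_bound) (use s in \<open>auto intro: mult_right_mono\<close>)
    qed
  qed
  then show "\<exists>C\<ge>0. \<forall>i\<in>I \<union> J. Lp_le p (Z i) (C * s i)"
    using C(1) by (intro exI[of _ "max C C'"]) auto
qed (use assms in \<open>auto simp: Lp_O_def\<close>)

section \<open>Variables with moments of all orders\<close>

text \<open>A class closed under products, so that every expectation in the orthogonality relations
  is known to exist.\<close>

definition moments :: "('a \<Rightarrow> real) \<Rightarrow> bool" where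
  "moments Z \<longleftrightarrow> Lp_O {()} (\<lambda>_. Z) (\<lambda>_. 1)"

lemma Lp_O_moments:
  assumes "Lp_O I Z s" "i \<in> I"
  shows "moments (Z i)"
proof -
  have "Lp_O {()} (\<lambda>_. Z i) (\<lambda>_. s i)"
    by (rule Lp_O_reindex[OF assms(1)]) (use assms in auto)
  then show ?thesis
    unfolding moments_def by (rule Lp_O_scale[where K = "s i"]) auto
qed

lemma moments_measurable: "moments Z \<Longrightarrow> Z \<in> borel_measurable M"
  unfolding moments_def by (drule Lp_O_measurable) auto

lemma moments_integrable:
  assumes "moments Z"
  shows "integrable M Z"
proof -
  obtain C where "Lp_le 1 Z (C * 1)"
    using assms unfolding moments_def by (auto elim: Lp_O_E[where p = 1])
  then show ?thesis
    using Lp_le_integrable[of 1 Z "C * 1"] integrable_abs_iff[of Z M] by (auto simp: Lp_le_def)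
qed

lemma moments_mult: "moments Z \<Longrightarrow> moments Z' \<Longrightarrow> moments (\<lambda>\<omega>. Z \<omega> * Z' \<omega>)"
  unfolding moments_def using Lp_O_mult[of "{()}" "\<lambda>_. Z" "\<lambda>_. 1" "\<lambda>_. Z'" "\<lambda>_. 1"] by simp

lemma moments_add:
  assumes "moments Z" "moments Z'"
  shows "moments (\<lambda>\<omega>. Z \<omega> + Z' \<omega>)"
  unfolding moments_def
  by (rule Lp_O_scale[OF Lp_O_add[OF assms[unfolded moments_def]], where K = 2]) auto

lemma moments_diff:
  assumes "moments Z" "moments Z'"
  shows "moments (\<lambda>\<omega>. Z \<omega> - Z' \<omega>)"
  unfolding moments_def
  by (rule Lp_O_scale[OF Lp_O_diff[OF assms[unfolded moments_def]], where K = 2]) auto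

lemma moments_bounded:
  assumes "Z \<in> borel_measurable M" "\<And>\<omega>. \<bar>Z \<omega>\<bar> \<le> K"
  shows "moments Z"
proof -
  have "moments (\<lambda>_. 1)"
    unfolding moments_def by (rule Lp_O_const[where K = 1]) auto
  from Lp_O_bounded_mult[OF this[unfolded moments_def], of "\<lambda>_. Z" K] assms
  show ?thesis unfolding moments_def by simp
qed

lemma moments_const: "moments (\<lambda>_. c)"
  by (rule moments_bounded) auto

lemma moments_power: "moments Z \<Longrightarrow> moments (\<lambda>\<omega>. Z \<omega> ^ n)"
  by (induction n) (auto intro: moments_const moments_mult)

lemma moments_sum:
  "finite A \<Longrightarrow> (\<And>k. k \<in> A \<Longrightarrow> moments (Z k)) \<Longrightarrow> moments (\<lambda>\<omega>. \<Sum>k\<in>A. Z k \<omega>)"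
  by (induction A rule: finite_induct) (auto intro: moments_const moments_add)

end

context wiener
begin

lemma cexp_orthogonal:
  assumes "\<Psi> \<in> borel_measurable (past v)" "moments \<Psi>" "moments f"
  shows "expectation (\<lambda>\<omega>. \<Psi> \<omega> * cexp v f \<omega>) = expectation (\<lambda>\<omega>. \<Psi> \<omega> * f \<omega>)"
proof -
  interpret P: finite_measure_subalgebra M "past v" by (rule finite_measure_subalgebra_past)
  show ?thesis
    by (rule P.real_cond_exp_intg(2)[OF moments_integrable[OF moments_mult[OF assms(2,3)]] assms(1)
          moments_measurable[OF assms(3)]])
qed

lemma cexp_past_measurable [measurable]: "cexp v f \<in> borel_measurable (past v)"
  by (rule borel_measurable_cond_exp)

lemma cexp_measurable: "cexp v f \<in> borel_measurable M"
  using measurable_from_subalg[OF subalgebra_past cexp_past_measurable] .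

lemma past_measurable_mono:
  "v \<le> w \<Longrightarrow> Z \<in> borel_measurable (past v) \<Longrightarrow> Z \<in> borel_measurable (past w)"
  using past_mono[of v w] unfolding measurable_def by auto

lemma past_measurable_imp: "Z \<in> borel_measurable (past v) \<Longrightarrow> Z \<in> borel_measurable M"
  using measurable_from_subalg[OF subalgebra_past] .

end

section \<open>Sums of increments\<close>

text \<open>The index gathers everything over which constants must be uniform. \<open>Y\<close>
  stands for the scheme, which differs from \<open>B\<close> by a drift that is Lipschitz in time in
  all orders, and \<open>f\<close> for \<open>b\<close>. There are \<open>2 ^ L\<close> meshes of
  width \<open>D\<close> starting at \<open>a\<close>, and \<open>x\<close> is the position in the
  mesh. The weights \<open>c\<close> make it possible to sum over fewer meshes and to cut the last
  one.\<close>

locale fbm_process = fbm M W B H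
  for M :: "'a measure" and W B H +
  fixes I :: "'i set" and Y :: "'i \<Rightarrow> real \<Rightarrow> 'a \<Rightarrow> real"
    and D a x :: "'i \<Rightarrow> real" and L :: "'i \<Rightarrow> nat" and c :: "'i \<Rightarrow> nat \<Rightarrow> real"
    and T K :: real and f f1 f2 :: "real \<Rightarrow> real"
  assumes D: "\<And>i. i \<in> I \<Longrightarrow> 0 < D i"
    and a: "\<And>i. i \<in> I \<Longrightarrow> 0 \<le> a i"
    and x: "\<And>i. i \<in> I \<Longrightarrow> 0 \<le> x i \<and> x i \<le> D i"
    and T: "\<And>i. i \<in> I \<Longrightarrow> a i + 2 ^ L i * D i \<le> T"
    and c: "\<And>i k. i \<in> I \<Longrightarrow> \<bar>c i k\<bar> \<le> 1"
    and Y_past: "\<And>i t. i \<in> I \<Longrightarrow> 0 \<le> t \<Longrightarrow> t \<le> T \<Longrightarrow> Y i t \<in> borel_measurable (past t)"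
    and drift: "Lp_O {(i, s, t). i \<in> I \<and> 0 \<le> s \<and> s \<le> t \<and> t \<le> T}
       (\<lambda>(i, s, t) \<omega>. Y i t \<omega> - Y i s \<omega> - (B t \<omega> - B s \<omega>)) (\<lambda>(i, s, t). t - s)"
    and f_measurable [measurable]: "f \<in> borel_measurable borel" "f1 \<in> borel_measurable borel" "f2 \<in> borel_measurable borel"
    and f_bounded: "\<And>y. \<bar>f1 y\<bar> \<le> K" "\<And>y. \<bar>f2 y\<bar> \<le> K"
    and f_taylor: "\<And>y z. \<bar>f z - f y - f1 y * (z - y) - f2 y / 2 * (z - y)\<^sup>2\<bar> \<le> K * \<bar>z - y\<bar> ^ 3"
    and f1_taylor: "\<And>y z. \<bar>f1 z - f1 y - f2 y * (z - y)\<bar> \<le> K * (z - y)\<^sup>2"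
    and f2_lipschitz: "\<And>y z. \<bar>f2 z - f2 y\<bar> \<le> K * \<bar>z - y\<bar>"
begin

definition rate :: real where "rate = min (3 * H) (H + 1/2)"

definition t :: "'i \<Rightarrow> nat \<Rightarrow> real" where "t i k = a i + real k * D i"

definition \<beta> :: "'i \<Rightarrow> nat \<Rightarrow> 'a \<Rightarrow> real" where
  "\<beta> i k \<omega> = B (t i k + x i) \<omega> - B (t i k) \<omega>"

text \<open>The increment over \<open>[t k, t k + x]\<close> of the square of
  \<open>B - B (t j)\<close>: the second order term of an expansion at time
  \<open>t j\<close>.\<close>

definition \<gamma> :: "'i \<Rightarrow> nat \<Rightarrow> nat \<Rightarrow> 'a \<Rightarrow> real" where
  "\<gamma> i j k \<omega> = (B (t i k + x i) \<omega> - B (t i j) \<omega>)\<^sup>2 - (B (t i k) \<omega> - B (t i j) \<omega>)\<^sup>2"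

definition e :: "'i \<Rightarrow> nat \<Rightarrow> nat \<Rightarrow> 'a \<Rightarrow> real" where "e i j k = cexp (t i j) (\<beta> i k)"

definition q :: "'i \<Rightarrow> nat \<Rightarrow> nat \<Rightarrow> 'a \<Rightarrow> real" where "q i j k = cexp (t i j) (\<gamma> i j k)"

text \<open>\<open>A i j k\<close> is the conditional expectation given the past of \<open>t j\<close> of the second order Taylor
  polynomial at \<open>Y (t j)\<close> of the increment of \<open>f (Y)\<close> over \<open>[t k, t k + x]\<close>; \<open>G i j0 j1 k\<close> is the
  corresponding quantity when the polynomial is taken at the earlier point \<open>Y (t j0)\<close>.\<close>

definition A :: "'i \<Rightarrow> nat \<Rightarrow> nat \<Rightarrow> 'a \<Rightarrow> real" where
  "A i j k \<omega> = f1 (Y i (t i j) \<omega>) * e i j k \<omega> + f2 (Y i (t i j) \<omega>) / 2 * q i j k \<omega>"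

definition G :: "'i \<Rightarrow> nat \<Rightarrow> nat \<Rightarrow> nat \<Rightarrow> 'a \<Rightarrow> real" where
  "G i j0 j1 k \<omega> = f1 (Y i (t i j0) \<omega>) * e i j1 k \<omega>
     + f2 (Y i (t i j0) \<omega>) / 2 * (q i j1 k \<omega> + 2 * (B (t i j1) \<omega> - B (t i j0) \<omega>) * e i j1 k \<omega>)"

definition P :: "('i \<times> nat \<times> nat) set" where "P = {(i, j, k). i \<in> I \<and> j \<le> k \<and> k < 2 ^ L i}"

text \<open>The size of the conditional increment when \<open>l\<close> meshes lie between the
  conditioning time and the increment. Writing \<open>1 + l\<close> includes the case
  \<open>l = 0\<close>, the full size \<open>D powr H\<close>.\<close>

definition w :: "'i \<Rightarrow> nat \<Rightarrow> real" where "w i l = D i powr H * (1 + real l) powr (H - 1)"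

lemma K: "0 \<le> K" using f_bounded(1)[of 0] by linarith

lemma rate: "0 < rate" "rate < 1" "rate \<le> 3 * H" "rate \<le> H + 1/2"
  using H by (auto simp: rate_def)

lemma t_mono: "i \<in> I \<Longrightarrow> j \<le> k \<Longrightarrow> t i j \<le> t i k"
  using D[of i] by (simp add: t_def)

lemma t_nonneg: "i \<in> I \<Longrightarrow> 0 \<le> t i k"
  using D[of i] a[of i] by (simp add: t_def)

lemma t_diff: "j \<le> k \<Longrightarrow> t i k - t i j = real (k - j) * D i"
  by (simp add: t_def of_nat_diff algebra_simps)

lemma t_le_T:
  assumes "i \<in> I" "k \<le> 2 ^ L i"
  shows "t i k \<le> T"
proof -
  have "real k \<le> 2 ^ L i"
    using assms(2) by (metis of_nat_le_iff of_nat_numeral of_nat_power)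
  then have "real k * D i \<le> 2 ^ L i * D i"
    using D[OF assms(1)] by (intro mult_right_mono) auto
  then show ?thesis using T[OF assms(1)] by (simp add: t_def)
qed

lemma t_x_le:
  assumes "i \<in> I" "j < k"
  shows "t i j + x i \<le> t i k"
proof -
  have "t i (Suc j) \<le> t i k" using assms by (intro t_mono) auto
  then show ?thesis using x[OF assms(1)] by (simp add: t_def algebra_simps)
qed

lemma t_x_le_T: "i \<in> I \<Longrightarrow> k < 2 ^ L i \<Longrightarrow> t i k + x i \<le> T"
  using t_x_le[of i k "Suc k"] t_le_T[of i "Suc k"] by simp

lemma D_le_T: "i \<in> I \<Longrightarrow> 2 ^ L i * D i \<le> T" and D_le_T': "i \<in> I \<Longrightarrow> D i \<le> T"
proof -
  assume i: "i \<in> I"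
  show *: "2 ^ L i * D i \<le> T" using T[OF i] a[OF i] by simp
  have "1 * D i \<le> 2 ^ L i * D i" using D[OF i] by (intro mult_right_mono) auto
  with * show "D i \<le> T" by simp
qed

lemma B_meas: "i \<in> I \<Longrightarrow> B (t i k) \<in> borel_measurable M" "i \<in> I \<Longrightarrow> B (t i k + x i) \<in> borel_measurable M"
  using t_nonneg[of i k] x[of i] by (auto intro!: B_measurable)

lemma w_nonneg: "0 \<le> w i l" by (simp add: w_def)

section \<open>Sizes of the conditional moments\<close>

text \<open>For \<open>j = k\<close> there is no distance and the bound without decay applies; for
  \<open>j < k\<close> the decaying one.\<close>

lemma e_O: "Lp_O P (\<lambda>(i, j, k). e i j k) (\<lambda>(i, j, k). w i (k - j))"
proof -
  have PUn: "P = {(i, j, k). i \<in> I \<and> j = k \<and> k < 2 ^ L i} \<union> {(i, j, k). i \<in> I \<and> j < k \<and> k < 2 ^ L i}" (is "_ = ?P1 \<union> ?P2")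
    by (auto simp: P_def)
  have "Lp_O ?P1 (\<lambda>y. (\<lambda>(v, u, s). cexp v (\<lambda>\<omega>. B s \<omega> - B u \<omega>)) ((\<lambda>(i, j, k). (t i j, t i k, t i k + x i)) y))
      (\<lambda>y. (\<lambda>(v, u, s). (s - u) powr H) ((\<lambda>(i, j, k). (t i j, t i k, t i k + x i)) y))"
    by (rule Lp_O_reindex[OF cexp_increment_O_close]) (use t_nonneg x in auto)
  then have 1: "Lp_O ?P1 (\<lambda>(i, j, k). e i j k) (\<lambda>(i, j, k). x i powr H)"
    by (rule Lp_O_cong) (auto simp: e_def \<beta>_def[abs_def])
  have 1: "Lp_O ?P1 (\<lambda>(i, j, k). e i j k) (\<lambda>(i, j, k). w i (k - j))"
    by (rule Lp_O_scale[OF 1, where K = 1]) (use x H in \<open>auto simp: w_def intro!: powr_mono2\<close>)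
  have "Lp_O ?P2 (\<lambda>y. (\<lambda>(v, u, s). cexp v (\<lambda>\<omega>. B s \<omega> - B u \<omega>)) ((\<lambda>(i, j, k). (t i j, t i k, t i k + x i)) y))
      (\<lambda>y. (\<lambda>(v, u, s). (s - u) * (u - v) powr (H - 1)) ((\<lambda>(i, j, k). (t i j, t i k, t i k + x i)) y))"
    by (rule Lp_O_reindex[OF cexp_increment_O_far]) (use t_nonneg x D in \<open>auto simp: t_def\<close>)
  then have 2: "Lp_O ?P2 (\<lambda>(i, j, k). e i j k) (\<lambda>(i, j, k). x i * (t i k - t i j) powr (H - 1))"
    by (rule Lp_O_cong) (auto simp: e_def \<beta>_def[abs_def])
  have "x i * (t i k - t i j) powr (H - 1) \<le> 2 * w i (k - j)" if i: "i \<in> I" and jk: "j < k" for i j k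
  proof -
    \<comment> \<open>Since \<open>k - j\<close> is at least one, it is at least half of
      \<open>1 + (k - j)\<close>.\<close>
    have "real (k - j) powr (H - 1) \<le> ((1 + real (k - j)) / 2) powr (H - 1)"
      using jk H by (intro powr_mono2') auto
    also have "\<dots> = (1 + real (k - j)) powr (H - 1) * 2 powr (1 - H)"
      by (simp add: powr_divide powr_minus_divide[of 2 "1 - H", simplified] field_simps)
    also have "\<dots> \<le> (1 + real (k - j)) powr (H - 1) * 2 powr 1"
      using H by (intro mult_left_mono powr_mono) auto
    finally have l: "real (k - j) powr (H - 1) \<le> 2 * (1 + real (k - j)) powr (H - 1)" by simp
    have "x i * (t i k - t i j) powr (H - 1) \<le> D i * (real (k - j) * D i) powr (H - 1)"
      using x[OF i] jk by (intro mult_mono) (auto simp: t_diff)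
    also have "\<dots> = D i powr H * real (k - j) powr (H - 1)"
      using D[OF i] by (simp add: powr_mult powr_diff)
    also have "\<dots> \<le> D i powr H * (2 * (1 + real (k - j)) powr (H - 1))"
      by (intro mult_left_mono l) simp
    finally show ?thesis by (simp add: w_def)
  qed
  then have 2: "Lp_O ?P2 (\<lambda>(i, j, k). e i j k) (\<lambda>(i, j, k). w i (k - j))"
    by (intro Lp_O_scale[OF 2, where K = 2]) (auto simp: w_nonneg)
  show ?thesis unfolding PUn by (rule Lp_O_Un[OF 1 2])
qed

lemma \<beta>_O: "Lp_O P (\<lambda>(i, j, k). \<beta> i k) (\<lambda>(i, j, k). D i powr H)"
proof -
  have "Lp_O P (\<lambda>y. (\<lambda>(u, s) \<omega>. B s \<omega> - B u \<omega>) ((\<lambda>(i, j, k). (t i k, t i k + x i)) y))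
      (\<lambda>y. (\<lambda>(u, s). (s - u) powr H) ((\<lambda>(i, j, k). (t i k, t i k + x i)) y))"
    by (rule Lp_O_reindex[OF B_increment_O]) (use t_nonneg x in \<open>auto simp: P_def\<close>)
  then have 1: "Lp_O P (\<lambda>(i, j, k). \<beta> i k) (\<lambda>(i, j, k). x i powr H)"
    by (rule Lp_O_cong) (auto simp: \<beta>_def[abs_def])
  show ?thesis
    by (rule Lp_O_scale[OF 1, where K = 1]) (use x H in \<open>auto simp: P_def intro!: powr_mono2\<close>)
qed

lemma B_diff_O: "Lp_O P (\<lambda>(i, j, k) \<omega>. B (t i k) \<omega> - B (t i j) \<omega>) (\<lambda>(i, j, k). ((1 + real (k - j)) * D i) powr H)"
  and B_diff_x_O: "Lp_O P (\<lambda>(i, j, k) \<omega>. B (t i k + x i) \<omega> - B (t i j) \<omega>) (\<lambda>(i, j, k). ((1 + real (k - j)) * D i) powr H)"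
proof -
  have "Lp_O P (\<lambda>y. (\<lambda>(u, s) \<omega>. B s \<omega> - B u \<omega>) ((\<lambda>(i, j, k). (t i j, t i k)) y))
      (\<lambda>y. (\<lambda>(u, s). (s - u) powr H) ((\<lambda>(i, j, k). (t i j, t i k)) y))"
    by (rule Lp_O_reindex[OF B_increment_O]) (use t_nonneg t_mono in \<open>auto simp: P_def\<close>)
  then have 1: "Lp_O P (\<lambda>(i, j, k) \<omega>. B (t i k) \<omega> - B (t i j) \<omega>) (\<lambda>(i, j, k). (t i k - t i j) powr H)"
    by (rule Lp_O_cong) auto
  show "Lp_O P (\<lambda>(i, j, k) \<omega>. B (t i k) \<omega> - B (t i j) \<omega>) (\<lambda>(i, j, k). ((1 + real (k - j)) * D i) powr H)"
    by (rule Lp_O_scale[OF 1, where K = 1])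
      (use D H in \<open>auto simp: P_def t_diff distrib_right less_imp_le intro!: powr_mono2\<close>)
  have "Lp_O P (\<lambda>y. (\<lambda>(u, s) \<omega>. B s \<omega> - B u \<omega>) ((\<lambda>(i, j, k). (t i j, t i k + x i)) y))
      (\<lambda>y. (\<lambda>(u, s). (s - u) powr H) ((\<lambda>(i, j, k). (t i j, t i k + x i)) y))"
    by (rule Lp_O_reindex[OF B_increment_O]) (use t_nonneg t_mono x in \<open>auto simp: P_def intro: add_increasing2\<close>)
  then have 2: "Lp_O P (\<lambda>(i, j, k) \<omega>. B (t i k + x i) \<omega> - B (t i j) \<omega>) (\<lambda>(i, j, k). (t i k + x i - t i j) powr H)"
    by (rule Lp_O_cong) auto
  have "(t i k + x i - t i j) powr H \<le> 1 * ((1 + real (k - j)) * D i) powr H" if "i \<in> I" "j \<le> k" for i j k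
    using x[OF that(1)] D[OF that(1)] t_diff[OF that(2), of i] t_mono[OF that] H
    by (auto simp: distrib_right intro!: powr_mono2)
  then show "Lp_O P (\<lambda>(i, j, k) \<omega>. B (t i k + x i) \<omega> - B (t i j) \<omega>) (\<lambda>(i, j, k). ((1 + real (k - j)) * D i) powr H)"
    by (intro Lp_O_scale[OF 2, where K = 1]) (auto simp: P_def)
qed

lemma cexp_B_diff_O: "Lp_O P (\<lambda>(i, j, k). cexp (t i j) (\<lambda>\<omega>. B (t i k) \<omega> - B (t i j) \<omega>)) (\<lambda>(i, j, k). ((1 + real (k - j)) * D i) powr H)"
  and cexp_B_diff_x_O: "Lp_O P (\<lambda>(i, j, k). cexp (t i j) (\<lambda>\<omega>. B (t i k + x i) \<omega> - B (t i j) \<omega>)) (\<lambda>(i, j, k). ((1 + real (k - j)) * D i) powr H)"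
proof -
  have "Lp_O P (\<lambda>y. (\<lambda>(v, u, s). cexp v (\<lambda>\<omega>. B s \<omega> - B u \<omega>)) ((\<lambda>(i, j, k). (t i j, t i j, t i k)) y))
      (\<lambda>y. (\<lambda>(v, u, s). (s - u) powr H) ((\<lambda>(i, j, k). (t i j, t i j, t i k)) y))"
    by (rule Lp_O_reindex[OF cexp_increment_O_close]) (use t_nonneg t_mono in \<open>auto simp: P_def\<close>)
  then have 1: "Lp_O P (\<lambda>(i, j, k). cexp (t i j) (\<lambda>\<omega>. B (t i k) \<omega> - B (t i j) \<omega>)) (\<lambda>(i, j, k). (t i k - t i j) powr H)"
    by (rule Lp_O_cong) auto
  show "Lp_O P (\<lambda>(i, j, k). cexp (t i j) (\<lambda>\<omega>. B (t i k) \<omega> - B (t i j) \<omega>)) (\<lambda>(i, j, k). ((1 + real (k - j)) * D i) powr H)"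
    by (rule Lp_O_scale[OF 1, where K = 1])
      (use D H in \<open>auto simp: P_def t_diff distrib_right less_imp_le intro!: powr_mono2\<close>)
  have "Lp_O P (\<lambda>y. (\<lambda>(v, u, s). cexp v (\<lambda>\<omega>. B s \<omega> - B u \<omega>)) ((\<lambda>(i, j, k). (t i j, t i j, t i k + x i)) y))
      (\<lambda>y. (\<lambda>(v, u, s). (s - u) powr H) ((\<lambda>(i, j, k). (t i j, t i j, t i k + x i)) y))"
    by (rule Lp_O_reindex[OF cexp_increment_O_close]) (use t_nonneg t_mono x in \<open>auto simp: P_def intro: add_increasing2\<close>)
  then have 2: "Lp_O P (\<lambda>(i, j, k). cexp (t i j) (\<lambda>\<omega>. B (t i k + x i) \<omega> - B (t i j) \<omega>)) (\<lambda>(i, j, k). (t i k + x i - t i j) powr H)"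
    by (rule Lp_O_cong) auto
  have "(t i k + x i - t i j) powr H \<le> 1 * ((1 + real (k - j)) * D i) powr H" if "i \<in> I" "j \<le> k" for i j k
    using x[OF that(1)] D[OF that(1)] t_diff[OF that(2), of i] t_mono[OF that] H
    by (auto simp: distrib_right intro!: powr_mono2)
  then show "Lp_O P (\<lambda>(i, j, k). cexp (t i j) (\<lambda>\<omega>. B (t i k + x i) \<omega> - B (t i j) \<omega>)) (\<lambda>(i, j, k). ((1 + real (k - j)) * D i) powr H)"
    by (intro Lp_O_scale[OF 2, where K = 1]) (auto simp: P_def)
qed

text \<open>Each conditional second moment is the square of a conditional mean plus a number. The
  difference of the squares factorizes, and one factor is the small quantity
  \<open>e\<close>.\<close>

lemma q_eq:
  assumes "(i, j, k) \<in> P"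
  shows "AE \<omega> in M. q i j k \<omega> = e i j k \<omega> * (cexp (t i j) (\<lambda>\<omega>. B (t i k + x i) \<omega> - B (t i j) \<omega>) \<omega>
      + cexp (t i j) (\<lambda>\<omega>. B (t i k) \<omega> - B (t i j) \<omega>) \<omega>)
    + ((t i k + x i - t i j) powr (2 * H) - (t i k - t i j) powr (2 * H)) / (2 * H)"
proof -
  interpret C: finite_measure_subalgebra M "past (t i j)" by (rule finite_measure_subalgebra_past)
  have i: "i \<in> I" and jk: "j \<le> k" using assms by (auto simp: P_def)
  note t0 = t_nonneg[OF i, of j] t_nonneg[OF i, of k] t_mono[OF i jk] x[OF i]
  have int: "integrable M (\<lambda>\<omega>. B (t i k + x i) \<omega> - B (t i j) \<omega>)" "integrable M (\<lambda>\<omega>. (B (t i k + x i) \<omega> - B (t i j) \<omega>)\<^sup>2)"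
    "integrable M (\<lambda>\<omega>. B (t i k) \<omega> - B (t i j) \<omega>)" "integrable M (\<lambda>\<omega>. (B (t i k) \<omega> - B (t i j) \<omega>)\<^sup>2)"
    using t0 by (auto intro!: B_increment_integrable)
  have \<beta>: "\<beta> i k = (\<lambda>\<omega>. (B (t i k + x i) \<omega> - B (t i j) \<omega>) - (B (t i k) \<omega> - B (t i j) \<omega>))"
    by (simp add: \<beta>_def[abs_def])
  have "AE \<omega> in M. e i j k \<omega> = cexp (t i j) (\<lambda>\<omega>. B (t i k + x i) \<omega> - B (t i j) \<omega>) \<omega>
      - cexp (t i j) (\<lambda>\<omega>. B (t i k) \<omega> - B (t i j) \<omega>) \<omega>"
    unfolding e_def \<beta> using int by (intro C.real_cond_exp_diff)
  moreover have "AE \<omega> in M. q i j k \<omega> = cexp (t i j) (\<lambda>\<omega>. (B (t i k + x i) \<omega> - B (t i j) \<omega>)\<^sup>2) \<omega>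
      - cexp (t i j) (\<lambda>\<omega>. (B (t i k) \<omega> - B (t i j) \<omega>)\<^sup>2) \<omega>"
    unfolding q_def \<gamma>_def[abs_def] using int by (intro C.real_cond_exp_diff)
  moreover have "AE \<omega> in M. cexp (t i j) (\<lambda>\<omega>. (B (t i k + x i) \<omega> - B (t i j) \<omega>)\<^sup>2) \<omega>
      = (cexp (t i j) (\<lambda>\<omega>. B (t i k + x i) \<omega> - B (t i j) \<omega>) \<omega>)\<^sup>2 + (t i k + x i - t i j) powr (2 * H) / (2 * H)"
    using t0 by (intro cexp_increment_square) auto
  moreover have "AE \<omega> in M. cexp (t i j) (\<lambda>\<omega>. (B (t i k) \<omega> - B (t i j) \<omega>)\<^sup>2) \<omega>
      = (cexp (t i j) (\<lambda>\<omega>. B (t i k) \<omega> - B (t i j) \<omega>) \<omega>)\<^sup>2 + (t i k - t i j) powr (2 * H) / (2 * H)"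
    using t0 by (intro cexp_increment_square) auto
  ultimately show ?thesis
  proof eventually_elim
    case (elim \<omega>)
    show ?case
      unfolding elim by (simp add: power2_eq_square algebra_simps diff_divide_distrib)
  qed
qed

text \<open>The random part is \<open>e\<close> times an increment over the distance from
  \<open>t j\<close>. The deterministic part is a difference of variances; as \<open>2 * H\<close>
  is at most one, concavity gives it the same order.\<close>

lemma q_O: "Lp_O P (\<lambda>(i, j, k). q i j k) (\<lambda>(i, j, k). w i (k - j) * ((1 + real (k - j)) * D i) powr H)"
proof -
  let ?l1 = "\<lambda>i j k. cexp (t i j) (\<lambda>\<omega>. B (t i k + x i) \<omega> - B (t i j) \<omega>)"
  let ?l2 = "\<lambda>i j k. cexp (t i j) (\<lambda>\<omega>. B (t i k) \<omega> - B (t i j) \<omega>)"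
  let ?d = "\<lambda>i j k. ((t i k + x i - t i j) powr (2 * H) - (t i k - t i j) powr (2 * H)) / (2 * H)"
  let ?s = "\<lambda>i j k. w i (k - j) * ((1 + real (k - j)) * D i) powr H"
  have 1: "Lp_O P (\<lambda>(i, j, k) \<omega>. e i j k \<omega> * (?l1 i j k \<omega> + ?l2 i j k \<omega>)) (\<lambda>(i, j, k). ?s i j k)"
    using Lp_O_mult[OF e_O Lp_O_add[OF cexp_B_diff_x_O cexp_B_diff_O]]
    by (rule Lp_O_scale[where K = 2, OF Lp_O_cong]) (auto simp: w_nonneg)
  have 2: "Lp_O P (\<lambda>(i, j, k) \<omega>. ?d i j k) (\<lambda>(i, j, k). ?s i j k)"
  proof -
    have "\<bar>?d i j k\<bar> \<le> 1 / (2 * H) * ?s i j k" if i: "i \<in> I" and jk: "j \<le> k" for i j k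
    proof -
      let ?l = "k - j"
      have le: "(t i k - t i j) powr (2 * H) \<le> (t i k + x i - t i j) powr (2 * H)"
        using x[OF i] t_mono[OF i jk] H by (intro powr_mono2) auto
      have "(t i k + x i - t i j) powr (2 * H) \<le> ((1 + real ?l) * D i) powr (2 * H)"
        using x[OF i] t_mono[OF i jk] H t_diff[OF jk, of i] by (intro powr_mono2) (auto simp: distrib_right)
      then have "(t i k + x i - t i j) powr (2 * H) - (t i k - t i j) powr (2 * H)
          \<le> ((1 + real ?l) powr (2 * H) - real ?l powr (2 * H)) * D i powr (2 * H)"
        using D[OF i] t_diff[OF jk, of i] by (simp add: powr_mult left_diff_distrib)
      also have "\<dots> \<le> (1 + real ?l) powr (2 * H - 1) * D i powr (2 * H)"
        using powr_Suc_diff_le[of "2 * H" ?l] H by (intro mult_right_mono) auto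
      also have "\<dots> = ?s i j k"
      proof -
        have "(1 + real ?l) powr (2 * H - 1) = (1 + real ?l) powr (H - 1) * (1 + real ?l) powr H"
          by (simp add: powr_add[symmetric])
        moreover have "D i powr (2 * H) = D i powr H * D i powr H" by (simp add: powr_add[symmetric])
        ultimately show ?thesis using D[OF i] by (simp add: w_def powr_mult mult_ac)
      qed
      finally show ?thesis
        using le H by (simp add: divide_right_mono)
    qed
    then show ?thesis
      by (intro Lp_O_cong[OF Lp_O_const[where c = "\<lambda>(i, j, k). ?d i j k" and K = "1 / (2 * H)"]])
        (auto simp: P_def w_nonneg)
  qed
  have 3: "Lp_O P (\<lambda>(i, j, k) \<omega>. e i j k \<omega> * (?l1 i j k \<omega> + ?l2 i j k \<omega>) + ?d i j k) (\<lambda>(i, j, k). ?s i j k)"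
    using Lp_O_add[OF 1 2]
    by (rule Lp_O_scale[where K = 2, OF Lp_O_cong]) (auto simp: w_nonneg)
  show ?thesis
  proof (rule Lp_O_dom[OF 3, where K = 1])
    show "AE \<omega> in M. \<bar>(case y of (i, j, k) \<Rightarrow> q i j k) \<omega>\<bar>
        \<le> 1 * \<bar>(case y of (i, j, k) \<Rightarrow> \<lambda>\<omega>. e i j k \<omega> * (?l1 i j k \<omega> + ?l2 i j k \<omega>) + ?d i j k) \<omega>\<bar>" if "y \<in> P" for y
    proof -
      obtain i j k where y: "y = (i, j, k)" by (cases y)
      show ?thesis using q_eq[OF that[unfolded y]] unfolding y by eventually_elim simp
    qed
  qed (auto simp: q_def cexp_measurable)
qed

section \<open>Taylor polynomials and orthogonality\<close>

text \<open>The polynomial before conditioning: \<open>A i j k\<close> is its projection on the past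
  of \<open>t j\<close>.\<close>

definition Z :: "'i \<Rightarrow> nat \<Rightarrow> nat \<Rightarrow> 'a \<Rightarrow> real" where
  "Z i j k \<omega> = f1 (Y i (t i j) \<omega>) * \<beta> i k \<omega> + f2 (Y i (t i j) \<omega>) / 2 * \<gamma> i j k \<omega>"

lemma Y_grid_past: "i \<in> I \<Longrightarrow> j \<le> 2 ^ L i \<Longrightarrow> j \<le> k \<Longrightarrow> Y i (t i j) \<in> borel_measurable (past (t i k))"
  by (rule past_measurable_mono[OF t_mono Y_past]) (auto simp: t_nonneg t_le_T)

lemma f_Y_past:
  assumes "i \<in> I" "j \<le> 2 ^ L i" "j \<le> k"
  shows "(\<lambda>\<omega>. f1 (Y i (t i j) \<omega>)) \<in> borel_measurable (past (t i k))"
    and "(\<lambda>\<omega>. f2 (Y i (t i j) \<omega>) / 2) \<in> borel_measurable (past (t i k))"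
  using Y_grid_past[OF assms] by measurable

lemma moments_f_Y:
  assumes "i \<in> I" "j \<le> 2 ^ L i"
  shows "moments (\<lambda>\<omega>. f1 (Y i (t i j) \<omega>))" and "moments (\<lambda>\<omega>. f2 (Y i (t i j) \<omega>) / 2)"
proof -
  note m = f_Y_past[OF assms order_refl, THEN past_measurable_imp]
  show "moments (\<lambda>\<omega>. f1 (Y i (t i j) \<omega>))"
    by (rule moments_bounded[OF m(1) f_bounded(1)])
  have "\<bar>f2 y / 2\<bar> \<le> K" for y using f_bounded(2)[of y] K by simp
  then show "moments (\<lambda>\<omega>. f2 (Y i (t i j) \<omega>) / 2)"
    by (rule moments_bounded[OF m(2)])
qed

lemma moments_P:
  assumes "(i, j, k) \<in> P"
  shows "moments (e i j k)" "moments (q i j k)" "moments (\<beta> i k)" "moments (\<gamma> i j k)"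
    "moments (\<lambda>\<omega>. B (t i k) \<omega> - B (t i j) \<omega>)"
proof -
  show "moments (e i j k)" using Lp_O_moments[OF e_O assms] by simp
  show "moments (q i j k)" using Lp_O_moments[OF q_O assms] by simp
  show "moments (\<beta> i k)" using Lp_O_moments[OF \<beta>_O assms] by simp
  show 1: "moments (\<lambda>\<omega>. B (t i k) \<omega> - B (t i j) \<omega>)" using Lp_O_moments[OF B_diff_O assms] by simp
  have 2: "moments (\<lambda>\<omega>. B (t i k + x i) \<omega> - B (t i j) \<omega>)" using Lp_O_moments[OF B_diff_x_O assms] by simp
  show "moments (\<gamma> i j k)"
    unfolding \<gamma>_def[abs_def] by (intro moments_diff moments_power 1 2)
qed

lemma P_D: "(i, j, k) \<in> P \<Longrightarrow> i \<in> I" "(i, j, k) \<in> P \<Longrightarrow> j \<le> 2 ^ L i" "(i, j, k) \<in> P \<Longrightarrow> j \<le> k"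
  by (auto simp: P_def)

text \<open>The projection property in weak form, tested against past variables with all moments.
  The coefficients of the polynomial are themselves past variables and are moved into the test
  variable.\<close>

lemma A_orth:
  assumes ijk: "(i, j, k) \<in> P" and \<Psi>: "\<Psi> \<in> borel_measurable (past (t i j))" "moments \<Psi>"
  shows "expectation (\<lambda>\<omega>. \<Psi> \<omega> * A i j k \<omega>) = expectation (\<lambda>\<omega>. \<Psi> \<omega> * Z i j k \<omega>)"
proof -
  note m = moments_P[OF ijk] and i = P_D[OF ijk]
  note fm = moments_f_Y[OF i(1,2)] and fp = f_Y_past[OF i(1,2) order_refl]
  let ?\<Psi>1 = "\<lambda>\<omega>. \<Psi> \<omega> * f1 (Y i (t i j) \<omega>)" and ?\<Psi>2 = "\<lambda>\<omega>. \<Psi> \<omega> * (f2 (Y i (t i j) \<omega>) / 2)"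
  have \<Psi>1: "?\<Psi>1 \<in> borel_measurable (past (t i j))" "moments ?\<Psi>1"
    by (rule borel_measurable_times[OF \<Psi>(1) fp(1)], rule moments_mult[OF \<Psi>(2) fm(1)])
  have \<Psi>2: "?\<Psi>2 \<in> borel_measurable (past (t i j))" "moments ?\<Psi>2"
    by (rule borel_measurable_times[OF \<Psi>(1) fp(2)], rule moments_mult[OF \<Psi>(2) fm(2)])
  have "expectation (\<lambda>\<omega>. \<Psi> \<omega> * A i j k \<omega>) = expectation (\<lambda>\<omega>. ?\<Psi>1 \<omega> * e i j k \<omega> + ?\<Psi>2 \<omega> * q i j k \<omega>)"
    by (simp add: A_def algebra_simps)
  also have "\<dots> = expectation (\<lambda>\<omega>. ?\<Psi>1 \<omega> * e i j k \<omega>) + expectation (\<lambda>\<omega>. ?\<Psi>2 \<omega> * q i j k \<omega>)"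
    by (intro Bochner_Integration.integral_add moments_integrable moments_mult[OF \<Psi>1(2) m(1)] moments_mult[OF \<Psi>2(2) m(2)])
  also have "\<dots> = expectation (\<lambda>\<omega>. ?\<Psi>1 \<omega> * \<beta> i k \<omega>) + expectation (\<lambda>\<omega>. ?\<Psi>2 \<omega> * \<gamma> i j k \<omega>)"
    unfolding e_def q_def using cexp_orthogonal[OF \<Psi>1 m(3)] cexp_orthogonal[OF \<Psi>2 m(4)] by simp
  also have "\<dots> = expectation (\<lambda>\<omega>. ?\<Psi>1 \<omega> * \<beta> i k \<omega> + ?\<Psi>2 \<omega> * \<gamma> i j k \<omega>)"
    by (intro Bochner_Integration.integral_add[symmetric] moments_integrable moments_mult[OF \<Psi>1(2) m(3)] moments_mult[OF \<Psi>2(2) m(4)])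
  also have "\<dots> = expectation (\<lambda>\<omega>. \<Psi> \<omega> * Z i j k \<omega>)"
    by (simp add: Z_def algebra_simps)
  finally show ?thesis .
qed

text \<open>\<open>G\<close> is the projection on the past of \<open>t j1\<close> of the polynomial
  taken at the earlier time \<open>t j0\<close>. Tested against the past of \<open>t j0\<close> it
  cannot be distinguished from \<open>A i j0 k\<close>, which makes their difference a martingale
  difference.\<close>

lemma G_orth:
  assumes ijk: "(i, j1, k) \<in> P" and ij: "(i, j0, j1) \<in> P" and \<Psi>: "\<Psi> \<in> borel_measurable (past (t i j0))" "moments \<Psi>"
  shows "expectation (\<lambda>\<omega>. \<Psi> \<omega> * G i j0 j1 k \<omega>) = expectation (\<lambda>\<omega>. \<Psi> \<omega> * Z i j0 k \<omega>)"
proof -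
  note m = moments_P[OF ijk] and i = P_D[OF ij]
  note fm = moments_f_Y[OF i(1,2)] and fp = f_Y_past[OF i]
  have \<Psi>': "\<Psi> \<in> borel_measurable (past (t i j1))"
    by (rule past_measurable_mono[OF t_mono[OF i(1,3)] \<Psi>(1)])
  have Bp: "(\<lambda>\<omega>. B (t i j1) \<omega> - B (t i j0) \<omega>) \<in> borel_measurable (past (t i j1))"
    using i t_nonneg[OF i(1)] t_mono[OF i(1,3)] by (intro borel_measurable_diff B_past_measurable) auto
  let ?\<Psi>1 = "\<lambda>\<omega>. \<Psi> \<omega> * f1 (Y i (t i j0) \<omega>)" and ?\<Psi>2 = "\<lambda>\<omega>. \<Psi> \<omega> * (f2 (Y i (t i j0) \<omega>) / 2)"
  let ?\<Psi>3 = "\<lambda>\<omega>. ?\<Psi>2 \<omega> * (B (t i j1) \<omega> - B (t i j0) \<omega>)"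
  let ?\<Psi>4 = "\<lambda>\<omega>. ?\<Psi>1 \<omega> + 2 * ?\<Psi>3 \<omega>"
  have \<Psi>2: "?\<Psi>2 \<in> borel_measurable (past (t i j1))" "moments ?\<Psi>2"
    by (rule borel_measurable_times[OF \<Psi>' fp(2)], rule moments_mult[OF \<Psi>(2) fm(2)])
  have \<Psi>4: "?\<Psi>4 \<in> borel_measurable (past (t i j1))" "moments ?\<Psi>4"
    by (intro borel_measurable_add borel_measurable_times borel_measurable_const \<Psi>' fp Bp,
        intro moments_add moments_mult moments_const \<Psi>(2) fm moments_P(5)[OF ij])
  have "expectation (\<lambda>\<omega>. \<Psi> \<omega> * G i j0 j1 k \<omega>) = expectation (\<lambda>\<omega>. ?\<Psi>4 \<omega> * e i j1 k \<omega> + ?\<Psi>2 \<omega> * q i j1 k \<omega>)"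
    by (intro Bochner_Integration.integral_cong refl) (simp add: G_def field_simps)
  also have "\<dots> = expectation (\<lambda>\<omega>. ?\<Psi>4 \<omega> * e i j1 k \<omega>) + expectation (\<lambda>\<omega>. ?\<Psi>2 \<omega> * q i j1 k \<omega>)"
    by (intro Bochner_Integration.integral_add moments_integrable moments_mult[OF \<Psi>4(2) m(1)] moments_mult[OF \<Psi>2(2) m(2)])
  also have "\<dots> = expectation (\<lambda>\<omega>. ?\<Psi>4 \<omega> * \<beta> i k \<omega>) + expectation (\<lambda>\<omega>. ?\<Psi>2 \<omega> * \<gamma> i j1 k \<omega>)"
    unfolding e_def q_def using cexp_orthogonal[OF \<Psi>4 m(3)] cexp_orthogonal[OF \<Psi>2 m(4)] by simp
  also have "\<dots> = expectation (\<lambda>\<omega>. ?\<Psi>4 \<omega> * \<beta> i k \<omega> + ?\<Psi>2 \<omega> * \<gamma> i j1 k \<omega>)"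
    by (intro Bochner_Integration.integral_add[symmetric] moments_integrable moments_mult[OF \<Psi>4(2) m(3)] moments_mult[OF \<Psi>2(2) m(4)])
  also have "\<dots> = expectation (\<lambda>\<omega>. \<Psi> \<omega> * Z i j0 k \<omega>)"
  proof (rule Bochner_Integration.integral_cong[OF refl])
    fix \<omega>
    \<comment> \<open>Moving the centre of the squares from \<open>t j0\<close> to
      \<open>t j1\<close> produces the mixed term that appears in \<open>G\<close>.\<close>
    have "\<gamma> i j0 k \<omega> = \<gamma> i j1 k \<omega> + 2 * (B (t i j1) \<omega> - B (t i j0) \<omega>) * \<beta> i k \<omega>"
      by (simp add: \<gamma>_def \<beta>_def power2_eq_square algebra_simps)
    then show "?\<Psi>4 \<omega> * \<beta> i k \<omega> + ?\<Psi>2 \<omega> * \<gamma> i j1 k \<omega> = \<Psi> \<omega> * Z i j0 k \<omega>"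
      by (simp only: Z_def) (simp add: field_simps)
  qed
  finally show ?thesis .
qed

lemma moments_A: "(i, j, k) \<in> P \<Longrightarrow> moments (A i j k)"
  unfolding A_def[abs_def] by (intro moments_add moments_mult moments_f_Y moments_P) (auto dest: P_D)

lemma moments_Z: "(i, j, k) \<in> P \<Longrightarrow> moments (Z i j k)"
  unfolding Z_def[abs_def] by (intro moments_add moments_mult moments_f_Y moments_P) (auto dest: P_D)

lemma moments_G: "(i, j1, k) \<in> P \<Longrightarrow> (i, j0, j1) \<in> P \<Longrightarrow> moments (G i j0 j1 k)"
  unfolding G_def[abs_def]
  by (intro moments_add moments_mult moments_f_Y moments_P moments_const) (auto dest: P_D)

lemma A_past:
  assumes "(i, j, k) \<in> P"
  shows "A i j k \<in> borel_measurable (past (t i j))"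
  unfolding A_def[abs_def] e_def q_def
  by (intro borel_measurable_add borel_measurable_times f_Y_past cexp_past_measurable P_D[OF assms] order_refl)

lemma G_past:
  assumes "(i, j1, k) \<in> P" "(i, j0, j1) \<in> P"
  shows "G i j0 j1 k \<in> borel_measurable (past (t i j1))"
proof -
  note i = P_D[OF assms(2)]
  have "(\<lambda>\<omega>. B (t i j1) \<omega> - B (t i j0) \<omega>) \<in> borel_measurable (past (t i j1))"
    using i t_nonneg[OF i(1)] t_mono[OF i(1,3)] by (intro borel_measurable_diff B_past_measurable) auto
  then show ?thesis
    unfolding G_def[abs_def] e_def q_def
    by (intro borel_measurable_add borel_measurable_times f_Y_past[OF i] cexp_past_measurable borel_measurable_const)
qed

section \<open>Dyadic blocks\<close>

text \<open>Three nested index sets: the scales \<open>m\<close>, the blocks \<open>j\<close> of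
  \<open>2 ^ Suc m\<close> meshes at a scale, and the meshes \<open>l\<close> in the right half of a
  block.\<close>

definition IM :: "('i \<times> nat) set" where "IM = (SIGMA i:I. {..<L i})"
definition J :: "(('i \<times> nat) \<times> nat) set" where "J = (SIGMA p:IM. {..<2 ^ (L (fst p) - snd p - 1)})"
definition J2 :: "((('i \<times> nat) \<times> nat) \<times> nat) set" where "J2 = (SIGMA b:J. {..<2 ^ snd (fst b)})"

text \<open>Refining scale \<open>Suc m\<close> to \<open>m\<close> leaves the conditioning time
  \<open>j0\<close> of the left half unchanged and moves that of the right half from
  \<open>j0\<close> to the midpoint \<open>j1\<close>. So only the right halves, of time length
  \<open>len\<close>, contribute.\<close>

definition j0 :: "nat \<Rightarrow> nat \<Rightarrow> nat" where "j0 m j = j * 2 ^ Suc m"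
definition j1 :: "nat \<Rightarrow> nat \<Rightarrow> nat" where "j1 m j = j * 2 ^ Suc m + 2 ^ m"
definition len :: "'i \<Rightarrow> nat \<Rightarrow> real" where "len i m = 2 ^ m * D i"

lemma J2_iff: "(((i, m), j), l) \<in> J2 \<longleftrightarrow> i \<in> I \<and> m < L i \<and> j < 2 ^ (L i - m - 1) \<and> l < 2 ^ m"
  by (auto simp: J2_def J_def IM_def)

lemma J_iff: "((i, m), j) \<in> J \<longleftrightarrow> i \<in> I \<and> m < L i \<and> j < 2 ^ (L i - m - 1)"
  by (auto simp: J_def IM_def)

lemma pow_split: "m < L i \<Longrightarrow> (2 :: 'b :: comm_semiring_1) ^ L i = 2 ^ (L i - m - 1) * 2 ^ Suc m"
  by (simp only: power_add[symmetric]) simp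

lemma block_bound:
  assumes "m < L i" "j < 2 ^ (L i - m - 1)" "l < 2 ^ m"
  shows "j1 m j + l < 2 ^ L i"
proof -
  have "j1 m j + l < Suc j * 2 ^ Suc m" using assms(3) by (simp add: j1_def)
  also have "\<dots> \<le> 2 ^ (L i - m - 1) * 2 ^ Suc m"
    using assms(2) by (intro mult_right_mono) auto
  also have "\<dots> = 2 ^ L i" by (rule pow_split[OF assms(1), symmetric])
  finally show ?thesis .
qed

lemma J2_P:
  assumes "(((i, m), j), l) \<in> J2"
  shows "(i, j1 m j, j1 m j + l) \<in> P" "(i, j0 m j, j1 m j + l) \<in> P"
  using assms block_bound[of m i j l] by (auto simp: J2_iff P_def j0_def j1_def)

lemma J_P: "((i, m), j) \<in> J \<Longrightarrow> (i, j0 m j, j1 m j) \<in> P"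
  using block_bound[of m i j 0] by (auto simp: J_iff P_def j0_def j1_def)

lemma len_bounds:
  assumes "i \<in> I" "m \<le> L i"
  shows "0 < len i m" "len i m \<le> T"
proof -
  show "0 < len i m" using D[OF assms(1)] by (simp add: len_def)
  have "(2 :: real) ^ m * D i \<le> 2 ^ L i * D i"
    using assms D[OF assms(1)] by (intro mult_right_mono power_increasing) auto
  then show "len i m \<le> T" using D_le_T[OF assms(1)] by (simp add: len_def)
qed

lemma blocks_len:
  assumes "i \<in> I" "m < L i"
  shows "2 ^ (L i - m - 1) * len i m \<le> T"
proof -
  have "2 * (2 ^ (L i - m - 1) * len i m) = 2 ^ L i * D i"
    using pow_split[OF assms(2), where 'b = real] by (simp add: len_def)
  moreover have "0 \<le> 2 ^ (L i - m - 1) * len i m"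
    using len_bounds[of i m] assms by simp
  ultimately show ?thesis using D_le_T[OF assms(1)] by linarith
qed

lemma len_powr: "i \<in> I \<Longrightarrow> len i m powr g = (2 ^ m) powr g * D i powr g"
  using D[of i] by (simp add: len_def powr_mult)

lemma k_len:
  assumes "(i, j, k) \<in> P"
  shows "(1 + real (k - j)) * D i \<le> T"
proof -
  have "1 + (k - j) \<le> 2 ^ L i" using assms by (auto simp: P_def)
  then have "real (1 + (k - j)) \<le> 2 ^ L i"
    by (metis of_nat_le_iff of_nat_numeral of_nat_power)
  then have "(1 + real (k - j)) * D i \<le> 2 ^ L i * D i"
    using D[of i] P_D(1)[OF assms] by (intro mult_right_mono) auto
  then show ?thesis using D_le_T[OF P_D(1)[OF assms]] by simp
qed

lemma w_antimono: "l \<le> l' \<Longrightarrow> w i l' \<le> w i l"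
  unfolding w_def using H by (intro mult_left_mono powr_mono2') auto

text \<open>All conditional increments in a half block together are of the size of a single
  increment of \<open>B\<close> over it.\<close>

lemma w_sum: "i \<in> I \<Longrightarrow> (\<Sum>l<2 ^ m. w i l) \<le> 1 / H * len i m powr H"
proof -
  assume i: "i \<in> I"
  have "(\<Sum>l<2 ^ m. w i l) = D i powr H * (\<Sum>l<2 ^ m. (1 + real l) powr (H - 1))"
    by (simp add: w_def sum_distrib_left)
  also have "\<dots> \<le> D i powr H * (real (2 ^ m) powr H / H)"
    using H by (intro mult_left_mono sum_powr_le) auto
  finally show ?thesis by (simp add: len_powr[OF i] mult.commute)
qed

lemma f_Y_measurable:
  assumes "i \<in> I" "j \<le> 2 ^ L i"
  shows "(\<lambda>\<omega>. f1 (Y i (t i j) \<omega>)) \<in> borel_measurable M" "(\<lambda>\<omega>. f2 (Y i (t i j) \<omega>)) \<in> borel_measurable M"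
  using Y_grid_past[OF assms order_refl, THEN past_measurable_imp] by measurable

lemma q_O': "Lp_O P (\<lambda>(i, j, k). q i j k) (\<lambda>(i, j, k). w i (k - j))"
proof (rule Lp_O_scale[OF q_O, where K = "T powr H"])
  fix p assume "p \<in> P"
  then obtain i j k where p: "p = (i, j, k)" "(i, j, k) \<in> P" by (cases p) auto
  have "((1 + real (k - j)) * D i) powr H \<le> T powr H"
    using k_len[OF p(2)] H D[OF P_D(1)[OF p(2)]] by (intro powr_mono2) auto
  then have "w i (k - j) * ((1 + real (k - j)) * D i) powr H \<le> w i (k - j) * T powr H"
    by (intro mult_left_mono w_nonneg)
  then show "(case p of (i, j, k) \<Rightarrow> w i (k - j) * ((1 + real (k - j)) * D i) powr H)
      \<le> T powr H * (case p of (i, j, k) \<Rightarrow> w i (k - j))"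
    unfolding p(1) by (simp only: prod.case mult.commute[of "T powr H"])
qed (auto simp: w_nonneg)

lemma A_O: "Lp_O P (\<lambda>(i, j, k). A i j k) (\<lambda>(i, j, k). w i (k - j))"
proof -
  have 1: "Lp_O P (\<lambda>p \<omega>. (\<lambda>(i, j, k) \<omega>. f1 (Y i (t i j) \<omega>)) p \<omega> * (\<lambda>(i, j, k). e i j k) p \<omega>) (\<lambda>(i, j, k). w i (k - j))"
    by (rule Lp_O_bounded_mult[OF e_O, where K = K])
      (auto simp: f_bounded intro!: f_Y_measurable dest: P_D)
  have 2: "Lp_O P (\<lambda>p \<omega>. (\<lambda>(i, j, k) \<omega>. f2 (Y i (t i j) \<omega>) / 2) p \<omega> * (\<lambda>(i, j, k). q i j k) p \<omega>) (\<lambda>(i, j, k). w i (k - j))"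
  proof (rule Lp_O_bounded_mult[OF q_O', where K = K])
    have "\<bar>f2 y / 2\<bar> \<le> K" for y using f_bounded(2)[of y] K by simp
    then show "\<bar>(case p of (i, j, k) \<Rightarrow> \<lambda>\<omega>. f2 (Y i (t i j) \<omega>) / 2) \<omega>\<bar> \<le> K" if "p \<in> P" for p \<omega>
      by (cases p) simp
  qed (auto intro!: f_Y_measurable borel_measurable_divide dest: P_D)
  show ?thesis
    by (rule Lp_O_scale[OF Lp_O_cong[OF Lp_O_add[OF 1 2]], where K = 2]) (auto simp: A_def w_nonneg)
qed

lemma B_block_O: "Lp_O J (\<lambda>((i, m), j) \<omega>. B (t i (j1 m j)) \<omega> - B (t i (j0 m j)) \<omega>) (\<lambda>((i, m), j). len i m powr H)"
proof -
  have "Lp_O J (\<lambda>y. (\<lambda>(i, j, k) \<omega>. B (t i k) \<omega> - B (t i j) \<omega>) ((\<lambda>((i, m), j). (i, j0 m j, j1 m j)) y))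
     (\<lambda>y. (\<lambda>(i, j, k). ((1 + real (k - j)) * D i) powr H) ((\<lambda>((i, m), j). (i, j0 m j, j1 m j)) y))"
    by (rule Lp_O_reindex[OF B_diff_O]) (use J_P in auto)
  then have 1: "Lp_O J (\<lambda>((i, m), j) \<omega>. B (t i (j1 m j)) \<omega> - B (t i (j0 m j)) \<omega>) (\<lambda>((i, m), j). ((1 + 2 ^ m) * D i) powr H)"
    by (rule Lp_O_cong) (auto simp: j0_def j1_def)
  have "((1 + 2 ^ m) * D i) powr H \<le> 2 * len i m powr H" if "i \<in> I" for i m
  proof -
    have "((1 + 2 ^ m) * D i) powr H \<le> (2 * len i m) powr H"
      using D[OF that] H by (intro powr_mono2) (auto simp: len_def)
    also have "\<dots> = 2 powr H * len i m powr H"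
      using D[OF that] by (simp add: len_def powr_mult)
    also have "\<dots> \<le> 2 powr 1 * len i m powr H"
      using H by (intro mult_right_mono powr_mono) auto
    finally show ?thesis by simp
  qed
  then show ?thesis by (intro Lp_O_scale[OF 1, where K = 2]) (auto simp: J_iff)
qed

lemma drift_block_O: "Lp_O J (\<lambda>((i, m), j) \<omega>. Y i (t i (j1 m j)) \<omega> - Y i (t i (j0 m j)) \<omega>
     - (B (t i (j1 m j)) \<omega> - B (t i (j0 m j)) \<omega>)) (\<lambda>((i, m), j). len i m)"
proof -
  have "Lp_O J (\<lambda>y. (\<lambda>(i, s, t) \<omega>. Y i t \<omega> - Y i s \<omega> - (B t \<omega> - B s \<omega>)) ((\<lambda>((i, m), j). (i, t i (j0 m j), t i (j1 m j))) y))
     (\<lambda>y. (\<lambda>(i, s, t). t - s) ((\<lambda>((i, m), j). (i, t i (j0 m j), t i (j1 m j))) y))"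
  proof (rule Lp_O_reindex[OF drift])
    fix p assume "p \<in> J"
    then obtain i m j where p: "p = ((i, m), j)" "((i, m), j) \<in> J" by (metis surj_pair)
    have i: "i \<in> I" "j0 m j \<le> j1 m j" "j1 m j \<le> 2 ^ L i"
      using J_P[OF p(2)] by (auto simp: P_def)
    show "((\<lambda>((i, m), j). (i, t i (j0 m j), t i (j1 m j))) p) \<in> {(i, s, t). i \<in> I \<and> 0 \<le> s \<and> s \<le> t \<and> t \<le> T}"
      unfolding p(1) using i t_nonneg t_mono t_le_T by auto
  qed
  then show ?thesis
    by (rule Lp_O_cong) (auto simp: t_diff j0_def j1_def len_def)
qed

lemma Y_block_O: "Lp_O J (\<lambda>((i, m), j) \<omega>. Y i (t i (j1 m j)) \<omega> - Y i (t i (j0 m j)) \<omega>) (\<lambda>((i, m), j). len i m powr H)"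
proof -
  have 1: "Lp_O J (\<lambda>((i, m), j) \<omega>. Y i (t i (j1 m j)) \<omega> - Y i (t i (j0 m j)) \<omega>) (\<lambda>((i, m), j). len i m + len i m powr H)"
    by (rule Lp_O_cong[OF Lp_O_add[OF drift_block_O B_block_O]]) auto
  have "len i m + len i m powr H \<le> (T powr (1 - H) + 1) * len i m powr H" if "i \<in> I" "m < L i" for i m
  proof -
    have "len i m powr 1 \<le> T powr (1 - H) * len i m powr H"
      using len_bounds[of i m] that H by (intro powr_le_powr_bounded) auto
    then show ?thesis using len_bounds[of i m] that by (simp add: distrib_right)
  qed
  then show ?thesis
    by (intro Lp_O_scale[OF 1, where K = "T powr (1 - H) + 1"]) (auto simp: J_iff)
qed

lemma Y_block_measurable:
  assumes "((i, m), j) \<in> J"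
  shows "Y i (t i (j0 m j)) \<in> borel_measurable M" "Y i (t i (j1 m j)) \<in> borel_measurable M"
  using J_P[OF assms] by (auto simp: P_def intro: Y_grid_past[OF _ _ order_refl, THEN past_measurable_imp])

text \<open>Replacing \<open>Y\<close> by \<open>B\<close> in the linear term costs the drift, of
  order \<open>len\<close>. This is within \<open>len powr (2 * H)\<close> on a bounded horizon
  because \<open>2 * H\<close> is less than one.\<close>

lemma f1_block_O: "Lp_O J (\<lambda>((i, m), j) \<omega>. f1 (Y i (t i (j1 m j)) \<omega>) - f1 (Y i (t i (j0 m j)) \<omega>)
     - f2 (Y i (t i (j0 m j)) \<omega>) * (B (t i (j1 m j)) \<omega> - B (t i (j0 m j)) \<omega>)) (\<lambda>((i, m), j). len i m powr (2 * H))"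
proof -
  let ?dY = "\<lambda>((i, m), j) \<omega>. Y i (t i (j1 m j)) \<omega> - Y i (t i (j0 m j)) \<omega>"
  let ?d = "\<lambda>((i, m), j) \<omega>. Y i (t i (j1 m j)) \<omega> - Y i (t i (j0 m j)) \<omega>
     - (B (t i (j1 m j)) \<omega> - B (t i (j0 m j)) \<omega>)"
  have absd: "Lp_O J (\<lambda>p \<omega>. \<bar>?d p \<omega>\<bar>) (\<lambda>((i, m), j). len i m)"
    by (rule Lp_O_dom[OF drift_block_O, where K = 1])
      (use Lp_O_measurable[OF drift_block_O] in auto)
  have 1: "Lp_O J (\<lambda>p \<omega>. ?dY p \<omega> * ?dY p \<omega> + \<bar>?d p \<omega>\<bar>) (\<lambda>((i, m), j). len i m powr (2 * H))"
  proof (rule Lp_O_scale[OF Lp_O_add[OF Lp_O_mult[OF Y_block_O Y_block_O] absd], where K = "1 + T powr (1 - 2 * H)"])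
    fix p assume "p \<in> J"
    then obtain i m j where p: "p = ((i, m), j)" "((i, m), j) \<in> J" by (metis surj_pair)
    have l: "0 < len i m" "len i m \<le> T" using len_bounds[of i m] p(2) by (auto simp: J_iff)
    have "len i m powr H * len i m powr H = len i m powr (2 * H)" by (simp add: powr_add[symmetric])
    moreover have "len i m powr 1 \<le> T powr (1 - 2 * H) * len i m powr (2 * H)"
      using l H by (intro powr_le_powr_bounded) auto
    ultimately show "((\<lambda>((i, m), j). len i m powr H) p) * ((\<lambda>((i, m), j). len i m powr H) p)
        + ((\<lambda>((i, m), j). len i m) p) \<le> (1 + T powr (1 - 2 * H)) * ((\<lambda>((i, m), j). len i m powr (2 * H)) p)"
      unfolding p(1) using l by (simp add: distrib_right)
  qed auto
  show ?thesis
  proof (rule Lp_O_dom[OF 1, where K = K])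
    fix p assume "p \<in> J"
    then obtain i m j where p: "p = ((i, m), j)" "((i, m), j) \<in> J" by (metis surj_pair)
    note [measurable] = Y_block_measurable[OF p(2)]
    have [measurable]: "B (t i (j0 m j)) \<in> borel_measurable M" "B (t i (j1 m j)) \<in> borel_measurable M"
      using B_meas(1) p(2) by (auto simp: J_iff)
    show "((\<lambda>((i, m), j). \<lambda>\<omega>. f1 (Y i (t i (j1 m j)) \<omega>) - f1 (Y i (t i (j0 m j)) \<omega>)
     - f2 (Y i (t i (j0 m j)) \<omega>) * (B (t i (j1 m j)) \<omega> - B (t i (j0 m j)) \<omega>)) p) \<in> borel_measurable M"
      unfolding p(1) prod.case by measurable
    show "AE \<omega> in M. \<bar>((\<lambda>((i, m), j). \<lambda>\<omega>. f1 (Y i (t i (j1 m j)) \<omega>) - f1 (Y i (t i (j0 m j)) \<omega>)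
     - f2 (Y i (t i (j0 m j)) \<omega>) * (B (t i (j1 m j)) \<omega> - B (t i (j0 m j)) \<omega>)) p) \<omega>\<bar>
      \<le> K * \<bar>?dY p \<omega> * ?dY p \<omega> + \<bar>?d p \<omega>\<bar>\<bar>"
      unfolding p(1) prod.case
    proof (rule AE_I2)
      fix \<omega>
      have *: "\<bar>f1 z - f1 y - f2 y * b\<bar> \<le> K * \<bar>(z - y) * (z - y) + \<bar>z - y - b\<bar>\<bar>" for z y b
      proof -
        have "\<bar>f1 z - f1 y - f2 y * b\<bar> \<le> \<bar>f1 z - f1 y - f2 y * (z - y)\<bar> + \<bar>f2 y * (z - y - b)\<bar>"
          by (simp add: algebra_simps)
        also have "\<dots> \<le> K * (z - y)\<^sup>2 + K * \<bar>z - y - b\<bar>"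
          unfolding abs_mult by (intro add_mono f1_taylor mult_right_mono f_bounded) auto
        also have "\<dots> = K * \<bar>(z - y) * (z - y) + \<bar>z - y - b\<bar>\<bar>"
          by (simp add: power2_eq_square distrib_left)
        finally show ?thesis .
      qed
      show "\<bar>f1 (Y i (t i (j1 m j)) \<omega>) - f1 (Y i (t i (j0 m j)) \<omega>)
        - f2 (Y i (t i (j0 m j)) \<omega>) * (B (t i (j1 m j)) \<omega> - B (t i (j0 m j)) \<omega>)\<bar>
        \<le> K * \<bar>(Y i (t i (j1 m j)) \<omega> - Y i (t i (j0 m j)) \<omega>) * (Y i (t i (j1 m j)) \<omega> - Y i (t i (j0 m j)) \<omega>)
          + \<bar>Y i (t i (j1 m j)) \<omega> - Y i (t i (j0 m j)) \<omega> - (B (t i (j1 m j)) \<omega> - B (t i (j0 m j)) \<omega>)\<bar>\<bar>"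
        by (rule *)
    qed
  qed
qed

lemma f2_block_O: "Lp_O J (\<lambda>((i, m), j) \<omega>. f2 (Y i (t i (j1 m j)) \<omega>) - f2 (Y i (t i (j0 m j)) \<omega>)) (\<lambda>((i, m), j). len i m powr H)"
proof (rule Lp_O_dom[OF Y_block_O, where K = K])
  fix p assume "p \<in> J"
  then obtain i m j where p: "p = ((i, m), j)" "((i, m), j) \<in> J" by (metis surj_pair)
  note [measurable] = Y_block_measurable[OF p(2)]
  show "((\<lambda>((i, m), j). \<lambda>\<omega>. f2 (Y i (t i (j1 m j)) \<omega>) - f2 (Y i (t i (j0 m j)) \<omega>)) p) \<in> borel_measurable M"
    unfolding p(1) prod.case by measurable
qed (auto simp: f2_lipschitz)

lemma e_block_O: "Lp_O J2 (\<lambda>(((i, m), j), l). e i (j1 m j) (j1 m j + l)) (\<lambda>(((i, m), j), l). w i l)"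
  and q_block_O: "Lp_O J2 (\<lambda>(((i, m), j), l). q i (j1 m j) (j1 m j + l)) (\<lambda>(((i, m), j), l). w i l * len i m powr H)"
proof -
  let ?h = "\<lambda>(((i, m), j), l). (i, j1 m j, j1 m j + l)"
  have "Lp_O J2 (\<lambda>y. (\<lambda>(i, j, k). e i j k) (?h y)) (\<lambda>y. (\<lambda>(i, j, k). w i (k - j)) (?h y))"
    by (rule Lp_O_reindex[OF e_O]) (use J2_P in auto)
  then show "Lp_O J2 (\<lambda>(((i, m), j), l). e i (j1 m j) (j1 m j + l)) (\<lambda>(((i, m), j), l). w i l)"
    by (rule Lp_O_cong) auto
  have "Lp_O J2 (\<lambda>y. (\<lambda>(i, j, k). q i j k) (?h y)) (\<lambda>y. (\<lambda>(i, j, k). w i (k - j) * ((1 + real (k - j)) * D i) powr H) (?h y))"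
    by (rule Lp_O_reindex[OF q_O]) (use J2_P in auto)
  then have 1: "Lp_O J2 (\<lambda>(((i, m), j), l). q i (j1 m j) (j1 m j + l)) (\<lambda>(((i, m), j), l). w i l * ((1 + real l) * D i) powr H)"
    by (rule Lp_O_cong) auto
  have "w i l * ((1 + real l) * D i) powr H \<le> 1 * (w i l * len i m powr H)" if "i \<in> I" "l < 2 ^ m" for i l m
  proof -
    have "1 + l \<le> 2 ^ m" using that by simp
    then have "real (1 + l) \<le> 2 ^ m"
      by (metis of_nat_le_iff of_nat_numeral of_nat_power)
    then have "((1 + real l) * D i) powr H \<le> len i m powr H"
      using D[OF that(1)] H by (intro powr_mono2) (auto simp: len_def)
    then show ?thesis by (simp add: mult_left_mono w_nonneg)
  qed
  then show "Lp_O J2 (\<lambda>(((i, m), j), l). q i (j1 m j) (j1 m j + l)) (\<lambda>(((i, m), j), l). w i l * len i m powr H)"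
    by (intro Lp_O_scale[OF 1, where K = 1]) (auto simp: J2_iff w_nonneg)
qed

lemma J2_fst: "p \<in> J2 \<Longrightarrow> fst p \<in> J" by (auto simp: J2_def)

text \<open>Replacing the expansion point \<open>Y (t j1)\<close> by \<open>Y (t j0)\<close> costs third order terms only.\<close>

lemma bias_O: "Lp_O J2 (\<lambda>(((i, m), j), l) \<omega>. A i (j1 m j) (j1 m j + l) \<omega> - G i (j0 m j) (j1 m j) (j1 m j + l) \<omega>)
     (\<lambda>(((i, m), j), l). len i m powr (2 * H) * w i l)"
proof -
  note b1 = Lp_O_reindex[OF f1_block_O, of J2 fst, OF J2_fst] and b2 = Lp_O_reindex[OF f2_block_O, of J2 fst, OF J2_fst]
  have 2: "Lp_O J2 (\<lambda>p \<omega>. 1/2 * ((\<lambda>((i, m), j) \<omega>. f2 (Y i (t i (j1 m j)) \<omega>) - f2 (Y i (t i (j0 m j)) \<omega>)) (fst p) \<omega>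
      * (\<lambda>(((i, m), j), l). q i (j1 m j) (j1 m j + l)) p \<omega>))
      (\<lambda>p. (\<lambda>((i, m), j). len i m powr H) (fst p) * (\<lambda>(((i, m), j), l). w i l * len i m powr H) p)"
    by (rule Lp_O_cmult[OF Lp_O_mult[OF b2 q_block_O], where c = "\<lambda>_. 1/2" and K = 1]) auto
  have 1: "Lp_O J2 (\<lambda>(((i, m), j), l) \<omega>. A i (j1 m j) (j1 m j + l) \<omega> - G i (j0 m j) (j1 m j) (j1 m j + l) \<omega>)
     (\<lambda>(((i, m), j), l). len i m powr (2 * H) * w i l + len i m powr H * (w i l * len i m powr H))"
    by (rule Lp_O_cong[OF Lp_O_add[OF Lp_O_mult[OF b1 e_block_O] 2]])
      (auto simp: A_def G_def field_simps)
  show ?thesis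
  proof (rule Lp_O_scale[OF 1, where K = 2])
    fix p assume "p \<in> J2"
    then obtain i m j l where p: "p = (((i, m), j), l)" by (metis surj_pair)
    have "len i m powr H * (w i l * len i m powr H) = len i m powr (2 * H) * w i l"
      using powr_add[of "len i m" H H, symmetric] by simp
    then show "((\<lambda>(((i, m), j), l). len i m powr (2 * H) * w i l + len i m powr H * (w i l * len i m powr H)) p)
        \<le> 2 * ((\<lambda>(((i, m), j), l). len i m powr (2 * H) * w i l) p)"
      unfolding p prod.case by (simp only:)
  qed (auto simp: w_nonneg)
qed

lemma A_block_O: "Lp_O J2 (\<lambda>(((i, m), j), l). A i (j0 m j) (j1 m j + l)) (\<lambda>(((i, m), j), l). w i l)"
proof -
  let ?h = "\<lambda>(((i, m), j), l). (i, j0 m j, j1 m j + l)"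
  have "Lp_O J2 (\<lambda>y. (\<lambda>(i, j, k). A i j k) (?h y)) (\<lambda>y. (\<lambda>(i, j, k). w i (k - j)) (?h y))"
    by (rule Lp_O_reindex[OF A_O]) (use J2_P in auto)
  then have 1: "Lp_O J2 (\<lambda>(((i, m), j), l). A i (j0 m j) (j1 m j + l)) (\<lambda>(((i, m), j), l). w i (j1 m j + l - j0 m j))"
    by (rule Lp_O_cong) auto
  show ?thesis
    by (rule Lp_O_scale[OF 1, where K = 1]) (auto simp: w_nonneg j0_def j1_def intro!: w_antimono)
qed

text \<open>\<open>G\<close> is the projection \<open>A\<close> at \<open>t j1\<close> minus the
  third order difference, so its size follows from theirs.\<close>

lemma G_block_O: "Lp_O J2 (\<lambda>(((i, m), j), l). G i (j0 m j) (j1 m j) (j1 m j + l)) (\<lambda>(((i, m), j), l). w i l)"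
proof -
  let ?h = "\<lambda>(((i, m), j), l). (i, j1 m j, j1 m j + l)"
  have "Lp_O J2 (\<lambda>y. (\<lambda>(i, j, k). A i j k) (?h y)) (\<lambda>y. (\<lambda>(i, j, k). w i (k - j)) (?h y))"
    by (rule Lp_O_reindex[OF A_O]) (use J2_P in auto)
  then have 1: "Lp_O J2 (\<lambda>(((i, m), j), l). A i (j1 m j) (j1 m j + l)) (\<lambda>(((i, m), j), l). w i l)"
    by (rule Lp_O_cong) auto
  have 2: "Lp_O J2 (\<lambda>(((i, m), j), l). G i (j0 m j) (j1 m j) (j1 m j + l)) (\<lambda>(((i, m), j), l). w i l + len i m powr (2 * H) * w i l)"
    by (rule Lp_O_cong[OF Lp_O_diff[OF 1 bias_O]]) auto
  show ?thesis
  proof (rule Lp_O_scale[OF 2, where K = "1 + T powr (2 * H)"])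
    fix p assume "p \<in> J2"
    then obtain i m j l where p: "p = (((i, m), j), l)" "(((i, m), j), l) \<in> J2" by (metis surj_pair)
    have "len i m powr (2 * H) \<le> T powr (2 * H)"
      using len_bounds[of i m] p(2) H by (intro powr_mono2) (auto simp: J2_iff)
    then have "len i m powr (2 * H) * w i l \<le> T powr (2 * H) * w i l"
      by (intro mult_right_mono w_nonneg)
    then show "((\<lambda>(((i, m), j), l). w i l + len i m powr (2 * H) * w i l) p)
        \<le> (1 + T powr (2 * H)) * ((\<lambda>(((i, m), j), l). w i l) p)"
      unfolding p(1) by (simp add: distrib_right)
  qed (auto simp: w_nonneg)
qed

text \<open>On a right half, the change of \<open>A\<close> from \<open>j0\<close> to
  \<open>j1\<close> is split at \<open>G\<close>: \<open>bias\<close> changes the expansion point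
  under the same conditioning, \<open>mart\<close> changes the conditioning for the same expansion
  point.\<close>

definition bias :: "'i \<Rightarrow> nat \<Rightarrow> nat \<Rightarrow> 'a \<Rightarrow> real" where
  "bias i m j \<omega> = (\<Sum>l<2 ^ m. c i (j1 m j + l) * (A i (j1 m j) (j1 m j + l) \<omega> - G i (j0 m j) (j1 m j) (j1 m j + l) \<omega>))"

definition mart :: "'i \<Rightarrow> nat \<Rightarrow> nat \<Rightarrow> 'a \<Rightarrow> real" where
  "mart i m j \<omega> = (\<Sum>l<2 ^ m. c i (j1 m j + l) * (G i (j0 m j) (j1 m j) (j1 m j + l) \<omega> - A i (j0 m j) (j1 m j + l) \<omega>))"

lemma bias_block_O: "Lp_O J (\<lambda>((i, m), j). bias i m j) (\<lambda>((i, m), j). len i m powr (3 * H))"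
proof -
  have 1: "Lp_O J2 (\<lambda>p \<omega>. (\<lambda>(((i, m), j), l). c i (j1 m j + l)) p * (\<lambda>(((i, m), j), l) \<omega>. A i (j1 m j) (j1 m j + l) \<omega>
       - G i (j0 m j) (j1 m j) (j1 m j + l) \<omega>) p \<omega>)
     (\<lambda>(((i, m), j), l). len i m powr (2 * H) * w i l)"
    by (rule Lp_O_cmult[OF bias_O, where K = 1]) (use c in \<open>auto simp: J2_iff\<close>)
  have 2: "Lp_O (SIGMA b:J. {..<2 ^ snd (fst b)}) (\<lambda>(b, l). (\<lambda>((i, m), j) \<omega>. c i (j1 m j + l) * (A i (j1 m j) (j1 m j + l) \<omega>
       - G i (j0 m j) (j1 m j) (j1 m j + l) \<omega>)) b)
     (\<lambda>(b, l). (\<lambda>((i, m), j). len i m powr (2 * H) * w i l) b)"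
    by (rule Lp_O_cong[OF 1[unfolded J2_def]]) auto
  have 3: "Lp_O J (\<lambda>((i, m), j). bias i m j) (\<lambda>((i, m), j). \<Sum>l<2 ^ m. len i m powr (2 * H) * w i l)"
    by (rule Lp_O_cong[OF Lp_O_sum[OF 2]]) (auto simp: bias_def)
  show ?thesis
  proof (rule Lp_O_scale[OF 3, where K = "1 / H"])
    fix p assume "p \<in> J"
    then obtain i m j where p: "p = ((i, m), j)" "((i, m), j) \<in> J" by (metis surj_pair)
    have "(\<Sum>l<2 ^ m. len i m powr (2 * H) * w i l) = len i m powr (2 * H) * (\<Sum>l<2 ^ m. w i l)"
      by (simp add: sum_distrib_left)
    also have "\<dots> \<le> len i m powr (2 * H) * (1 / H * len i m powr H)"
      using p(2) by (intro mult_left_mono w_sum) (auto simp: J_iff)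
    also have "\<dots> = 1 / H * len i m powr (3 * H)"
      using powr_add[of "len i m" "2 * H" H, symmetric] by simp
    finally show "((\<lambda>((i, m), j). \<Sum>l<2 ^ m. len i m powr (2 * H) * w i l) p)
        \<le> 1 / H * ((\<lambda>((i, m), j). len i m powr (3 * H)) p)"
      unfolding p(1) by simp
  qed auto
qed

text \<open>Inside a block the terms are simply added up; the square root is gained between
  different blocks.\<close>

lemma mart_block_O: "Lp_O J (\<lambda>((i, m), j). mart i m j) (\<lambda>((i, m), j). len i m powr H)"
proof -
  have 1: "Lp_O J2 (\<lambda>p \<omega>. (\<lambda>(((i, m), j), l). c i (j1 m j + l)) p * ((\<lambda>(((i, m), j), l). G i (j0 m j) (j1 m j) (j1 m j + l)) p \<omega>
       - (\<lambda>(((i, m), j), l). A i (j0 m j) (j1 m j + l)) p \<omega>))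
     (\<lambda>p. (\<lambda>(((i, m), j), l). w i l) p + (\<lambda>(((i, m), j), l). w i l) p)"
    by (rule Lp_O_cmult[OF Lp_O_diff[OF G_block_O A_block_O], where K = 1]) (use c in \<open>auto simp: J2_iff\<close>)
  have 2: "Lp_O (SIGMA b:J. {..<2 ^ snd (fst b)}) (\<lambda>(b, l). (\<lambda>((i, m), j) \<omega>. c i (j1 m j + l) * (G i (j0 m j) (j1 m j) (j1 m j + l) \<omega>
       - A i (j0 m j) (j1 m j + l) \<omega>)) b)
     (\<lambda>(b, l). (\<lambda>((i, m), j). 2 * w i l) b)"
    by (rule Lp_O_cong[OF 1[unfolded J2_def]]) auto
  have 3: "Lp_O J (\<lambda>((i, m), j). mart i m j) (\<lambda>((i, m), j). \<Sum>l<2 ^ m. 2 * w i l)"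
    by (rule Lp_O_cong[OF Lp_O_sum[OF 2]]) (auto simp: mart_def)
  show ?thesis
  proof (rule Lp_O_scale[OF 3, where K = "2 / H"])
    fix p assume "p \<in> J"
    then obtain i m j where p: "p = ((i, m), j)" "((i, m), j) \<in> J" by (metis surj_pair)
    have "(\<Sum>l<2 ^ m. 2 * w i l) = 2 * (\<Sum>l<2 ^ m. w i l)"
      by (simp add: sum_distrib_left)
    also have "\<dots> \<le> 2 * (1 / H * len i m powr H)"
      using p(2) by (intro mult_left_mono w_sum) (auto simp: J_iff)
    finally show "((\<lambda>((i, m), j). \<Sum>l<2 ^ m. 2 * w i l) p)
        \<le> 2 / H * ((\<lambda>((i, m), j). len i m powr H) p)"
      unfolding p(1) by simp
  qed auto
qed

lemma mart_past:
  assumes "((i, m), j) \<in> J"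
  shows "mart i m j \<in> borel_measurable (past (t i (j1 m j)))" "moments (mart i m j)"
proof -
  have p: "(((i, m), j), l) \<in> J2" if "l < 2 ^ m" for l
    using assms that by (simp add: J2_iff J_iff)
  have P: "(i, j1 m j, j1 m j + l) \<in> P" "(i, j0 m j, j1 m j + l) \<in> P" if "l < 2 ^ m" for l
    using J2_P[OF p[OF that]] by auto
  note P' = J_P[OF assms]
  show "mart i m j \<in> borel_measurable (past (t i (j1 m j)))"
    unfolding mart_def[abs_def]
    by (intro borel_measurable_sum borel_measurable_times borel_measurable_const borel_measurable_diff G_past
        past_measurable_mono[OF t_mono A_past] P P' P_D[OF P']) auto
  show "moments (mart i m j)"
    unfolding mart_def[abs_def]
    by (intro moments_sum moments_mult moments_const moments_diff moments_G moments_A P P') auto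
qed

text \<open>Both parts of each summand have the same expectation against \<open>\<Psi>\<close>,
  namely that of the polynomial \<open>Z\<close> at \<open>t j0\<close>.\<close>

lemma mart_orth:
  assumes J: "((i, m), j) \<in> J" and \<Psi>: "\<Psi> \<in> borel_measurable (past (t i (j0 m j)))" "moments \<Psi>"
  shows "expectation (\<lambda>\<omega>. \<Psi> \<omega> * mart i m j \<omega>) = 0"
proof -
  have p: "(((i, m), j), l) \<in> J2" if "l < 2 ^ m" for l
    using J that by (simp add: J2_iff J_iff)
  have P: "(i, j1 m j, j1 m j + l) \<in> P" "(i, j0 m j, j1 m j + l) \<in> P" if "l < 2 ^ m" for l
    using J2_P[OF p[OF that]] by auto
  note P' = J_P[OF J]
  have int: "integrable M (\<lambda>\<omega>. \<Psi> \<omega> * G i (j0 m j) (j1 m j) (j1 m j + l) \<omega>)"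
    "integrable M (\<lambda>\<omega>. \<Psi> \<omega> * A i (j0 m j) (j1 m j + l) \<omega>)" if "l < 2 ^ m" for l
    by (intro moments_integrable moments_mult \<Psi>(2) moments_G moments_A P[OF that] P')+
  have "expectation (\<lambda>\<omega>. \<Psi> \<omega> * mart i m j \<omega>)
      = expectation (\<lambda>\<omega>. \<Sum>l<2 ^ m. c i (j1 m j + l) * (\<Psi> \<omega> * G i (j0 m j) (j1 m j) (j1 m j + l) \<omega> - \<Psi> \<omega> * A i (j0 m j) (j1 m j + l) \<omega>))"
    by (simp add: mart_def sum_distrib_left algebra_simps)
  also have "\<dots> = (\<Sum>l<2 ^ m. c i (j1 m j + l) * (expectation (\<lambda>\<omega>. \<Psi> \<omega> * G i (j0 m j) (j1 m j) (j1 m j + l) \<omega>)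
      - expectation (\<lambda>\<omega>. \<Psi> \<omega> * A i (j0 m j) (j1 m j + l) \<omega>)))"
    using int by (subst Bochner_Integration.integral_sum) auto
  also have "\<dots> = 0"
    using G_orth[OF P(1) P' \<Psi>] A_orth[OF P(2) \<Psi>] by (intro sum.neutral) auto
  finally show ?thesis .
qed

section \<open>Summation over the scales\<close>

text \<open>Every \<open>k\<close> is conditioned at the left end of its dyadic block of
  \<open>2 ^ m\<close> meshes: at \<open>t k\<close> itself for \<open>m = 0\<close>, and at the
  first grid point for \<open>m = L i\<close>.\<close>

definition S :: "'i \<Rightarrow> nat \<Rightarrow> 'a \<Rightarrow> real" where
  "S i m \<omega> = (\<Sum>k<2 ^ L i. c i k * A i (2 ^ m * (k div 2 ^ m)) k \<omega>)"

lemma S_step: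
  assumes m: "m < L i"
  shows "S i m \<omega> - S i (Suc m) \<omega> = (\<Sum>j<2 ^ (L i - m - 1). bias i m j \<omega> + mart i m j \<omega>)"
proof -
  define g where "g k = c i k * (A i (2 ^ m * (k div 2 ^ m)) k \<omega> - A i (2 ^ Suc m * (k div 2 ^ Suc m)) k \<omega>)" for k
  have "S i m \<omega> - S i (Suc m) \<omega> = (\<Sum>k<2 ^ (L i - m - 1) * 2 ^ Suc m. g k)"
    unfolding S_def g_def pow_split[OF m, where 'b = nat] by (simp add: sum_subtractf[symmetric] right_diff_distrib)
  also have "\<dots> = (\<Sum>j<2 ^ (L i - m - 1). sum g {j * 2 ^ Suc m..<j * 2 ^ Suc m + 2 ^ Suc m})"
    by (rule sum.nat_group[symmetric])
  also have "\<dots> = (\<Sum>j<2 ^ (L i - m - 1). bias i m j \<omega> + mart i m j \<omega>)"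
  proof (rule sum.cong[OF refl])
    fix j
    have "sum g {j * 2 ^ Suc m..<j * 2 ^ Suc m + 2 ^ Suc m}
        = sum g {j0 m j..<j0 m j + 2 ^ m} + sum g {j1 m j..<j1 m j + 2 ^ m}"
    proof -
      have eq: "j * 2 ^ Suc m = j0 m j" "j0 m j + 2 ^ Suc m = j1 m j + 2 ^ m" "j0 m j + 2 ^ m = j1 m j"
        by (simp_all add: j0_def j1_def)
      show ?thesis
        unfolding eq by (rule sum.atLeastLessThan_concat[symmetric]) (auto simp: j0_def j1_def)
    qed
    \<comment> \<open>In the left half both scales condition at \<open>j0 m j\<close>, so nothing
      changes there.\<close>
    moreover have "sum g {j0 m j..<j0 m j + 2 ^ m} = 0"
    proof (rule sum.neutral, rule ballI)
      fix k assume "k \<in> {j0 m j..<j0 m j + 2 ^ m}"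
      then obtain l where k: "k = j0 m j + l" "l < 2 ^ m"
        by (metis add_less_cancel_left atLeastLessThan_iff le_Suc_ex)
      have "k div 2 ^ m = 2 * j" "k div 2 ^ Suc m = j"
        using k by (auto simp: j0_def intro!: div_nat_eqI)
      moreover have "(2 :: nat) ^ m * (2 * j) = 2 ^ Suc m * j" by simp
      ultimately show "g k = 0" by (simp only: g_def) simp
    qed
    moreover have "sum g {j1 m j..<j1 m j + 2 ^ m} = (\<Sum>l<2 ^ m. g (j1 m j + l))"
      using sum.shift_bounds_nat_ivl[of g 0 "j1 m j" "2 ^ m"] by (simp add: atLeast0LessThan add.commute)
    moreover have "g (j1 m j + l) = c i (j1 m j + l) * (A i (j1 m j) (j1 m j + l) \<omega> - A i (j0 m j) (j1 m j + l) \<omega>)"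
      if "l < 2 ^ m" for l
    proof -
      have "(j1 m j + l) div 2 ^ m = 2 * j + 1" "(j1 m j + l) div 2 ^ Suc m = j"
        using that by (auto simp: j1_def intro!: div_nat_eqI)
      then show ?thesis by (simp add: g_def j0_def j1_def algebra_simps)
    qed
    ultimately show "sum g {j * 2 ^ Suc m..<j * 2 ^ Suc m + 2 ^ Suc m} = bias i m j \<omega> + mart i m j \<omega>"
      by (simp add: bias_def mart_def sum.distrib[symmetric] right_diff_distrib)
  qed
  finally show ?thesis .
qed

text \<open>There are at most \<open>T / len\<close> blocks, so a power \<open>g\<close> per block
  becomes \<open>g - 1\<close>, which is at least \<open>rate - 1\<close>.\<close>

lemma blocks_powr:
  assumes i: "i \<in> I" and m: "m < L i" and g: "rate \<le> g"
  shows "2 ^ (L i - m - 1) * len i m powr g \<le> T * T powr (g - rate) * len i m powr (rate - 1)"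
proof -
  note l = len_bounds[OF i, of m]
  have "2 ^ (L i - m - 1) * len i m powr g = (2 ^ (L i - m - 1) * len i m) * len i m powr (g - 1)"
    using l m by (simp add: powr_diff)
  also have "\<dots> \<le> T * (T powr (g - 1 - (rate - 1)) * len i m powr (rate - 1))"
    using l m g blocks_len[OF i m] by (intro mult_mono powr_le_powr_bounded) auto
  finally show ?thesis by (simp add: algebra_simps)
qed

lemma bias_level_O: "Lp_O IM (\<lambda>(i, m) \<omega>. \<Sum>j<2 ^ (L i - m - 1). bias i m j \<omega>) (\<lambda>(i, m). len i m powr (rate - 1))"
proof -
  have 1: "Lp_O (SIGMA p:IM. {..<2 ^ (L (fst p) - snd p - 1)}) (\<lambda>(p, j). (\<lambda>(i, m). bias i m j) p)
      (\<lambda>(p, j). (\<lambda>(i, m). len i m powr (3 * H)) p)"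
    by (rule Lp_O_cong[OF bias_block_O[unfolded J_def]]) auto
  have 2: "Lp_O IM (\<lambda>(i, m) \<omega>. \<Sum>j<2 ^ (L i - m - 1). bias i m j \<omega>) (\<lambda>(i, m). 2 ^ (L i - m - 1) * len i m powr (3 * H))"
    by (rule Lp_O_cong[OF Lp_O_sum[OF 1]]) auto
  show ?thesis
    by (rule Lp_O_scale[OF 2, where K = "T * T powr (3 * H - rate)"])
      (use blocks_powr[where g = "3 * H"] rate in \<open>auto simp: IM_def\<close>)
qed

lemma mart_level_O: "Lp_O IM (\<lambda>(i, m) \<omega>. \<Sum>j<2 ^ (L i - m - 1). mart i m j \<omega>) (\<lambda>(i, m). len i m powr (rate - 1))"
proof -
  have 1: "Lp_O (SIGMA p:IM. {..<2 ^ (L (fst p) - snd p - 1)}) (\<lambda>(p, j). (\<lambda>p j. (\<lambda>(i, m). mart i m j) p) p j)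
      (\<lambda>(p, j). (\<lambda>(i, m). len i m powr H) p)"
    by (rule Lp_O_cong[OF mart_block_O[unfolded J_def]]) auto
  have 2: "Lp_O IM (\<lambda>p \<omega>. \<Sum>j<2 ^ (L (fst p) - snd p - 1). (\<lambda>p j. (\<lambda>(i, m). mart i m j) p) p j \<omega>)
      (\<lambda>p. sqrt (real (2 ^ (L (fst p) - snd p - 1))) * (\<lambda>(i, m). len i m powr H) p)"
  proof (rule Lp_O_martingale[OF 1])
    fix p and j r :: nat assume "p \<in> IM" and j: "j < 2 ^ (L (fst p) - snd p - 1)"
    then obtain i m where p: "p = (i, m)" "i \<in> I" "m < L i" by (auto simp: IM_def)
    have J: "((i, m), j') \<in> J" if "j' \<le> j" for j'
      using p j that by (simp add: J_iff)
    \<comment> \<open>The midpoint of an earlier block precedes the start of a later one. Hence the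
      earlier terms belong to the past to which the later term is orthogonal.\<close>
    have le: "j1 m j' \<le> j0 m j" if "j' < j" for j'
    proof -
      have "j1 m j' \<le> Suc j' * 2 ^ Suc m" by (simp add: j1_def)
      also have "\<dots> \<le> j0 m j" unfolding j0_def using that by (intro mult_right_mono) auto
      finally show ?thesis .
    qed
    have "(\<lambda>\<omega>. (\<Sum>j'<j. mart i m j' \<omega>) ^ r) \<in> borel_measurable (past (t i (j0 m j)))"
      using le by (intro borel_measurable_power borel_measurable_sum past_measurable_mono[OF t_mono[OF p(2)] mart_past(1)] J) auto
    moreover have "moments (\<lambda>\<omega>. (\<Sum>j'<j. mart i m j' \<omega>) ^ r)"
      by (intro moments_power moments_sum mart_past(2) J) auto
    ultimately show "expectation (\<lambda>\<omega>. (\<Sum>j'<j. (\<lambda>p j. (\<lambda>(i, m). mart i m j) p) p j' \<omega>) ^ r * (\<lambda>p j. (\<lambda>(i, m). mart i m j) p) p j \<omega>) = 0"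
      unfolding p(1) prod.case by (intro mart_orth J) auto
  qed (auto split: prod.splits)
  have 3: "Lp_O IM (\<lambda>(i, m) \<omega>. \<Sum>j<2 ^ (L i - m - 1). mart i m j \<omega>) (\<lambda>(i, m). sqrt (2 ^ (L i - m - 1)) * len i m powr H)"
    by (rule Lp_O_cong[OF 2]) auto
  have "sqrt (2 ^ (L i - m - 1)) * len i m powr H \<le> sqrt T * T powr (H + 1/2 - rate) * len i m powr (rate - 1)"
    if i: "i \<in> I" and m: "m < L i" for i m
  proof -
    note l = len_bounds[OF i, of m]
    \<comment> \<open>With at most \<open>T / len\<close> blocks, the square root of their number
      costs \<open>len powr (- 1/2)\<close>; so half a power of \<open>len\<close> is split
      off.\<close>
    have "len i m powr H = sqrt (len i m) * len i m powr (H - 1/2)"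
      using l m by (simp add: powr_half_sqrt[symmetric] powr_add[symmetric])
    then have "sqrt (2 ^ (L i - m - 1)) * len i m powr H = sqrt (2 ^ (L i - m - 1) * len i m) * len i m powr (H - 1/2)"
      by (simp add: real_sqrt_mult)
    also have "\<dots> \<le> sqrt T * (T powr (H - 1/2 - (rate - 1)) * len i m powr (rate - 1))"
      using l m rate blocks_len[OF i m] by (intro mult_mono powr_le_powr_bounded real_sqrt_le_mono) auto
    finally show ?thesis by (simp add: algebra_simps)
  qed
  then show ?thesis
    by (intro Lp_O_scale[OF 3, where K = "sqrt T * T powr (H + 1/2 - rate)"]) (auto simp: IM_def)
qed

lemma levels_O: "Lp_O I (\<lambda>i \<omega>. S i 0 \<omega> - S i (L i) \<omega>) (\<lambda>i. D i powr (rate - 1))"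
proof -
  have 1: "Lp_O (SIGMA i:I. {..<L i}) (\<lambda>(i, m) \<omega>. S i m \<omega> - S i (Suc m) \<omega>) (\<lambda>(i, m). 2 * len i m powr (rate - 1))"
    by (rule Lp_O_cong[OF Lp_O_add[OF bias_level_O mart_level_O, unfolded IM_def]]) (auto simp: S_step sum.distrib)
  have 2: "Lp_O I (\<lambda>i \<omega>. S i 0 \<omega> - S i (L i) \<omega>) (\<lambda>i. \<Sum>m<L i. 2 * len i m powr (rate - 1))"
    by (rule Lp_O_cong[OF Lp_O_sum[where Z = "\<lambda>i m \<omega>. S i m \<omega> - S i (Suc m) \<omega>" and s = "\<lambda>i m. 2 * len i m powr (rate - 1)", OF 1]])
      (use sum_lessThan_telescope'[of "\<lambda>m. S i m \<omega>" "L i" for i \<omega>] in auto)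
  show ?thesis
  proof (rule Lp_O_scale[OF 2, where K = "2 * (1 / (1 - 2 powr (rate - 1)))"])
    fix i assume i: "i \<in> I"
    have "(\<Sum>m<L i. 2 * len i m powr (rate - 1)) = 2 * (\<Sum>m<L i. (2 ^ m * D i) powr (rate - 1))"
      by (simp add: len_def sum_distrib_left)
    also have "\<dots> \<le> 2 * (1 / (1 - 2 powr (rate - 1)) * D i powr (rate - 1))"
      using rate D[OF i] by (intro mult_left_mono sum_dyadic_le) auto
    finally show "(\<Sum>m<L i. 2 * len i m powr (rate - 1)) \<le> 2 * (1 / (1 - 2 powr (rate - 1))) * D i powr (rate - 1)"
      by simp
  qed auto
qed

text \<open>At the coarsest scale everything is conditioned on the past of the first grid point. The
  weights sum to a constant, which is of the required order because \<open>D powr (rate - 1)\<close>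
  is bounded below.\<close>

lemma top_O: "Lp_O I (\<lambda>i. S i (L i)) (\<lambda>i. D i powr (rate - 1))"
proof -
  have "Lp_O (SIGMA i:I. {..<2 ^ L i}) (\<lambda>y. (\<lambda>(i, j, k). A i j k) ((\<lambda>(i, k). (i, 0, k)) y))
      (\<lambda>y. (\<lambda>(i, j, k). w i (k - j)) ((\<lambda>(i, k). (i, 0, k)) y))"
    by (rule Lp_O_reindex[OF A_O]) (auto simp: P_def)
  then have 1: "Lp_O (SIGMA i:I. {..<2 ^ L i}) (\<lambda>(i, k). A i 0 k) (\<lambda>(i, k). w i k)"
    by (rule Lp_O_cong) auto
  have 2: "Lp_O (SIGMA i:I. {..<2 ^ L i}) (\<lambda>(i, k) \<omega>. c i k * A i 0 k \<omega>) (\<lambda>(i, k). w i k)"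
    by (rule Lp_O_cong[OF Lp_O_cmult[OF 1, where c = "\<lambda>(i, k). c i k" and K = 1]]) (use c in auto)
  have 3: "Lp_O I (\<lambda>i. S i (L i)) (\<lambda>i. \<Sum>k<2 ^ L i. w i k)"
    by (rule Lp_O_cong[OF Lp_O_sum[where Z = "\<lambda>i k \<omega>. c i k * A i 0 k \<omega>" and s = w, OF 2]])
      (auto simp: S_def intro!: sum.cong)
  show ?thesis
  proof (rule Lp_O_scale[OF 3, where K = "1 / H * (T powr H * T powr (1 - rate))"])
    fix i assume i: "i \<in> I"
    have "len i (L i) powr H \<le> T powr H"
      using len_bounds[OF i, of "L i"] H by (intro powr_mono2) auto
    moreover have "1 \<le> T powr (1 - rate) * D i powr (rate - 1)"
      using powr_le_powr_bounded[of "D i" T "rate - 1" 0] D[OF i] D_le_T'[OF i] rate by simp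
    ultimately have "len i (L i) powr H * 1 \<le> T powr H * (T powr (1 - rate) * D i powr (rate - 1))"
      by (intro mult_mono) auto
    then have "1 / H * len i (L i) powr H \<le> 1 / H * (T powr H * (T powr (1 - rate) * D i powr (rate - 1)))"
      using H by (intro mult_left_mono) auto
    then show "(\<Sum>k<2 ^ L i. w i k) \<le> 1 / H * (T powr H * T powr (1 - rate)) * D i powr (rate - 1)"
      using w_sum[OF i, of "L i"] by (simp only: mult.assoc)
  qed auto
qed

section \<open>The finest scale\<close>

definition KI :: "('i \<times> nat) set" where "KI = (SIGMA i:I. {..<2 ^ L i})"

lemma KI_P: "(i, k) \<in> KI \<Longrightarrow> (i, k, k) \<in> P"
  by (auto simp: KI_def P_def)

text \<open>The polynomial minus its projection on the past of \<open>t k\<close>. It is known by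
  the next grid point, since \<open>x\<close> does not exceed the mesh; so these are martingale
  differences of size \<open>D powr H\<close>, one per mesh.\<close>

lemma fine_mart_O: "Lp_O I (\<lambda>i \<omega>. \<Sum>k<2 ^ L i. c i k * (Z i k k \<omega> - A i k k \<omega>)) (\<lambda>i. D i powr (rate - 1))"
proof -
  have Ak: "Lp_O KI (\<lambda>(i, k). A i k k) (\<lambda>(i, k). D i powr H)"
    by (rule Lp_O_cong[OF Lp_O_reindex[OF A_O, of KI "\<lambda>(i, k). (i, k, k)"]]) (auto simp: KI_P w_def)
  have b: "Lp_O KI (\<lambda>(i, k). \<beta> i k) (\<lambda>(i, k). D i powr H)"
    by (rule Lp_O_cong[OF Lp_O_reindex[OF \<beta>_O, of KI "\<lambda>(i, k). (i, k, k)"]]) (auto simp: KI_P)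
  have z1: "Lp_O KI (\<lambda>p \<omega>. (\<lambda>(i, k) \<omega>. f1 (Y i (t i k) \<omega>)) p \<omega> * (\<lambda>(i, k). \<beta> i k) p \<omega>) (\<lambda>(i, k). D i powr H)"
    by (rule Lp_O_bounded_mult[OF b, where K = K]) (auto simp: f_bounded KI_def intro!: f_Y_measurable)
  have z2: "Lp_O KI (\<lambda>p \<omega>. (\<lambda>(i, k) \<omega>. f2 (Y i (t i k) \<omega>)) p \<omega> * ((\<lambda>(i, k). \<beta> i k) p \<omega> * (\<lambda>(i, k). \<beta> i k) p \<omega>))
      (\<lambda>p. (\<lambda>(i, k). D i powr H) p * (\<lambda>(i, k). D i powr H) p)"
    by (rule Lp_O_bounded_mult[OF Lp_O_mult[OF b b], where K = K]) (auto simp: f_bounded KI_def intro!: f_Y_measurable)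
  have z: "Lp_O KI (\<lambda>(i, k) \<omega>. c i k * (Z i k k \<omega> - A i k k \<omega>)) (\<lambda>(i, k). D i powr H + D i powr H * D i powr H + D i powr H)"
    by (rule Lp_O_cong[OF Lp_O_cmult[OF Lp_O_diff[OF Lp_O_add[OF z1 Lp_O_cmult[OF z2, where c = "\<lambda>_. 1/2" and K = 1]] Ak],
            where c = "\<lambda>(i, k). c i k" and K = 1]])
      (use c in \<open>auto simp: KI_def Z_def \<beta>_def \<gamma>_def power2_eq_square\<close>)
  have 1: "Lp_O KI (\<lambda>(i, k) \<omega>. c i k * (Z i k k \<omega> - A i k k \<omega>)) (\<lambda>(i, k). D i powr H)"
  proof (rule Lp_O_scale[OF z, where K = "2 + T powr H"])
    fix p assume "p \<in> KI"
    then obtain i k where p: "p = (i, k)" "i \<in> I" by (auto simp: KI_def)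
    have "D i powr H \<le> T powr H" using D_le_T'[OF p(2)] D[OF p(2)] H by (intro powr_mono2) auto
    then have "D i powr H * D i powr H \<le> T powr H * D i powr H" by (intro mult_right_mono) auto
    then show "((\<lambda>(i, k). D i powr H + D i powr H * D i powr H + D i powr H) p) \<le> (2 + T powr H) * ((\<lambda>(i, k). D i powr H) p)"
      unfolding p(1) by (simp add: distrib_right)
  qed auto
  have 2: "Lp_O I (\<lambda>i \<omega>. \<Sum>k<2 ^ L i. (\<lambda>i k \<omega>. c i k * (Z i k k \<omega> - A i k k \<omega>)) i k \<omega>) (\<lambda>i. sqrt (real (2 ^ L i)) * D i powr H)"
  proof (rule Lp_O_martingale[where D = "\<lambda>i k \<omega>. c i k * (Z i k k \<omega> - A i k k \<omega>)", OF 1[unfolded KI_def]])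
    fix i k r assume i: "i \<in> I" and k: "k < (2 :: nat) ^ L i"
    have P: "(i, k', k') \<in> P" if "k' \<le> k" for k' using i k that by (auto simp: P_def)
    let ?\<Psi> = "\<lambda>\<omega>. (\<Sum>j<k. c i j * (Z i j j \<omega> - A i j j \<omega>)) ^ r"
    have "Z i j j \<in> borel_measurable (past (t i k))" if "j < k" for j
    proof -
      have "B (t i j + x i) \<in> borel_measurable (past (t i k))" "B (t i j) \<in> borel_measurable (past (t i k))"
        using t_x_le[OF i that] t_nonneg[OF i, of j] x[OF i] t_mono[OF i, of j k] that
        by (auto intro!: B_past_measurable)
      moreover have "j \<le> 2 ^ L i" "j \<le> k" using that k by auto
      note f_Y_past[OF i this]
      ultimately show ?thesis
        unfolding Z_def[abs_def] \<beta>_def \<gamma>_def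
        by (intro borel_measurable_add borel_measurable_times borel_measurable_diff borel_measurable_power)
    qed
    moreover have "A i j j \<in> borel_measurable (past (t i k))" if "j < k" for j
      using that by (intro past_measurable_mono[OF t_mono[OF i] A_past] P) auto
    ultimately have \<Psi>1: "?\<Psi> \<in> borel_measurable (past (t i k))"
      by (intro borel_measurable_power borel_measurable_sum borel_measurable_times borel_measurable_diff) auto
    have \<Psi>2: "moments ?\<Psi>"
      by (intro moments_power moments_sum moments_mult moments_const moments_diff moments_Z moments_A P) auto
    have int: "integrable M (\<lambda>\<omega>. ?\<Psi> \<omega> * Z i k k \<omega>)" "integrable M (\<lambda>\<omega>. ?\<Psi> \<omega> * A i k k \<omega>)"
      by (intro moments_integrable moments_mult \<Psi>2 moments_Z moments_A P order_refl)+
    have "expectation (\<lambda>\<omega>. ?\<Psi> \<omega> * (c i k * (Z i k k \<omega> - A i k k \<omega>)))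
        = expectation (\<lambda>\<omega>. c i k * (?\<Psi> \<omega> * Z i k k \<omega> - ?\<Psi> \<omega> * A i k k \<omega>))"
      by (simp add: algebra_simps)
    also have "\<dots> = 0"
      using int A_orth[OF P[OF order_refl] \<Psi>1 \<Psi>2] by simp
    finally show "expectation (\<lambda>\<omega>. (\<Sum>j<k. c i j * (Z i j j \<omega> - A i j j \<omega>)) ^ r * (c i k * (Z i k k \<omega> - A i k k \<omega>))) = 0" .
  qed auto
  show ?thesis
  proof (rule Lp_O_scale[OF 2, where K = "sqrt T * T powr (H + 1/2 - rate)"])
    fix i assume i: "i \<in> I"
    have "D i powr H = sqrt (D i) * D i powr (H - 1/2)"
      using D[OF i] by (simp add: powr_half_sqrt[symmetric] powr_add[symmetric])
    then have "sqrt (real (2 ^ L i)) * D i powr H = sqrt (2 ^ L i * D i) * D i powr (H - 1/2)"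
      by (simp add: real_sqrt_mult)
    also have "\<dots> \<le> sqrt T * (T powr (H - 1/2 - (rate - 1)) * D i powr (rate - 1))"
      using D[OF i] rate D_le_T[OF i] D_le_T'[OF i] by (intro mult_mono powr_le_powr_bounded real_sqrt_le_mono) auto
    finally show "sqrt (real (2 ^ L i)) * D i powr H \<le> sqrt T * T powr (H + 1/2 - rate) * D i powr (rate - 1)"
      by (simp add: algebra_simps)
  qed auto
qed

text \<open>Per mesh the Taylor remainder is of order \<open>D powr (3 * H)\<close> and the drift of
  order \<open>D\<close>, both within \<open>D powr rate\<close>. The \<open>2 ^ L\<close> meshes
  are summed without cancellation.\<close>

lemma fine_taylor_O: "Lp_O I (\<lambda>i \<omega>. \<Sum>k<2 ^ L i. c i k * (f (Y i (t i k + x i) \<omega>) - f (Y i (t i k) \<omega>) - Z i k k \<omega>))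
    (\<lambda>i. D i powr (rate - 1))"
proof -
  have b: "Lp_O KI (\<lambda>(i, k). \<beta> i k) (\<lambda>(i, k). D i powr H)"
    by (rule Lp_O_cong[OF Lp_O_reindex[OF \<beta>_O, of KI "\<lambda>(i, k). (i, k, k)"]]) (auto simp: KI_P)
  have "Lp_O KI (\<lambda>y. (\<lambda>(i, s, t) \<omega>. Y i t \<omega> - Y i s \<omega> - (B t \<omega> - B s \<omega>)) ((\<lambda>(i, k). (i, t i k, t i k + x i)) y))
     (\<lambda>y. (\<lambda>(i, s, t). t - s) ((\<lambda>(i, k). (i, t i k, t i k + x i)) y))"
    by (rule Lp_O_reindex[OF drift]) (auto simp: KI_def t_nonneg t_x_le_T x)
  then have d0: "Lp_O KI (\<lambda>(i, k) \<omega>. Y i (t i k + x i) \<omega> - Y i (t i k) \<omega> - \<beta> i k \<omega>) (\<lambda>(i, k). x i)"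
    by (rule Lp_O_cong) (auto simp: \<beta>_def)
  have d: "Lp_O KI (\<lambda>(i, k) \<omega>. Y i (t i k + x i) \<omega> - Y i (t i k) \<omega> - \<beta> i k \<omega>) (\<lambda>(i, k). D i)"
    by (rule Lp_O_scale[OF d0, where K = 1]) (use x D in \<open>auto simp: KI_def less_imp_le\<close>)
  let ?d = "\<lambda>(i, k) \<omega>. Y i (t i k + x i) \<omega> - Y i (t i k) \<omega> - \<beta> i k \<omega>" and ?b = "\<lambda>(i, k). \<beta> i k"
  have dH: "Lp_O KI ?d (\<lambda>(i, k). D i powr H)"
  proof (rule Lp_O_scale[OF d, where K = "T powr (1 - H)"])
    fix p assume "p \<in> KI"
    then obtain i k where p: "p = (i, k)" "i \<in> I" by (auto simp: KI_def)
    have "D i powr 1 \<le> T powr (1 - H) * D i powr H"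
      using D[OF p(2)] D_le_T'[OF p(2)] H by (intro powr_le_powr_bounded) auto
    then show "((\<lambda>(i, k). D i) p) \<le> T powr (1 - H) * ((\<lambda>(i, k). D i powr H) p)"
      unfolding p(1) using D[OF p(2)] by simp
  qed auto
  have dY: "Lp_O KI (\<lambda>p \<omega>. ?d p \<omega> + ?b p \<omega>) (\<lambda>p. (\<lambda>(i, k). D i powr H) p + (\<lambda>(i, k). D i powr H) p)"
    by (rule Lp_O_add[OF dH b])
  let ?y = "\<lambda>(i, k) \<omega>. Y i (t i k + x i) \<omega> - Y i (t i k) \<omega>"
  have y: "Lp_O KI ?y (\<lambda>(i, k). D i powr H)"
    by (rule Lp_O_scale[OF Lp_O_cong[OF dY, where s' = "\<lambda>(i, k). 2 * D i powr H"], where K = 2]) auto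
  have abs: "Lp_O KI' (\<lambda>p \<omega>. \<bar>Q p \<omega>\<bar>) s" if "Lp_O KI' Q s" for KI' :: "('i \<times> nat) set" and Q s
    by (rule Lp_O_dom[OF that, where K = 1]) (use Lp_O_measurable[OF that] in auto)
  have R: "Lp_O KI (\<lambda>p \<omega>. \<bar>?y p \<omega> * (?y p \<omega> * ?y p \<omega>)\<bar> + (\<bar>?d p \<omega>\<bar> + \<bar>?d p \<omega> * (?b p \<omega> + ?y p \<omega>)\<bar>))
      (\<lambda>p. (\<lambda>(i, k). D i powr H) p * ((\<lambda>(i, k). D i powr H) p * (\<lambda>(i, k). D i powr H) p)
        + ((\<lambda>(i, k). D i) p + (\<lambda>(i, k). D i) p * ((\<lambda>(i, k). D i powr H) p + (\<lambda>(i, k). D i powr H) p)))"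
    by (intro Lp_O_add abs Lp_O_mult y d b)
  have R': "Lp_O KI (\<lambda>p \<omega>. \<bar>?y p \<omega> * (?y p \<omega> * ?y p \<omega>)\<bar> + (\<bar>?d p \<omega>\<bar> + \<bar>?d p \<omega> * (?b p \<omega> + ?y p \<omega>)\<bar>)) (\<lambda>(i, k). D i powr rate)"
  proof (rule Lp_O_scale[OF R, where K = "T powr (3 * H - rate) + (1 + 2 * T powr H) * T powr (1 - rate)"])
    fix p assume "p \<in> KI"
    then obtain i k where p: "p = (i, k)" "i \<in> I" by (auto simp: KI_def)
    note Di = D[OF p(2)] D_le_T'[OF p(2)]
    have "D i powr H * (D i powr H * D i powr H) = D i powr (3 * H)"
      by (simp add: powr_add[symmetric])
    also have "\<dots> \<le> T powr (3 * H - rate) * D i powr rate"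
      using Di rate by (intro powr_le_powr_bounded) auto
    finally have 1: "D i powr H * (D i powr H * D i powr H) \<le> T powr (3 * H - rate) * D i powr rate" .
    have 2: "D i \<le> T powr (1 - rate) * D i powr rate"
      using powr_le_powr_bounded[of "D i" T rate 1] Di rate by simp
    have 3: "D i powr H \<le> T powr H" using Di H by (intro powr_mono2) auto
    have "D i + D i * (D i powr H + D i powr H) = (1 + 2 * D i powr H) * D i" by (simp add: algebra_simps)
    also have "\<dots> \<le> (1 + 2 * T powr H) * (T powr (1 - rate) * D i powr rate)"
      using 2 3 Di by (intro mult_mono) auto
    finally have "D i powr H * (D i powr H * D i powr H) + (D i + D i * (D i powr H + D i powr H))
        \<le> T powr (3 * H - rate) * D i powr rate + (1 + 2 * T powr H) * (T powr (1 - rate) * D i powr rate)"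
      using 1 by linarith
    then show "(\<lambda>(i, k). D i powr H) p * ((\<lambda>(i, k). D i powr H) p * (\<lambda>(i, k). D i powr H) p)
        + ((\<lambda>(i, k). D i) p + (\<lambda>(i, k). D i) p * ((\<lambda>(i, k). D i powr H) p + (\<lambda>(i, k). D i powr H) p))
      \<le> (T powr (3 * H - rate) + (1 + 2 * T powr H) * T powr (1 - rate)) * ((\<lambda>(i, k). D i powr rate) p)"
      unfolding p(1) prod.case by (simp only: distrib_right mult.assoc)
  qed auto
  have 1: "Lp_O KI (\<lambda>(i, k) \<omega>. c i k * (f (Y i (t i k + x i) \<omega>) - f (Y i (t i k) \<omega>) - Z i k k \<omega>)) (\<lambda>(i, k). D i powr rate)"
  proof (rule Lp_O_dom[OF R', where K = K])
    fix p assume "p \<in> KI"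
    then obtain i k where p: "p = (i, k)" "i \<in> I" "k < 2 ^ L i" by (auto simp: KI_def)
    have [measurable]: "Y i (t i k + x i) \<in> borel_measurable M" "Y i (t i k) \<in> borel_measurable M"
      using t_nonneg[OF p(2), of k] x[OF p(2)] t_x_le_T[OF p(2,3)]
      by (auto intro!: past_measurable_imp[OF Y_past] p(2))
    have [measurable]: "Z i k k \<in> borel_measurable M"
      using p by (intro moments_measurable moments_Z KI_P) (auto simp: KI_def)
    show "(\<lambda>(i, k) \<omega>. c i k * (f (Y i (t i k + x i) \<omega>) - f (Y i (t i k) \<omega>) - Z i k k \<omega>)) p \<in> borel_measurable M"
      unfolding p(1) prod.case by measurable
    \<comment> \<open>Besides the Taylor remainder, the increment \<open>z - y\<close> is replaced
      by the increment \<open>b\<close> of the noise, to first and to second order; both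
      replacements contain the factor \<open>z - y - b\<close>, the drift.\<close>
    have *: "\<bar>a * (f z - f y - (f1 y * b + f2 y / 2 * b\<^sup>2))\<bar>
        \<le> K * \<bar>\<bar>(z - y) * ((z - y) * (z - y))\<bar> + (\<bar>z - y - b\<bar> + \<bar>(z - y - b) * (b + (z - y))\<bar>)\<bar>" if a: "\<bar>a\<bar> \<le> 1" for a z y b
    proof -
      let ?h = "z - y"
      have "f z - f y - (f1 y * b + f2 y / 2 * b\<^sup>2)
          = (f z - f y - f1 y * ?h - f2 y / 2 * ?h\<^sup>2) + f1 y * (?h - b) + f2 y / 2 * ((?h - b) * (b + ?h))"
        by (simp add: power2_eq_square field_simps)
      then have "\<bar>f z - f y - (f1 y * b + f2 y / 2 * b\<^sup>2)\<bar>
          \<le> \<bar>f z - f y - f1 y * ?h - f2 y / 2 * ?h\<^sup>2\<bar> + \<bar>f1 y\<bar> * \<bar>?h - b\<bar> + \<bar>f2 y\<bar> / 2 * \<bar>(?h - b) * (b + ?h)\<bar>"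
        by (simp add: abs_mult[symmetric] abs_divide[symmetric])
      also have "\<dots> \<le> K * \<bar>?h\<bar> ^ 3 + K * \<bar>?h - b\<bar> + K * \<bar>(?h - b) * (b + ?h)\<bar>"
        using f_bounded(2)[of y] K by (intro add_mono mult_right_mono f_taylor f_bounded) auto
      also have "\<dots> = K * \<bar>\<bar>?h * (?h * ?h)\<bar> + (\<bar>?h - b\<bar> + \<bar>(?h - b) * (b + ?h)\<bar>)\<bar>"
        by (simp add: abs_mult power3_eq_cube distrib_left mult.assoc)
      finally have "\<bar>f z - f y - (f1 y * b + f2 y / 2 * b\<^sup>2)\<bar>
        \<le> K * \<bar>\<bar>?h * (?h * ?h)\<bar> + (\<bar>?h - b\<bar> + \<bar>(?h - b) * (b + ?h)\<bar>)\<bar>" .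
      then show ?thesis
        using mult_mono[OF a, of "\<bar>f z - f y - (f1 y * b + f2 y / 2 * b\<^sup>2)\<bar>"] K by (simp add: abs_mult)
    qed
    show "AE \<omega> in M. \<bar>(\<lambda>(i, k) \<omega>. c i k * (f (Y i (t i k + x i) \<omega>) - f (Y i (t i k) \<omega>) - Z i k k \<omega>)) p \<omega>\<bar>
        \<le> K * \<bar>\<bar>?y p \<omega> * (?y p \<omega> * ?y p \<omega>)\<bar> + (\<bar>?d p \<omega>\<bar> + \<bar>?d p \<omega> * (?b p \<omega> + ?y p \<omega>)\<bar>)\<bar>"
      unfolding p(1) prod.case
    proof (rule AE_I2)
      fix \<omega>
      have "Z i k k \<omega> = f1 (Y i (t i k) \<omega>) * \<beta> i k \<omega> + f2 (Y i (t i k) \<omega>) / 2 * (\<beta> i k \<omega>)\<^sup>2"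
        by (simp add: Z_def \<beta>_def \<gamma>_def)
      then show "\<bar>c i k * (f (Y i (t i k + x i) \<omega>) - f (Y i (t i k) \<omega>) - Z i k k \<omega>)\<bar>
        \<le> K * \<bar>\<bar>(Y i (t i k + x i) \<omega> - Y i (t i k) \<omega>) * ((Y i (t i k + x i) \<omega> - Y i (t i k) \<omega>) * (Y i (t i k + x i) \<omega> - Y i (t i k) \<omega>))\<bar>
          + (\<bar>Y i (t i k + x i) \<omega> - Y i (t i k) \<omega> - \<beta> i k \<omega>\<bar>
          + \<bar>(Y i (t i k + x i) \<omega> - Y i (t i k) \<omega> - \<beta> i k \<omega>) * (\<beta> i k \<omega> + (Y i (t i k + x i) \<omega> - Y i (t i k) \<omega>))\<bar>)\<bar>"
        by (simp only:) (rule *[OF c[OF p(2)]])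
    qed
  qed
  have 2: "Lp_O I (\<lambda>i \<omega>. \<Sum>k<2 ^ L i. c i k * (f (Y i (t i k + x i) \<omega>) - f (Y i (t i k) \<omega>) - Z i k k \<omega>))
      (\<lambda>i. \<Sum>k<(2 :: nat) ^ L i. D i powr rate)"
    by (rule Lp_O_sum[OF 1[unfolded KI_def]]) auto
  show ?thesis
  proof (rule Lp_O_scale[OF 2, where K = T])
    fix i assume i: "i \<in> I"
    have "(\<Sum>k<(2 :: nat) ^ L i. D i powr rate) = (2 ^ L i * D i) * D i powr (rate - 1)"
      using D[OF i] by (simp add: powr_diff)
    also have "\<dots> \<le> T * D i powr (rate - 1)" by (intro mult_right_mono D_le_T[OF i]) auto
    finally show "(\<Sum>k<(2 :: nat) ^ L i. D i powr rate) \<le> T * D i powr (rate - 1)" .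
  qed auto
qed

text \<open>An increment of \<open>f\<close> is its Taylor remainder, plus the polynomial minus its
  projection, plus the projection; the sum of the projections is \<open>S i 0\<close>, which
  telescopes down to \<open>S i (L i)\<close>.\<close>

theorem increment_sum_O:
  "Lp_O I (\<lambda>i \<omega>. \<Sum>k<2 ^ L i. c i k * (f (Y i (t i k + x i) \<omega>) - f (Y i (t i k) \<omega>))) (\<lambda>i. D i powr (rate - 1))"
proof -
  have "Lp_O I (\<lambda>i \<omega>. \<Sum>k<2 ^ L i. c i k * (f (Y i (t i k + x i) \<omega>) - f (Y i (t i k) \<omega>))) (\<lambda>i. 4 * D i powr (rate - 1))"
    by (rule Lp_O_cong[OF Lp_O_add[OF Lp_O_add[OF fine_taylor_O fine_mart_O] Lp_O_add[OF levels_O top_O]]])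
      (simp_all add: S_def sum.distrib[symmetric] algebra_simps)
  then show ?thesis by (rule Lp_O_scale[where K = 4]) auto
qed

end

section \<open>Signed integrals\<close>

lemma jordan_pos_sets [simp, measurable_cong]: "sets (jordan_pos N \<eta>) = sets N"
  and jordan_pos_space [simp]: "space (jordan_pos N \<eta>) = space N"
  unfolding jordan_pos_def by (simp_all add: sets.sets_measure_of_eq sets.space_measure_of_eq)

lemma jordan_neg_sets [simp, measurable_cong]: "sets (jordan_neg N \<eta>) = sets N"
  and jordan_neg_space [simp]: "space (jordan_neg N \<eta>) = space N"
  unfolding jordan_neg_def by simp_all

text \<open>The values of the defining set function are real numbers, and \<open>measure_of\<close> is the zero measure
  when they are not \<open>\<sigma>\<close>-additive; hence finiteness needs no property of \<open>\<eta>\<close>.\<close>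

lemma finite_measure_jordan_pos: "finite_measure (jordan_pos N \<eta>)"
proof
  show "emeasure (jordan_pos N \<eta>) (space (jordan_pos N \<eta>)) \<noteq> \<infinity>"
    unfolding jordan_pos_def emeasure_measure_of_conv by simp
qed

lemma finite_measure_jordan_neg: "finite_measure (jordan_neg N \<eta>)"
  unfolding jordan_neg_def by (rule finite_measure_jordan_pos)

definition total_var :: "'b measure \<Rightarrow> ('b set \<Rightarrow> real) \<Rightarrow> 'b measure" where
  "total_var N \<eta> = measure_of (space N) (sets N) (\<lambda>A. emeasure (jordan_pos N \<eta>) A + emeasure (jordan_neg N \<eta>) A)"

lemma total_var_sets [simp, measurable_cong]: "sets (total_var N \<eta>) = sets N"
  and total_var_space [simp]: "space (total_var N \<eta>) = space N"
  unfolding total_var_def by (simp_all add: sets.sets_measure_of_eq sets.space_measure_of_eq)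

lemma emeasure_total_var:
  assumes "A \<in> sets N"
  shows "emeasure (total_var N \<eta>) A = emeasure (jordan_pos N \<eta>) A + emeasure (jordan_neg N \<eta>) A"
proof (rule emeasure_measure_of[OF total_var_def])
  show "countably_additive (sets (total_var N \<eta>)) (\<lambda>A. emeasure (jordan_pos N \<eta>) A + emeasure (jordan_neg N \<eta>) A)"
  proof (rule countably_additiveI)
    fix F :: "nat \<Rightarrow> 'a set" assume F: "range F \<subseteq> sets (total_var N \<eta>)" "disjoint_family F"
    have "(\<Sum>i. emeasure (jordan_pos N \<eta>) (F i) + emeasure (jordan_neg N \<eta>) (F i))
        = (\<Sum>i. emeasure (jordan_pos N \<eta>) (F i)) + (\<Sum>i. emeasure (jordan_neg N \<eta>) (F i))"
      by (rule suminf_add[symmetric]) auto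
    also have "\<dots> = emeasure (jordan_pos N \<eta>) (\<Union>(range F)) + emeasure (jordan_neg N \<eta>) (\<Union>(range F))"
      using F by (simp add: suminf_emeasure)
    finally show "(\<Sum>i. emeasure (jordan_pos N \<eta>) (F i) + emeasure (jordan_neg N \<eta>) (F i))
        = emeasure (jordan_pos N \<eta>) (\<Union>(range F)) + emeasure (jordan_neg N \<eta>) (\<Union>(range F))" .
  qed
qed (use assms sets.space_closed in \<open>auto simp: positive_def\<close>)

lemma finite_measure_total_var: "finite_measure (total_var N \<eta>)"
  using finite_measure.finite_emeasure_space[OF finite_measure_jordan_pos[of N \<eta>]]
    finite_measure.finite_emeasure_space[OF finite_measure_jordan_neg[of N \<eta>]]
  by (intro finite_measureI) (auto simp: emeasure_total_var)

text \<open>Each of the two Jordan parts is bounded by the total variation separately, whence the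
  factor \<open>2\<close>; it reappears in the Gronwall constants below.\<close>

lemma signed_integral_abs_le:
  assumes f: "f \<in> borel_measurable N"
  shows "ennreal \<bar>signed_integral N \<eta> f\<bar> \<le> (\<integral>\<^sup>+ r. ennreal (2 * \<bar>f r\<bar>) \<partial>total_var N \<eta>)"
proof -
  have le: "ennreal \<bar>\<integral>r. f r \<partial>\<mu>\<bar> \<le> (\<integral>\<^sup>+ r. ennreal \<bar>f r\<bar> \<partial>total_var N \<eta>)"
    if \<mu>: "sets \<mu> = sets N" "\<And>A. A \<in> sets N \<Longrightarrow> emeasure \<mu> A \<le> emeasure (total_var N \<eta>) A" for \<mu>
  proof -
    have "ennreal \<bar>\<integral>r. f r \<partial>\<mu>\<bar> \<le> (\<integral>\<^sup>+ r. ennreal \<bar>f r\<bar> \<partial>\<mu>)"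
    proof (cases "integrable \<mu> f")
      case True
      then show ?thesis using integral_norm_bound_ennreal[OF True] by simp
    qed (simp add: not_integrable_integral_eq)
    also have "\<dots> \<le> (\<integral>\<^sup>+ r. ennreal \<bar>f r\<bar> \<partial>total_var N \<eta>)"
      using \<mu> by (intro nn_integral_mono_measure) (auto simp: le_measure)
    finally show ?thesis .
  qed
  have "ennreal \<bar>signed_integral N \<eta> f\<bar> \<le> ennreal \<bar>\<integral>r. f r \<partial>jordan_pos N \<eta>\<bar> + ennreal \<bar>\<integral>r. f r \<partial>jordan_neg N \<eta>\<bar>"
    unfolding signed_integral_def by (simp add: ennreal_plus[symmetric] del: ennreal_plus)
  also have "\<dots> \<le> (\<integral>\<^sup>+ r. ennreal \<bar>f r\<bar> \<partial>total_var N \<eta>) + (\<integral>\<^sup>+ r. ennreal \<bar>f r\<bar> \<partial>total_var N \<eta>)"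
    by (intro add_mono le) (auto simp: emeasure_total_var)
  also have "\<dots> = (\<integral>\<^sup>+ r. ennreal \<bar>f r\<bar> + ennreal \<bar>f r\<bar> \<partial>total_var N \<eta>)"
    using f by (intro nn_integral_add[symmetric]) auto
  also have "\<dots> = (\<integral>\<^sup>+ r. ennreal (2 * \<bar>f r\<bar>) \<partial>total_var N \<eta>)"
    by (intro nn_integral_cong) (simp add: ennreal_plus[symmetric] del: ennreal_plus)
  finally show ?thesis .
qed

lemma bounded_jordan_integrable:
  fixes f :: "'b \<Rightarrow> real"
  assumes "f \<in> borel_measurable N" "\<And>r. r \<in> space N \<Longrightarrow> \<bar>f r\<bar> \<le> R"
  shows "integrable (jordan_pos N \<eta>) f" "integrable (jordan_neg N \<eta>) f"
  using assms
  by (auto intro!: finite_measure.integrable_const_bound[OF finite_measure_jordan_pos, where B = R]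
      finite_measure.integrable_const_bound[OF finite_measure_jordan_neg, where B = R] AE_I2)

lemma signed_integral_diff:
  assumes "f \<in> borel_measurable N" "\<And>r. r \<in> space N \<Longrightarrow> \<bar>f r\<bar> \<le> R"
    and "g \<in> borel_measurable N" "\<And>r. r \<in> space N \<Longrightarrow> \<bar>g r\<bar> \<le> R"
  shows "signed_integral N \<eta> (\<lambda>r. f r - g r) = signed_integral N \<eta> f - signed_integral N \<eta> g"
  using bounded_jordan_integrable[OF assms(1,2)] bounded_jordan_integrable[OF assms(3,4)]
  by (simp add: signed_integral_def)

lemma signed_integral_sum:
  assumes "\<And>k. k \<in> A \<Longrightarrow> f k \<in> borel_measurable N" "\<And>k r. k \<in> A \<Longrightarrow> r \<in> space N \<Longrightarrow> \<bar>f k r\<bar> \<le> R"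
  shows "signed_integral N \<eta> (\<lambda>r. \<Sum>k\<in>A. c k * f k r) = (\<Sum>k\<in>A. c k * signed_integral N \<eta> (f k))"
  using bounded_jordan_integrable[OF assms]
  by (simp add: signed_integral_def sum_subtractf right_diff_distrib)

lemma signed_integral_bound:
  assumes f: "f \<in> borel_measurable N" "\<And>r. r \<in> space N \<Longrightarrow> \<bar>f r\<bar> \<le> R" and R: "0 \<le> R"
  shows "\<bar>signed_integral N \<eta> f\<bar> \<le> 2 * R * measure (total_var N \<eta>) (space N)"
proof -
  interpret finite_measure "total_var N \<eta>" by (rule finite_measure_total_var)
  have "ennreal \<bar>signed_integral N \<eta> f\<bar> \<le> (\<integral>\<^sup>+ r. ennreal (2 * \<bar>f r\<bar>) \<partial>total_var N \<eta>)"
    by (rule signed_integral_abs_le[OF f(1)])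
  also have "\<dots> \<le> (\<integral>\<^sup>+ r. ennreal (2 * R) \<partial>total_var N \<eta>)"
    using f(2) by (intro nn_integral_mono ennreal_leI) auto
  also have "\<dots> = ennreal (2 * R * measure (total_var N \<eta>) (space N))"
    using R by (simp add: emeasure_eq_measure ennreal_mult[symmetric])
  finally show ?thesis
    using R by (subst (asm) ennreal_le_iff) auto
qed

lemma signed_integral_measurable:
  assumes m: "(\<lambda>(s, r). \<phi> s r) \<in> borel_measurable (K \<Otimes>\<^sub>M N)"
  shows "(\<lambda>s. signed_integral N \<eta> (\<phi> s)) \<in> borel_measurable K"
proof -
  interpret p: finite_measure "jordan_pos N \<eta>" by (rule finite_measure_jordan_pos)
  interpret n: finite_measure "jordan_neg N \<eta>" by (rule finite_measure_jordan_neg)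
  have "(\<lambda>s. \<integral>r. \<phi> s r \<partial>jordan_pos N \<eta>) \<in> borel_measurable K"
    using m by (intro p.borel_measurable_lebesgue_integral) (simp cong: measurable_cong_sets)
  moreover have "(\<lambda>s. \<integral>r. \<phi> s r \<partial>jordan_neg N \<eta>) \<in> borel_measurable K"
    using m by (intro n.borel_measurable_lebesgue_integral) (simp cong: measurable_cong_sets)
  ultimately show ?thesis
    unfolding signed_integral_def by measurable
qed

section \<open>Processes with continuous paths\<close>

lemma floor_div_tendsto: "(\<lambda>m. of_int \<lfloor>real (Suc m) * t\<rfloor> / real (Suc m)) \<longlonglongrightarrow> t"
proof (rule tendsto_sandwich)
  show "(\<lambda>m. t - 1 / real (Suc m)) \<longlonglongrightarrow> t"
    using tendsto_diff[OF tendsto_const LIMSEQ_Suc[OF lim_1_over_n], of t] by simp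
  show "\<forall>\<^sub>F m in sequentially. t - 1 / real (Suc m) \<le> of_int \<lfloor>real (Suc m) * t\<rfloor> / real (Suc m)"
  proof (intro always_eventually allI)
    fix m
    have "real (Suc m) * t - 1 \<le> of_int \<lfloor>real (Suc m) * t\<rfloor>" by linarith
    then have "(real (Suc m) * t - 1) / real (Suc m) \<le> of_int \<lfloor>real (Suc m) * t\<rfloor> / real (Suc m)"
      by (intro divide_right_mono) auto
    then show "t - 1 / real (Suc m) \<le> of_int \<lfloor>real (Suc m) * t\<rfloor> / real (Suc m)"
      by (simp add: diff_divide_distrib)
  qed
  show "\<forall>\<^sub>F m in sequentially. of_int \<lfloor>real (Suc m) * t\<rfloor> / real (Suc m) \<le> t"
  proof (intro always_eventually allI)
    fix m
    have "of_int \<lfloor>real (Suc m) * t\<rfloor> \<le> real (Suc m) * t" by linarith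
    then show "of_int \<lfloor>real (Suc m) * t\<rfloor> / real (Suc m) \<le> t"
      by (simp add: divide_le_eq mult.commute del: of_nat_Suc)
  qed
qed simp

text \<open>Joint measurability: the process is a limit of processes that are constant between
  consecutive multiples of \<open>1 / Suc m\<close>, each of which involves countably many times
  only.\<close>

lemma continuous_process_measurable:
  fixes Z :: "real \<Rightarrow> 'a \<Rightarrow> real"
  assumes Z: "\<And>t. Z t \<in> borel_measurable M" and cont: "\<And>\<omega>. \<omega> \<in> space M \<Longrightarrow> continuous_on UNIV (\<lambda>t. Z t \<omega>)"
  shows "(\<lambda>(t, \<omega>). Z t \<omega>) \<in> borel_measurable (borel \<Otimes>\<^sub>M M)"
proof (rule borel_measurable_LIMSEQ_real)
  fix x assume x: "x \<in> space (borel \<Otimes>\<^sub>M M :: (real \<times> 'a) measure)"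
  have "isCont (\<lambda>t. Z t (snd x)) (fst x)"
    using cont[of "snd x"] x by (simp add: space_pair_measure continuous_on_eq_continuous_at mem_Times_iff)
  from isCont_tendsto_compose[OF this floor_div_tendsto]
  show "(\<lambda>m. Z (of_int \<lfloor>real (Suc m) * fst x\<rfloor> / real (Suc m)) (snd x)) \<longlonglongrightarrow> (case x of (t, \<omega>) \<Rightarrow> Z t \<omega>)"
    by (simp add: case_prod_beta')
next
  fix m
  show "(\<lambda>x. Z (of_int \<lfloor>real (Suc m) * fst x\<rfloor> / real (Suc m)) (snd x)) \<in> borel_measurable (borel \<Otimes>\<^sub>M M)"
    by (rule measurable_compose_countable[where f = "\<lambda>i x. Z (of_int i / real (Suc m)) (snd x)"
          and g = "\<lambda>x. \<lfloor>real (Suc m) * fst x\<rfloor>"])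
      (use Z in measurable)
qed

lemma continuous_on_bounded_Icc:
  fixes g :: "real \<Rightarrow> real"
  assumes "continuous_on {a..b} g"
  obtains R where "0 \<le> R" "\<And>t. t \<in> {a..b} \<Longrightarrow> \<bar>g t\<bar> \<le> R"
proof -
  have "bounded (g ` {a..b})"
    using assms by (intro compact_imp_bounded compact_continuous_image) auto
  then obtain R where "0 < R" "\<forall>y\<in>g ` {a..b}. norm y \<le> R"
    by (auto simp: bounded_pos)
  then show thesis by (intro that[of R]) auto
qed

context prob_space
begin

text \<open>Continuity of the paths supplies the exhausting events: every path is bounded on the
  compact interval.\<close>

lemma Lp_le_gronwall_continuous:
  fixes Z A :: "real \<Rightarrow> 'a \<Rightarrow> real" and \<rho> :: "real \<Rightarrow> 'b \<Rightarrow> real"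
  assumes \<mu>: "finite_measure \<mu>" and p: "1 \<le> p"
    and Zm: "\<And>t. Z t \<in> borel_measurable M" and Zc: "\<And>\<omega>. \<omega> \<in> space M \<Longrightarrow> continuous_on UNIV (\<lambda>t. Z t \<omega>)"
    and \<rho>m: "(\<lambda>(s, r). \<rho> s r) \<in> borel_measurable (borel \<Otimes>\<^sub>M \<mu>)"
    and \<rho>: "\<And>s r. s \<in> {0..T} \<Longrightarrow> r \<in> space \<mu> \<Longrightarrow> \<rho> s r \<in> {-\<tau>..s}" and \<tau>: "0 \<le> \<tau>"
    and A: "\<And>t. t \<in> {0..T} \<Longrightarrow> Lp_le p (A t) \<alpha>"
    and neg: "\<And>t. t \<in> {-\<tau>..<0} \<Longrightarrow> Lp_le p (Z t) \<alpha>" and \<alpha>: "0 \<le> \<alpha>"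
    and ineq: "\<And>t. t \<in> {0..T} \<Longrightarrow> AE \<omega> in M. ennreal \<bar>Z t \<omega>\<bar> \<le> ennreal \<bar>A t \<omega>\<bar>
       + (\<integral>\<^sup>+ s. (\<integral>\<^sup>+ r. ennreal (\<kappa> * \<bar>Z (\<rho> s r) \<omega>\<bar>) \<partial>\<mu>) * indicator {0..t} s \<partial>lborel)"
    and \<kappa>: "0 < \<kappa>" and l: "0 < l" "2 * \<kappa> * measure \<mu> (space \<mu>) \<le> l"
    and t: "t \<in> {0..T}"
  shows "Lp_le p (Z t) (2 * \<alpha> * exp (l * t))"
proof -
  define clamp where "clamp s = max (-\<tau>) (min T s)" for s
  \<comment> \<open>Boundedness is demanded at countably many times, so that \<open>E k\<close> is
    an event; continuity extends it to the interval. The clamp keeps these times inside the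
    interval.\<close>
  define E where "E k = {\<omega>\<in>space M. \<forall>m i. \<bar>Z (clamp (of_int i / real (Suc m))) \<omega>\<bar> \<le> real k}" for k :: nat
  have absZ: "Lp_le p (\<lambda>\<omega>. \<bar>Z t \<omega>\<bar>) c \<longleftrightarrow> Lp_le p (Z t) c" for c t
    using Zm[of t] by (auto simp: Lp_le_def)
  have "Lp_le p (\<lambda>\<omega>. \<bar>Z t \<omega>\<bar>) (2 * \<alpha> * exp (l * t))"
  proof (rule Lp_le_gronwall[OF \<mu> p _ \<rho>m \<rho> \<tau> _ A _ \<alpha> _ _ _ _ ineq \<kappa> l t])
    show "(\<lambda>(t, \<omega>). \<bar>Z t \<omega>\<bar>) \<in> borel_measurable (borel \<Otimes>\<^sub>M M)"
      using Zm Zc by (intro continuous_process_measurable) (auto intro: continuous_intros)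
    show "E k \<in> sets M" for k
      unfolding E_def using Zm by measurable
    show "incseq E"
      by (rule incseq_SucI) (auto simp: E_def add_increasing)
    show "AE \<omega> in M. \<exists>k. \<omega> \<in> E k"
    proof (rule AE_I2)
      fix \<omega> assume \<omega>: "\<omega> \<in> space M"
      obtain R where R: "0 \<le> R" "\<And>t. t \<in> {-\<tau>..max T (-\<tau>)} \<Longrightarrow> \<bar>Z t \<omega>\<bar> \<le> R"
        using continuous_on_bounded_Icc[OF continuous_on_subset[OF Zc[OF \<omega>] subset_UNIV]] by metis
      obtain k :: nat where "R \<le> real k" using real_arch_simple by blast
      moreover have "clamp s \<in> {-\<tau>..max T (-\<tau>)}" for s
        by (auto simp: clamp_def max_def min_def)
      ultimately have "\<bar>Z (clamp s) \<omega>\<bar> \<le> real k" for s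
        using R(2)[of "clamp s"] by fastforce
      then show "\<exists>k. \<omega> \<in> E k" using \<omega> by (auto simp: E_def)
    qed
    show "\<bar>Z t \<omega>\<bar> \<le> real k" if "\<omega> \<in> E k" "t \<in> {-\<tau>..T}" for k t \<omega>
    proof -
      have \<omega>: "\<omega> \<in> space M" using that by (simp add: E_def)
      have "continuous_on UNIV (\<lambda>s. \<bar>Z (clamp s) \<omega>\<bar>)"
        unfolding clamp_def
        by (intro continuous_on_rabs continuous_on_compose2[OF Zc[OF \<omega>]] continuous_intros) auto
      then have "isCont (\<lambda>s. \<bar>Z (clamp s) \<omega>\<bar>) t"
        by (simp add: continuous_on_eq_continuous_at)
      from isCont_tendsto_compose[OF this floor_div_tendsto]
      have "\<bar>Z (clamp t) \<omega>\<bar> \<le> real k"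
        by (rule LIMSEQ_le_const2) (use that(1) in \<open>auto simp: E_def\<close>)
      then show ?thesis using that by (simp add: clamp_def)
    qed
  qed (use neg in \<open>auto simp: absZ\<close>)
  then show ?thesis by (simp add: absZ)
qed

end

section \<open>Taylor bounds for the drift function\<close>

text \<open>Mean value theorem. Each application raises the order by one, so the Taylor remainders
  follow from the Lipschitz bound of the second derivative without changing the constant.\<close>

lemma abs_le_power_of_deriv:
  fixes g g' :: "real \<Rightarrow> real"
  assumes g: "\<And>z. (g has_real_derivative g' z) (at z)" and 0: "g y = 0"
    and le: "\<And>z. \<bar>g' z\<bar> \<le> C * \<bar>z - y\<bar> ^ n" and C: "0 \<le> C"
  shows "\<bar>g z\<bar> \<le> C * \<bar>z - y\<bar> ^ Suc n"
proof -
  have "\<exists>w. \<bar>w - y\<bar> \<le> \<bar>z - y\<bar> \<and> g z - g y = (z - y) * g' w"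
  proof (cases z y rule: linorder_cases)
    case less
    obtain w where "z < w" "w < y" "g y - g z = (y - z) * g' w"
      using MVT2[OF less, of g g'] g by blast
    then show ?thesis by (intro exI[of _ w]) (auto simp: algebra_simps)
  next
    case greater
    obtain w where "y < w" "w < z" "g z - g y = (z - y) * g' w"
      using MVT2[OF greater, of g g'] g by blast
    then show ?thesis by (intro exI[of _ w]) auto
  qed auto
  then obtain w where w: "\<bar>w - y\<bar> \<le> \<bar>z - y\<bar>" "g z - g y = (z - y) * g' w" by blast
  have "\<bar>g z\<bar> = \<bar>z - y\<bar> * \<bar>g' w\<bar>" using w 0 by (simp add: abs_mult)
  also have "\<dots> \<le> \<bar>z - y\<bar> * (C * \<bar>z - y\<bar> ^ n)"
    using w(1) C by (intro mult_left_mono order_trans[OF le] power_mono) auto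
  finally show ?thesis by (simp add: mult_ac)
qed

lemma taylor_bounds:
  assumes b3: "class_C 3 b" and b': "class_Cb 2 (deriv b)"
  obtains K where "0 < K" "\<And>y. \<bar>deriv b y\<bar> \<le> K" "\<And>y. \<bar>deriv (deriv b) y\<bar> \<le> K"
    "\<And>y z. \<bar>b z - b y - deriv b y * (z - y) - deriv (deriv b) y / 2 * (z - y)\<^sup>2\<bar> \<le> K * \<bar>z - y\<bar> ^ 3"
    "\<And>y z. \<bar>deriv b z - deriv b y - deriv (deriv b) y * (z - y)\<bar> \<le> K * (z - y)\<^sup>2"
    "\<And>y z. \<bar>deriv (deriv b) z - deriv (deriv b) y\<bar> \<le> K * \<bar>z - y\<bar>"
    "\<And>y z. \<bar>b z - b y\<bar> \<le> K * \<bar>z - y\<bar>"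
    "continuous_on UNIV b" "continuous_on UNIV (deriv b)" "continuous_on UNIV (deriv (deriv b))"
proof -
  let ?f1 = "deriv b" and ?f2 = "deriv (deriv b)" and ?f3 = "deriv (deriv (deriv b))"
  have diff: "(deriv ^^ j) b field_differentiable at x" if "j < 3" for j x
    using b3 that unfolding class_C_def by blast
  have d0: "(b has_real_derivative ?f1 x) (at x)" for x
    using diff[of 0 x] by (simp add: DERIV_deriv_iff_field_differentiable)
  have d1: "(?f1 has_real_derivative ?f2 x) (at x)" for x
    using diff[of 1 x] by (simp add: DERIV_deriv_iff_field_differentiable)
  have d2: "(?f2 has_real_derivative ?f3 x) (at x)" for x
    using diff[of 2 x] by (simp add: DERIV_deriv_iff_field_differentiable numeral_2_eq_2)
  have bd: "bounded (range ((deriv ^^ j) ?f1))" if "j \<le> 2" for j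
    using b' that unfolding class_Cb_def by blast
  obtain K1 where K1: "\<And>y. \<bar>?f1 y\<bar> \<le> K1" using bd[of 0] by (auto simp: bounded_iff)
  obtain K2 where K2: "\<And>y. \<bar>?f2 y\<bar> \<le> K2" using bd[of 1] by (auto simp: bounded_iff)
  obtain K3 where K3: "\<And>y. \<bar>?f3 y\<bar> \<le> K3" using bd[of 2] by (auto simp: bounded_iff numeral_2_eq_2)
  define K where "K = 1 + \<bar>K1\<bar> + \<bar>K2\<bar> + \<bar>K3\<bar>"
  have K: "0 < K" "\<bar>?f1 y\<bar> \<le> K" "\<bar>?f2 y\<bar> \<le> K" "\<bar>?f3 y\<bar> \<le> K" for y
    using K1[of y] K2[of y] K3[of y] by (auto simp: K_def)
  have K0: "0 \<le> K" using K(1) by simp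
  have "\<bar>?f2 z - ?f2 y\<bar> \<le> K * \<bar>z - y\<bar> ^ Suc 0" for y z
    by (rule abs_le_power_of_deriv[where g' = ?f3])
      (use K0 K(4) d2 in \<open>auto intro!: derivative_eq_intros\<close>)
  then have l2: "\<bar>?f2 z - ?f2 y\<bar> \<le> K * \<bar>z - y\<bar>" for y z by simp
  have "\<bar>b z - b y\<bar> \<le> K * \<bar>z - y\<bar> ^ Suc 0" for y z
    by (rule abs_le_power_of_deriv[where g' = ?f1])
      (use K0 K(2) d0 in \<open>auto intro!: derivative_eq_intros\<close>)
  then have l0: "\<bar>b z - b y\<bar> \<le> K * \<bar>z - y\<bar>" for y z by simp
  have l1: "\<bar>?f1 z - ?f1 y - ?f2 y * (z - y)\<bar> \<le> K * \<bar>z - y\<bar> ^ Suc 1" for y z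
    by (rule abs_le_power_of_deriv[where g' = "\<lambda>z. ?f2 z - ?f2 y"])
      (use l2 K0 d1 in \<open>auto intro!: derivative_eq_intros\<close>)
  have l1': "\<bar>?f1 z - ?f1 y - ?f2 y * (z - y)\<bar> \<le> K * (z - y)\<^sup>2" for y z
    using l1[of z y] by (simp add: power2_eq_square)
  have l3: "\<bar>b z - b y - ?f1 y * (z - y) - ?f2 y / 2 * (z - y)\<^sup>2\<bar> \<le> K * \<bar>z - y\<bar> ^ Suc 2" for y z
    by (rule abs_le_power_of_deriv[where g' = "\<lambda>z. ?f1 z - ?f1 y - ?f2 y * (z - y)"])
      (use l1' K0 d0 in \<open>auto intro!: derivative_eq_intros\<close>)
  show thesis
  proof (rule that[of K])
    show "\<bar>?f1 z - ?f1 y - ?f2 y * (z - y)\<bar> \<le> K * (z - y)\<^sup>2" for y z by (rule l1')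
    show "\<bar>b z - b y - ?f1 y * (z - y) - ?f2 y / 2 * (z - y)\<^sup>2\<bar> \<le> K * \<bar>z - y\<bar> ^ 3" for y z
      using l3[of z y] by (simp add: numeral_3_eq_3)
    show "continuous_on UNIV b" "continuous_on UNIV ?f1" "continuous_on UNIV ?f2"
      using d0 d1 d2 by (auto simp: continuous_on_eq_continuous_at intro: DERIV_isCont)
  qed (use K l2 l0 in auto)
qed

section \<open>The delay equation and its Euler scheme\<close>

lemma signed_integral_cong:
  assumes "\<And>r. r \<in> space N \<Longrightarrow> f r = g r"
  shows "signed_integral N \<eta> f = signed_integral N \<eta> g"
  unfolding signed_integral_def using assms by (auto intro!: arg_cong2[where f = "(-)"] Bochner_Integration.integral_cong)

lemma grid_floor_measurable [measurable]: "grid_floor \<Delta> \<in> borel_measurable borel"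
  unfolding grid_floor_def by measurable

lemma grid_floor_bounds:
  assumes "0 < \<Delta>"
  shows "grid_floor \<Delta> s \<le> s" "s < grid_floor \<Delta> s + \<Delta>" "0 \<le> s \<Longrightarrow> 0 \<le> grid_floor \<Delta> s"
proof -
  have "of_int \<lfloor>s / \<Delta>\<rfloor> * \<Delta> \<le> s / \<Delta> * \<Delta>" using assms by (intro mult_right_mono) linarith+
  then show "grid_floor \<Delta> s \<le> s" using assms by (simp add: grid_floor_def)
  have "s / \<Delta> * \<Delta> < (of_int \<lfloor>s / \<Delta>\<rfloor> + 1) * \<Delta>" using assms by (intro mult_strict_right_mono) linarith+
  then show "s < grid_floor \<Delta> s + \<Delta>" using assms by (simp add: grid_floor_def distrib_right)
  show "0 \<le> grid_floor \<Delta> s" if "0 \<le> s"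
    using assms that by (simp add: grid_floor_def)
qed

lemma continuous_on_atLeast_0:
  fixes g :: "real \<Rightarrow> real"
  assumes "\<And>T. continuous_on {0..T} g"
  shows "continuous_on {0..} g"
  unfolding continuous_on_eq_continuous_within
proof
  fix t :: real assume t: "t \<in> {0..}"
  have "at t within {0..} = at t within {0..t + 1}"
    by (rule at_within_nhd[of _ "{..<t + 1}"]) auto
  moreover have "continuous (at t within {0..t + 1}) g"
    using assms[of "t + 1"] t by (simp add: continuous_on_eq_continuous_within)
  ultimately show "continuous (at t within {0..}) g" by simp
qed

lemma set_integrable_bounded_Icc:
  fixes F :: "real \<Rightarrow> real"
  assumes "F \<in> borel_measurable borel" "\<And>s. s \<in> {0..t} \<Longrightarrow> \<bar>F s\<bar> \<le> R"
  shows "set_integrable lborel {0..t} F"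
proof (rule set_integrable_bound[where f = "\<lambda>_. R"])
  show "set_integrable lborel {0..t} (\<lambda>_. R)"
    unfolding set_integrable_def by (intro integrable_scaleR_left integrable_real_indicator) (auto simp: emeasure_lborel_Icc_eq)
  show "set_borel_measurable lborel {0..t} F"
    using assms(1) unfolding set_borel_measurable_def by measurable
  show "AE x in lborel. x \<in> {0..t} \<longrightarrow> norm (F x) \<le> norm R"
    using assms(2) by (auto intro!: AE_I2 order_trans[OF _ abs_ge_self])
qed

lemma set_integral_Icc_diff_le:
  fixes F :: "real \<Rightarrow> real"
  assumes int: "set_integrable lborel {0..t} F" and st: "0 \<le> s" "s \<le> t"
  shows "ennreal \<bar>(LBINT u:{0..t}. F u) - (LBINT u:{0..s}. F u)\<bar> \<le> (\<integral>\<^sup>+ u. ennreal \<bar>F u\<bar> * indicator {s..t} u \<partial>lborel)"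
proof -
  have int': "set_integrable lborel {0..s} F"
    by (rule set_integrable_subset[OF int]) (use st in auto)
  have i3: "integrable lborel (\<lambda>u. indicator {0..t} u * F u - indicator {0..s} u * F u)"
    using int int' by (auto simp: set_integrable_def)
  have "(LBINT u:{0..t}. F u) - (LBINT u:{0..s}. F u) = (\<integral>u. indicator {0..t} u * F u - indicator {0..s} u * F u \<partial>lborel)"
    using int int' by (simp add: set_lebesgue_integral_def set_integrable_def)
  also have "ennreal \<bar>\<dots>\<bar> \<le> (\<integral>\<^sup>+ u. ennreal \<bar>indicator {0..t} u * F u - indicator {0..s} u * F u\<bar> \<partial>lborel)"
    using integral_norm_bound_ennreal[OF i3] by simp
  also have "\<dots> \<le> (\<integral>\<^sup>+ u. ennreal \<bar>F u\<bar> * indicator {s..t} u \<partial>lborel)"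
    using st by (intro nn_integral_mono) (auto simp: indicator_def)
  finally show ?thesis .
qed

lemma set_integral_Icc_abs_le:
  fixes F :: "real \<Rightarrow> real"
  assumes int: "set_integrable lborel {0..t} F"
  shows "ennreal \<bar>LBINT u:{0..t}. F u\<bar> \<le> (\<integral>\<^sup>+ u. ennreal \<bar>F u\<bar> * indicator {0..t} u \<partial>lborel)"
proof -
  have "ennreal \<bar>LBINT u:{0..t}. F u\<bar> \<le> (\<integral>\<^sup>+ u. ennreal \<bar>indicator {0..t} u * F u\<bar> \<partial>lborel)"
    using integral_norm_bound_ennreal[OF int[unfolded set_integrable_def]] by (simp add: set_lebesgue_integral_def)
  also have "\<dots> = (\<integral>\<^sup>+ u. ennreal \<bar>F u\<bar> * indicator {0..t} u \<partial>lborel)"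
    by (intro nn_integral_cong) (auto simp: indicator_def)
  finally show ?thesis .
qed

lemma set_integral_singleton_0: "(LBINT u:{0::real}. F u) = (0 :: real)"
  unfolding set_lebesgue_integral_def
proof (rule integral_eq_zero_AE)
  show "AE u in lborel. indicator {0} u *\<^sub>R F u = (0 :: real)"
    using AE_lborel_singleton[of "0 :: real"] by eventually_elim auto
qed

locale sdde = fbm M W B H
  for M :: "'a measure" and W B H +
  fixes \<tau> :: real and \<eta> :: "real set \<Rightarrow> real" and b x0 :: "real \<Rightarrow> real"
    and X :: "real \<Rightarrow> 'a \<Rightarrow> real" and Xn :: "nat \<Rightarrow> real \<Rightarrow> 'a \<Rightarrow> real"
  assumes \<tau>: "0 < \<tau>" and b3: "class_C 3 b" and b_growth: "linear_growth b" and b': "class_Cb 2 (deriv b)"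
    and x0: "C1_on_Icc (-\<tau>) 0 x0"
    and sol: "sdde_solution M \<tau> \<eta> b x0 B X"
    and euler: "\<And>n. 1 \<le> n \<Longrightarrow> euler_scheme M \<tau> \<eta> b x0 B n (Xn n)"
begin

abbreviation V :: "real measure" where "V \<equiv> delay_space \<tau>"
abbreviation \<mu> :: "real measure" where "\<mu> \<equiv> total_var V \<eta>"
abbreviation SI :: "(real \<Rightarrow> real) \<Rightarrow> real" where "SI \<equiv> signed_integral V \<eta>"
abbreviation \<Delta> :: "nat \<Rightarrow> real" where "\<Delta> n \<equiv> \<tau> / real n"
abbreviation gf :: "nat \<Rightarrow> real \<Rightarrow> real" where "gf n \<equiv> grid_floor (\<Delta> n)"

lemma V_space: "r \<in> space V \<longleftrightarrow> 0 \<le> r \<and> r \<le> \<tau>"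
  by (simp add: space_restrict_space)

lemma \<Delta>: "1 \<le> n \<Longrightarrow> 0 < \<Delta> n" "1 \<le> n \<Longrightarrow> \<Delta> n \<le> \<tau>" "1 \<le> n \<Longrightarrow> real n * \<Delta> n = \<tau>"
  using \<tau> by (auto simp: field_simps)

lemma gf_diff_bounds:
  assumes "1 \<le> n" "0 \<le> s" "r \<in> space V"
  shows "- \<tau> \<le> gf n s - gf n r" "gf n s - gf n r \<le> s"
  using grid_floor_bounds[OF \<Delta>(1)[OF assms(1)], of s] grid_floor_bounds[OF \<Delta>(1)[OF assms(1)], of r] assms
  by (auto simp: V_space)

lemma id_V_measurable [measurable]: "(\<lambda>r. r) \<in> V \<rightarrow>\<^sub>M borel"
  by (rule measurable_restrict_space1) simp

text \<open>The continuation of the initial path by its end values. Unlike the extension by zero it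
  is Lipschitz on the whole line.\<close>

definition x0c :: "real \<Rightarrow> real" where "x0c t = x0 (max (-\<tau>) (min t 0))"

lemma x0c_simps: "-\<tau> \<le> t \<Longrightarrow> t \<le> 0 \<Longrightarrow> x0c t = x0 t" "0 \<le> t \<Longrightarrow> x0c t = x0 0"
  using \<tau> by (auto simp: x0c_def max_def min_def)

lemma x0c_lipschitz:
  obtains Kx where "0 \<le> Kx" "\<And>s t. \<bar>x0c s - x0c t\<bar> \<le> Kx * \<bar>s - t\<bar>"
proof -
  obtain g where g: "continuous_on {-\<tau>..0} g"
    "\<And>t. t \<in> {-\<tau>..0} \<Longrightarrow> (x0 has_real_derivative g t) (at t within {-\<tau>..0})"
    using x0 unfolding C1_on_Icc_def by blast
  obtain R where R: "0 \<le> R" "\<And>t. t \<in> {-\<tau>..0} \<Longrightarrow> \<bar>g t\<bar> \<le> R"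
    using continuous_on_bounded_Icc[OF g(1)] by metis
  have *: "\<bar>x0 s - x0 t\<bar> \<le> R * \<bar>s - t\<bar>" if "s \<in> {-\<tau>..0}" "t \<in> {-\<tau>..0}" for s t
    using field_differentiable_bound[of "{-\<tau>..0}" x0 g R s t] g(2) R(2) that by (simp add: norm_minus_commute)
  have "\<bar>x0c s - x0c t\<bar> \<le> R * \<bar>s - t\<bar>" for s t
  proof -
    have "\<bar>x0c s - x0c t\<bar> \<le> R * \<bar>max (-\<tau>) (min s 0) - max (-\<tau>) (min t 0)\<bar>"
      unfolding x0c_def using \<tau> by (intro *) auto
    also have "\<dots> \<le> R * \<bar>s - t\<bar>" using R(1) by (intro mult_left_mono) auto
    finally show ?thesis .
  qed
  with R(1) show thesis by (rule that)
qed

lemma x0c_continuous: "continuous_on A x0c"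
proof -
  obtain Kx where Kx: "0 \<le> Kx" "\<And>s t. \<bar>x0c s - x0c t\<bar> \<le> Kx * \<bar>s - t\<bar>" using x0c_lipschitz by metis
  then have "lipschitz_on Kx A x0c" by (auto simp: lipschitz_on_def dist_real_def)
  then show ?thesis by (rule lipschitz_on_continuous_on)
qed

lemma x0c_bounded:
  obtains R where "0 \<le> R" "\<And>t. \<bar>x0c t\<bar> \<le> R"
proof -
  obtain R where R: "0 \<le> R" "\<And>t. t \<in> {-\<tau>..0} \<Longrightarrow> \<bar>x0c t\<bar> \<le> R"
    using continuous_on_bounded_Icc[OF x0c_continuous] by metis
  have "\<bar>x0c t\<bar> \<le> R" for t
    using R(2)[of "max (-\<tau>) (min t 0)"] \<tau> by (auto simp: x0c_def)
  with R(1) show thesis by (rule that)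
qed

section \<open>Versions off a null set\<close>

definition good :: "nat \<Rightarrow> 'a \<Rightarrow> bool" where
  "good n \<omega> \<longleftrightarrow> B 0 \<omega> = 0 \<and> continuous_on {0..} (\<lambda>t. B t \<omega>) \<and>
     continuous_on {0..} (\<lambda>t. X t \<omega>) \<and> (\<forall>t\<in>{-\<tau>..<0}. X t \<omega> = x0 t) \<and>
     (\<forall>t\<ge>0. X t \<omega> = x0 0 + (LBINT s:{0..t}. SI (\<lambda>r. b (X (s - r) \<omega>))) + B t \<omega>) \<and>
     (\<forall>t\<in>{-\<tau>..<0}. Xn n t \<omega> = x0 t) \<and>
     (\<forall>t\<ge>0. Xn n t \<omega> = x0 0 + (LBINT s:{0..t}. SI (\<lambda>r. b (Xn n (gf n s - gf n r) \<omega>))) + B t \<omega>)"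

lemma AE_good:
  assumes n: "1 \<le> n"
  shows "AE \<omega> in M. good n \<omega>"
proof -
  have "AE \<omega> in M. continuous_on {0..} (\<lambda>t. B t \<omega>)"
    using fbm unfolding fbm_from_wiener_def by blast
  moreover note B_0
  moreover have "AE \<omega> in M. continuous_on {0..} (\<lambda>t. X t \<omega>) \<and> (\<forall>t\<in>{-\<tau>..<0}. X t \<omega> = x0 t) \<and>
        (\<forall>t\<ge>0. X t \<omega> = x0 0 + (LBINT s:{0..t}. SI (\<lambda>r. b (X (s - r) \<omega>))) + B t \<omega>)"
    using sol unfolding sdde_solution_def by blast
  moreover have "AE \<omega> in M. (\<forall>t\<in>{-\<tau>..<0}. Xn n t \<omega> = x0 t) \<and>
        (\<forall>t\<ge>0. Xn n t \<omega> = x0 0 + (LBINT s:{0..t}. SI (\<lambda>r. b (Xn n (gf n s - gf n r) \<omega>))) + B t \<omega>)"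
    using euler[OF n] unfolding euler_scheme_def by blast
  ultimately show ?thesis unfolding good_def by eventually_elim blast
qed

text \<open>The set where the equations fail need not be an event. A fixed null set containing it
  yields the event \<open>om n\<close>, which belongs to \<open>past v\<close> for every
  \<open>v\<close>.\<close>

definition bad :: "nat \<Rightarrow> 'a set" where
  "bad n = (SOME N. N \<in> null_sets M \<and> {\<omega>\<in>space M. \<not> good n \<omega>} \<subseteq> N)"

lemma bad:
  assumes "1 \<le> n"
  shows "bad n \<in> null_sets M" "\<omega> \<in> space M \<Longrightarrow> \<omega> \<notin> bad n \<Longrightarrow> good n \<omega>"
proof -
  have "\<exists>N. N \<in> null_sets M \<and> {\<omega>\<in>space M. \<not> good n \<omega>} \<subseteq> N"
    using AE_good[OF assms] by (auto elim!: AE_E)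
  from someI_ex[OF this] show "bad n \<in> null_sets M" "\<omega> \<in> space M \<Longrightarrow> \<omega> \<notin> bad n \<Longrightarrow> good n \<omega>"
    unfolding bad_def[symmetric] by auto
qed

definition om :: "nat \<Rightarrow> 'a set" where "om n = space M - bad n"

lemma om:
  assumes n: "1 \<le> n"
  shows "om n \<in> events" "om n \<in> sets (past v)" "\<omega> \<in> om n \<Longrightarrow> good n \<omega>" "AE \<omega> in M. \<omega> \<in> om n"
proof -
  show "om n \<in> events" using bad(1)[OF n] by (auto simp: om_def)
  have "space (past v) - bad n \<in> sets (past v)"
    using null_sets_past[OF bad(1)[OF n]] by (rule sets.compl_sets)
  then show "om n \<in> sets (past v)" by (simp add: om_def)
  show "\<omega> \<in> om n \<Longrightarrow> good n \<omega>" using bad(2)[OF n] by (auto simp: om_def)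
  show "AE \<omega> in M. \<omega> \<in> om n"
    using AE_not_in[OF bad(1)[OF n]] AE_space by eventually_elim (simp add: om_def)
qed

text \<open>Versions that are continuous in \<open>t \<in> \<real>\<close> for every \<open>\<omega>\<close>; they vanish on a null set.\<close>

definition ext :: "nat \<Rightarrow> (real \<Rightarrow> 'a \<Rightarrow> real) \<Rightarrow> real \<Rightarrow> 'a \<Rightarrow> real" where
  "ext n Z t \<omega> = indicator (om n) \<omega> * (x0c t + (Z (max t 0) \<omega> - x0 0))"

abbreviation y :: "nat \<Rightarrow> real \<Rightarrow> 'a \<Rightarrow> real" where "y n \<equiv> ext n (Xn n)"
abbreviation xx :: "nat \<Rightarrow> real \<Rightarrow> 'a \<Rightarrow> real" where "xx n \<equiv> ext n X"

lemma start:
  assumes "good n \<omega>"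
  shows "X 0 \<omega> = x0 0" "Xn n 0 \<omega> = x0 0"
proof -
  have "X 0 \<omega> = x0 0 + (LBINT s:{0..0}. SI (\<lambda>r. b (X (s - r) \<omega>))) + B 0 \<omega>"
    and "Xn n 0 \<omega> = x0 0 + (LBINT s:{0..0}. SI (\<lambda>r. b (Xn n (gf n s - gf n r) \<omega>))) + B 0 \<omega>" and "B 0 \<omega> = 0"
    using assms unfolding good_def by blast+
  then show "X 0 \<omega> = x0 0" "Xn n 0 \<omega> = x0 0" by (simp_all add: set_integral_singleton_0)
qed

lemma ext_eq:
  assumes n: "1 \<le> n" and \<omega>: "\<omega> \<in> om n" and t: "- \<tau> \<le> t"
  shows "y n t \<omega> = Xn n t \<omega>" "xx n t \<omega> = X t \<omega>"
proof -
  note g = om(3)[OF n \<omega>] and s = start[OF om(3)[OF n \<omega>]]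
  have "Xn n t \<omega> = x0 t" "X t \<omega> = x0 t" if "t < 0"
    using g t that unfolding good_def by auto
  then show "y n t \<omega> = Xn n t \<omega>" "xx n t \<omega> = X t \<omega>"
    using \<omega> t s by (cases "t < 0"; simp add: ext_def x0c_simps)+
qed

lemma ext_neg:
  assumes n: "1 \<le> n" and t: "t \<le> 0"
  shows "y n t \<omega> = indicator (om n) \<omega> * x0c t" "xx n t \<omega> = indicator (om n) \<omega> * x0c t"
  using start[OF om(3)[OF n]] t by (auto simp: ext_def indicator_def)

lemma ext_measurable:
  assumes n: "1 \<le> n"
  shows "y n t \<in> borel_measurable M" "xx n t \<in> borel_measurable M"
proof -
  have [measurable]: "Xn n (max t 0) \<in> borel_measurable M" "X (max t 0) \<in> borel_measurable M"
    using euler[OF n] sol \<tau> unfolding euler_scheme_def sdde_solution_def by auto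
  note [measurable] = om(1)[OF n]
  show "y n t \<in> borel_measurable M" "xx n t \<in> borel_measurable M"
    unfolding ext_def[abs_def] by measurable
qed

lemma ext_continuous:
  assumes n: "1 \<le> n" and Z: "\<And>\<omega>. \<omega> \<in> om n \<Longrightarrow> continuous_on {0..} (\<lambda>t. Z t \<omega>)"
  shows "continuous_on UNIV (\<lambda>t. ext n Z t \<omega>)"
proof (cases "\<omega> \<in> om n")
  case True
  have "continuous_on UNIV (\<lambda>t. Z (max t 0) \<omega>)"
    by (rule continuous_on_compose2[OF Z[OF True]]) (auto intro!: continuous_intros)
  then show ?thesis
    unfolding ext_def by (intro continuous_intros x0c_continuous)
next
  case False
  then show ?thesis by (simp add: ext_def)
qed

lemma xx_continuous: "1 \<le> n \<Longrightarrow> continuous_on UNIV (\<lambda>t. xx n t \<omega>)"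
  using om(3) by (intro ext_continuous) (auto simp: good_def)

lemma y_equation:
  assumes n: "1 \<le> n" and \<omega>: "\<omega> \<in> om n" and t: "0 \<le> t"
  shows "y n t \<omega> = x0 0 + (LBINT s:{0..t}. SI (\<lambda>r. b (y n (gf n s - gf n r) \<omega>))) + B t \<omega>"
proof -
  have "Xn n t \<omega> = x0 0 + (LBINT s:{0..t}. SI (\<lambda>r. b (Xn n (gf n s - gf n r) \<omega>))) + B t \<omega>"
    using om(3)[OF n \<omega>] t unfolding good_def by blast
  also have "(LBINT s:{0..t}. SI (\<lambda>r. b (Xn n (gf n s - gf n r) \<omega>))) = (LBINT s:{0..t}. SI (\<lambda>r. b (y n (gf n s - gf n r) \<omega>)))"
    using gf_diff_bounds(1)[OF n] ext_eq(1)[OF n \<omega>]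
    by (intro set_lebesgue_integral_cong allI impI signed_integral_cong) auto
  finally show ?thesis using ext_eq(1)[OF n \<omega>, of t] t \<tau> by simp
qed

lemma xx_equation:
  assumes n: "1 \<le> n" and \<omega>: "\<omega> \<in> om n" and t: "0 \<le> t"
  shows "xx n t \<omega> = x0 0 + (LBINT s:{0..t}. SI (\<lambda>r. b (xx n (s - r) \<omega>))) + B t \<omega>"
proof -
  have "X t \<omega> = x0 0 + (LBINT s:{0..t}. SI (\<lambda>r. b (X (s - r) \<omega>))) + B t \<omega>"
    using om(3)[OF n \<omega>] t unfolding good_def by blast
  also have "(LBINT s:{0..t}. SI (\<lambda>r. b (X (s - r) \<omega>))) = (LBINT s:{0..t}. SI (\<lambda>r. b (xx n (s - r) \<omega>)))"
    using ext_eq(2)[OF n \<omega>]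
    by (intro set_lebesgue_integral_cong allI impI signed_integral_cong) (auto simp: V_space)
  finally show ?thesis using ext_eq(2)[OF n \<omega>, of t] t \<tau> by simp
qed

lemma b_continuous: "continuous_on A b"
  using taylor_bounds[OF b3 b'] continuous_on_subset by (metis subset_UNIV)

lemma b_measurable [measurable]: "b \<in> borel_measurable borel"
  by (rule borel_measurable_continuous_onI[OF b_continuous])

lemma b_linear_bound:
  obtains Kb where "0 < Kb" "\<And>z. \<bar>b z\<bar> \<le> Kb * (1 + \<bar>z\<bar>)"
proof -
  obtain K where K: "\<And>z. \<bar>b z\<bar> \<le> K * (1 + \<bar>z\<bar>)" using b_growth unfolding linear_growth_def by blast
  have "\<bar>b z\<bar> \<le> (1 + \<bar>K\<bar>) * (1 + \<bar>z\<bar>)" for z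
    using K[of z] mult_right_mono[of K "1 + \<bar>K\<bar>" "1 + \<bar>z\<bar>"] by linarith
  then show thesis by (intro that[of "1 + \<bar>K\<bar>"]) auto
qed

lemma gf_diff: "gf n s - gf n r = of_int (\<lfloor>s / \<Delta> n\<rfloor> - \<lfloor>r / \<Delta> n\<rfloor>) * \<Delta> n"
  by (simp only: grid_floor_def of_int_diff left_diff_distrib)

text \<open>Continuity of the path of the scheme is not yet available, since it is derived from the
  integrability of this function. Measurability comes from the grid: the path is evaluated at
  integer multiples of the step only.\<close>

lemma y_SI_measurable: "(\<lambda>s. SI (\<lambda>r. b (y n (gf n s - gf n r) \<omega>))) \<in> borel_measurable borel"
proof (rule signed_integral_measurable)
  have "(\<lambda>p. b (y n (of_int (\<lfloor>fst p / \<Delta> n\<rfloor> - \<lfloor>snd p / \<Delta> n\<rfloor>) * \<Delta> n) \<omega>)) \<in> borel_measurable (borel \<Otimes>\<^sub>M V)"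
    by (rule measurable_compose_countable[where f = "\<lambda>i p. b (y n (of_int i * \<Delta> n) \<omega>)"
          and g = "\<lambda>p. \<lfloor>fst p / \<Delta> n\<rfloor> - \<lfloor>snd p / \<Delta> n\<rfloor>"]) measurable
  then show "(\<lambda>(s, r). b (y n (gf n s - gf n r) \<omega>)) \<in> borel_measurable (borel \<Otimes>\<^sub>M V)"
    by (simp only: gf_diff case_prod_beta')
qed

lemma y_grid_measurable: "(\<lambda>r. b (y n (gf n s - gf n r) \<omega>)) \<in> borel_measurable V"
proof -
  have "(\<lambda>r. b (y n (of_int (\<lfloor>s / \<Delta> n\<rfloor> - \<lfloor>r / \<Delta> n\<rfloor>) * \<Delta> n) \<omega>)) \<in> borel_measurable V"
    by (rule measurable_compose_countable[where f = "\<lambda>i p. b (y n (of_int i * \<Delta> n) \<omega>)"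
          and g = "\<lambda>r. \<lfloor>s / \<Delta> n\<rfloor> - \<lfloor>r / \<Delta> n\<rfloor>"]) measurable
  then show ?thesis by (simp only: gf_diff)
qed

lemma y_SI_set_integrable:
  assumes n: "1 \<le> n"
  shows "set_integrable lborel {0..t} (\<lambda>s. SI (\<lambda>r. b (y n (gf n s - gf n r) \<omega>)))"
proof -
  \<comment> \<open>For \<open>s\<close> in \<open>{0..t}\<close> and \<open>r\<close> in
    \<open>{0..\<tau>}\<close> only finitely many grid points occur, the earliest being
    \<open>- \<tau>\<close> with index \<open>- n\<close>; hence the integrand is bounded.\<close>
  define S where "S = (\<lambda>i. \<bar>b (y n (of_int i * \<Delta> n) \<omega>)\<bar>) ` {- int n..\<lfloor>t / \<Delta> n\<rfloor>}"
  define R where "R = Max (insert 0 S)"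
  have S: "finite S" by (simp add: S_def)
  have R0: "0 \<le> R" unfolding R_def using S by simp
  have "\<bar>b (y n (gf n s - gf n r) \<omega>)\<bar> \<le> R" if s: "s \<in> {0..t}" and r: "r \<in> space V" for s r
  proof -
    define i where "i = \<lfloor>s / \<Delta> n\<rfloor> - \<lfloor>r / \<Delta> n\<rfloor>"
    have eq: "gf n s - gf n r = of_int i * \<Delta> n" by (simp only: i_def gf_diff)
    have "r / \<Delta> n \<le> \<tau> / \<Delta> n" using r \<Delta>[OF n] by (intro divide_right_mono) (auto simp: V_space)
    also have "\<dots> = real n" using \<tau> n by simp
    finally have "r / \<Delta> n \<le> real n" .
    then have "\<lfloor>r / \<Delta> n\<rfloor> \<le> int n" by linarith
    moreover have "0 \<le> \<lfloor>s / \<Delta> n\<rfloor>" "0 \<le> \<lfloor>r / \<Delta> n\<rfloor>" using s r \<Delta>[OF n] by (auto simp: V_space)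
    moreover have "\<lfloor>s / \<Delta> n\<rfloor> \<le> \<lfloor>t / \<Delta> n\<rfloor>" using s \<Delta>[OF n] by (intro floor_mono divide_right_mono) auto
    ultimately have "i \<in> {- int n..\<lfloor>t / \<Delta> n\<rfloor>}" unfolding i_def atLeastAtMost_iff by linarith
    then have "\<bar>b (y n (gf n s - gf n r) \<omega>)\<bar> \<in> S" unfolding eq S_def by blast
    then show ?thesis unfolding R_def using S by simp
  qed
  then have "\<bar>SI (\<lambda>r. b (y n (gf n s - gf n r) \<omega>))\<bar> \<le> 2 * R * measure \<mu> (space V)" if "s \<in> {0..t}" for s
    using that R0 by (intro signed_integral_bound y_grid_measurable) auto
  then show ?thesis by (rule set_integrable_bounded_Icc[OF y_SI_measurable])
qed

lemma y_continuous:
  assumes n: "1 \<le> n"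
  shows "continuous_on UNIV (\<lambda>t. y n t \<omega>)"
proof (rule ext_continuous[OF n])
  fix \<omega> assume \<omega>: "\<omega> \<in> om n"
  let ?F = "\<lambda>s. SI (\<lambda>r. b (y n (gf n s - gf n r) \<omega>))"
  have "continuous_on {0..T} (\<lambda>t. Xn n t \<omega>)" for T
  proof -
    have "?F integrable_on {0..T}"
      by (rule set_borel_integral_eq_integral(1)[OF y_SI_set_integrable[OF n]])
    then have "continuous_on {0..T} (\<lambda>t. integral {0..t} ?F)"
      by (rule indefinite_integral_continuous_1)
    moreover have "continuous_on {0..T} (\<lambda>t. B t \<omega>)"
      using om(3)[OF n \<omega>] by (auto simp: good_def intro: continuous_on_subset)
    ultimately have "continuous_on {0..T} (\<lambda>t. x0 0 + integral {0..t} ?F + B t \<omega>)"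
      by (intro continuous_intros)
    then show ?thesis
    proof (rule continuous_on_eq)
      fix t assume t: "t \<in> {0..T}"
      show "x0 0 + integral {0..t} ?F + B t \<omega> = Xn n t \<omega>"
        using y_equation[OF n \<omega>, of t] ext_eq(1)[OF n \<omega>, of t] \<tau> t
          set_borel_integral_eq_integral(2)[OF y_SI_set_integrable[OF n], of t \<omega>] by simp
    qed
  qed
  then show "continuous_on {0..} (\<lambda>t. Xn n t \<omega>)" by (rule continuous_on_atLeast_0)
qed

section \<open>Adaptedness of the scheme\<close>

text \<open>Up to time \<open>t\<close> in the mesh after \<open>k * \<Delta> n\<close>, the drift
  uses values at grid points up to \<open>k * \<Delta> n\<close> only. By induction these are known,
  and \<open>B t\<close> is known at time \<open>t\<close>.\<close>

lemma y_past_step: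
  assumes n: "1 \<le> n" and t: "real k * \<Delta> n < t" "t \<le> real (Suc k) * \<Delta> n"
    and IH: "\<And>u. 0 \<le> u \<Longrightarrow> u \<le> real k * \<Delta> n \<Longrightarrow> y n u \<in> borel_measurable (past u)"
  shows "y n t \<in> borel_measurable (past t)"
proof -
  have t0: "0 < t" using t(1) \<Delta>(1)[OF n] by (meson less_le_trans mult_nonneg_nonneg not_le of_nat_0_le_iff order.strict_trans1 less_imp_le)
  \<comment> \<open>Capping the index makes every \<open>\<psi> i\<close> measurable with respect to
    the past; on the interval of integration the cap is never active.\<close>
  define \<psi> where "\<psi> i \<omega> = b (y n (min (of_int i * \<Delta> n) (real k * \<Delta> n)) \<omega>)" for i :: int and \<omega>
  define Q where "Q = (\<lambda>\<omega> s. SI (\<lambda>r. \<psi> (\<lfloor>s / \<Delta> n\<rfloor> - \<lfloor>r / \<Delta> n\<rfloor>) \<omega>))"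
  have \<psi> [measurable]: "\<psi> i \<in> borel_measurable (past t)" for i
  proof -
    define z where "z = min (of_int i * \<Delta> n) (real k * \<Delta> n)"
    have "y n z \<in> borel_measurable (past t)"
    proof (cases "z < 0")
      case True
      note [measurable] = om(2)[OF n, of t]
      have "(\<lambda>\<omega>. indicator (om n) \<omega> * x0c z) \<in> borel_measurable (past t)" by measurable
      moreover have "y n z = (\<lambda>\<omega>. indicator (om n) \<omega> * x0c z)" using ext_neg(1)[OF n, of z] True by auto
      ultimately show ?thesis by simp
    next
      case False

      have z: "0 \<le> z" "z \<le> real k * \<Delta> n" "z \<le> t" using False t(1) by (auto simp: z_def)
      show ?thesis by (rule past_measurable_mono[OF z(3) IH[OF z(1,2)]])
    qed
    then show ?thesis unfolding \<psi>_def[abs_def] z_def[symmetric] by (rule measurable_compose[OF _ b_measurable])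
  qed
  have fl: "(\<lambda>(s, r). \<lfloor>s / \<Delta> n\<rfloor> - \<lfloor>r / \<Delta> n\<rfloor>) \<in> borel \<Otimes>\<^sub>M V \<rightarrow>\<^sub>M count_space UNIV" by measurable
  have fst1: "fst \<in> past t \<Otimes>\<^sub>M lborel \<rightarrow>\<^sub>M past t" and snd1: "snd \<in> past t \<Otimes>\<^sub>M lborel \<rightarrow>\<^sub>M borel" by simp_all
  have "(\<lambda>q. (\<lambda>(s, r). \<lfloor>s / \<Delta> n\<rfloor> - \<lfloor>r / \<Delta> n\<rfloor>) (snd (fst q), snd q)) \<in> (past t \<Otimes>\<^sub>M lborel) \<Otimes>\<^sub>M V \<rightarrow>\<^sub>M count_space UNIV"
    by (rule measurable_compose[OF measurable_Pair[OF measurable_compose[OF measurable_fst snd1] measurable_snd] fl])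
  then have "(\<lambda>q. \<psi> (\<lfloor>snd (fst q) / \<Delta> n\<rfloor> - \<lfloor>snd q / \<Delta> n\<rfloor>) (fst (fst q))) \<in> borel_measurable ((past t \<Otimes>\<^sub>M lborel) \<Otimes>\<^sub>M V)"
    by (intro measurable_compose_countable[where f = "\<lambda>i q. \<psi> i (fst (fst q))"
          and g = "\<lambda>q. \<lfloor>snd (fst q) / \<Delta> n\<rfloor> - \<lfloor>snd q / \<Delta> n\<rfloor>", OF measurable_compose[OF measurable_compose[OF measurable_fst fst1] \<psi>]]) simp
  then have "(\<lambda>p. SI (\<lambda>r. \<psi> (\<lfloor>snd p / \<Delta> n\<rfloor> - \<lfloor>r / \<Delta> n\<rfloor>) (fst p))) \<in> borel_measurable (past t \<Otimes>\<^sub>M lborel)"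
    by (intro signed_integral_measurable) (simp add: case_prod_beta')
  then have Qm [measurable]: "(\<lambda>(\<omega>, s). Q \<omega> s) \<in> borel_measurable (past t \<Otimes>\<^sub>M lborel)"
    by (simp add: Q_def case_prod_beta')
  have meas: "(\<lambda>\<omega>. \<integral>s. indicator {0..<t} s * Q \<omega> s \<partial>lborel) \<in> borel_measurable (past t)"
    by (rule lborel.borel_measurable_lebesgue_integral) measurable
  \<comment> \<open>The end point \<open>s = t\<close> is left out: if \<open>t\<close> is the next
    grid point, the integer part jumps there. It is a null set for the integral.\<close>
  have eq: "y n t \<omega> = x0 0 + (\<integral>s. indicator {0..<t} s * Q \<omega> s \<partial>lborel) + B t \<omega>" if \<omega>: "\<omega> \<in> om n" for \<omega>
  proof -
    have \<omega>': "\<omega> \<in> space (past t)" using \<omega> by (simp add: om_def)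
    have "(LBINT s:{0..t}. SI (\<lambda>r. b (y n (gf n s - gf n r) \<omega>))) = (\<integral>s. indicator {0..<t} s * Q \<omega> s \<partial>lborel)"
      unfolding set_lebesgue_integral_def
    proof (rule integral_cong_AE)
      show "(\<lambda>s. indicator {0..t} s *\<^sub>R SI (\<lambda>r. b (y n (gf n s - gf n r) \<omega>))) \<in> borel_measurable lborel"
        using y_SI_measurable[of n \<omega>] by (intro borel_measurable_scaleR borel_measurable_indicator) auto
      have "(\<lambda>s. (\<lambda>(\<omega>, s). Q \<omega> s) (\<omega>, s)) \<in> borel_measurable lborel"
        by (rule measurable_compose[OF measurable_Pair1'[OF \<omega>'] Qm])
      then show "(\<lambda>s. indicator {0..<t} s * Q \<omega> s) \<in> borel_measurable lborel" by simp
      have ne: "indicator {0..t} s *\<^sub>R SI (\<lambda>r. b (y n (gf n s - gf n r) \<omega>)) = indicator {0..<t} s * Q \<omega> s" if "s \<noteq> t" for s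
      proof (cases "s \<in> {0..<t}")
        case True
        have "s / \<Delta> n < real (Suc k)"
          by (subst pos_divide_less_eq[OF \<Delta>(1)[OF n]]) (use True t(2) in \<open>meson atLeastLessThan_iff less_le_trans\<close>)
        then have "\<lfloor>s / \<Delta> n\<rfloor> < int (Suc k)" by (simp add: floor_less_iff del: of_nat_Suc)
        then have "\<lfloor>s / \<Delta> n\<rfloor> \<le> int k" by simp
        have "SI (\<lambda>r. b (y n (gf n s - gf n r) \<omega>)) = Q \<omega> s"
          unfolding Q_def
        proof (rule signed_integral_cong)
          fix r assume "r \<in> space V"
          then have "0 \<le> \<lfloor>r / \<Delta> n\<rfloor>" using \<Delta>(1)[OF n] by (simp add: V_space)
          with \<open>\<lfloor>s / \<Delta> n\<rfloor> \<le> int k\<close> have "\<lfloor>s / \<Delta> n\<rfloor> - \<lfloor>r / \<Delta> n\<rfloor> \<le> int k" by linarith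
          then have "of_int (\<lfloor>s / \<Delta> n\<rfloor> - \<lfloor>r / \<Delta> n\<rfloor>) \<le> real k" by linarith
          then have "of_int (\<lfloor>s / \<Delta> n\<rfloor> - \<lfloor>r / \<Delta> n\<rfloor>) * \<Delta> n \<le> real k * \<Delta> n"
            using \<Delta>(1)[OF n] by (intro mult_right_mono) auto
          then show "b (y n (gf n s - gf n r) \<omega>) = \<psi> (\<lfloor>s / \<Delta> n\<rfloor> - \<lfloor>r / \<Delta> n\<rfloor>) \<omega>"
            unfolding gf_diff \<psi>_def by (simp only: min_absorb1)
        qed
        then show ?thesis using True by simp
      next
        case False
        then show ?thesis using that by (auto simp: indicator_def)
      qed
      show "AE s in lborel. indicator {0..t} s *\<^sub>R SI (\<lambda>r. b (y n (gf n s - gf n r) \<omega>)) = indicator {0..<t} s * Q \<omega> s"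
        using AE_lborel_singleton[of t] by eventually_elim (rule ne)
    qed
    then show ?thesis using y_equation[OF n \<omega>, of t] t0 by simp
  qed
  show ?thesis
  proof (rule borel_measurable_past_AE)
    show "AE \<omega> in M. y n t \<omega> = x0 0 + (\<integral>s. indicator {0..<t} s * Q \<omega> s \<partial>lborel) + B t \<omega>"
      using om(4)[OF n] by eventually_elim (rule eq)
    show "(\<lambda>\<omega>. x0 0 + (\<integral>s. indicator {0..<t} s * Q \<omega> s \<partial>lborel) + B t \<omega>) \<in> borel_measurable (past t)"
      using t0 by (intro borel_measurable_add borel_measurable_const meas B_past_measurable) auto
    show "y n t \<in> borel_measurable M" by (rule ext_measurable(1)[OF n])
  qed
qed

lemma y_past:
  assumes n: "1 \<le> n" and t: "0 \<le> t"
  shows "y n t \<in> borel_measurable (past t)"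
proof -
  have "y n u \<in> borel_measurable (past u)" if "0 \<le> u" "u \<le> real k * \<Delta> n" for k u
    using that
  proof (induction k arbitrary: u)
    case 0
    then have "u = 0" by simp
    note [measurable] = om(2)[OF n, of 0]
    have "(\<lambda>\<omega>. indicator (om n) \<omega> * x0c 0) \<in> borel_measurable (past 0)" by measurable
    moreover have "y n 0 = (\<lambda>\<omega>. indicator (om n) \<omega> * x0c 0)" using ext_neg(1)[OF n, of 0] by auto
    ultimately show ?case using \<open>u = 0\<close> by simp
  next
    case (Suc k)
    show ?case
    proof (cases "u \<le> real k * \<Delta> n")
      case False
      then show ?thesis using Suc.prems by (intro y_past_step[OF n _ _ Suc.IH]) auto
    qed (use Suc in auto)
  qed
  moreover have "t \<le> real (nat \<lceil>t / \<Delta> n\<rceil>) * \<Delta> n"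
    using \<Delta>(1)[OF n] t by (subst pos_divide_le_eq[symmetric]) linarith+
  ultimately show ?thesis using t by blast
qed

lemma y_process_measurable: "1 \<le> n \<Longrightarrow> (\<lambda>(t, \<omega>). y n t \<omega>) \<in> borel_measurable (borel \<Otimes>\<^sub>M M)"
  by (rule continuous_process_measurable[OF ext_measurable(1) y_continuous])

section \<open>Moment bounds for the scheme\<close>

lemma finite_\<mu>: "finite_measure \<mu>" by (rule finite_measure_total_var)

lemma y_increment_le:
  assumes n: "1 \<le> n" and \<omega>: "\<omega> \<in> om n" and Kb: "\<And>z. \<bar>b z\<bar> \<le> Kb * (1 + \<bar>z\<bar>)" and st: "0 \<le> s" "s \<le> t"
  shows "ennreal \<bar>y n t \<omega> - y n s \<omega> - (B t \<omega> - B s \<omega>)\<bar>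
    \<le> (\<integral>\<^sup>+ u. (\<integral>\<^sup>+ r. ennreal (2 * Kb * (1 + \<bar>y n (gf n u - gf n r) \<omega>\<bar>)) \<partial>\<mu>) * indicator {s..t} u \<partial>lborel)"
proof -
  let ?F = "\<lambda>u. SI (\<lambda>r. b (y n (gf n u - gf n r) \<omega>))"
  have le: "ennreal \<bar>?F u\<bar> \<le> (\<integral>\<^sup>+ r. ennreal (2 * Kb * (1 + \<bar>y n (gf n u - gf n r) \<omega>\<bar>)) \<partial>\<mu>)" for u
  proof -
    note signed_integral_abs_le[OF y_grid_measurable[of n u \<omega>], of \<eta>]
    also have "(\<integral>\<^sup>+ r. ennreal (2 * \<bar>b (y n (gf n u - gf n r) \<omega>)\<bar>) \<partial>\<mu>) \<le> (\<integral>\<^sup>+ r. ennreal (2 * Kb * (1 + \<bar>y n (gf n u - gf n r) \<omega>\<bar>)) \<partial>\<mu>)"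
    proof (rule nn_integral_mono, rule ennreal_leI)
      fix r show "2 * \<bar>b (y n (gf n u - gf n r) \<omega>)\<bar> \<le> 2 * Kb * (1 + \<bar>y n (gf n u - gf n r) \<omega>\<bar>)"
        using Kb[of "y n (gf n u - gf n r) \<omega>"] unfolding mult.assoc by (rule mult_left_mono) simp
    qed
    finally show ?thesis .
  qed
  have eq: "y n t \<omega> - y n s \<omega> - (B t \<omega> - B s \<omega>) = (LBINT u:{0..t}. ?F u) - (LBINT u:{0..s}. ?F u)"
    using y_equation[OF n \<omega>, of s] y_equation[OF n \<omega>, of t] st by simp
  have 1: "ennreal \<bar>(LBINT u:{0..t}. ?F u) - (LBINT u:{0..s}. ?F u)\<bar> \<le> (\<integral>\<^sup>+ u. ennreal \<bar>?F u\<bar> * indicator {s..t} u \<partial>lborel)"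
    by (rule set_integral_Icc_diff_le[OF y_SI_set_integrable[OF n] st])
  have 2: "(\<integral>\<^sup>+ u. ennreal \<bar>?F u\<bar> * indicator {s..t} u \<partial>lborel) \<le> (\<integral>\<^sup>+ u. (\<integral>\<^sup>+ r. ennreal (2 * Kb * (1 + \<bar>y n (gf n u - gf n r) \<omega>\<bar>)) \<partial>\<mu>) * indicator {s..t} u \<partial>lborel)"
  proof -
    define g where "g u = ennreal \<bar>?F u\<bar>" for u
    define h where "h u = (\<integral>\<^sup>+ r. ennreal (2 * Kb * (1 + \<bar>y n (gf n u - gf n r) \<omega>\<bar>)) \<partial>\<mu>)" for u
    have "g u \<le> h u" for u unfolding g_def h_def by (rule le)
    then have "(\<integral>\<^sup>+ u. g u * indicator {s..t} u \<partial>lborel) \<le> (\<integral>\<^sup>+ u. h u * indicator {s..t} u \<partial>lborel)"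
      by (intro nn_integral_mono mult_right_mono) auto
    then show ?thesis unfolding g_def h_def .
  qed
  show ?thesis unfolding eq by (rule order_trans[OF 1 2])
qed

lemma B_O: "Lp_O {0..T} B (\<lambda>_. 1)"
proof (rule Lp_O_dom[where K = 1])
  have "Lp_O {0..T} (\<lambda>t \<omega>. B t \<omega> - B 0 \<omega>) (\<lambda>t. t powr H)"
    using Lp_O_reindex[OF B_increment_O, of "{0..T}" "\<lambda>t. (0, t)"] by simp
  then show "Lp_O {0..T} (\<lambda>t \<omega>. B t \<omega> - B 0 \<omega>) (\<lambda>_. 1)"
    by (rule Lp_O_scale[where K = "T powr H"]) (use H in \<open>auto intro: powr_mono2\<close>)
  show "AE \<omega> in M. \<bar>B t \<omega>\<bar> \<le> 1 * \<bar>B t \<omega> - B 0 \<omega>\<bar>" for t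
    using B_0 by eventually_elim simp
qed (auto intro: B_measurable)

lemma grid_lag_measurable: "(\<lambda>(s, r). gf n s - gf n r) \<in> borel_measurable (borel \<Otimes>\<^sub>M V)"
  by measurable

text \<open>Linear growth of \<open>b\<close> and Gronwall's inequality with the lag
  \<open>gf n s - gf n r\<close>, which never exceeds \<open>s\<close>; all constants are free of
  \<open>n\<close>.\<close>

lemma y_O:
  "Lp_O {(n, t). 1 \<le> n \<and> - \<tau> \<le> t \<and> t \<le> T} (\<lambda>(n, t). y n t) (\<lambda>_. 1)"
proof -
  obtain Kb where Kb: "0 < Kb" "\<And>z. \<bar>b z\<bar> \<le> Kb * (1 + \<bar>z\<bar>)" using b_linear_bound by metis
  obtain R where R: "0 \<le> R" "\<And>t. \<bar>x0c t\<bar> \<le> R" using x0c_bounded by metis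
  define m where "m = measure \<mu> (space \<mu>)"
  have m0: "0 \<le> m" by (simp add: m_def)
  show ?thesis
    unfolding Lp_O_def
  proof (intro conjI ballI allI impI)
    fix p :: nat assume p: "1 \<le> p"
    obtain CB where CB: "0 \<le> CB" "\<And>t. t \<in> {0..T} \<Longrightarrow> Lp_le p (B t) (CB * 1)"
      using Lp_O_E[OF B_O p, of T] by metis
    define \<alpha> where "\<alpha> = R + 2 * Kb * \<bar>T\<bar> * m + CB"
    \<comment> \<open>Twice the Gronwall constant \<open>2 * Kb\<close> times the mass of
      \<open>\<mu>\<close>; the added one keeps \<open>l\<close> positive if the mass is
      zero.\<close>
    define l where "l = 4 * Kb * m + 1"
    have \<alpha>0: "0 \<le> \<alpha>" "R \<le> \<alpha>" using R(1) Kb(1) m0 CB(1) by (auto simp: \<alpha>_def)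
    have l0: "0 < l" using Kb(1) m0 by (simp add: l_def add_nonneg_pos)
    have const: "Lp_le p (\<lambda>_. c) d" if "\<bar>c\<bar> \<le> d" for c d
      using that by (auto simp: Lp_le_def emeasure_space_1 intro!: ennreal_leI power_mono)
    have neg: "Lp_le p (y n t) \<alpha>" if n: "1 \<le> n" and t: "t \<le> 0" for n t
    proof (rule Lp_le_dom[OF const[of R \<alpha>]])
      show "AE \<omega> in M. \<bar>y n t \<omega>\<bar> \<le> \<bar>R\<bar>"
        using R by (intro AE_I2) (auto simp: ext_neg(1)[OF n t] indicator_def)
    qed (use R \<alpha>0 ext_measurable(1)[OF n] in auto)
    have pos: "Lp_le p (y n t) (2 * \<alpha> * exp (l * t))" if n: "1 \<le> n" and t: "t \<in> {0..T}" for n t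
    proof (rule Lp_le_gronwall_continuous[OF finite_\<mu> p ext_measurable(1)[OF n] y_continuous[OF n] _ _ less_imp_le[OF \<tau>] _ _ \<alpha>0(1) _ _ l0 _ t])
      show "(\<lambda>(s, r). gf n s - gf n r) \<in> borel_measurable (borel \<Otimes>\<^sub>M \<mu>)"
        using grid_lag_measurable by (simp cong: measurable_cong_sets)
      show "gf n s - gf n r \<in> {- \<tau>..s}" if "s \<in> {0..T}" "r \<in> space \<mu>" for s r
        using gf_diff_bounds[OF n, of s r] that by simp
      show "Lp_le p (\<lambda>\<omega>. (R + 2 * Kb * \<bar>T\<bar> * m) + \<bar>B t \<omega>\<bar>) \<alpha>" if t: "t \<in> {0..T}" for t
        unfolding \<alpha>_def
      proof (rule Lp_le_add[OF p const])
        show "Lp_le p (\<lambda>\<omega>. \<bar>B t \<omega>\<bar>) CB" using CB(2)[OF t] by (auto simp: Lp_le_def)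
      qed (use R Kb m0 in simp)
      show "Lp_le p (y n t) \<alpha>" if "t \<in> {- \<tau>..<0}" for t using that by (intro neg[OF n]) auto
      show "AE \<omega> in M. ennreal \<bar>y n t \<omega>\<bar> \<le> ennreal \<bar>(R + 2 * Kb * \<bar>T\<bar> * m) + \<bar>B t \<omega>\<bar>\<bar>
       + (\<integral>\<^sup>+ s. (\<integral>\<^sup>+ r. ennreal ((2 * Kb) * \<bar>y n (gf n s - gf n r) \<omega>\<bar>) \<partial>\<mu>) * indicator {0..t} s \<partial>lborel)"
        if t: "t \<in> {0..T}" for t
        using om(4)[OF n] B_0
      proof eventually_elim
        case (elim \<omega>)
        let ?I = "\<integral>\<^sup>+ s. (\<integral>\<^sup>+ r. ennreal ((2 * Kb) * \<bar>y n (gf n s - gf n r) \<omega>\<bar>) \<partial>\<mu>) * indicator {0..t} s \<partial>lborel"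
        have [measurable]: "(\<lambda>(s, r). y n (gf n s - gf n r) \<omega>) \<in> borel_measurable (borel \<Otimes>\<^sub>M V)"
          using measurable_compose[OF grid_lag_measurable borel_measurable_continuous_onI[OF y_continuous[OF n]]]
          by (simp add: case_prod_beta')
        interpret \<mu>: finite_measure \<mu> by (rule finite_\<mu>)
        have "ennreal \<bar>y n t \<omega> - y n 0 \<omega> - (B t \<omega> - B 0 \<omega>)\<bar>
          \<le> (\<integral>\<^sup>+ u. (\<integral>\<^sup>+ r. ennreal (2 * Kb * (1 + \<bar>y n (gf n u - gf n r) \<omega>\<bar>)) \<partial>\<mu>) * indicator {0..t} u \<partial>lborel)"
          using elim(1) t by (intro y_increment_le[OF n _ Kb(2)]) auto
        also have "\<dots> = (\<integral>\<^sup>+ u. ennreal (2 * Kb * m) * indicator {0..t} u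
            + (\<integral>\<^sup>+ r. ennreal (2 * Kb * \<bar>y n (gf n u - gf n r) \<omega>\<bar>) \<partial>\<mu>) * indicator {0..t} u \<partial>lborel)"
        proof (intro nn_integral_cong)
          fix u :: real
          have "(\<integral>\<^sup>+ r. ennreal (2 * Kb * (1 + \<bar>y n (gf n u - gf n r) \<omega>\<bar>)) \<partial>\<mu>)
            = (\<integral>\<^sup>+ r. ennreal (2 * Kb) + ennreal (2 * Kb * \<bar>y n (gf n u - gf n r) \<omega>\<bar>) \<partial>\<mu>)"
            using Kb(1) by (intro nn_integral_cong) (simp add: ennreal_plus[symmetric] distrib_left del: ennreal_plus)
          also have "\<dots> = ennreal (2 * Kb * m) + (\<integral>\<^sup>+ r. ennreal (2 * Kb * \<bar>y n (gf n u - gf n r) \<omega>\<bar>) \<partial>\<mu>)"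
            using Kb(1) by (subst nn_integral_add) (auto simp: \<mu>.emeasure_eq_measure m_def ennreal_mult[symmetric])
          finally show "(\<integral>\<^sup>+ r. ennreal (2 * Kb * (1 + \<bar>y n (gf n u - gf n r) \<omega>\<bar>)) \<partial>\<mu>) * indicator {0..t} u
            = ennreal (2 * Kb * m) * indicator {0..t} u + (\<integral>\<^sup>+ r. ennreal (2 * Kb * \<bar>y n (gf n u - gf n r) \<omega>\<bar>) \<partial>\<mu>) * indicator {0..t} u"
            by (simp add: distrib_right)
        qed
        also have "\<dots> = ennreal (2 * Kb * m) * ennreal t + ?I"
          using t by (subst nn_integral_add) (auto simp: nn_integral_cmult_indicator emeasure_lborel_Icc_eq)
        also have "ennreal (2 * Kb * m) * ennreal t = ennreal (2 * Kb * m * t)"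
          using Kb(1) m0 t by (simp add: ennreal_mult[symmetric])
        finally have 1: "ennreal \<bar>y n t \<omega> - y n 0 \<omega> - (B t \<omega> - B 0 \<omega>)\<bar> \<le> ennreal (2 * Kb * m * t) + ?I" .
        have "\<bar>y n 0 \<omega>\<bar> \<le> R" using R by (auto simp: ext_neg(1)[OF n] indicator_def)
        then have "\<bar>y n t \<omega>\<bar> \<le> \<bar>y n t \<omega> - y n 0 \<omega> - (B t \<omega> - B 0 \<omega>)\<bar> + (R + \<bar>B t \<omega>\<bar>)"
          using elim(2) by linarith
        then have "ennreal \<bar>y n t \<omega>\<bar> \<le> ennreal \<bar>y n t \<omega> - y n 0 \<omega> - (B t \<omega> - B 0 \<omega>)\<bar> + ennreal (R + \<bar>B t \<omega>\<bar>)"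
          using R(1) by (simp add: ennreal_plus[symmetric] ennreal_leI del: ennreal_plus)
        also have "\<dots> \<le> (ennreal (2 * Kb * m * t) + ?I) + ennreal (R + \<bar>B t \<omega>\<bar>)"
          by (intro add_mono 1) auto
        also have "\<dots> = ennreal (2 * Kb * m * t + (R + \<bar>B t \<omega>\<bar>)) + ?I"
          using Kb(1) m0 t R(1) by (simp add: ac_simps)
        also have "\<dots> \<le> ennreal \<bar>(R + 2 * Kb * \<bar>T\<bar> * m) + \<bar>B t \<omega>\<bar>\<bar> + ?I"
        proof (intro add_mono ennreal_leI order_refl)
          have "(2 * Kb * m) * t \<le> (2 * Kb * m) * \<bar>T\<bar>" using t Kb(1) m0 by (intro mult_left_mono) auto
          then show "2 * Kb * m * t + (R + \<bar>B t \<omega>\<bar>) \<le> \<bar>(R + 2 * Kb * \<bar>T\<bar> * m) + \<bar>B t \<omega>\<bar>\<bar>"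
            by (simp add: mult_ac)
        qed
        finally show ?case .
      qed
      show "0 < 2 * Kb" using Kb by simp
      show "2 * (2 * Kb) * measure \<mu> (space \<mu>) \<le> l" by (simp add: l_def m_def)
    qed
    have "Lp_le p (y n t) (\<alpha> * (2 * exp (l * \<bar>T\<bar>)) * 1)" if n: "1 \<le> n" and t: "- \<tau> \<le> t" "t \<le> T" for n t
    proof (cases "t < 0")
      case True
      have "1 \<le> exp (l * \<bar>T\<bar>)" using l0 by simp
      then have "1 \<le> 2 * exp (l * \<bar>T\<bar>)" by linarith
      then have "\<alpha> * 1 \<le> \<alpha> * (2 * exp (l * \<bar>T\<bar>))" using \<alpha>0 by (intro mult_left_mono) auto
      then show ?thesis using neg[OF n, of t] True by (auto intro: Lp_le_mono_bound)
    next
      case False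
      have "2 * \<alpha> * exp (l * t) \<le> \<alpha> * (2 * exp (l * \<bar>T\<bar>)) * 1"
        using l0 t \<alpha>0(1) by (simp add: mult_left_mono)
      then show ?thesis using pos[OF n, of t] False t by (auto intro: Lp_le_mono_bound)
    qed
    then show "\<exists>C\<ge>0. \<forall>i\<in>{(n, t). 1 \<le> n \<and> - \<tau> \<le> t \<and> t \<le> T}. Lp_le p (case i of (n, t) \<Rightarrow> y n t) (C * 1)"
      using \<alpha>0(1) by (intro exI[of _ "\<alpha> * (2 * exp (l * \<bar>T\<bar>))"]) auto
  qed auto
qed

text \<open>The drift assumption of the increment sums: the integrand of the drift has moments
  bounded uniformly in \<open>n\<close>, so its integral is Lipschitz in time.\<close>

lemma y_drift_O:
  "Lp_O {(n, s, t). 1 \<le> n \<and> 0 \<le> s \<and> s \<le> t \<and> t \<le> T}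
     (\<lambda>(n, s, t) \<omega>. y n t \<omega> - y n s \<omega> - (B t \<omega> - B s \<omega>)) (\<lambda>(n, s, t). t - s)"
  unfolding Lp_O_def
proof (intro conjI ballI allI impI)
  obtain Kb where Kb: "0 < Kb" "\<And>z. \<bar>b z\<bar> \<le> Kb * (1 + \<bar>z\<bar>)" using b_linear_bound by metis
  define m where "m = measure \<mu> (space \<mu>)"
  have m0: "0 \<le> m" by (simp add: m_def)
  fix p :: nat assume p: "1 \<le> p"
  have "\<exists>C\<ge>0. \<forall>i\<in>{(n, t). 1 \<le> n \<and> - \<tau> \<le> t \<and> t \<le> T}. Lp_le p ((\<lambda>(n, t). y n t) i) (C * 1)"
    using y_O[of T] p unfolding Lp_O_def by blast
  then obtain C where C: "0 \<le> C" "\<forall>i\<in>{(n, t). 1 \<le> n \<and> - \<tau> \<le> t \<and> t \<le> T}. Lp_le p ((\<lambda>(n, t). y n t) i) (C * 1)"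
    by blast
  have C': "Lp_le p (y n t) C" if "1 \<le> n" "- \<tau> \<le> t" "t \<le> T" for n t
    using C(2)[rule_format, of "(n, t)"] that by simp
  let ?c = "2 * Kb * (1 + C)"
  have "Lp_le p (\<lambda>\<omega>. y n t \<omega> - y n s \<omega> - (B t \<omega> - B s \<omega>)) (?c * m * (t - s))"
    if n: "1 \<le> n" and st: "0 \<le> s" "s \<le> t" "t \<le> T" for n s t
  proof (rule Lp_le_double_integral[OF finite_\<mu> p, where a = s and b = t and c = "\<lambda>_. ?c"
        and G = "\<lambda>u r \<omega>. 2 * Kb * (1 + \<bar>y n (gf n u - gf n r) \<omega>\<bar>)"])
    have "(\<lambda>q. (\<lambda>(t, \<omega>). y n t \<omega>) ((\<lambda>(s, r). gf n s - gf n r) (fst q), snd q)) \<in> borel_measurable ((borel \<Otimes>\<^sub>M V) \<Otimes>\<^sub>M M)"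
      by (rule measurable_compose[OF measurable_Pair[OF measurable_compose[OF measurable_fst grid_lag_measurable] measurable_snd] y_process_measurable[OF n]])
    then have "(\<lambda>q. 2 * Kb * (1 + \<bar>(\<lambda>(t, \<omega>). y n t \<omega>) ((\<lambda>(s, r). gf n s - gf n r) (fst q), snd q)\<bar>)) \<in> borel_measurable ((borel \<Otimes>\<^sub>M V) \<Otimes>\<^sub>M M)"
      by measurable
    then show "(\<lambda>((u, r), \<omega>). 2 * Kb * (1 + \<bar>y n (gf n u - gf n r) \<omega>\<bar>)) \<in> borel_measurable ((borel \<Otimes>\<^sub>M \<mu>) \<Otimes>\<^sub>M M)"
      by (simp add: case_prod_beta' cong: measurable_cong_sets)
    show "0 \<le> 2 * Kb * (1 + \<bar>y n (gf n u - gf n r) \<omega>\<bar>)" for u r \<omega> using Kb(1) by simp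
    show "(\<lambda>_. ?c) \<in> borel_measurable borel" by (rule measurable_const) simp
    show "0 < ?c" using Kb(1) C(1) by simp
    have "(\<integral>\<^sup>+ u. ennreal ?c * indicator {s..t} u \<partial>lborel) * ennreal m = ennreal ?c * ennreal (t - s) * ennreal m"
      using st by (simp add: nn_integral_cmult_indicator emeasure_lborel_Icc_eq)
    also have "\<dots> = ennreal (?c * m * (t - s))"
      using Kb(1) C(1) st m0 by (simp add: ennreal_mult[symmetric] mult_ac)
    finally show "(\<integral>\<^sup>+ u. ennreal ?c * indicator {s..t} u \<partial>lborel) * ennreal (measure \<mu> (space \<mu>)) \<le> ennreal (?c * m * (t - s))"
      by (simp add: m_def)
    show "0 \<le> ?c * m * (t - s)" using Kb(1) C(1) st m0 by simp
    show "Lp_le p (\<lambda>\<omega>. 2 * Kb * (1 + \<bar>y n (gf n u - gf n r) \<omega>\<bar>)) ?c" if u: "u \<in> {s..t}" and r: "r \<in> space \<mu>" for u r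
    proof -
      have "Lp_le p (\<lambda>\<omega>. 2 * Kb) (2 * Kb)" "Lp_le p (\<lambda>\<omega>. 2 * Kb * \<bar>y n (gf n u - gf n r) \<omega>\<bar>) (2 * Kb * C)"
      proof -
        show "Lp_le p (\<lambda>\<omega>. 2 * Kb) (2 * Kb)" using Kb(1) by (auto simp: Lp_le_def emeasure_space_1)
        have "Lp_le p (y n (gf n u - gf n r)) C"
          using gf_diff_bounds[OF n, of u r] u r st by (intro C'[OF n]) auto
        then show "Lp_le p (\<lambda>\<omega>. 2 * Kb * \<bar>y n (gf n u - gf n r) \<omega>\<bar>) (2 * Kb * C)"
          using Kb(1) by (intro Lp_le_cmult_abs) simp_all
      qed
      from Lp_le_add[OF p this] show ?thesis by (simp add: distrib_left)
    qed
    show "(\<lambda>\<omega>. y n t \<omega> - y n s \<omega> - (B t \<omega> - B s \<omega>)) \<in> borel_measurable M"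
      using ext_measurable(1)[OF n, of t] ext_measurable(1)[OF n, of s] B_measurable[of s] B_measurable[of t] st by auto
    show "AE \<omega> in M. ennreal \<bar>y n t \<omega> - y n s \<omega> - (B t \<omega> - B s \<omega>)\<bar>
      \<le> (\<integral>\<^sup>+ u. (\<integral>\<^sup>+ r. ennreal (2 * Kb * (1 + \<bar>y n (gf n u - gf n r) \<omega>\<bar>)) \<partial>\<mu>) * indicator {s..t} u \<partial>lborel)"
      using om(4)[OF n] by eventually_elim (rule y_increment_le[OF n _ Kb(2) st(1,2)])
  qed
  then show "\<exists>Ca\<ge>0. \<forall>i\<in>{(n, s, t). 1 \<le> n \<and> 0 \<le> s \<and> s \<le> t \<and> t \<le> T}.
      Lp_le p ((\<lambda>(n, s, t) \<omega>. y n t \<omega> - y n s \<omega> - (B t \<omega> - B s \<omega>)) i) (Ca * (case i of (n, s, t) \<Rightarrow> t - s))"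
    using Kb(1) C(1) m0 by (intro exI[of _ "?c * m"]) auto
qed auto

end

section \<open>Sums over the grid for a fixed delay\<close>

text \<open>Filling \<open>N\<close> meshes up to a power of two at most about doubles their number,
  so the time horizon stays bounded.\<close>

lemma ex_power2_ge: "\<exists>L. N \<le> 2 ^ L \<and> 2 ^ L \<le> 2 * N + (1 :: nat)"
proof (induction N)
  case 0
  show ?case by (intro exI[of _ 0]) simp
next
  case (Suc N)
  then obtain L where L: "N \<le> 2 ^ L" "2 ^ L \<le> 2 * N + (1 :: nat)" by blast
  show ?case
  proof (cases "Suc N \<le> 2 ^ L")
    case True
    then show ?thesis using L by (intro exI[of _ L]) auto
  next
    case False
    then have "2 ^ L = N" using L(1) by simp
    moreover have "1 \<le> (2 :: nat) ^ L" by simp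
    ultimately have "Suc N \<le> 2 ^ Suc L" "2 ^ Suc L \<le> 2 * Suc N + (1 :: nat)" by auto
    then show ?thesis by blast
  qed
qed

lemma sum_split_shift:
  fixes g :: "nat \<Rightarrow> real"
  assumes "N \<le> m"
  shows "(\<Sum>k<N. g k) = (\<Sum>k<min k0 N. g k) + (\<Sum>j<m. (if k0 + j < N then 1 else 0) * g (k0 + j))"
proof (cases "k0 < N")
  case True
  have "(\<Sum>j<m. (if k0 + j < N then 1 else 0) * g (k0 + j)) = (\<Sum>j\<in>{..<m} \<inter> {j. k0 + j < N}. g (k0 + j))"
    by (subst sum.inter_restrict) (auto intro!: sum.cong)
  also have "{..<m} \<inter> {j. k0 + j < N} = {..<N - k0}" using assms by auto
  also have "(\<Sum>j<N - k0. g (k0 + j)) = (\<Sum>k\<in>{k0..<N}. g k)"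
    by (rule sum.reindex_bij_witness[of _ "\<lambda>k. k - k0" "\<lambda>j. k0 + j"]) auto
  finally show ?thesis
    using True sum.atLeastLessThan_concat[of 0 k0 N g] by (simp add: lessThan_atLeast0 min_def)
next
  case False
  then show ?thesis by (simp add: min_def)
qed

context sdde
begin

abbreviation rho :: real where "rho \<equiv> min (3 * H) (H + 1/2)"

text \<open>The exponent \<open>rho - 1\<close> is negative, so bounded quantities are of the
  admissible order \<open>\<Delta> n powr (rho - 1)\<close>.\<close>

lemma one_le_rate: "1 \<le> n \<Longrightarrow> 1 \<le> \<tau> powr (1 - rho) * \<Delta> n powr (rho - 1)"
proof -
  assume n: "1 \<le> n"
  have "rho - 1 \<le> 0" using H by simp
  then have "\<tau> powr (rho - 1) \<le> \<Delta> n powr (rho - 1)"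
    using \<Delta>[OF n] by (intro powr_mono2') auto
  then have "\<tau> powr (1 - rho) * \<tau> powr (rho - 1) \<le> \<tau> powr (1 - rho) * \<Delta> n powr (rho - 1)"
    by (intro mult_left_mono) auto
  moreover have "\<tau> powr (1 - rho) * \<tau> powr (rho - 1) = 1"
    using \<tau> by (simp add: powr_add[symmetric])
  ultimately show ?thesis by simp
qed

text \<open>The weights belong to the index because they will depend on the position in the mesh and
  on the final time, and the bounds have to be uniform in both.\<close>

definition shifts :: "real \<Rightarrow> (nat \<times> nat \<times> real \<times> real \<times> (nat \<Rightarrow> real)) set" where
  "shifts S = {(n, N, r, x, c). 1 \<le> n \<and> 0 \<le> r \<and> r \<le> \<tau> \<and> 0 \<le> x \<and> x \<le> \<Delta> n \<and> real N * \<Delta> n \<le> S \<and> (\<forall>k. \<bar>c k\<bar> \<le> 1)}"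

text \<open>The first \<open>k\<close> for which the lagged time \<open>k * \<Delta> n - r\<close>
  is nonnegative. From there on the scheme is driven by \<open>B\<close>; before, it is the initial
  path.\<close>

definition k0 :: "nat \<Rightarrow> real \<Rightarrow> nat" where "k0 n r = nat \<lceil>r / \<Delta> n\<rceil>"

lemma k0:
  assumes n: "1 \<le> n" and r: "0 \<le> r"
  shows "r \<le> real (k0 n r) * \<Delta> n" "real (k0 n r) * \<Delta> n < r + \<Delta> n"
    "k < k0 n r \<Longrightarrow> real k * \<Delta> n < r" 
proof -
  have c: "real (k0 n r) = of_int \<lceil>r / \<Delta> n\<rceil>" using r \<tau> by (simp add: k0_def)
  have "r / \<Delta> n \<le> real (k0 n r)" unfolding c by linarith
  then show "r \<le> real (k0 n r) * \<Delta> n" by (subst (asm) pos_divide_le_eq[OF \<Delta>(1)[OF n]])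
  have "real (k0 n r) - 1 < r / \<Delta> n" unfolding c by linarith
  then have "(real (k0 n r) - 1) * \<Delta> n < r" by (subst (asm) pos_less_divide_eq[OF \<Delta>(1)[OF n]])
  then show *: "real (k0 n r) * \<Delta> n < r + \<Delta> n" unfolding left_diff_distrib by linarith
  assume "k < k0 n r"
  then have "(real k + 1) * \<Delta> n \<le> real (k0 n r) * \<Delta> n" using \<Delta>(1)[OF n] by (intro mult_right_mono) auto
  then show "real k * \<Delta> n < r" using * unfolding distrib_right by linarith
qed

text \<open>From \<open>k0\<close> on, the lagged times form a grid with mesh
  \<open>\<Delta> n\<close> that starts at \<open>k0 * \<Delta> n - r\<close>, in the first mesh
  after zero. The result on increment sums applies, with zero weights beyond
  \<open>N\<close>.\<close>

lemma shift_late_O: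
  "Lp_O (shifts S) (\<lambda>(n, N, r, x, c) \<omega>. \<Sum>j<2 ^ (SOME L. N \<le> 2 ^ L \<and> 2 ^ L \<le> 2 * N + (1 :: nat)).
      (if k0 n r + j < N then c (k0 n r + j) else 0) *
      (b (y n (real (k0 n r + j) * \<Delta> n - r + x) \<omega>) - b (y n (real (k0 n r + j) * \<Delta> n - r) \<omega>)))
    (\<lambda>(n, N, r, x, c). \<Delta> n powr (rho - 1))"
proof -
  obtain K where K: "0 < K" "\<And>y. \<bar>deriv b y\<bar> \<le> K" "\<And>y. \<bar>deriv (deriv b) y\<bar> \<le> K"
    "\<And>y z. \<bar>b z - b y - deriv b y * (z - y) - deriv (deriv b) y / 2 * (z - y)\<^sup>2\<bar> \<le> K * \<bar>z - y\<bar> ^ 3"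
    "\<And>y z. \<bar>deriv b z - deriv b y - deriv (deriv b) y * (z - y)\<bar> \<le> K * (z - y)\<^sup>2"
    "\<And>y z. \<bar>deriv (deriv b) z - deriv (deriv b) y\<bar> \<le> K * \<bar>z - y\<bar>"
    "continuous_on UNIV (deriv b)" "continuous_on UNIV (deriv (deriv b))"
    using taylor_bounds[OF b3 b'] by metis
  define Lg where "Lg N = (SOME L. N \<le> 2 ^ L \<and> 2 ^ L \<le> 2 * N + (1 :: nat))" for N
  have Lg: "N \<le> 2 ^ Lg N" "2 ^ Lg N \<le> 2 * N + (1 :: nat)" for N
    unfolding Lg_def using someI_ex[OF ex_power2_ge[of N]] by blast+
  \<comment> \<open>\<open>2 * N + 1\<close> meshes take at most \<open>2 * S + \<tau>\<close>, and
    the grid starts at most \<open>\<tau>\<close> after zero.\<close>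
  define T where "T = 2 * S + 2 * \<tau>"
  interpret P: fbm_process M W B H "shifts S" "\<lambda>(n, N, r, x, c). y n" "\<lambda>(n, N, r, x, c). \<Delta> n"
    "\<lambda>(n, N, r, x, c). real (k0 n r) * \<Delta> n - r" "\<lambda>(n, N, r, x, c). x" "\<lambda>(n, N, r, x, c). Lg N"
    "\<lambda>(n, N, r, x, c) j. if k0 n r + j < N then c (k0 n r + j) else 0" T K b "deriv b" "deriv (deriv b)"
  proof
    fix i assume i: "i \<in> shifts S"
    obtain n N r x c where [simp]: "i = (n, N, r, x, c)" by (cases i) auto
    have n: "1 \<le> n" and r: "0 \<le> r" "r \<le> \<tau>" and x: "0 \<le> x" "x \<le> \<Delta> n" and N: "real N * \<Delta> n \<le> S" and c: "\<And>k. \<bar>c k\<bar> \<le> 1"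
      using i by (auto simp: shifts_def)
    show "0 < (case i of (n, N, r, x, c) \<Rightarrow> \<Delta> n)" using \<Delta>(1)[OF n] by simp
    show "0 \<le> (case i of (n, N, r, x, c) \<Rightarrow> real (k0 n r) * \<Delta> n - r)" using k0(1)[OF n r(1)] by simp
    show "0 \<le> (case i of (n, N, r, x, c) \<Rightarrow> x) \<and> (case i of (n, N, r, x, c) \<Rightarrow> x) \<le> (case i of (n, N, r, x, c) \<Rightarrow> \<Delta> n)"
      using x by simp
    have "real (2 ^ Lg N) * \<Delta> n \<le> real (2 * N + 1) * \<Delta> n"
      using Lg(2)[of N] \<Delta>(1)[OF n] by (intro mult_right_mono of_nat_mono) auto
    also have "real (2 * N + 1) * d = 2 * (real N * d) + d" for d by (simp add: distrib_right)
    finally have "2 ^ Lg N * \<Delta> n \<le> 2 * S + \<tau>" using N \<Delta>(2)[OF n] by simp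
    moreover have "real (k0 n r) * \<Delta> n - r \<le> \<tau>" using k0(2)[OF n r(1)] \<Delta>(2)[OF n] by linarith
    ultimately have "real (k0 n r) * \<Delta> n - r + 2 ^ Lg N * \<Delta> n \<le> T" unfolding T_def by linarith
    then show "(case i of (n, N, r, x, c) \<Rightarrow> real (k0 n r) * \<Delta> n - r)
        + 2 ^ (case i of (n, N, r, x, c) \<Rightarrow> Lg N) * (case i of (n, N, r, x, c) \<Rightarrow> \<Delta> n) \<le> T" by simp
    show "\<bar>(case i of (n, N, r, x, c) \<Rightarrow> \<lambda>j. if k0 n r + j < N then c (k0 n r + j) else 0) k\<bar> \<le> 1" for k
      using c by simp
    show "(case i of (n, N, r, x, c) \<Rightarrow> y n) t \<in> borel_measurable (past t)" if "0 \<le> t" for t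
      using y_past[OF n that] by simp
  next
    have "Lp_O {(i, s, t). i \<in> shifts S \<and> 0 \<le> s \<and> s \<le> t \<and> t \<le> T}
     (\<lambda>p. (\<lambda>(n, s, t) \<omega>. y n t \<omega> - y n s \<omega> - (B t \<omega> - B s \<omega>)) ((\<lambda>((n, _), s, t). (n, s, t)) p))
     (\<lambda>p. (\<lambda>(n, s, t). t - s) ((\<lambda>((n, _), s, t). (n, s, t)) p))"
      by (rule Lp_O_reindex[OF y_drift_O[of T]]) (auto simp: shifts_def)
    then show "Lp_O {(i, s, t). i \<in> shifts S \<and> 0 \<le> s \<and> s \<le> t \<and> t \<le> T}
     (\<lambda>(i, s, t) \<omega>. (case i of (n, N, r, x, c) \<Rightarrow> y n) t \<omega> - (case i of (n, N, r, x, c) \<Rightarrow> y n) s \<omega> - (B t \<omega> - B s \<omega>))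
     (\<lambda>(i, s, t). t - s)"
      by (rule Lp_O_cong) auto
  next
    show "deriv b \<in> borel_measurable borel" "deriv (deriv b) \<in> borel_measurable borel"
      using K(7,8) by (auto intro: borel_measurable_continuous_onI)
  qed (use K in auto)
  have "Lp_O (shifts S) (\<lambda>(n, N, r, x, c) \<omega>. \<Sum>j<2 ^ Lg N. (if k0 n r + j < N then c (k0 n r + j) else 0) *
      (b (y n (real (k0 n r + j) * \<Delta> n - r + x) \<omega>) - b (y n (real (k0 n r + j) * \<Delta> n - r) \<omega>)))
    (\<lambda>(n, N, r, x, c). \<Delta> n powr (rho - 1))"
  proof (rule Lp_O_cong[OF P.increment_sum_O])
    fix i \<omega> assume i: "i \<in> shifts S"
    obtain n N r x c where i_eq: "i = (n, N, r, x, c)" by (cases i) auto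
    have t: "P.t i j = real (k0 n r + j) * \<Delta> n - r" for j
      unfolding P.t_def i_eq prod.case of_nat_add distrib_right by linarith
    show "(\<Sum>k<2 ^ (case i of (n, N, r, x, c) \<Rightarrow> Lg N). (case i of (n, N, r, x, c) \<Rightarrow> \<lambda>j. if k0 n r + j < N then c (k0 n r + j) else 0) k *
          (b ((case i of (n, N, r, x, c) \<Rightarrow> y n) (P.t i k + (case i of (n, N, r, x, c) \<Rightarrow> x)) \<omega>)
            - b ((case i of (n, N, r, x, c) \<Rightarrow> y n) (P.t i k) \<omega>)))
      = (case i of (n, N, r, x, c) \<Rightarrow> \<lambda>\<omega>. \<Sum>j<2 ^ Lg N. (if k0 n r + j < N then c (k0 n r + j) else 0) *
      (b (y n (real (k0 n r + j) * \<Delta> n - r + x) \<omega>) - b (y n (real (k0 n r + j) * \<Delta> n - r) \<omega>))) \<omega>"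
      unfolding t unfolding i_eq prod.case ..
    show "(case i of (n, N, r, x, c) \<Rightarrow> \<Delta> n) powr (P.rate - 1) = (case i of (n, N, r, x, c) \<Rightarrow> \<Delta> n powr (rho - 1))"
      unfolding i_eq prod.case P.rate_def ..
  qed
  then show ?thesis unfolding Lg_def .
qed

text \<open>Left of zero only the initial path varies, and right of zero only the solution; so an
  increment across zero splits.\<close>

lemma ext_increment:
  assumes n: "1 \<le> n" and z': "z' \<le> 0"
  shows "y n z \<omega> - y n z' \<omega> = indicator (om n) \<omega> * (x0c z - x0c z') + (y n (max z 0) \<omega> - y n 0 \<omega>)"
  unfolding ext_neg(1)[OF n z'] ext_neg(1)[OF n order_refl]
  using x0c_simps(2)[of "max z 0"] x0c_simps(2)[of 0] by (simp add: ext_def algebra_simps)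

text \<open>At most one of the lags \<open>k \<Delta> - r + x\<close> with \<open>k < k0\<close> is positive.\<close>

lemma shift_early_O:
  "Lp_O (shifts S) (\<lambda>(n, N, r, x, c) \<omega>. \<Sum>k<min (k0 n r) N. c k *
      (b (y n (real k * \<Delta> n - r + x) \<omega>) - b (y n (real k * \<Delta> n - r) \<omega>)))
    (\<lambda>(n, N, r, x, c). \<Delta> n powr (rho - 1))"
proof -
  obtain K where K: "0 < K" "\<And>y z. \<bar>b z - b y\<bar> \<le> K * \<bar>z - y\<bar>"
    using taylor_bounds[OF b3 b'] by metis
  obtain Kx where Kx: "0 \<le> Kx" "\<And>s t. \<bar>x0c s - x0c t\<bar> \<le> Kx * \<bar>s - t\<bar>" using x0c_lipschitz by metis
  \<comment> \<open>The positive part of the only lagged time, for \<open>k = k0 - 1\<close>, that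
    may exceed zero after the shift by \<open>x\<close>.\<close>
  define e where "e n r x = max (real (k0 n r - 1) * \<Delta> n - r + x) 0" for n r x
  have e: "0 \<le> e n r x" "e n r x \<le> \<tau>" if n: "1 \<le> n" and r: "0 \<le> r" and x: "0 \<le> x" "x \<le> \<Delta> n" for n r x
  proof -
    have "real (k0 n r - 1) * \<Delta> n - r \<le> 0"
    proof (cases "k0 n r = 0")
      case False
      then show ?thesis using k0(3)[OF n r, of "k0 n r - 1"] by linarith
    qed (use r in simp)
    then show "0 \<le> e n r x" "e n r x \<le> \<tau>" using x \<Delta>(2)[OF n] \<tau> unfolding e_def by linarith+
  qed
  have y_at: "Lp_O (shifts S) (\<lambda>(n, N, r, x, c). y n (u n r x)) (\<lambda>_. 1)"
    if u: "\<And>n r x. 1 \<le> n \<Longrightarrow> 0 \<le> r \<Longrightarrow> 0 \<le> x \<Longrightarrow> x \<le> \<Delta> n \<Longrightarrow> 0 \<le> u n r x \<and> u n r x \<le> \<tau>" for u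
  proof -
    have "Lp_O (shifts S) (\<lambda>i. (\<lambda>(n, t). y n t) ((\<lambda>(n, N, r, x, c). (n, u n r x)) i)) (\<lambda>i. 1)"
    proof (rule Lp_O_reindex[OF y_O[of \<tau>]])
      fix i assume i: "i \<in> shifts S"
      obtain n N r x c where i_eq: "i = (n, N, r, x, c)" by (cases i) auto
      have "1 \<le> n" "0 \<le> u n r x \<and> u n r x \<le> \<tau>" using i u[of n r x] by (simp_all add: i_eq shifts_def)
      then show "(case i of (n, N, r, x, c) \<Rightarrow> (n, u n r x)) \<in> {(n, t). 1 \<le> n \<and> - \<tau> \<le> t \<and> t \<le> \<tau>}"
        unfolding i_eq using \<tau> by simp
    qed
    then show ?thesis by (rule Lp_O_cong) (auto simp: case_prod_beta')
  qed
  have yO: "Lp_O (shifts S) (\<lambda>(n, N, r, x, c). y n (e n r x)) (\<lambda>_. 1)"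
    using e by (intro y_at) auto
  have y0: "Lp_O (shifts S) (\<lambda>(n, N, r, x, c). y n 0) (\<lambda>_. 1)"
    using \<tau> by (intro y_at[of "\<lambda>_ _ _. 0"]) auto
  have "Lp_O (shifts S) (\<lambda>i \<omega>. 2 * Kx * \<tau> + \<bar>(\<lambda>(n, N, r, x, c). y n (e n r x)) i \<omega> - (\<lambda>(n, N, r, x, c). y n 0) i \<omega>\<bar>) (\<lambda>_. 1 + (1 + 1))"
  proof (rule Lp_O_add)
    show "Lp_O (shifts S) (\<lambda>_ _. 2 * Kx * \<tau>) (\<lambda>_. 1)"
      by (rule Lp_O_const[where K = "2 * Kx * \<tau>"]) (use Kx \<tau> in auto)
    show "Lp_O (shifts S) (\<lambda>i \<omega>. \<bar>(\<lambda>(n, N, r, x, c). y n (e n r x)) i \<omega> - (\<lambda>(n, N, r, x, c). y n 0) i \<omega>\<bar>) (\<lambda>_. 1 + 1)"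
      by (rule Lp_O_dom[OF Lp_O_diff[OF yO y0], where K = 1])
        (use Lp_O_measurable[OF yO] Lp_O_measurable[OF y0] in auto)
  qed
  then have "Lp_O (shifts S) (\<lambda>(n, N, r, x, c) \<omega>. \<Sum>k<min (k0 n r) N. c k *
      (b (y n (real k * \<Delta> n - r + x) \<omega>) - b (y n (real k * \<Delta> n - r) \<omega>))) (\<lambda>_. 1 + (1 + 1))"
  proof (rule Lp_O_dom[where K = K])
    fix i assume i: "i \<in> shifts S"
    obtain n N r x c where i_eq [simp]: "i = (n, N, r, x, c)" by (cases i) auto
    have n: "1 \<le> n" and r: "0 \<le> r" "r \<le> \<tau>" and x: "0 \<le> x" "x \<le> \<Delta> n" and c: "\<And>k. \<bar>c k\<bar> \<le> 1"
      using i by (auto simp: shifts_def)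
    have [measurable]: "y n z \<in> borel_measurable M" for z by (rule ext_measurable(1)[OF n])
    show "(case i of (n, N, r, x, c) \<Rightarrow> \<lambda>\<omega>. \<Sum>k<min (k0 n r) N. c k *
      (b (y n (real k * \<Delta> n - r + x) \<omega>) - b (y n (real k * \<Delta> n - r) \<omega>))) \<in> borel_measurable M"
      unfolding i_eq prod.case
      by (intro borel_measurable_sum borel_measurable_times borel_measurable_const borel_measurable_diff
          measurable_compose[OF _ b_measurable] ext_measurable(1)[OF n])
    show "AE \<omega> in M. \<bar>(case i of (n, N, r, x, c) \<Rightarrow> \<lambda>\<omega>. \<Sum>k<min (k0 n r) N. c k *
      (b (y n (real k * \<Delta> n - r + x) \<omega>) - b (y n (real k * \<Delta> n - r) \<omega>))) \<omega>\<bar>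
      \<le> K * \<bar>2 * Kx * \<tau> + \<bar>(\<lambda>(n, N, r, x, c). y n (e n r x)) i \<omega> - (\<lambda>(n, N, r, x, c). y n 0) i \<omega>\<bar>\<bar>"
      unfolding i_eq prod.case
    proof (rule AE_I2)
      fix \<omega>
      define w where "w = \<bar>y n (e n r x) \<omega> - y n 0 \<omega>\<bar>"
      have summand: "\<bar>c k * (b (y n (real k * \<Delta> n - r + x) \<omega>) - b (y n (real k * \<Delta> n - r) \<omega>))\<bar>
          \<le> K * (Kx * \<Delta> n + (if k = k0 n r - 1 then w else 0))" if k: "k < k0 n r" for k
      proof -
        let ?z' = "real k * \<Delta> n - r" let ?z = "?z' + x"
        have z': "?z' \<le> 0" using k0(3)[OF n r(1) k] by linarith
        have "\<bar>c k * (b (y n ?z \<omega>) - b (y n ?z' \<omega>))\<bar> \<le> 1 * \<bar>b (y n ?z \<omega>) - b (y n ?z' \<omega>)\<bar>"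
          unfolding abs_mult by (intro mult_right_mono c) auto
        also have "\<dots> \<le> K * \<bar>y n ?z \<omega> - y n ?z' \<omega>\<bar>" using K(2) by simp
        also have "\<dots> \<le> K * (Kx * \<Delta> n + (if k = k0 n r - 1 then w else 0))"
        proof (intro mult_left_mono less_imp_le[OF K(1)])
          have "\<bar>indicator (om n) \<omega> * (x0c ?z - x0c ?z')\<bar> \<le> \<bar>x0c ?z - x0c ?z'\<bar>" by (simp add: indicator_def)
          also have "\<dots> \<le> Kx * \<bar>?z - ?z'\<bar>" by (rule Kx(2))
          also have "\<dots> \<le> Kx * \<Delta> n" using Kx(1) x by (intro mult_left_mono) auto
          finally have 1: "\<bar>indicator (om n) \<omega> * (x0c ?z - x0c ?z')\<bar> \<le> Kx * \<Delta> n" .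
          have 2: "\<bar>y n (max ?z 0) \<omega> - y n 0 \<omega>\<bar> \<le> (if k = k0 n r - 1 then w else 0)"
          proof (cases "k = k0 n r - 1")
            case True
            then show ?thesis by (simp add: w_def e_def)
          next
            case False
            then have "k + 1 < k0 n r" using k by linarith
            have d: "real (k + 1) * d = real k * d + d" for d by (simp add: distrib_right)
            from k0(3)[OF n r(1) \<open>k + 1 < k0 n r\<close>] have "real k * \<Delta> n + \<Delta> n < r" unfolding d .
            then have "?z \<le> 0" using x by linarith
            then show ?thesis using False by (simp add: max_absorb2)
          qed
          show "\<bar>y n ?z \<omega> - y n ?z' \<omega>\<bar> \<le> Kx * \<Delta> n + (if k = k0 n r - 1 then w else 0)"
            unfolding ext_increment[OF n z'] using 1 2 by linarith
        qed
        finally show ?thesis .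
      qed
      have "\<bar>\<Sum>k<min (k0 n r) N. c k * (b (y n (real k * \<Delta> n - r + x) \<omega>) - b (y n (real k * \<Delta> n - r) \<omega>))\<bar>
        \<le> (\<Sum>k<min (k0 n r) N. K * (Kx * \<Delta> n + (if k = k0 n r - 1 then w else 0)))"
        by (rule order_trans[OF sum_abs], rule sum_mono, rule summand) simp
      also have "\<dots> \<le> (\<Sum>k<k0 n r. K * (Kx * \<Delta> n + (if k = k0 n r - 1 then w else 0)))"
      proof (rule sum_mono2)
        show "0 \<le> K * (Kx * \<Delta> n + (if k = k0 n r - 1 then w else 0))" for k
          using K(1) Kx(1) less_imp_le[OF \<Delta>(1)[OF n]]
          by (intro mult_nonneg_nonneg add_nonneg_nonneg) (auto simp: w_def)
      qed auto
      also have "\<dots> = K * (Kx * (real (k0 n r) * \<Delta> n) + (\<Sum>k<k0 n r. if k = k0 n r - 1 then w else 0))"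
        unfolding sum_distrib_left[symmetric] sum.distrib sum_constant card_lessThan by (simp only: mult.left_commute)
      also have "\<dots> \<le> K * (2 * Kx * \<tau> + w)"
      proof (intro mult_left_mono add_mono less_imp_le[OF K(1)])
        \<comment> \<open>The increments of the initial path, at most \<open>Kx * \<Delta> n\<close>
          each, add up to a constant because
          \<open>k0 * \<Delta> n < r + \<Delta> n \<le> 2 * \<tau>\<close>.\<close>
        have "Kx * (real (k0 n r) * \<Delta> n) \<le> Kx * (2 * \<tau>)"
          using k0(2)[OF n r(1)] r \<Delta>(2)[OF n] Kx(1) by (intro mult_left_mono) linarith+
        then show "Kx * (real (k0 n r) * \<Delta> n) \<le> 2 * Kx * \<tau>" by (simp add: mult_ac)
        show "(\<Sum>k<k0 n r. if k = k0 n r - 1 then w else 0) \<le> w" by (simp add: w_def)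
      qed
      also have "\<dots> \<le> K * \<bar>2 * Kx * \<tau> + w\<bar>" using K(1) by (intro mult_left_mono) auto
      finally show "\<bar>\<Sum>k<min (k0 n r) N. c k * (b (y n (real k * \<Delta> n - r + x) \<omega>) - b (y n (real k * \<Delta> n - r) \<omega>))\<bar>
        \<le> K * \<bar>2 * Kx * \<tau> + \<bar>y n (e n r x) \<omega> - y n 0 \<omega>\<bar>\<bar>" unfolding w_def .
    qed
  qed
  then show ?thesis
  proof (rule Lp_O_scale[where K = "3 * \<tau> powr (1 - rho)"])
    fix i assume i: "i \<in> shifts S"
    obtain n N r x c where i_eq [simp]: "i = (n, N, r, x, c)" by (cases i) auto
    have "1 \<le> n" using i by (simp add: shifts_def)
    from one_le_rate[OF this]
    show "1 + (1 + 1) \<le> 3 * \<tau> powr (1 - rho) * (case i of (n, N, r, x, c) \<Rightarrow> \<Delta> n powr (rho - 1))"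
      unfolding i_eq prod.case by linarith
  qed auto
qed

lemma shift_O:
  "Lp_O (shifts S) (\<lambda>(n, N, r, x, c) \<omega>. \<Sum>k<N. c k *
      (b (y n (real k * \<Delta> n - r + x) \<omega>) - b (y n (real k * \<Delta> n - r) \<omega>)))
    (\<lambda>(n, N, r, x, c). \<Delta> n powr (rho - 1))"
proof (rule Lp_O_scale[OF Lp_O_cong[OF Lp_O_add[OF shift_early_O shift_late_O]], where K = 2])
  fix i \<omega> assume i: "i \<in> shifts S"
  obtain n N r x c where i_eq [simp]: "i = (n, N, r, x, c)" by (cases i) auto
  define L where "L = (SOME L. N \<le> 2 ^ L \<and> 2 ^ L \<le> 2 * N + (1 :: nat))"
  have L: "N \<le> 2 ^ L" unfolding L_def using someI_ex[OF ex_power2_ge[of N]] by blast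
  define g where "g k = c k * (b (y n (real k * \<Delta> n - r + x) \<omega>) - b (y n (real k * \<Delta> n - r) \<omega>))" for k
  have "(\<Sum>k<N. g k) = (\<Sum>k<min (k0 n r) N. g k) + (\<Sum>j<2 ^ L. (if k0 n r + j < N then c (k0 n r + j) else 0) *
      (b (y n (real (k0 n r + j) * \<Delta> n - r + x) \<omega>) - b (y n (real (k0 n r + j) * \<Delta> n - r) \<omega>)))"
    unfolding sum_split_shift[OF L, of g "k0 n r"] by (auto simp: g_def intro!: sum.cong)
  then show "(case i of (n, N, r, x, c) \<Rightarrow> \<lambda>\<omega>. \<Sum>k<min (k0 n r) N. c k *
      (b (y n (real k * \<Delta> n - r + x) \<omega>) - b (y n (real k * \<Delta> n - r) \<omega>))) \<omega> +
      (case i of (n, N, r, x, c) \<Rightarrow> \<lambda>\<omega>. \<Sum>j<2 ^ (SOME L. N \<le> 2 ^ L \<and> 2 ^ L \<le> 2 * N + (1 :: nat)).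
      (if k0 n r + j < N then c (k0 n r + j) else 0) *
      (b (y n (real (k0 n r + j) * \<Delta> n - r + x) \<omega>) - b (y n (real (k0 n r + j) * \<Delta> n - r) \<omega>))) \<omega>
    = (case i of (n, N, r, x, c) \<Rightarrow> \<lambda>\<omega>. \<Sum>k<N. c k *
      (b (y n (real k * \<Delta> n - r + x) \<omega>) - b (y n (real k * \<Delta> n - r) \<omega>))) \<omega>"
    unfolding i_eq prod.case g_def L_def by (rule sym)
qed auto

text \<open>Both times are compared with \<open>k * \<Delta> n - r\<close>. The exact one is ahead
  of it by \<open>v\<close>, that of the scheme by \<open>r - gf n r\<close>, and both offsets lie
  in one mesh; so two shifts are subtracted.\<close>

lemma lag_O:
  "Lp_O (shifts S) (\<lambda>(n, N, r, v, c) \<omega>. \<Sum>k<N. c k *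
      (b (y n (real k * \<Delta> n + v - r) \<omega>) - b (y n (real k * \<Delta> n - gf n r) \<omega>)))
    (\<lambda>(n, N, r, v, c). \<Delta> n powr (rho - 1))"
proof -
  have 2: "Lp_O (shifts S) (\<lambda>i. (\<lambda>(n, N, r, x, c) \<omega>. \<Sum>k<N. c k *
      (b (y n (real k * \<Delta> n - r + x) \<omega>) - b (y n (real k * \<Delta> n - r) \<omega>))) ((\<lambda>(n, N, r, v, c). (n, N, r, r - gf n r, c)) i))
    (\<lambda>i. (\<lambda>(n, N, r, x, c). \<Delta> n powr (rho - 1)) ((\<lambda>(n, N, r, v, c). (n, N, r, r - gf n r, c)) i))"
  proof (rule Lp_O_reindex[OF shift_O[of S]])
    fix i assume i: "i \<in> shifts S"
    obtain n N r x c where i_eq [simp]: "i = (n, N, r, x, c)" by (cases i) auto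
    have n: "1 \<le> n" using i by (simp add: shifts_def)
    have "0 \<le> r - gf n r" "r - gf n r \<le> \<Delta> n" using grid_floor_bounds[OF \<Delta>(1)[OF n], of r] by linarith+
    then show "(case i of (n, N, r, v, c) \<Rightarrow> (n, N, r, r - gf n r, c)) \<in> shifts S"
      using i unfolding shifts_def by simp
  qed
  show ?thesis
  proof (rule Lp_O_scale[OF Lp_O_cong[OF Lp_O_diff[OF shift_O 2]], where K = 2])
    fix i \<omega> assume i: "i \<in> shifts S"
    obtain n N r v c where i_eq: "i = (n, N, r, v, c)" by (cases i) auto
    have e: "real k * \<Delta> n - r + (r - gf n r) = real k * \<Delta> n - gf n r" "real k * \<Delta> n - r + v = real k * \<Delta> n + v - r" for k
      by linarith+
    show "(case i of (n, N, r, x, c) \<Rightarrow> \<lambda>\<omega>. \<Sum>k<N. c k *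
      (b (y n (real k * \<Delta> n - r + x) \<omega>) - b (y n (real k * \<Delta> n - r) \<omega>))) \<omega>
     - (case (case i of (n, N, r, v, c) \<Rightarrow> (n, N, r, r - gf n r, c)) of (n, N, r, x, c) \<Rightarrow> \<lambda>\<omega>. \<Sum>k<N. c k *
      (b (y n (real k * \<Delta> n - r + x) \<omega>) - b (y n (real k * \<Delta> n - r) \<omega>))) \<omega>
     = (case i of (n, N, r, v, c) \<Rightarrow> \<lambda>\<omega>. \<Sum>k<N. c k *
      (b (y n (real k * \<Delta> n + v - r) \<omega>) - b (y n (real k * \<Delta> n - gf n r) \<omega>))) \<omega>"
      unfolding i_eq prod.case e sum_subtractf[symmetric] right_diff_distrib[symmetric] by simp
  qed auto
qed

end

section \<open>Folding the time integral onto one mesh; real moment orders\<close>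

lemma sum_indicator_blocks:
  assumes "0 < D"
  shows "(\<Sum>k<N. indicator {0..<D} (s - real k * D)) = (indicator {0..<real N * D} s :: real)"
proof (induction N)
  case (Suc N)
  have "real N * D \<le> s \<Longrightarrow> 0 \<le> s" using assms by (meson mult_nonneg_nonneg of_nat_0_le_iff less_imp_le order_trans)
  then show ?case unfolding sum.lessThan_Suc Suc using assms by (auto simp: indicator_def distrib_right)
qed simp

text \<open>Exchanges the integral over all times for an integral over the position \<open>v\<close>
  in a mesh of the sum over all meshes. In this form the cancellation between meshes becomes
  visible.\<close>

lemma lborel_integral_blocks:
  fixes G :: "real \<Rightarrow> real"
  assumes D: "0 < D" and G: "integrable lborel G" and zero: "\<And>s. s \<notin> {0..<real N * D} \<Longrightarrow> G s = 0"
  shows "(\<integral>s. G s \<partial>lborel) = (\<integral>v. indicator {0..<D} v * (\<Sum>k<N. G (real k * D + v)) \<partial>lborel)"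
proof -
  let ?f = "\<lambda>k s. indicator {0..<D} (s - real k * D) * G s"
  have int: "integrable lborel (?f k)" for k :: nat
  proof (rule Bochner_Integration.integrable_bound[OF G])
    have "(\<lambda>s. indicator {0..<D} (s - real k * D) :: real) \<in> borel_measurable borel"
      by (rule measurable_compose[of "\<lambda>s. s - real k * D" borel borel]) auto
    then show "?f k \<in> borel_measurable lborel"
      using borel_measurable_integrable[OF G] by (intro borel_measurable_times) auto
  qed (auto simp: indicator_def)
  have "G s = (\<Sum>k<N. ?f k s)" for s
    unfolding sum_distrib_right[symmetric] sum_indicator_blocks[OF D] using zero[of s] by (auto simp: indicator_def)
  then have "(\<integral>s. G s \<partial>lborel) = (\<integral>s. (\<Sum>k<N. ?f k s) \<partial>lborel)"
    by (intro Bochner_Integration.integral_cong refl)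
  also have "\<dots> = (\<Sum>k<N. \<integral>s. ?f k s \<partial>lborel)" by (rule Bochner_Integration.integral_sum) (rule int)
  also have "\<dots> = (\<Sum>k<N. \<integral>v. ?f k (real k * D + 1 * v) \<partial>lborel)"
  proof (rule sum.cong[OF refl])
    fix k
    show "(\<integral>s. ?f k s \<partial>lborel) = (\<integral>v. ?f k (real k * D + 1 * v) \<partial>lborel)"
      using lborel_integral_real_affine[of 1 "?f k" "real k * D"] by simp
  qed
  also have "\<dots> = (\<integral>v. (\<Sum>k<N. ?f k (real k * D + 1 * v)) \<partial>lborel)"
    by (rule Bochner_Integration.integral_sum[symmetric], rule lborel_integrable_real_affine[OF int]) simp
  also have "\<dots> = (\<integral>v. indicator {0..<D} v * (\<Sum>k<N. G (real k * D + v)) \<partial>lborel)"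
    by (simp only: sum_distrib_left mult_1 add_diff_cancel_left')
  finally show ?thesis .
qed

lemma integral_abs_le_nn_integral:
  fixes f :: "'b \<Rightarrow> real"
  shows "ennreal \<bar>\<integral>x. f x \<partial>N\<bar> \<le> (\<integral>\<^sup>+ x. ennreal \<bar>f x\<bar> \<partial>N)"
proof (cases "integrable N f")
  case True
  then show ?thesis using integral_norm_bound_ennreal[OF True] by simp
qed (simp add: not_integrable_integral_eq)

text \<open>Reaches a real order \<open>p\<close> from a natural order above it, by comparing
  \<open>u\<close> with the level \<open>c\<close>.\<close>

lemma abs_powr_le:
  fixes c p u :: real and q :: nat
  assumes c: "0 < c" and p: "1 \<le> p" "p \<le> real q"
  shows "\<bar>u\<bar> powr p \<le> c powr p * (1 + \<bar>u\<bar> ^ q / c ^ q)"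
proof (cases "\<bar>u\<bar> \<le> c")
  case True
  then have "\<bar>u\<bar> powr p \<le> c powr p * 1" using p by (simp add: powr_mono2)
  also have "\<dots> \<le> c powr p * (1 + \<bar>u\<bar> ^ q / c ^ q)" using c by (intro mult_left_mono) auto
  finally show ?thesis .
next
  case False
  then have 1: "1 \<le> \<bar>u\<bar> / c" using c by simp
  have "\<bar>u\<bar> powr p = (c * (\<bar>u\<bar> / c)) powr p" using c by simp
  also have "\<dots> = c powr p * (\<bar>u\<bar> / c) powr p" using c 1 by (intro powr_mult)
  also have "\<dots> \<le> c powr p * (\<bar>u\<bar> / c) powr real q" using p 1 by (intro mult_left_mono powr_mono) auto
  also have "(\<bar>u\<bar> / c) powr real q = \<bar>u\<bar> ^ q / c ^ q"
    using False c by (subst powr_realpow) (auto simp: power_divide)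
  also have "c powr p * (\<bar>u\<bar> ^ q / c ^ q) \<le> c powr p * (1 + \<bar>u\<bar> ^ q / c ^ q)" by (intro mult_left_mono) auto
  finally show ?thesis .
qed

lemma (in prob_space) Lp_le_powr:
  assumes Z: "Lp_le q Z c" and c: "0 < c" and p: "1 \<le> p" "p \<le> real q"
  shows "integrable M (\<lambda>\<omega>. \<bar>Z \<omega>\<bar> powr p)" "expectation (\<lambda>\<omega>. \<bar>Z \<omega>\<bar> powr p) powr (1 / p) \<le> 2 * c"
proof -
  have [measurable]: "Z \<in> borel_measurable M" using Z by (auto simp: Lp_le_def)
  have i: "integrable M (\<lambda>\<omega>. c powr p * (1 + \<bar>Z \<omega>\<bar> ^ q / c ^ q))"
    using Lp_le_integrable[OF Z] by (intro integrable_mult_right Bochner_Integration.integrable_add integrable_divide) auto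
  show int: "integrable M (\<lambda>\<omega>. \<bar>Z \<omega>\<bar> powr p)"
    by (rule Bochner_Integration.integrable_bound[OF i])
      (use abs_powr_le[OF c p] in \<open>auto intro!: AE_I2 order_trans[OF _ abs_ge_self]\<close>)
  have "expectation (\<lambda>\<omega>. \<bar>Z \<omega>\<bar> powr p) \<le> expectation (\<lambda>\<omega>. c powr p * (1 + \<bar>Z \<omega>\<bar> ^ q / c ^ q))"
    by (intro integral_mono int i abs_powr_le c p)
  also have "\<dots> = c powr p * (1 + expectation (\<lambda>\<omega>. \<bar>Z \<omega>\<bar> ^ q) / c ^ q)"
    using Lp_le_integrable[OF Z] by (simp add: prob_space)
  also have "\<dots> \<le> c powr p * (1 + 1)"
    using Lp_le_expectation[OF Z] c by (intro mult_left_mono add_left_mono) auto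
  \<comment> \<open>The two halves of the bound give a factor \<open>2\<close>, at most
    \<open>2 powr p\<close>; so the norm loses a factor \<open>2\<close> for every
    \<open>p\<close>.\<close>
  also have "\<dots> \<le> c powr p * 2 powr p"
    using p powr_mono[of 1 p 2] by (intro mult_left_mono) auto
  also have "\<dots> = (2 * c) powr p" using c by (simp add: powr_mult mult.commute)
  finally have "expectation (\<lambda>\<omega>. \<bar>Z \<omega>\<bar> powr p) powr (1 / p) \<le> ((2 * c) powr p) powr (1 / p)"
    using p by (intro powr_mono2) auto
  also have "\<dots> = 2 * c" using c p by (simp add: powr_powr)
  finally show "expectation (\<lambda>\<omega>. \<bar>Z \<omega>\<bar> powr p) powr (1 / p) \<le> 2 * c" .
qed

section \<open>The integrated local error\<close>

context sdde
begin

lemma lag_set_integrable: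
  assumes \<phi>: "continuous_on UNIV \<phi>" and \<rho>: "(\<lambda>(s, r). \<rho> s r) \<in> borel_measurable (borel \<Otimes>\<^sub>M V)"
    and range: "\<And>s r. s \<in> {0..t} \<Longrightarrow> r \<in> space V \<Longrightarrow> \<rho> s r \<in> {- \<tau>..t}"
  shows "set_integrable lborel {0..t} (\<lambda>s. SI (\<lambda>r. \<phi> (\<rho> s r)))"
    and "s \<in> space borel \<Longrightarrow> (\<lambda>r. \<phi> (\<rho> s r)) \<in> borel_measurable V"
proof -
  have m: "(\<lambda>(s, r). \<phi> (\<rho> s r)) \<in> borel_measurable (borel \<Otimes>\<^sub>M V)"
    using measurable_compose[OF \<rho> borel_measurable_continuous_onI[OF \<phi>]] by (simp add: case_prod_beta')
  show m': "(\<lambda>r. \<phi> (\<rho> s r)) \<in> borel_measurable V" if "s \<in> space borel" for s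
    using measurable_compose[OF measurable_Pair1'[OF that] m] by simp
  obtain R where R: "0 \<le> R" "\<And>u. u \<in> {-\<tau>..t} \<Longrightarrow> \<bar>\<phi> u\<bar> \<le> R"
    using continuous_on_bounded_Icc[OF continuous_on_subset[OF \<phi> subset_UNIV]] by metis
  show "set_integrable lborel {0..t} (\<lambda>s. SI (\<lambda>r. \<phi> (\<rho> s r)))"
  proof (rule set_integrable_bounded_Icc[OF signed_integral_measurable[OF m]])
    show "\<bar>SI (\<lambda>r. \<phi> (\<rho> s r))\<bar> \<le> 2 * R * measure \<mu> (space V)" if "s \<in> {0..t}" for s
      using R(2)[OF range[OF that]] by (intro signed_integral_bound m' R(1)) auto
  qed
qed

lemma lag_measurable: "(\<lambda>(s, r). s - r) \<in> borel_measurable (borel \<Otimes>\<^sub>M V)"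
  by measurable

lemma lag_bounds: "0 \<le> s \<Longrightarrow> r \<in> space V \<Longrightarrow> - \<tau> \<le> s - r \<and> s - r \<le> s"
  by (simp add: V_space)

lemma lag_diff_le:
  assumes \<phi>: "continuous_on UNIV \<phi>" and \<psi>: "continuous_on UNIV \<psi>"
  shows "ennreal \<bar>(LBINT s:{0..t}. SI (\<lambda>r. \<phi> (s - r))) - (LBINT s:{0..t}. SI (\<lambda>r. \<psi> (s - r)))\<bar>
    \<le> (\<integral>\<^sup>+ s. (\<integral>\<^sup>+ r. ennreal (2 * \<bar>\<phi> (s - r) - \<psi> (s - r)\<bar>) \<partial>\<mu>) * indicator {0..t} s \<partial>lborel)"
proof -
  have r: "s - r \<in> {- \<tau>..t}" if "s \<in> {0..t}" "r \<in> space V" for s r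
    using lag_bounds[of s r] that by auto
  note i\<phi> = lag_set_integrable[OF \<phi> lag_measurable r] and i\<psi> = lag_set_integrable[OF \<psi> lag_measurable r]
  have "(LBINT s:{0..t}. SI (\<lambda>r. \<phi> (s - r))) - (LBINT s:{0..t}. SI (\<lambda>r. \<psi> (s - r)))
      = (LBINT s:{0..t}. SI (\<lambda>r. \<phi> (s - r)) - SI (\<lambda>r. \<psi> (s - r)))"
    by (rule set_integral_diff(2)[OF i\<phi>(1) i\<psi>(1), symmetric])
  also have "(LBINT s:{0..t}. SI (\<lambda>r. \<phi> (s - r)) - SI (\<lambda>r. \<psi> (s - r))) = (LBINT s:{0..t}. SI (\<lambda>r. \<phi> (s - r) - \<psi> (s - r)))"
  proof (rule set_lebesgue_integral_cong)
    obtain R1 where R1: "0 \<le> R1" "\<And>u. u \<in> {-\<tau>..t} \<Longrightarrow> \<bar>\<phi> u\<bar> \<le> R1"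
      using continuous_on_bounded_Icc[OF continuous_on_subset[OF \<phi> subset_UNIV]] by metis
    obtain R2 where R2: "0 \<le> R2" "\<And>u. u \<in> {-\<tau>..t} \<Longrightarrow> \<bar>\<psi> u\<bar> \<le> R2"
      using continuous_on_bounded_Icc[OF continuous_on_subset[OF \<psi> subset_UNIV]] by metis
    show "\<forall>s. s \<in> {0..t} \<longrightarrow> SI (\<lambda>r. \<phi> (s - r)) - SI (\<lambda>r. \<psi> (s - r)) = SI (\<lambda>r. \<phi> (s - r) - \<psi> (s - r))"
    proof (intro allI impI, rule signed_integral_diff[symmetric, where R = "R1 + R2"])
      fix s r assume "s \<in> {0..t}" "r \<in> space V"
      from R1(2)[OF r[OF this]] R2(2)[OF r[OF this]]
      show "\<bar>\<phi> (s - r)\<bar> \<le> R1 + R2" "\<bar>\<psi> (s - r)\<bar> \<le> R1 + R2" using R1(1) R2(1) by linarith+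
    qed (auto intro: i\<phi>(2) i\<psi>(2))
  qed simp
  finally have eq: "(LBINT s:{0..t}. SI (\<lambda>r. \<phi> (s - r))) - (LBINT s:{0..t}. SI (\<lambda>r. \<psi> (s - r)))
      = (LBINT s:{0..t}. SI (\<lambda>r. \<phi> (s - r) - \<psi> (s - r)))" .
  have "continuous_on UNIV (\<lambda>u. \<phi> u - \<psi> u)" by (intro continuous_intros \<phi> \<psi>)
  note i = lag_set_integrable[OF this lag_measurable r]
  have le: "ennreal \<bar>SI (\<lambda>r. \<phi> (s - r) - \<psi> (s - r))\<bar> \<le> (\<integral>\<^sup>+ r. ennreal (2 * \<bar>\<phi> (s - r) - \<psi> (s - r)\<bar>) \<partial>\<mu>)" for s
    by (rule signed_integral_abs_le[OF i(2)]) auto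
  show ?thesis
    unfolding eq
  proof (rule order_trans[OF set_integral_Icc_abs_le[OF i(1)]])
    show "(\<integral>\<^sup>+ u. ennreal \<bar>SI (\<lambda>r. \<phi> (u - r) - \<psi> (u - r))\<bar> * indicator {0..t} u \<partial>lborel)
      \<le> (\<integral>\<^sup>+ s. (\<integral>\<^sup>+ r. ennreal (2 * \<bar>\<phi> (s - r) - \<psi> (s - r)\<bar>) \<partial>\<mu>) * indicator {0..t} s \<partial>lborel)"
      by (rule nn_integral_mono, rule mult_right_mono[OF le]) (rule zero_le)
  qed auto
qed

text \<open>At \<open>s = k * \<Delta> n + v\<close> the integer part of the time is
  \<open>k * \<Delta> n\<close>, whatever \<open>v\<close> is. The absolute value is taken only
  after summation over \<open>k\<close>, since the estimate of that sum lives on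
  cancellation.\<close>

lemma block_diff_le:
  fixes \<phi> :: "real \<Rightarrow> real"
  assumes n: "1 \<le> n" and \<phi>: "continuous_on UNIV \<phi>" and t: "0 \<le> t" "t < real N * \<Delta> n"
  shows "ennreal \<bar>(LBINT s:{0..t}. SI (\<lambda>r. \<phi> (s - r))) - (LBINT s:{0..t}. SI (\<lambda>r. \<phi> (gf n s - gf n r)))\<bar>
    \<le> (\<integral>\<^sup>+ v. (\<integral>\<^sup>+ r. ennreal (2 * \<bar>\<Sum>k<N. (if real k * \<Delta> n + v \<le> t then 1 else 0) *
          (\<phi> (real k * \<Delta> n + v - r) - \<phi> (real k * \<Delta> n - gf n r))\<bar>) \<partial>\<mu>) * indicator {0..\<Delta> n} v \<partial>lborel)"
proof -
  define D where "D = \<Delta> n"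
  have D: "0 < D" unfolding D_def by (rule \<Delta>(1)[OF n])
  define S where "S = real N * D"
  define F where "F s = SI (\<lambda>r. \<phi> (s - r)) - SI (\<lambda>r. \<phi> (gf n s - gf n r))" for s
  have r1: "s - r \<in> {- \<tau>..T}" if "s \<in> {0..T}" "r \<in> space V" for s r T
    using lag_bounds[of s r] that by auto
  have r2: "gf n s - gf n r \<in> {- \<tau>..T}" if "s \<in> {0..T}" "r \<in> space V" for s r T
    using gf_diff_bounds[OF n, of s r] that by auto
  note i1 = lag_set_integrable[OF \<phi> lag_measurable r1] and i2 = lag_set_integrable[OF \<phi> grid_lag_measurable r2]
  have Fi: "set_integrable lborel {0..t} F" unfolding F_def by (rule set_integral_diff(1)[OF i1(1) i2(1)])
  have eq: "(LBINT s:{0..t}. SI (\<lambda>r. \<phi> (s - r))) - (LBINT s:{0..t}. SI (\<lambda>r. \<phi> (gf n s - gf n r))) = (LBINT s:{0..t}. F s)"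
    unfolding F_def by (rule set_integral_diff(2)[OF i1(1) i2(1), symmetric])
  define G where "G s = indicator {0..t} s * F s" for s
  have Gi: "integrable lborel G" using Fi unfolding set_integrable_def G_def by simp
  have "(LBINT s:{0..t}. F s) = (\<integral>s. G s \<partial>lborel)" unfolding set_lebesgue_integral_def G_def by simp
  also have "\<dots> = (\<integral>v. indicator {0..<D} v * (\<Sum>k<N. G (real k * D + v)) \<partial>lborel)"
    by (rule lborel_integral_blocks[OF D Gi]) (use t in \<open>auto simp: G_def D_def\<close>)
  finally have eq': "(LBINT s:{0..t}. F s) = (\<integral>v. indicator {0..<D} v * (\<Sum>k<N. G (real k * D + v)) \<partial>lborel)" .
  obtain R where R: "0 \<le> R" "\<And>u. u \<in> {-\<tau>..S} \<Longrightarrow> \<bar>\<phi> u\<bar> \<le> R"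
    using continuous_on_bounded_Icc[OF continuous_on_subset[OF \<phi> subset_UNIV]] by metis
  define h where "h k v r = \<phi> (real k * D + v - r) - \<phi> (real k * D - gf n r)" for k v r
  \<comment> \<open>Cuts the last mesh at \<open>t\<close>; this is how the weights come to depend
    on \<open>v\<close>.\<close>
  define c where "c k v = (if real k * D + v \<le> t then 1 else 0 :: real)" for k :: nat and v
  have le: "ennreal \<bar>indicator {0..<D} v * (\<Sum>k<N. G (real k * D + v))\<bar>
      \<le> (\<integral>\<^sup>+ r. ennreal (2 * \<bar>\<Sum>k<N. c k v * h k v r\<bar>) \<partial>\<mu>) * indicator {0..D} v" for v
  proof (cases "v \<in> {0..<D}")
    case True
    have gfk: "gf n (real k * D + v) = real k * D" for k
    proof -
      have "\<lfloor>(real k * D + v) / D\<rfloor> = int k"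
        by (rule floor_unique) (use True D in \<open>auto simp: add_divide_distrib\<close>)
      then show ?thesis by (simp add: grid_floor_def D_def)
    qed
    have kS: "real k * D + v \<in> {0..S}" if "k < N" for k
    proof -
      have "(real k + 1) * D \<le> S" unfolding S_def using that D by (intro mult_right_mono) auto
      then show ?thesis using True D by (auto simp: distrib_right)
    qed
    have hb: "\<bar>\<phi> (real k * D + v - r)\<bar> \<le> R" "\<bar>\<phi> (real k * D - gf n r)\<bar> \<le> R" if "k < N" "r \<in> space V" for k r
      using R(2)[OF r1[OF kS[OF that(1)] that(2)]] R(2)[OF r2[OF kS[OF that(1)] that(2)]] unfolding gfk by auto
    have m2: "(\<lambda>r. \<phi> (real k * D - gf n r)) \<in> borel_measurable V" for k
      using i2(2)[where s = "real k * D + v"] unfolding gfk by simp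
    have m1: "(\<lambda>r. \<phi> (real k * D + v - r)) \<in> borel_measurable V" for k
      using i1(2)[where s = "real k * D + v"] by simp
    have hm: "h k v \<in> borel_measurable V" for k unfolding h_def[abs_def] by (intro borel_measurable_diff m1 m2)
    have Gk: "G (real k * D + v) = c k v * SI (h k v)" if k: "k < N" for k
    proof -
      have "SI (h k v) = F (real k * D + v)"
        unfolding h_def[abs_def] F_def gfk by (rule signed_integral_diff[OF m1 hb(1)[OF k] m2 hb(2)[OF k]])
      then show ?thesis using kS[OF k] by (auto simp: G_def c_def indicator_def)
    qed
    have "(\<Sum>k<N. G (real k * D + v)) = (\<Sum>k<N. c k v * SI (h k v))" using Gk by simp
    \<comment> \<open>Linearity moves the sum over \<open>k\<close> inside the delay integral before
      the total variation is used.\<close>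
    also have "\<dots> = SI (\<lambda>r. \<Sum>k<N. c k v * h k v r)"
    proof (rule signed_integral_sum[symmetric, where R = "R + R"])
      fix k r assume "k \<in> {..<N}" "r \<in> space V"
      then show "\<bar>h k v r\<bar> \<le> R + R" using hb[of k r] unfolding h_def by auto
    qed (rule hm)
    finally have "(\<Sum>k<N. G (real k * D + v)) = SI (\<lambda>r. \<Sum>k<N. c k v * h k v r)" .
    moreover have "ennreal \<bar>SI (\<lambda>r. \<Sum>k<N. c k v * h k v r)\<bar> \<le> (\<integral>\<^sup>+ r. ennreal (2 * \<bar>\<Sum>k<N. c k v * h k v r\<bar>) \<partial>\<mu>)"
      by (rule signed_integral_abs_le) (intro borel_measurable_sum borel_measurable_times borel_measurable_const hm)
    ultimately show ?thesis using True by simp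
  qed simp
  have "ennreal \<bar>LBINT s:{0..t}. F s\<bar> \<le> (\<integral>\<^sup>+ v. (\<integral>\<^sup>+ r. ennreal (2 * \<bar>\<Sum>k<N. c k v * h k v r\<bar>) \<partial>\<mu>) * indicator {0..D} v \<partial>lborel)"
    unfolding eq' by (rule order_trans[OF integral_abs_le_nn_integral]) (rule nn_integral_mono, rule le)
  then show ?thesis unfolding eq c_def h_def D_def .
qed

definition err :: "nat \<Rightarrow> real \<Rightarrow> 'a \<Rightarrow> real" where
  "err n t \<omega> = (LBINT s:{0..t}. SI (\<lambda>r. b (y n (s - r) \<omega>))) - (LBINT s:{0..t}. SI (\<lambda>r. b (y n (gf n s - gf n r) \<omega>)))"

lemma path_integral_measurable:
  fixes \<rho> :: "real \<Rightarrow> real \<Rightarrow> real"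
  assumes n: "1 \<le> n" and \<rho>: "(\<lambda>(s, r). \<rho> s r) \<in> borel_measurable (borel \<Otimes>\<^sub>M V)"
  shows "(\<lambda>\<omega>. LBINT s:{0..t}. SI (\<lambda>r. b (y n (\<rho> s r) \<omega>))) \<in> borel_measurable M"
proof -
  have fst1: "fst \<in> M \<Otimes>\<^sub>M lborel \<rightarrow>\<^sub>M M" and snd1: "snd \<in> M \<Otimes>\<^sub>M lborel \<rightarrow>\<^sub>M borel" by simp_all
  have "(\<lambda>q. (\<lambda>(s, r). \<rho> s r) (snd (fst q), snd q)) \<in> (M \<Otimes>\<^sub>M lborel) \<Otimes>\<^sub>M V \<rightarrow>\<^sub>M borel"
    by (rule measurable_compose[OF measurable_Pair[OF measurable_compose[OF measurable_fst snd1] measurable_snd] \<rho>])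
  from measurable_compose[OF measurable_Pair[OF this measurable_compose[OF measurable_fst fst1]] y_process_measurable[OF n]]
  have "(\<lambda>q. y n (\<rho> (snd (fst q)) (snd q)) (fst (fst q))) \<in> (M \<Otimes>\<^sub>M lborel) \<Otimes>\<^sub>M V \<rightarrow>\<^sub>M borel" by simp
  from measurable_compose[OF this b_measurable]
  have "(\<lambda>p. SI (\<lambda>r. b (y n (\<rho> (snd p) r) (fst p)))) \<in> borel_measurable (M \<Otimes>\<^sub>M lborel)"
    by (intro signed_integral_measurable) (simp add: case_prod_beta')
  then have Q: "(\<lambda>(\<omega>, s). SI (\<lambda>r. b (y n (\<rho> s r) \<omega>))) \<in> borel_measurable (M \<Otimes>\<^sub>M lborel)"
    by (simp only: case_prod_beta')
  have ind: "(\<lambda>p. indicator {0..t} (snd p) :: real) \<in> borel_measurable (M \<Otimes>\<^sub>M lborel)"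
    by (rule measurable_compose[OF snd1 borel_measurable_indicator[OF borel_closed[OF closed_atLeastAtMost]]])
  have "(\<lambda>(\<omega>, s). indicator {0..t} s *\<^sub>R SI (\<lambda>r. b (y n (\<rho> s r) \<omega>))) \<in> borel_measurable (M \<Otimes>\<^sub>M lborel)"
    using borel_measurable_scaleR[OF ind Q] by (simp only: case_prod_beta')
  then show ?thesis
    unfolding set_lebesgue_integral_def by (rule lborel.borel_measurable_lebesgue_integral)
qed

lemma b_y_continuous: "1 \<le> n \<Longrightarrow> continuous_on UNIV (\<lambda>u. b (y n u \<omega>))"
  by (rule continuous_on_compose2[OF b_continuous y_continuous subset_UNIV])

lemma b_xx_continuous: "1 \<le> n \<Longrightarrow> continuous_on UNIV (\<lambda>u. b (xx n u \<omega>))"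
  by (rule continuous_on_compose2[OF b_continuous xx_continuous subset_UNIV])

text \<open>For fixed \<open>v\<close> and \<open>r\<close> the sum over the meshes is of order
  \<open>\<Delta> n powr (rho - 1)\<close>. Integration over \<open>v\<close> in one mesh gains the
  missing power, and integration over \<open>r\<close> costs the total mass of
  \<open>\<mu>\<close>.\<close>

lemma err_O: "Lp_O {(n, t). 1 \<le> n \<and> 0 \<le> t \<and> t \<le> T} (\<lambda>(n, t). err n t) (\<lambda>(n, t). \<Delta> n powr rho)"
  unfolding Lp_O_def
proof (intro conjI ballI allI impI)
  define m where "m = measure \<mu> (space \<mu>)"
  have m0: "0 \<le> m" by (simp add: m_def)
  fix p :: nat assume p: "1 \<le> p"
  let ?Z = "\<lambda>(n, N, r, v, c) \<omega>. \<Sum>k<N. c k * (b (y n (real k * \<Delta> n + v - r) \<omega>) - b (y n (real k * \<Delta> n - gf n r) \<omega>))"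
  have "\<exists>C\<ge>0. \<forall>i\<in>shifts (T + \<tau>). Lp_le p (?Z i) (C * (\<lambda>(n, N, r, v, c). \<Delta> n powr (rho - 1)) i)"
    using lag_O[of "T + \<tau>"] p unfolding Lp_O_def by blast
  then obtain C where C: "0 \<le> C" "\<forall>i\<in>shifts (T + \<tau>). Lp_le p (?Z i) (C * (\<lambda>(n, N, r, v, c). \<Delta> n powr (rho - 1)) i)"
    by blast
  have "Lp_le p (err n t) ((2 * (C + 1) * m) * \<Delta> n powr rho)" if n: "1 \<le> n" and t: "0 \<le> t" "t \<le> T" for n t
  proof -
    define D where "D = \<Delta> n"
    have D: "0 < D" "D \<le> \<tau>" using \<Delta>[OF n] by (simp_all add: D_def)
    \<comment> \<open>Just enough meshes to pass \<open>t\<close>; they end before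
      \<open>T + \<tau>\<close>.\<close>
    define N where "N = nat \<lfloor>t / D\<rfloor> + 1"
    have Nr: "real N = of_int \<lfloor>t / D\<rfloor> + 1" using t D by (simp add: N_def)
    have "t / D < real N" unfolding Nr by linarith
    then have tN: "t < real N * D" by (subst (asm) pos_divide_less_eq[OF D(1)])
    have "real N - 1 \<le> t / D" unfolding Nr by linarith
    then have "(real N - 1) * D \<le> t" by (subst (asm) pos_le_divide_eq[OF D(1)])
    then have NT: "real N * D \<le> T + \<tau>" using t D unfolding left_diff_distrib by linarith
    define c where "c v k = (if real k * D + v \<le> t then 1 else 0 :: real)" for k :: nat and v
    define E where "E v r \<omega> = (\<Sum>k<N. c v k * (b (y n (real k * D + v - r) \<omega>) - b (y n (real k * D - gf n r) \<omega>)))" for v r \<omega>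
    \<comment> \<open>The factor \<open>2\<close> comes from the signed integral;
      \<open>C + 1\<close> makes the weight in Minkowski's inequality positive.\<close>
    let ?c = "2 * ((C + 1) * D powr (rho - 1))"
    show ?thesis
    proof (rule Lp_le_double_integral[OF finite_\<mu> p, where a = 0 and b = D and c = "\<lambda>_. ?c" and G = "\<lambda>v r \<omega>. 2 * \<bar>E v r \<omega>\<bar>"])
      have ff: "(\<lambda>q. fst (fst q)) \<in> (borel \<Otimes>\<^sub>M V) \<Otimes>\<^sub>M M \<rightarrow>\<^sub>M borel"
        by (rule measurable_compose[OF measurable_fst measurable_fst])
      have sf: "(\<lambda>q. snd (fst q)) \<in> (borel \<Otimes>\<^sub>M V) \<Otimes>\<^sub>M M \<rightarrow>\<^sub>M borel"
        by (rule measurable_compose[OF measurable_compose[OF measurable_fst measurable_snd] id_V_measurable])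
      have yb: "(\<lambda>q. b (y n (g q) (snd q))) \<in> borel_measurable ((borel \<Otimes>\<^sub>M V) \<Otimes>\<^sub>M M)"
        if "g \<in> borel_measurable ((borel \<Otimes>\<^sub>M V) \<Otimes>\<^sub>M M)" for g
        using measurable_compose[OF measurable_compose[OF measurable_Pair[OF that measurable_snd] y_process_measurable[OF n]] b_measurable]
        by simp
      have cm: "(\<lambda>q. c (fst (fst q)) k) \<in> borel_measurable ((borel \<Otimes>\<^sub>M V) \<Otimes>\<^sub>M M)" for k
        by (rule measurable_compose[OF ff]) (unfold c_def, measurable)
      have "(\<lambda>q. 2 * \<bar>E (fst (fst q)) (snd (fst q)) (snd q)\<bar>) \<in> borel_measurable ((borel \<Otimes>\<^sub>M V) \<Otimes>\<^sub>M M)"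
        unfolding E_def
        by (intro borel_measurable_sum borel_measurable_times borel_measurable_const borel_measurable_diff borel_measurable_abs
            cm yb borel_measurable_add ff sf measurable_compose[OF sf grid_floor_measurable])
      then show "(\<lambda>((v, r), \<omega>). 2 * \<bar>E v r \<omega>\<bar>) \<in> borel_measurable ((borel \<Otimes>\<^sub>M \<mu>) \<Otimes>\<^sub>M M)"
        by (simp add: case_prod_beta' cong: measurable_cong_sets)
      show "(\<lambda>_. ?c) \<in> borel_measurable borel" by (rule measurable_const) simp
      show "0 < ?c" using C(1) D by simp
      have "(\<integral>\<^sup>+ u. ennreal ?c * indicator {0..D} u \<partial>lborel) * ennreal m = ennreal ?c * ennreal D * ennreal m"
        using D by (simp add: nn_integral_cmult_indicator emeasure_lborel_Icc_eq)
      also have "\<dots> = ennreal (?c * D * m)" using C(1) D m0 by (simp add: ennreal_mult[symmetric])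
      also have "?c * D * m = (2 * (C + 1) * m) * (D powr (rho - 1) * D powr 1)" using D by simp
      also have "D powr (rho - 1) * D powr 1 = D powr rho" unfolding powr_add[symmetric] by simp
      finally show "(\<integral>\<^sup>+ u. ennreal ?c * indicator {0..D} u \<partial>lborel) * ennreal (measure \<mu> (space \<mu>))
          \<le> ennreal ((2 * (C + 1) * m) * \<Delta> n powr rho)"
        by (simp add: m_def D_def)
      show "0 \<le> (2 * (C + 1) * m) * \<Delta> n powr rho" using C(1) m0 by simp
      show "Lp_le p (\<lambda>\<omega>. 2 * \<bar>E v r \<omega>\<bar>) ?c" if v: "v \<in> {0..D}" and r: "r \<in> space \<mu>" for v r
      proof (rule Lp_le_cmult_abs)
        have "(n, N, r, v, c v) \<in> shifts (T + \<tau>)"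
          using n v r NT unfolding shifts_def D_def by (simp add: V_space c_def)
        from C(2)[rule_format, OF this] have "Lp_le p (E v r) (C * D powr (rho - 1))"
          unfolding prod.case E_def[abs_def] D_def by simp
        then show "Lp_le p (E v r) ((C + 1) * D powr (rho - 1))"
          by (rule Lp_le_mono_bound) (intro mult_right_mono; simp)
      qed simp
      show "err n t \<in> borel_measurable M"
        unfolding err_def[abs_def]
        by (intro borel_measurable_diff path_integral_measurable[OF n] lag_measurable grid_lag_measurable)
      show "AE \<omega> in M. ennreal \<bar>err n t \<omega>\<bar> \<le> (\<integral>\<^sup>+ v. (\<integral>\<^sup>+ r. ennreal (2 * \<bar>E v r \<omega>\<bar>) \<partial>\<mu>) * indicator {0..D} v \<partial>lborel)"
      proof (rule AE_I2)
        fix \<omega>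
        show "ennreal \<bar>err n t \<omega>\<bar> \<le> (\<integral>\<^sup>+ v. (\<integral>\<^sup>+ r. ennreal (2 * \<bar>E v r \<omega>\<bar>) \<partial>\<mu>) * indicator {0..D} v \<partial>lborel)"
          unfolding err_def E_def c_def D_def
          by (rule block_diff_le[OF n b_y_continuous[OF n] t(1) tN[unfolded D_def], of \<omega>])
      qed
    qed (use C in auto)
  qed
  then show "\<exists>C\<ge>0. \<forall>i\<in>{(n, t). 1 \<le> n \<and> 0 \<le> t \<and> t \<le> T}. Lp_le p ((\<lambda>(n, t). err n t) i) (C * (\<lambda>(n, t). \<Delta> n powr rho) i)"
    using C(1) m0 by (intro exI[of _ "2 * (C + 1) * m"]) auto
qed auto

section \<open>The error of the scheme\<close>

definition U :: "nat \<Rightarrow> real \<Rightarrow> 'a \<Rightarrow> real" where "U n t \<omega> = xx n t \<omega> - y n t \<omega>"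

lemma U_neg: "1 \<le> n \<Longrightarrow> t \<le> 0 \<Longrightarrow> U n t \<omega> = 0"
  unfolding U_def using ext_neg[of n t] by simp

lemma U_measurable: "1 \<le> n \<Longrightarrow> U n t \<in> borel_measurable M"
  unfolding U_def[abs_def] by (intro borel_measurable_diff ext_measurable)

lemma U_continuous: "1 \<le> n \<Longrightarrow> continuous_on UNIV (\<lambda>t. U n t \<omega>)"
  unfolding U_def by (intro continuous_on_diff xx_continuous y_continuous)

text \<open>The noise is the same in both equations and cancels. Inserting the exact lag along the
  path of the scheme leaves \<open>err\<close> and a term that the Lipschitz bound of
  \<open>b\<close> turns into the error at earlier times.\<close>

lemma U_le:
  assumes n: "1 \<le> n" and \<omega>: "\<omega> \<in> om n" and t: "0 \<le> t" and K: "\<And>y z. \<bar>b z - b y\<bar> \<le> K * \<bar>z - y\<bar>"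
  shows "ennreal \<bar>U n t \<omega>\<bar> \<le> ennreal \<bar>err n t \<omega>\<bar>
    + (\<integral>\<^sup>+ s. (\<integral>\<^sup>+ r. ennreal ((2 * K) * \<bar>U n (s - r) \<omega>\<bar>) \<partial>\<mu>) * indicator {0..t} s \<partial>lborel)"
proof -
  define \<phi> where "\<phi> u = b (xx n u \<omega>)" for u
  define \<psi> where "\<psi> u = b (y n u \<omega>)" for u
  have \<phi>: "continuous_on UNIV \<phi>" and \<psi>: "continuous_on UNIV \<psi>"
    unfolding \<phi>_def[abs_def] \<psi>_def[abs_def] by (rule b_xx_continuous[OF n], rule b_y_continuous[OF n])
  define d where "d = (LBINT s:{0..t}. SI (\<lambda>r. \<phi> (s - r))) - (LBINT s:{0..t}. SI (\<lambda>r. \<psi> (s - r)))"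
  define e where "e = err n t \<omega>"
  have "U n t \<omega> = d + e"
    unfolding U_def d_def e_def err_def xx_equation[OF n \<omega> t] y_equation[OF n \<omega> t] \<phi>_def \<psi>_def by linarith
  then have 1: "ennreal \<bar>U n t \<omega>\<bar> \<le> ennreal \<bar>e\<bar> + ennreal \<bar>d\<bar>"
    by (simp add: ennreal_plus[symmetric] ennreal_leI del: ennreal_plus)
  have le: "(\<integral>\<^sup>+ r. ennreal (2 * \<bar>\<phi> (s - r) - \<psi> (s - r)\<bar>) \<partial>\<mu>) \<le> (\<integral>\<^sup>+ r. ennreal ((2 * K) * \<bar>U n (s - r) \<omega>\<bar>) \<partial>\<mu>)" for s
  proof (rule nn_integral_mono, rule ennreal_leI)
    fix r
    have "\<bar>\<phi> (s - r) - \<psi> (s - r)\<bar> \<le> K * \<bar>U n (s - r) \<omega>\<bar>" unfolding \<phi>_def \<psi>_def U_def by (rule K)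
    then show "2 * \<bar>\<phi> (s - r) - \<psi> (s - r)\<bar> \<le> (2 * K) * \<bar>U n (s - r) \<omega>\<bar>"
      unfolding mult.assoc by (rule mult_left_mono) simp
  qed
  have "(\<integral>\<^sup>+ s. (\<integral>\<^sup>+ r. ennreal (2 * \<bar>\<phi> (s - r) - \<psi> (s - r)\<bar>) \<partial>\<mu>) * indicator {0..t} s \<partial>lborel)
      \<le> (\<integral>\<^sup>+ s. (\<integral>\<^sup>+ r. ennreal ((2 * K) * \<bar>U n (s - r) \<omega>\<bar>) \<partial>\<mu>) * indicator {0..t} s \<partial>lborel)"
    by (rule nn_integral_mono, rule mult_right_mono[OF le]) (rule zero_le)
  from order_trans[OF lag_diff_le[OF \<phi> \<psi>] this]
  have 2: "ennreal \<bar>d\<bar> \<le> (\<integral>\<^sup>+ s. (\<integral>\<^sup>+ r. ennreal ((2 * K) * \<bar>U n (s - r) \<omega>\<bar>) \<partial>\<mu>) * indicator {0..t} s \<partial>lborel)"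
    unfolding d_def .
  show ?thesis unfolding e_def[symmetric] by (rule order_trans[OF 1 add_left_mono[OF 2]])
qed

lemma U_O: "Lp_O {(n, t). 1 \<le> n \<and> 0 \<le> t \<and> t \<le> T} (\<lambda>(n, t). U n t) (\<lambda>(n, t). \<Delta> n powr rho)"
  unfolding Lp_O_def
proof (intro conjI ballI allI impI)
  obtain K where K: "0 < K" "\<And>y z. \<bar>b z - b y\<bar> \<le> K * \<bar>z - y\<bar>"
    using taylor_bounds[OF b3 b'] by metis
  define m where "m = measure \<mu> (space \<mu>)"
  have m0: "0 \<le> m" by (simp add: m_def)
  define l where "l = 4 * K * m + 1"
  have l0: "0 < l" using K(1) m0 by (simp add: l_def add_nonneg_pos)
  fix p :: nat assume p: "1 \<le> p"
  have "\<exists>C\<ge>0. \<forall>i\<in>{(n, t). 1 \<le> n \<and> 0 \<le> t \<and> t \<le> T}. Lp_le p ((\<lambda>(n, t). err n t) i) (C * (\<lambda>(n, t). \<Delta> n powr rho) i)"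
    using err_O[of T] p unfolding Lp_O_def by blast
  then obtain C where C: "0 \<le> C"
    "\<forall>i\<in>{(n, t). 1 \<le> n \<and> 0 \<le> t \<and> t \<le> T}. Lp_le p ((\<lambda>(n, t). err n t) i) (C * (\<lambda>(n, t). \<Delta> n powr rho) i)" by blast
  have "Lp_le p (U n t) ((2 * C * exp (l * T)) * \<Delta> n powr rho)" if n: "1 \<le> n" and t: "0 \<le> t" "t \<le> T" for n t
  proof -
    define \<alpha> where "\<alpha> = C * \<Delta> n powr rho"
    have \<alpha>0: "0 \<le> \<alpha>" using C(1) by (simp add: \<alpha>_def)
    have err: "Lp_le p (err n t) \<alpha>" if "t \<in> {0..T}" for t
      using C(2)[rule_format, of "(n, t)"] that n by (simp add: \<alpha>_def)
    have "Lp_le p (U n t) (2 * \<alpha> * exp (l * t))"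
    proof (rule Lp_le_gronwall_continuous[OF finite_\<mu> p U_measurable[OF n] U_continuous[OF n] _ _ less_imp_le[OF \<tau>] err _ \<alpha>0 _ _ l0])
      show "(\<lambda>(s, r). s - r) \<in> borel_measurable (borel \<Otimes>\<^sub>M \<mu>)"
        using lag_measurable by (simp cong: measurable_cong_sets)
      show "s - r \<in> {- \<tau>..s}" if "s \<in> {0..T}" "r \<in> space \<mu>" for s r
        using lag_bounds[of s r] that by simp
      show "Lp_le p (U n t) \<alpha>" if "t \<in> {- \<tau>..<0}" for t
      proof -
        have "U n t = (\<lambda>_. 0)" using U_neg[OF n, of t] that by auto
        then show ?thesis using \<alpha>0 p by (simp add: Lp_le_def power_0_left)
      qed
      show "AE \<omega> in M. ennreal \<bar>U n t \<omega>\<bar> \<le> ennreal \<bar>err n t \<omega>\<bar>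
        + (\<integral>\<^sup>+ s. (\<integral>\<^sup>+ r. ennreal ((2 * K) * \<bar>U n (s - r) \<omega>\<bar>) \<partial>\<mu>) * indicator {0..t} s \<partial>lborel)"
        if t: "t \<in> {0..T}" for t
        using om(4)[OF n]
      proof eventually_elim
        case (elim \<omega>)
        have "0 \<le> t" using t by simp
        from U_le[OF n elim this K(2)] show ?case .
      qed
      show "0 < 2 * K" using K by simp
      show "2 * (2 * K) * measure \<mu> (space \<mu>) \<le> l" by (simp add: l_def m_def)
      show "t \<in> {0..T}" using t by simp
    qed
    then show ?thesis
    proof (rule Lp_le_mono_bound)
      have "2 * \<alpha> * exp (l * t) \<le> 2 * \<alpha> * exp (l * T)"
        using \<alpha>0 l0 t by (intro mult_left_mono) auto
      also have "\<dots> = (2 * C * exp (l * T)) * \<Delta> n powr rho" unfolding \<alpha>_def by (simp only: mult_ac)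
      finally show "2 * \<alpha> * exp (l * t) \<le> (2 * C * exp (l * T)) * \<Delta> n powr rho" .
    qed
  qed
  then show "\<exists>C\<ge>0. \<forall>i\<in>{(n, t). 1 \<le> n \<and> 0 \<le> t \<and> t \<le> T}. Lp_le p ((\<lambda>(n, t). U n t) i) (C * (\<lambda>(n, t). \<Delta> n powr rho) i)"
    using C(1) by (intro exI[of _ "2 * C * exp (l * T)"]) auto
qed auto

theorem euler_scheme_rate:
  fixes p T :: real
  assumes p: "1 \<le> p"
  shows "\<exists>C>0. \<forall>n\<ge>1.
           (\<forall>t\<in>{0..T}. integrable M (\<lambda>\<omega>. \<bar>X t \<omega> - Xn n t \<omega>\<bar> powr p)) \<and>
           (SUP t\<in>{0..T}. ereal ((\<integral>\<omega>. \<bar>X t \<omega> - Xn n t \<omega>\<bar> powr p \<partial>M) powr (1 / p)))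
             \<le> ereal (C * \<Delta> n powr rho)"
proof -
  \<comment> \<open>A natural order above \<open>p\<close>, which controls the real order
    \<open>p\<close>.\<close>
  define q where "q = nat \<lceil>p\<rceil>"
  have q: "p \<le> real q" unfolding q_def by linarith
  then have q1: "1 \<le> q" using p by (cases q) auto
  have "\<exists>C\<ge>0. \<forall>i\<in>{(n, t). 1 \<le> n \<and> 0 \<le> t \<and> t \<le> T}. Lp_le q ((\<lambda>(n, t). U n t) i) (C * (\<lambda>(n, t). \<Delta> n powr rho) i)"
    using U_O[of T] q1 unfolding Lp_O_def by blast
  then obtain C where C: "0 \<le> C"
    "\<forall>i\<in>{(n, t). 1 \<le> n \<and> 0 \<le> t \<and> t \<le> T}. Lp_le q ((\<lambda>(n, t). U n t) i) (C * (\<lambda>(n, t). \<Delta> n powr rho) i)" by blast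
  have main: "integrable M (\<lambda>\<omega>. \<bar>X t \<omega> - Xn n t \<omega>\<bar> powr p)"
    "(\<integral>\<omega>. \<bar>X t \<omega> - Xn n t \<omega>\<bar> powr p \<partial>M) powr (1 / p) \<le> (2 * (C + 1)) * \<Delta> n powr rho"
    if n: "1 \<le> n" and t: "t \<in> {0..T}" for n t
  proof -
    define c where "c = (C + 1) * \<Delta> n powr rho"
    have "\<Delta> n \<noteq> 0" using \<Delta>(1)[OF n] by linarith
    then have "0 < \<Delta> n powr rho" by (subst powr_gt_zero)
    then have c: "0 < c" unfolding c_def using C(1) by (intro mult_pos_pos) auto
    have "Lp_le q (U n t) (C * \<Delta> n powr rho)" using C(2)[rule_format, of "(n, t)"] n t by simp
    then have "Lp_le q (U n t) c"
      unfolding c_def by (rule Lp_le_mono_bound) (intro mult_right_mono; simp)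
    note U = Lp_le_powr[OF this c p q]
    have [measurable]: "X t \<in> borel_measurable M" "Xn n t \<in> borel_measurable M" "U n t \<in> borel_measurable M"
      using sol euler[OF n] t \<tau> U_measurable[OF n] unfolding sdde_solution_def euler_scheme_def by auto
    have ae: "AE \<omega> in M. \<bar>U n t \<omega>\<bar> powr p = \<bar>X t \<omega> - Xn n t \<omega>\<bar> powr p"
      using om(4)[OF n]
    proof eventually_elim
      case (elim \<omega>)
      have "- \<tau> \<le> t" using t \<tau> by simp
      then show ?case using ext_eq[OF n elim, of t] by (simp add: U_def)
    qed
    show "integrable M (\<lambda>\<omega>. \<bar>X t \<omega> - Xn n t \<omega>\<bar> powr p)"
      by (rule integrable_cong_AE_imp[OF U(1) _ ae]) measurable
    have "(\<integral>\<omega>. \<bar>X t \<omega> - Xn n t \<omega>\<bar> powr p \<partial>M) = (\<integral>\<omega>. \<bar>U n t \<omega>\<bar> powr p \<partial>M)"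
      by (rule integral_cong_AE[OF _ _ AE_symmetric[OF ae]]) measurable
    then show "(\<integral>\<omega>. \<bar>X t \<omega> - Xn n t \<omega>\<bar> powr p \<partial>M) powr (1 / p) \<le> (2 * (C + 1)) * \<Delta> n powr rho"
      using U(2) by (simp only: c_def mult.assoc)
  qed
  show ?thesis
  proof (intro exI[of _ "2 * (C + 1)"] conjI allI impI ballI SUP_least)
    show "0 < 2 * (C + 1)" using C(1) by simp
    fix n :: nat and t assume "1 \<le> n" "t \<in> {0..T}"
    from main[OF this]
    show "integrable M (\<lambda>\<omega>. \<bar>X t \<omega> - Xn n t \<omega>\<bar> powr p)"
      and "ereal ((\<integral>\<omega>. \<bar>X t \<omega> - Xn n t \<omega>\<bar> powr p \<partial>M) powr (1 / p)) \<le> ereal (2 * (C + 1) * \<Delta> n powr rho)"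
      by simp_all
  qed
qed

end

theorem theorem3:
  fixes M :: "'a measure"
    and W B X :: "real \<Rightarrow> 'a \<Rightarrow> real"
    and Xn :: "nat \<Rightarrow> real \<Rightarrow> 'a \<Rightarrow> real"
    and H \<tau> T p :: real
    and \<eta> :: "real set \<Rightarrow> real"
    and b x0 :: "real \<Rightarrow> real"
  assumes "prob_space M" and "complete_measure M"
    and "two_sided_wiener M W"
    and "0 < H" and "H < 1/2"
    and "fbm_from_wiener M W H B"
    and "\<tau> > 0"
    and "finite_signed_measure (delay_space \<tau>) \<eta>"
    and "class_C 3 b" and "linear_growth b" and "class_Cb 2 (deriv b)"
    and "C1_on_Icc (-\<tau>) 0 x0" and "\<forall>t. t \<notin> {-\<tau>..0} \<longrightarrow> x0 t = 0"
    and "sdde_solution M \<tau> \<eta> b x0 B X"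
    and "\<forall>n\<ge>1. euler_scheme M \<tau> \<eta> b x0 B n (Xn n)"
    and "T > 0" and "p \<ge> 1"
  shows "\<exists>C>0. \<forall>n\<ge>1.
           (\<forall>t\<in>{0..T}. integrable M (\<lambda>\<omega>. \<bar>X t \<omega> - Xn n t \<omega>\<bar> powr p)) \<and>
           (SUP t\<in>{0..T}. ereal ((\<integral>\<omega>. \<bar>X t \<omega> - Xn n t \<omega>\<bar> powr p \<partial>M) powr (1 / p)))
             \<le> ereal (C * (\<tau> / real n) powr min (3 * H) (H + 1/2))"
proof -
  interpret prob_space M by fact
  interpret wiener M W by unfold_locales fact
  interpret fbm M W B H by unfold_locales fact+
  interpret sdde M W B H \<tau> \<eta> b x0 X Xn by unfold_locales (use assms in auto)
  show ?thesis by (rule euler_scheme_rate[OF \<open>p \<ge> 1\<close>])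
qed

end
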